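(* Let $(W^{2n},\lambda)$ be a $2n$-dimensional Liouville domain. Then, for any $H\in\mathcal H(W,\lambda)$, $$\frac{n!\,\min\{{\rm Sys}(\partial W),\tau_{\min}(H)\}^{n+1}}{(n+1)\,{\rm Cal}(H)}\le\rho(W_H)\le\frac{n!\,{\rm Sys}(\partial W)^{n+1}}{(n+1)\,{\rm Cal}(H)}.$$
   Context: A Liouville domain $(W,\lambda)$ is a compact exact symplectic manifold with boundary (symplectic form $d\lambda$) whose Liouville vector field $Y_\lambda$, defined by $\iota_{Y_\lambda}d\lambda=\lambda$, is outward transverse to $\partial W$. Let $S^1=\mathbb R/\mathbb Z$. For smooth $H:S^1\times W\to\mathbb R$ put $H_t=H(t,\cdot)$, define $X_{H_t}$ by $\iota_{X_{H_t}}d\lambda=dH_t$, and $\tau_{\lambda,H}=\lambda(X_{H_t})+H$. $\mathcal H(W,\lambda)$ is the set of smooth $H:S^1\times W\to\mathbb R$ which are autonomous (independent of $t$) in a neighborhood of $\partial W$, vanish on $\partial W$, and satisfy $\tau_{\lambda,H}>0$ everywhere. $\tau_{\min}(H)=\min_{S^1\times W}\tau_{\lambda,H}$ and ${\rm Cal}(H)=\int_{S^1\times W}H\,dt\wedge(d\lambda)^n$. The tube is $W_H=\{(w,z)\in W\times\mathbb C\mid z=re^{2\pi i t},\ \pi|z|^2\le H(t,w)\}$ with $\hat\lambda=\lambda+\pi r^2dt$, a Liouville domain; $\alpha_H=\hat\lambda|_{\partial W_H}$. ${\rm Sys}(\partial W)$ and ${\rm Sys}(\partial W_H)$ denote the minimal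 period of a closed Reeb orbit of $(\partial W,\lambda|_{\partial W})$ and $(\partial W_H,\alpha_H)$ respectively. The systolic ratio is $$\rho(W_H)=\frac{{\rm Sys}(\partial W_H)^{n+1}}{{\rm Vol}(\partial W_H,\alpha_H)},\qquad{\rm Vol}(\partial W_H,\alpha_H)=\frac1{n!}\int_{\partial W_H}\alpha_H\wedge(d\alpha_H)^n.$$ *)

theory Defs
  imports "HOL-Analysis.Analysis" "HOL-Combinatorics.Permutations"
begin

section \<open>Smooth maps on subsets of normed spaces\<close>

primrec Ck_on :: "nat \<Rightarrow> 'a::real_normed_vector set \<Rightarrow> ('a \<Rightarrow> 'b::real_normed_vector) \<Rightarrow> bool" where
  "Ck_on 0 = (\<lambda>S f. continuous_on S f)"
| "Ck_on (Suc k) = (\<lambda>S f. (\<forall>x\<in>S. f differentiable (at x)) \<and>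
      (\<forall>v. Ck_on k S (\<lambda>x. frechet_derivative f (at x) v)))"

text \<open>
  \<open>Ck_on\<close> is meant for open sets.  On an arbitrary set, in particular on a relatively open
  subset of a half-space, a map is smooth if it extends locally to smooth maps on open sets.
\<close>

definition smooth_on :: "'a::real_normed_vector set \<Rightarrow> ('a \<Rightarrow> 'b::real_normed_vector) \<Rightarrow> bool" where
  "smooth_on S f \<longleftrightarrow>
     (\<forall>x\<in>S. \<exists>U g. open U \<and> x \<in> U \<and> (\<forall>k. Ck_on k U g) \<and> (\<forall>y\<in>S \<inter> U. g y = f y))"


section \<open>Manifolds with boundary\<close>

text \<open>
  A manifold is given by an indexed atlas.  Its underlying set is the union of the chart domains
  and its topology is the subspace topology of the (Hausdorff, second countable) type of points.
  The values of \<open>coord A i\<close> outside \<open>chart_dom A i\<close> are irrelevant.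
\<close>

record ('i, 'w, 'e) atlas =
  charts :: "'i set"
  chart_dom :: "'i \<Rightarrow> 'w set"
  coord :: "'i \<Rightarrow> 'w \<Rightarrow> 'e"

definition points :: "('i, 'w, 'e) atlas \<Rightarrow> 'w set" where
  "points A = (\<Union>i\<in>charts A. chart_dom A i)"

definition chart_img :: "('i, 'w, 'e) atlas \<Rightarrow> 'i \<Rightarrow> 'e set" where
  "chart_img A i = coord A i ` chart_dom A i"

definition param :: "('i, 'w, 'e) atlas \<Rightarrow> 'i \<Rightarrow> 'e \<Rightarrow> 'w" where
  "param A i = inv_into (chart_dom A i) (coord A i)"

definition some_chart :: "('i, 'w, 'e) atlas \<Rightarrow> 'w \<Rightarrow> 'i" where
  "some_chart A p = (SOME i. i \<in> charts A \<and> p \<in> chart_dom A i)"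

definition half_space :: "(real \<times> 'f::euclidean_space) set" where
  "half_space = {x. 0 \<le> fst x}"

definition manifold_with_boundary ::
    "('i, 'w::{t2_space, second_countable_topology}, real \<times> 'f::euclidean_space) atlas \<Rightarrow> bool" where
  "manifold_with_boundary A \<longleftrightarrow>
     (\<forall>i\<in>charts A.
        openin (top_of_set (points A)) (chart_dom A i) \<and>
        openin (top_of_set half_space) (chart_img A i) \<and>
        homeomorphism (chart_dom A i) (chart_img A i) (coord A i) (param A i)) \<and>
     (\<forall>i\<in>charts A. \<forall>j\<in>charts A.
        smooth_on (coord A i ` (chart_dom A i \<inter> chart_dom A j)) (coord A j \<circ> param A i))"

definition bdry :: "('i, 'w, real \<times> 'f::euclidean_space) atlas \<Rightarrow> 'w set" where
  "bdry A = {p. \<exists>i\<in>charts A. p \<in> chart_dom A i \<and> fst (coord A i p) = 0}"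

definition bdry_atlas ::
    "('i, 'w, real \<times> 'f::euclidean_space) atlas \<Rightarrow> ('i, 'w, 'f) atlas" where
  "bdry_atlas A = \<lparr> charts = charts A, chart_dom = (\<lambda>i. chart_dom A i \<inter> bdry A),
                    coord = (\<lambda>i p. snd (coord A i p)) \<rparr>"


section \<open>Differential forms\<close>

text \<open>
  A one-form is a family of local representatives \<open>lam i x\<close>, one for each chart \<open>i\<close> and each
  \<open>x \<in> chart_img A i\<close>, which agree under pullback by the transition maps.  All derivatives are
  taken within \<open>chart_img A i\<close>, so as to include the boundary points of the half-space.
\<close>

type_synonym ('i, 'e) oneform = "'i \<Rightarrow> 'e \<Rightarrow> 'e \<Rightarrow> real"

definition smooth_oneform ::
    "('i, 'w, 'e::euclidean_space) atlas \<Rightarrow> ('i, 'e) oneform \<Rightarrow> bool" where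
  "smooth_oneform A lam \<longleftrightarrow>
     (\<forall>i\<in>charts A. (\<forall>x\<in>chart_img A i. linear (lam i x)) \<and>
        (\<forall>u. smooth_on (chart_img A i) (\<lambda>x. lam i x u))) \<and>
     (\<forall>i\<in>charts A. \<forall>j\<in>charts A. \<forall>p\<in>chart_dom A i \<inter> chart_dom A j. \<forall>u.
        lam i (coord A i p) u =
        lam j (coord A j p)
          (frechet_derivative (coord A j \<circ> param A i) (at (coord A i p) within chart_img A i) u))"

definition ext_d ::
    "('i, 'w, 'e::euclidean_space) atlas \<Rightarrow> ('i, 'e) oneform \<Rightarrow> 'i \<Rightarrow> 'e \<Rightarrow> 'e \<Rightarrow> 'e \<Rightarrow> real" where
  "ext_d A lam i x u v =
     frechet_derivative (\<lambda>y. lam i y v) (at x within chart_img A i) u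
     - frechet_derivative (\<lambda>y. lam i y u) (at x within chart_img A i) v"

text \<open>
  An alternating \<open>k\<close>-form on a vector space is a function of sequences of vectors which depends
  only on the entries with index below \<open>k\<close>.
\<close>

definition wedge ::
    "nat \<Rightarrow> nat \<Rightarrow> ((nat \<Rightarrow> 'v) \<Rightarrow> real) \<Rightarrow> ((nat \<Rightarrow> 'v) \<Rightarrow> real) \<Rightarrow> (nat \<Rightarrow> 'v) \<Rightarrow> real" where
  "wedge k l \<alpha> \<beta> v =
     (\<Sum>\<sigma> | \<sigma> permutes {..<k + l}.
        of_int (sign \<sigma>) * \<alpha> (\<lambda>j. v (\<sigma> j)) * \<beta> (\<lambda>j. v (\<sigma> (k + j)))) / (fact k * fact l)"

primrec wedge_power :: "nat \<Rightarrow> ((nat \<Rightarrow> 'v) \<Rightarrow> real) \<Rightarrow> nat \<Rightarrow> (nat \<Rightarrow> 'v) \<Rightarrow> real" where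
  "wedge_power k \<omega> 0 = (\<lambda>v. 1)"
| "wedge_power k \<omega> (Suc m) = wedge k (k * m) \<omega> (wedge_power k \<omega> m)"

definition d_power ::
    "('i, 'w, 'e::euclidean_space) atlas \<Rightarrow> ('i, 'e) oneform \<Rightarrow> nat \<Rightarrow>
       'i \<Rightarrow> 'e \<Rightarrow> (nat \<Rightarrow> 'e) \<Rightarrow> real" where
  "d_power A lam n i x = wedge_power 2 (\<lambda>v. ext_d A lam i x (v 0) (v 1)) n"

definition contact_top_form ::
    "('i, 'w, 'e::euclidean_space) atlas \<Rightarrow> ('i, 'e) oneform \<Rightarrow> nat \<Rightarrow>
       'i \<Rightarrow> 'e \<Rightarrow> (nat \<Rightarrow> 'e) \<Rightarrow> real" where
  "contact_top_form A \<alpha> n i x = wedge 1 (2 * n) (\<lambda>v. \<alpha> i x (v 0)) (d_power A \<alpha> n i x)"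

definition basis_frame :: "nat \<Rightarrow> 'e::euclidean_space" where
  "basis_frame = (SOME b. bij_betw b {..<DIM('e)} Basis)"

text \<open>
  Integration against a nowhere vanishing form \<open>\<nu>\<close> of top degree.  The manifold is oriented by
  \<open>\<nu>\<close> itself, so that the integral of \<open>f \<nu>\<close> is the integral of \<open>f\<close> against the measure which
  in each chart has the density \<open>\<bar>\<nu>(e\<^sub>1, \<dots>, e\<^sub>d)\<bar>\<close>.  The absolute value accounts for
  charts which reverse the orientation, and makes the order of the basis irrelevant.
\<close>

definition form_measure ::
    "('i, 'w::topological_space, 'e::euclidean_space) atlas \<Rightarrow>
       ('i \<Rightarrow> 'e \<Rightarrow> (nat \<Rightarrow> 'e) \<Rightarrow> real) \<Rightarrow> 'w measure" where
  "form_measure A \<nu> = (THE \<mu>.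
     sets \<mu> = sets (restrict_space borel (points A)) \<and>
     (\<forall>i\<in>charts A. \<forall>B\<in>sets borel. B \<subseteq> chart_dom A i \<longrightarrow>
        emeasure \<mu> B = (\<integral>\<^sup>+x\<in>coord A i ` B. ennreal \<bar>\<nu> i x basis_frame\<bar> \<partial>lborel)))"


section \<open>Closed Reeb orbits and contact volume\<close>

definition reeb_vector ::
    "('i, 'w, 'e::euclidean_space) atlas \<Rightarrow> ('i, 'e) oneform \<Rightarrow> 'i \<Rightarrow> 'e \<Rightarrow> 'e \<Rightarrow> bool" where
  "reeb_vector A \<alpha> i x v \<longleftrightarrow> \<alpha> i x v = 1 \<and> (\<forall>u. ext_d A \<alpha> i x v u = 0)"

definition reeb_orbit ::
    "('i, 'w::topological_space, 'e::euclidean_space) atlas \<Rightarrow> ('i, 'e) oneform \<Rightarrow>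
       (real \<Rightarrow> 'w) \<Rightarrow> bool" where
  "reeb_orbit A \<alpha> \<gamma> \<longleftrightarrow>
     continuous_on UNIV \<gamma> \<and> range \<gamma> \<subseteq> points A \<and>
     (\<forall>s. \<forall>i\<in>charts A. \<gamma> s \<in> chart_dom A i \<longrightarrow>
        (\<exists>v. (coord A i \<circ> \<gamma> has_vector_derivative v) (at s) \<and>
             reeb_vector A \<alpha> i (coord A i (\<gamma> s)) v))"

text \<open>The minimal period is \<open>\<infinity>\<close> if there is no closed Reeb orbit.\<close>

definition min_period ::
    "('i, 'w::topological_space, 'e::euclidean_space) atlas \<Rightarrow> ('i, 'e) oneform \<Rightarrow> ereal" where
  "min_period A \<alpha> =
     Inf {ereal T |T. 0 < T \<and> (\<exists>\<gamma>. reeb_orbit A \<alpha> \<gamma> \<and> (\<forall>s. \<gamma> (s + T) = \<gamma> s))}"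

definition contact_volume ::
    "('i, 'w::topological_space, 'e::euclidean_space) atlas \<Rightarrow> ('i, 'e) oneform \<Rightarrow> nat \<Rightarrow> real" where
  "contact_volume A \<alpha> n = measure (form_measure A (contact_top_form A \<alpha> n)) (points A) / fact n"


section \<open>Liouville domains\<close>

definition bdry_form :: "('i, real \<times> 'f::euclidean_space) oneform \<Rightarrow> ('i, 'f) oneform" where
  "bdry_form lam i y v = lam i (0, y) (0, v)"

definition liouville_vec ::
    "('i, 'w, 'e::euclidean_space) atlas \<Rightarrow> ('i, 'e) oneform \<Rightarrow> 'i \<Rightarrow> 'e \<Rightarrow> 'e" where
  "liouville_vec A lam i x = (THE Y. \<forall>u. ext_d A lam i x Y u = lam i x u)"

text \<open>The half-space is \<open>0 \<le> fst x\<close>, so outward pointing means negative first coordinate.\<close>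

definition liouville_domain ::
    "nat \<Rightarrow> ('i, 'w::{t2_space, second_countable_topology}, real \<times> 'f::euclidean_space) atlas \<Rightarrow>
       ('i, real \<times> 'f) oneform \<Rightarrow> bool" where
  "liouville_domain n W lam \<longleftrightarrow>
     DIM(real \<times> 'f) = 2 * n \<and>
     manifold_with_boundary W \<and> compact (points W) \<and> points W \<noteq> {} \<and>
     smooth_oneform W lam \<and>
     (\<forall>i\<in>charts W. \<forall>x\<in>chart_img W i. \<forall>v. (\<forall>u. ext_d W lam i x v u = 0) \<longrightarrow> v = 0) \<and>
     (\<forall>i\<in>charts W. \<forall>x\<in>chart_img W i. fst x = 0 \<longrightarrow> fst (liouville_vec W lam i x) < 0)"

definition Sys ::
    "('i, 'w::topological_space, real \<times> 'f::euclidean_space) atlas \<Rightarrow>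
       ('i, real \<times> 'f) oneform \<Rightarrow> ereal" where
  "Sys W lam = min_period (bdry_atlas W) (bdry_form lam)"

text \<open>\<open>systolic_ratio n\<close> is for Liouville domains of dimension \<open>2 * (n + 1)\<close>.\<close>

definition systolic_ratio ::
    "nat \<Rightarrow> ('i, 'w::topological_space, real \<times> 'f::euclidean_space) atlas \<Rightarrow>
       ('i, real \<times> 'f) oneform \<Rightarrow> ereal" where
  "systolic_ratio n W lam =
     Sys W lam ^ (n + 1) / ereal (contact_volume (bdry_atlas W) (bdry_form lam) n)"


section \<open>Hamiltonians\<close>

text \<open>Functions on \<open>S\<^sup>1 \<times> W\<close> with \<open>S\<^sup>1 = \<real>/\<int>\<close> are functions \<open>H t w\<close> of period one in \<open>t\<close>.\<close>

definition ham_vec ::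
    "('i, 'w, 'e::euclidean_space) atlas \<Rightarrow> ('i, 'e) oneform \<Rightarrow> ('w \<Rightarrow> real) \<Rightarrow> 'i \<Rightarrow> 'e \<Rightarrow> 'e" where
  "ham_vec W lam h i x =
     (THE X. \<forall>u. ext_d W lam i x X u =
               frechet_derivative (h \<circ> param W i) (at x within chart_img W i) u)"

definition ham_tau ::
    "('i, 'w, 'e::euclidean_space) atlas \<Rightarrow> ('i, 'e) oneform \<Rightarrow> (real \<Rightarrow> 'w \<Rightarrow> real) \<Rightarrow>
       real \<Rightarrow> 'w \<Rightarrow> real" where
  "ham_tau W lam H t w =
     (let i = some_chart W w; x = coord W i w in lam i x (ham_vec W lam (H t) i x) + H t w)"

definition hamiltonians ::
    "('i, 'w::topological_space, real \<times> 'f::euclidean_space) atlas \<Rightarrow> ('i, real \<times> 'f) oneform \<Rightarrow>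
       (real \<Rightarrow> 'w \<Rightarrow> real) set" where
  "hamiltonians W lam = {H.
     (\<forall>t. \<forall>w\<in>points W. H (t + 1) w = H t w) \<and>
     (\<forall>i\<in>charts W. smooth_on (UNIV \<times> chart_img W i) (\<lambda>(t, x). H t (param W i x))) \<and>
     (\<exists>U. openin (top_of_set (points W)) U \<and> bdry W \<subseteq> U \<and> (\<forall>w\<in>U. \<forall>s t. H s w = H t w)) \<and>
     (\<forall>t. \<forall>w\<in>bdry W. H t w = 0) \<and>
     (\<forall>t. \<forall>w\<in>points W. 0 < ham_tau W lam H t w)}"

definition tau_min ::
    "('i, 'w, 'e::euclidean_space) atlas \<Rightarrow> ('i, 'e) oneform \<Rightarrow> (real \<Rightarrow> 'w \<Rightarrow> real) \<Rightarrow> real" where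
  "tau_min W lam H = Inf {ham_tau W lam H t w |t w. w \<in> points W}"

definition Cal ::
    "nat \<Rightarrow> ('i, 'w::topological_space, 'e::euclidean_space) atlas \<Rightarrow> ('i, 'e) oneform \<Rightarrow>
       (real \<Rightarrow> 'w \<Rightarrow> real) \<Rightarrow> real" where
  "Cal n W lam H =
     (\<integral>(t, w). H t w \<partial>(restrict_space lborel {0..<1} \<Otimes>\<^sub>M form_measure W (d_power W lam n)))"


section \<open>The tube\<close>

definition times_complex ::
    "('i, 'w, real \<times> 'f::euclidean_space) atlas \<Rightarrow> ('i, 'w \<times> complex, real \<times> ('f \<times> complex)) atlas"
  where
  "times_complex W = \<lparr> charts = charts W, chart_dom = (\<lambda>i. chart_dom W i \<times> UNIV),
     coord = (\<lambda>i (w, z). (fst (coord W i w), (snd (coord W i w), z))) \<rparr>"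

text \<open>
  The form \<open>lam + \<pi> r\<^sup>2 dt\<close> on \<open>W \<times> \<complex>\<close>, where \<open>z = x + i y = r e\<^bsup>2 \<pi> i t\<^esup>\<close> and hence
  \<open>\<pi> r\<^sup>2 dt = (x dy - y dx) / 2\<close>, which is smooth across \<open>z = 0\<close>.
\<close>

definition hat_form ::
    "('i, real \<times> 'f::euclidean_space) oneform \<Rightarrow> ('i, real \<times> ('f \<times> complex)) oneform" where
  "hat_form lam i = (\<lambda>(s, (y, z)) (s', (y', z')).
     lam i (s, y) (s', y') + (Re z * Im z' - Im z * Re z') / 2)"

text \<open>
  The smooth structure that a subset \<open>S\<close> inherits from a manifold \<open>N\<close> of the same dimension: its
  charts are all homeomorphisms from open subsets of \<open>S\<close> to open subsets of the half-space that
  are smooth in both directions with respect to \<open>N\<close>.  Smoothness of a map on \<open>S\<close> means that it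
  extends locally to a smooth map on \<open>N\<close>.  The set \<open>S\<close> may touch the boundary of \<open>N\<close>.
\<close>

definition domain_atlas ::
    "('i, 'p::topological_space, real \<times> 'g::euclidean_space) atlas \<Rightarrow> 'p set \<Rightarrow>
       ('p set \<times> ('p \<Rightarrow> real \<times> 'g), 'p, real \<times> 'g) atlas" where
  "domain_atlas N S = \<lparr>
     charts = {(V, \<psi>).
       openin (top_of_set S) V \<and> openin (top_of_set half_space) (\<psi> ` V) \<and>
       homeomorphism V (\<psi> ` V) \<psi> (inv_into V \<psi>) \<and>
       (\<forall>i\<in>charts N.
          smooth_on (coord N i ` (V \<inter> chart_dom N i)) (\<psi> \<circ> param N i) \<and>
          smooth_on (\<psi> ` (V \<inter> chart_dom N i)) (coord N i \<circ> inv_into V \<psi>))},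
     chart_dom = fst,
     coord = snd \<rparr>"

definition domain_form ::
    "('i, 'p::topological_space, real \<times> 'g::euclidean_space) atlas \<Rightarrow>
       ('i, real \<times> 'g) oneform \<Rightarrow> ('p set \<times> ('p \<Rightarrow> real \<times> 'g), real \<times> 'g) oneform" where
  "domain_form N lam = (\<lambda>(V, \<psi>) y u.
     let p = inv_into V \<psi> y; i = some_chart N p in
     lam i (coord N i p)
       (frechet_derivative (coord N i \<circ> inv_into V \<psi>) (at y within \<psi> ` V) u))"

definition tube_set ::
    "('i, 'w, 'e) atlas \<Rightarrow> (real \<Rightarrow> 'w \<Rightarrow> real) \<Rightarrow> ('w \<times> complex) set" where
  "tube_set W H = {(w, z). w \<in> points W \<and>
     (\<exists>r t. 0 \<le> r \<and> z = complex_of_real r * cis (2 * pi * t) \<and> pi * (cmod z)\<^sup>2 \<le> H t w)}"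

definition tube where
  "tube W H = domain_atlas (times_complex W) (tube_set W H)"

definition tube_form where
  "tube_form W lam = domain_form (times_complex W) (hat_form lam)"

end

theory Submission
  imports Defs
begin

text \<open>
The coordinate change \<open>(t, w) \<mapsto> (w, \<surd>(H\<^sub>t(w) / \<pi>) e\<^bsup>2 \<pi> i t\<^esup>)\<close> turns the contact volume of the tube into the integral of
\<open>\<tau> dt \<and> (d\<lambda>)\<^sup>n\<close>, which Stokes' theorem identifies with \<open>(n + 1) Cal(H)\<close>.  A Reeb orbit of the tube either lies in \<open>z = 0\<close>,
and is an orbit of \<open>\<partial>W\<close>, or winds around it with angular speed \<open>2 \<pi> / \<tau>\<close>, so that its period is at least the minimum of \<open>\<tau>\<close>.
\<close>

section \<open>Calculus on thick sets\<close>

text \<open>The identity behind everything is \<tau> = H - dH(Y) with Y the Liouville field, since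
  \<lambda>(X) = d\<lambda>(Y, X) = -dH(Y). The field Y has divergence n for the volume
  (d\<lambda>)^n and H vanishes on the boundary, so the integral of dH(Y) is -n times that of H;
  this is the factor n + 1. Positivity of \<tau> also shapes the tube: at a nonpositive interior
  minimum of H it would give \<tau> = H, so H is positive inside, and on the boundary, where Y
  points outward, it makes the normal derivative of H nonzero. Hence the boundary of the tube is a
  regular hypersurface also at z = 0. There, however, the square root of H is not smooth and the
  angle is undefined: the coordinate change is used only off z = 0, that locus being null for both
  measures, and autonomy of H near the boundary removes the angle from the defining function and
  keeps |z| constant along nearby orbits, so no orbit enters or leaves z = 0. The charts of the tube
  are arbitrary, so all forms are computed through their transition maps to the product charts of W
  with the plane.\<close>

definition thick :: "'a::euclidean_space set => bool" where
 "thick S \<longleftrightarrow> (\<forall>x\<in>S. \<forall>i\<in>Basis. \<forall>e>0. \<exists>d. 0 < \<bar>d\<bar> & \<bar>d\<bar> < e & x + d *\<^sub>R i : S)"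

lemma thick_open: "open S ==> thick S"
proof (unfold thick_def, intro ballI allI impI)
 fix x i :: 'a and e :: real assume "open S" "x : S" "i : Basis" "0 < e"
 then obtain r where "r > 0" "ball x r <= S" by (meson open_contains_ball)
 let ?d = "min (e/2) (r/2)"
 have "0 < \<bar>?d\<bar>" "\<bar>?d\<bar> < e" using \<open>0<e\<close> \<open>0<r\<close> by auto
 moreover have "x + ?d *\<^sub>R i : S"
 using \<open>ball x r <= S\<close> \<open>i : Basis\<close> \<open>0<e\<close> \<open>0<r\<close>
 by (intro subsetD[OF \<open>ball x r <= S\<close>]) (auto simp: dist_norm)
 ultimately show "\<exists>d. 0 < \<bar>d\<bar> & \<bar>d\<bar> < e & x + d *\<^sub>R i : S" by blast
qed

text \<open>Basis vectors have nonnegative first component, so a small positive step along any of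
  them stays in the half-space.\<close>

lemma thick_openin_half_space:
 assumes "openin (top_of_set half_space) S" shows "thick S"
proof (unfold thick_def, intro ballI allI impI)
 fix x i :: "real \<times> 'a" and e :: real assume *: "x : S" "i : Basis" "0 < e"
 obtain T where "open T" and S: "S = half_space Int T" using assms by (auto simp: openin_open)
 then obtain r where "r > 0" "ball x r <= T" using *(1) by (metis IntD2 open_contains_ball)
 let ?d = "min (e/2) (r/2)"
 have "0 < \<bar>?d\<bar>" "\<bar>?d\<bar> < e" using \<open>0<e\<close> \<open>0<r\<close> by auto
 moreover have "x + ?d *\<^sub>R i : S"
 proof -
 have "fst i \<ge> 0" using \<open>i : Basis\<close> by (auto simp: Basis_prod_def)
 moreover have "fst x \<ge> 0" using *(1) S by (auto simp: half_space_def)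
 ultimately have "x + ?d *\<^sub>R i : half_space"
 using \<open>0<e\<close> \<open>0<r\<close> by (auto simp: half_space_def)
 moreover have "x + ?d *\<^sub>R i : T"
 using \<open>i : Basis\<close> \<open>0<e\<close> \<open>0<r\<close>
 by (intro subsetD[OF \<open>ball x r <= T\<close>]) (auto simp: dist_norm)
 ultimately show ?thesis using S by auto
 qed
 ultimately show "\<exists>d. 0 < \<bar>d\<bar> & \<bar>d\<bar> < e & x + d *\<^sub>R i : S" by blast
qed

lemma thick_Times: assumes "thick A" "thick B" shows "thick (A \<times> B)"
 unfolding thick_def
proof (intro ballI allI impI)
 fix x i :: "'a \<times> 'b" and e :: real assume *: "x : A \<times> B" "i : Basis" "0 < e"
 from *(2) consider u where "u : Basis" "i = (u, 0)" | v where "v : Basis" "i = (0, v)"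
 by (auto simp: Basis_prod_def)
 then show "\<exists>d. 0 < \<bar>d\<bar> & \<bar>d\<bar> < e & x + d *\<^sub>R i : A \<times> B"
 proof cases
 case 1
 with * assms(1)[unfolded thick_def, rule_format, of "fst x" u e] show ?thesis by (cases x) auto
 next
 case 2
 with * assms(2)[unfolded thick_def, rule_format, of "snd x" v e] show ?thesis by (cases x) auto
 qed
qed

text \<open>This is what \<open>thick\<close> is made for: points of the set arbitrarily close to x
  along every coordinate axis determine a derivative on the basis. It lets the choice operator
  \<open>frechet_derivative\<close> within a set be computed, also at boundary points of the
  half-space.\<close>

lemma thick_derivative_unique:
 assumes "thick S" "x : S" "(f has_derivative f') (at x within S)" "(f has_derivative f'') (at x within S)"
 shows "f' = f''"
 using assms(1,2) by (intro frechet_derivative_unique_within[OF assms(3,4)]) (auto simp: thick_def)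

lemma thick_frechet_eq:
 assumes "thick S" "x : S" "(f has_derivative f') (at x within S)"
 shows "frechet_derivative f (at x within S) = f'"
 by (metis assms differentiable_def frechet_derivative_works thick_derivative_unique)

lemma has_derivative_transform_on:
 assumes "(f has_derivative f') (at x within S)" "x : S" "!!y. y : S ==> g y = f y"
 shows "(g has_derivative f') (at x within S)"
 using has_derivative_transform[OF assms(2) assms(3) assms(1)] .

lemma at_within_Int_open: "open U ==> x : U ==> at x within (S Int U) = at x within S"
 using at_within_nhd[of x U "S Int U" S] by auto

section \<open>Smooth maps\<close>

lemma Ck_on_subset: "Ck_on k S f ==> T <= S ==> Ck_on k T f"
 by (induction k arbitrary: f) (auto intro: continuous_on_subset)

lemma Ck_on_cong:
 assumes "open S" "!!x. x : S ==> f x = g x" "Ck_on k S f"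
 shows "Ck_on k S g"
 using assms(2,3)
proof (induction k arbitrary: f g)
 case 0 then show ?case using continuous_on_cong[of S S f g] by auto
next
 case (Suc k)
 have "g differentiable (at x)" if "x : S" for x
 proof -
 have "f differentiable (at x)" using Suc.prems(2) that by simp
 then show ?thesis
 unfolding differentiable_def
 using has_derivative_transform_within_open[of f _ x UNIV S g] \<open>open S\<close> that Suc.prems(1) by blast
 qed
 moreover have "Ck_on k S (%x. frechet_derivative g (at x) v)" for v
 proof (rule Suc.IH[of "%x. frechet_derivative f (at x) v"])
 show "frechet_derivative f (at x) v = frechet_derivative g (at x) v" if "x : S" for x
 using frechet_derivative_transform_within_open[of f x S g] \<open>open S\<close> Suc.prems that by simp
 qed (use Suc.prems(2) in simp)
 ultimately show ?case by simp
qed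

text \<open>An explicit candidate replaces the choice operator \<open>frechet_derivative\<close>.
  The closure properties below follow by induction on k, the Leibniz and chain formulas supplying
  the candidate.\<close>

lemma Ck_on_SucI:
 assumes "open S" "!!x. x : S ==> (f has_derivative f' x) (at x)" "!!v. Ck_on k S (%x. f' x v)"
 shows "Ck_on (Suc k) S f"
proof -
 have "frechet_derivative f (at x) = f' x" if "x : S" for x
 using assms(2)[OF that] by (metis frechet_derivative_at)
 then have "Ck_on k S (%x. frechet_derivative f (at x) v)" for v
 using Ck_on_cong[OF assms(1) _ assms(3)[of v]] by simp
 then show ?thesis using assms(2) by (auto simp: differentiable_def)
qed

lemma Ck_on_has_derivative:
 "Ck_on (Suc k) S f ==> x : S ==> (f has_derivative frechet_derivative f (at x)) (at x)"
 by (simp add: frechet_derivative_works)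

lemma Ck_on_SucD: "Ck_on (Suc k) S f ==> Ck_on k S f"
proof (induction k arbitrary: f)
 case 0
 then show ?case by (auto intro!: continuous_at_imp_continuous_on differentiable_imp_continuous_within)
next
 case (Suc k)
 then show ?case by (metis Ck_on.simps(2))
qed

lemma Ck_on_continuous: "Ck_on k S f ==> continuous_on S f"
 by (induction k) (use Ck_on_SucD in auto)

lemma Ck_on_const: "open S ==> Ck_on k S (%x. c)"
 by (induction k arbitrary: c) (simp_all add: frechet_derivative_const)

lemma Ck_on_bounded_linear:
 assumes "open S" "Ck_on k S f" "bounded_linear L"
 shows "Ck_on k S (%x. L (f x))"
 using assms(2)
proof (induction k arbitrary: f)
 case 0
 then show ?case using bounded_linear.continuous_on[OF assms(3)] by simp
next
 case (Suc k)
 show ?case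
 proof (rule Ck_on_SucI[OF assms(1)])
 show "((%x. L (f x)) has_derivative (%v. L (frechet_derivative f (at x) v))) (at x)" if "x : S" for x
 using bounded_linear.has_derivative[OF assms(3) Ck_on_has_derivative[OF Suc.prems that]] .
 show "Ck_on k S (%x. L (frechet_derivative f (at x) v))" for v
 using Suc by simp
 qed
qed

lemma Ck_on_linear_self: "open S ==> bounded_linear L ==> Ck_on k S L"
proof (cases k)
 case 0
 then show "bounded_linear L ==> ?thesis" by (simp add: linear_continuous_on)
next
 case (Suc m)
 then show "open S ==> bounded_linear L ==> ?thesis"
 by (auto simp del: Ck_on.simps intro!: Ck_on_SucI[where f' = "%x. L"] Ck_on_const bounded_linear_imp_has_derivative)
qed

lemma Ck_on_ident: "open S ==> Ck_on k S (%x. x)"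
 using Ck_on_linear_self[OF _ bounded_linear_ident] .

lemma Ck_on_add:
 assumes "open S" "Ck_on k S f" "Ck_on k S g" shows "Ck_on k S (%x. f x + g x)"
 using assms(2,3)
proof (induction k arbitrary: f g)
 case 0 then show ?case by (auto intro: continuous_intros)
next
 case (Suc k)
 show ?case
 proof (rule Ck_on_SucI[OF assms(1)])
 show "((%x. f x + g x) has_derivative (%v. frechet_derivative f (at x) v + frechet_derivative g (at x) v)) (at x)"
 if "x : S" for x
 using Ck_on_has_derivative[OF Suc.prems(1) that] Ck_on_has_derivative[OF Suc.prems(2) that]
 by (rule has_derivative_add)
 show "Ck_on k S (%x. frechet_derivative f (at x) v + frechet_derivative g (at x) v)" for v
 using Suc by simp
 qed
qed

lemma Ck_on_sum:
 assumes "open S" "!!i. i : I ==> Ck_on k S (f i)" shows "Ck_on k S (%x. \<Sum>i\<in>I. f i x)"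
 using assms(2) by (induction I rule: infinite_finite_induct) (auto intro: Ck_on_const Ck_on_add assms(1))

lemma (in bounded_bilinear) Ck_on_prod:
 assumes "open S" "Ck_on k S f" "Ck_on k S g" shows "Ck_on k S (%x. prod (f x) (g x))"
 using assms(2,3)
proof (induction k arbitrary: f g)
 case 0 then show ?case by (auto intro: continuous_on)
next
 case (Suc k)
 show ?case
 proof (rule Ck_on_SucI[OF assms(1)])
 show "((%x. prod (f x) (g x)) has_derivative
 (%v. prod (f x) (frechet_derivative g (at x) v) + prod (frechet_derivative f (at x) v) (g x))) (at x)"
 if "x : S" for x
 using Ck_on_has_derivative[OF Suc.prems(1) that] Ck_on_has_derivative[OF Suc.prems(2) that]
 by (rule FDERIV)
 show "Ck_on k S (%x. prod (f x) (frechet_derivative g (at x) v) + prod (frechet_derivative f (at x) v) (g x))" for v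
 using Suc.prems by (intro Ck_on_add[OF assms(1)] Suc.IH Ck_on_SucD[of k S f] Ck_on_SucD[of k S g]) auto
 qed
qed

lemmas Ck_on_mult = bounded_bilinear.Ck_on_prod[OF bounded_bilinear_mult]
lemmas Ck_on_scaleR = bounded_bilinear.Ck_on_prod[OF bounded_bilinear_scaleR]
lemmas Ck_on_inner = bounded_bilinear.Ck_on_prod[OF bounded_bilinear_inner]

lemma Ck_on_uminus: "open S ==> Ck_on k S f ==> Ck_on k S (%x. - f x)"
 by (rule Ck_on_bounded_linear[OF _ _ bounded_linear_minus[OF bounded_linear_ident]])

lemma Ck_on_diff: "open S ==> Ck_on k S f ==> Ck_on k S g ==> Ck_on k S (%x. f x - g x)"
 using Ck_on_add[of S k f "%x. - g x"] Ck_on_uminus[of S k g] by simp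

lemma Ck_on_Pair:
 assumes "open S" "Ck_on k S f" "Ck_on k S g" shows "Ck_on k S (%x. (f x, g x))"
proof -
 have "bounded_linear (%x. (x, 0::'c))" "bounded_linear (%x. (0::'b, x))"
 by (auto intro: bounded_linear_Pair bounded_linear_ident bounded_linear_zero)
 from Ck_on_add[OF assms(1) Ck_on_bounded_linear[OF assms(1,2) this(1)] Ck_on_bounded_linear[OF assms(1,3) this(2)]]
 show ?thesis by simp
qed

lemma linear_basis_sum: "linear L ==> L x = (\<Sum>b\<in>Basis. (x \<bullet> b) *\<^sub>R L b)"
 for x :: "'a::euclidean_space"
 by (metis (no_types, lifting) euclidean_representation linear_sum linear_cmul sum.cong)

text \<open>In the chain rule the point enters the derivative of g both through the base point and
  through the argument. Expanding the argument in the basis of the middle space separates the two: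
  products of components of Df with partial derivatives of g composed with f, to which the induction
  applies.\<close>

lemma Ck_on_compose:
 fixes f :: "'a::real_normed_vector => 'b::euclidean_space"
 assumes "open S" "open T" "f ` S <= T" "Ck_on k S f" "Ck_on k T g"
 shows "Ck_on k S (%x. g (f x))"
 using assms(4,5)
proof (induction k arbitrary: g)
 case 0 then show ?case using assms(3) continuous_on_compose2[of T g S f] by simp
next
 case (Suc k)
 show ?case
 proof (rule Ck_on_SucI[OF assms(1)])
 fix x assume x: "x : S"
 then have "f x : T" using assms(3) by auto
 have g: "(g has_derivative frechet_derivative g (at (f x))) (at (f x))"
 using Ck_on_has_derivative[OF Suc.prems(2) \<open>f x : T\<close>] .
 have "linear (frechet_derivative g (at (f x)))"
 using g has_derivative_linear by blast
 then have eq: "frechet_derivative g (at (f x)) v = (\<Sum>b\<in>Basis. (v \<bullet> b) *\<^sub>R frechet_derivative g (at (f x)) b)" for v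
 by (rule linear_basis_sum)
 show "((%x. g (f x)) has_derivative
 (%v. \<Sum>b\<in>Basis. (frechet_derivative f (at x) v \<bullet> b) *\<^sub>R frechet_derivative g (at (f x)) b)) (at x)"
 using has_derivative_compose[OF Ck_on_has_derivative[OF Suc.prems(1) x] g]
 by (simp only: eq[symmetric])
 next
 fix v
 show "Ck_on k S (%x. \<Sum>b\<in>Basis. (frechet_derivative f (at x) v \<bullet> b) *\<^sub>R frechet_derivative g (at (f x)) b)"
 using Suc.prems Ck_on_SucD[of k S f]
 by (intro Ck_on_sum Ck_on_scaleR Ck_on_inner Ck_on_const Suc.IH assms(1)) auto
 qed
qed

lemma Ck_on_inverse:
 fixes f :: "'a::real_normed_vector => 'b::real_normed_field"
 assumes "open S" "!!x. x : S ==> f x ~= 0" "Ck_on k S f"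
 shows "Ck_on k S (%x. inverse (f x))"
 using assms(3)
proof (induction k)
 case 0 then show ?case using assms(2) by (auto intro: continuous_on_inverse)
next
 case (Suc k)
 show ?case
 proof (rule Ck_on_SucI[OF assms(1)])
 show "((%x. inverse (f x)) has_derivative
 (%v. - (inverse (f x) * frechet_derivative f (at x) v * inverse (f x)))) (at x)" if "x : S" for x
 using Ck_on_has_derivative[OF Suc.prems that] assms(2)[OF that]
 by (rule Deriv.has_derivative_inverse[rotated])
 show "Ck_on k S (%x. - (inverse (f x) * frechet_derivative f (at x) v * inverse (f x)))" for v
 using Suc Ck_on_SucD[of k S f] by (intro Ck_on_uminus Ck_on_mult assms(1)) auto
 qed
qed

lemma Ck_on_Ln: "Ck_on k (- \<real>\<^sub>\<le>\<^sub>0) Ln"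
proof (cases k)
 case 0 then show ?thesis by (auto intro!: continuous_intros)
next
 case (Suc m)
 have op: "open (- \<real>\<^sub>\<le>\<^sub>0 :: complex set)" by (simp add: open_Compl)
 show ?thesis unfolding Suc
 proof (rule Ck_on_SucI[OF op])
 show "(Ln has_derivative (%v. inverse z * v)) (at z)" if "z : - \<real>\<^sub>\<le>\<^sub>0" for z
 using has_field_derivative_Ln[of z] that by (auto simp: has_field_derivative_def)
 show "Ck_on m (- \<real>\<^sub>\<le>\<^sub>0) (%z::complex. inverse z * v)" for v
 by (intro Ck_on_mult Ck_on_inverse Ck_on_const Ck_on_ident op) auto
 qed
qed

lemma smooth_onD:
 "smooth_on S f ==> x : S ==>
 \<exists>U g. open U & x : U & (\<forall>k. Ck_on k U g) & (\<forall>y. y : S --> y : U --> g y = f y)"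
 unfolding smooth_on_def Ball_def Int_iff imp_conjL by iprover

lemma smooth_on_subset: "smooth_on S f ==> T <= S ==> smooth_on T f"
 unfolding smooth_on_def Ball_def Int_iff imp_conjL by (meson subsetD)

lemma smooth_on_cong: "smooth_on S f ==> (!!x. x : S ==> f x = g x) ==> smooth_on S g"
 unfolding smooth_on_def by (metis Int_iff)

lemma smooth_on_open: "open S ==> (!!k. Ck_on k S f) ==> smooth_on S f"
 unfolding smooth_on_def by blast

lemma smooth_on_bounded_linear:
 assumes "smooth_on S f" "bounded_linear L" shows "smooth_on S (%x. L (f x))"
 unfolding smooth_on_def
proof
 fix x assume "x : S"
 obtain U g where *: "open U" "x : U" "\<forall>k. Ck_on k U g"
 "\<forall>y. y : S --> y : U --> g y = f y"
 using smooth_onD[OF assms(1) \<open>x : S\<close>] by (elim exE conjE) (rule that)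
 note * = *(1,2) *(3)[rule_format] *(4)[rule_format]
 then show "\<exists>U g. open U & x : U & (\<forall>k. Ck_on k U g) & (\<forall>y\<in>S Int U. g y = L (f y))"
 by (intro exI[of _ U] exI[of _ "%x. L (g x)"]) (use Ck_on_bounded_linear[OF *(1) _ assms(2), of _ g] in auto)
qed

lemma smooth_on_binop:
 fixes f :: "'a::real_normed_vector => 'b::real_normed_vector" and g :: "'a => 'c::real_normed_vector"
 assumes "smooth_on S f" "smooth_on S g"
 and "!!U (f :: 'a => 'b) g k. open U ==> Ck_on k U f ==> Ck_on k U g ==> Ck_on k U (%x. F (f x) (g x))"
 shows "smooth_on S (%x. F (f x) (g x))"
 unfolding smooth_on_def
proof
 fix x assume x: "x : S"
 obtain U f' where *: "open U" "x : U" "\<forall>k. Ck_on k U f'"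
 "\<forall>y. y : S --> y : U --> f' y = f y"
 using smooth_onD[OF assms(1) x] by (elim exE conjE) (rule that)
 note * = *(1,2) *(3)[rule_format] *(4)[rule_format]
 obtain V g' where **: "open V" "x : V" "\<forall>k. Ck_on k V g'"
 "\<forall>y. y : S --> y : V --> g' y = g y"
 using smooth_onD[OF assms(2) x] by (elim exE conjE) (rule that)
 note ** = **(1,2) **(3)[rule_format] **(4)[rule_format]
 show "\<exists>U h. open U & x : U & (\<forall>k. Ck_on k U h) & (\<forall>y\<in>S Int U. h y = F (f y) (g y))"
 using * ** by (intro exI[of _ "U Int V"] exI[of _ "%x. F (f' x) (g' x)"])
 (auto intro!: assms(3)[where f = f' and g = g'] intro: Ck_on_subset)
qed

lemma smooth_on_add: "smooth_on S f ==> smooth_on S g ==> smooth_on S (%x. f x + g x)"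
 by (rule smooth_on_binop) (auto intro: Ck_on_add)

lemma smooth_on_Pair: "smooth_on S f ==> smooth_on S g ==> smooth_on S (%x. (f x, g x))"
 by (rule smooth_on_binop) (auto intro: Ck_on_Pair)

lemma smooth_on_compose:
 fixes f :: "'a::real_normed_vector => 'b::euclidean_space"
 assumes "smooth_on S f" "smooth_on T g" "f ` S <= T"
 shows "smooth_on S (%x. g (f x))"
 unfolding smooth_on_def
proof
 fix x assume x: "x : S"
 obtain U f' where *: "open U" "x : U" "\<forall>k. Ck_on k U f'"
 "\<forall>y. y : S --> y : U --> f' y = f y"
 using smooth_onD[OF assms(1) x] by (elim exE conjE) (rule that)
 note * = *(1,2) *(3)[rule_format] *(4)[rule_format]
 have "f x : T" using x assms(3) by auto
 obtain V g' where **: "open V" "f x : V" "\<forall>k. Ck_on k V g'"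
 "\<forall>y. y : T --> y : V --> g' y = g y"
 using smooth_onD[OF assms(2) \<open>f x : T\<close>] by (elim exE conjE) (rule that)
 note ** = **(1,2) **(3)[rule_format] **(4)[rule_format]
 have op: "open (U Int f' -` V)"
 using *(1,3) **(1) Ck_on_continuous continuous_on_open_vimage[of U f'] by (metis inf_commute)
 show "\<exists>U h. open U & x : U & (\<forall>k. Ck_on k U h) & (\<forall>y\<in>S Int U. h y = g (f y))"
 proof (intro exI[of _ "U Int f' -` V"] exI[of _ "%x. g' (f' x)"] conjI allI)
 show "Ck_on k (U Int f' -` V) (%x. g' (f' x))" for k
 by (rule Ck_on_compose[OF op **(1) _ _ **(3)]) (auto intro: Ck_on_subset[OF *(3)])
 show "\<forall>y\<in>S Int (U Int f' -` V). g' (f' y) = g (f y)" using assms(3) *(4) **(4) by (auto simp: image_subset_iff)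
 qed (use op * ** x in auto)
qed

lemma smooth_on_continuous:
 assumes "smooth_on S f" shows "continuous_on S f"
 unfolding continuous_on_eq_continuous_within
proof
 fix x assume x: "x : S"
 obtain U f' where *: "open U" "x : U" "\<forall>k. Ck_on k U f'"
 "\<forall>y. y : S --> y : U --> f' y = f y"
 using smooth_onD[OF assms(1) x] by (elim exE conjE) (rule that)
 note * = *(1,2) *(3)[rule_format] *(4)[rule_format]
 have "continuous (at x) f'" using * Ck_on_continuous continuous_on_eq_continuous_at by blast
 then have "continuous (at x within S Int U) f'" using continuous_at_imp_continuous_at_within by blast
 moreover have "continuous (at x within S Int U) f \<longleftrightarrow> continuous (at x within S Int U) f'"
 unfolding continuous_within using *(4)[OF x *(2)]
 by (intro filterlim_cong) (use * in \<open>auto simp: eventually_at_filter\<close>)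
 ultimately show "continuous (at x within S) f" using * at_within_Int_open by metis
qed

lemma smooth_on_ext_derivative:
 assumes "open U" "!!y. y : S ==> y : U ==> g y = f y" "y : S" "y : U" "Ck_on (Suc k) U g"
 shows "(f has_derivative frechet_derivative g (at y)) (at y within S)"
proof -
 have "(g has_derivative frechet_derivative g (at y)) (at y within S Int U)"
 using Ck_on_has_derivative[OF assms(5,4)] has_derivative_at_withinI by blast
 then have "(f has_derivative frechet_derivative g (at y)) (at y within S Int U)"
 by (rule has_derivative_transform_on) (use assms in auto)
 then show ?thesis using at_within_Int_open assms by metis
qed

abbreviation "fd_within f S x \<equiv> frechet_derivative f (at x within S)"

lemma smooth_on_has_derivative:
 assumes "smooth_on S f" "x : S" shows "(f has_derivative fd_within f S x) (at x within S)"
proof -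
 obtain U f' where *: "open U" "x : U" "\<forall>k. Ck_on k U f'"
 "\<forall>y. y : S --> y : U --> f' y = f y"
 using smooth_onD[OF assms] by (elim exE conjE) (rule that)
 note * = *(1,2) *(3)[rule_format] *(4)[rule_format]
 have "(f has_derivative frechet_derivative f' (at x)) (at x within S)"
 by (rule smooth_on_ext_derivative[OF *(1) _ assms(2) *(2) *(3)[of "Suc 0"]]) (use * in auto)
 then show ?thesis by (metis differentiable_def frechet_derivative_works)
qed

text \<open>On a thick set the derivative within S equals the full derivative of any smooth local
  extension, and that derivative serves as the extension required here.\<close>

lemma smooth_on_derivative:
 assumes "smooth_on S f" "thick S" shows "smooth_on S (%x. fd_within f S x v)"
 unfolding smooth_on_def
proof
 fix x assume x: "x : S"
 obtain U f' where *: "open U" "x : U" "\<forall>k. Ck_on k U f'"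
 "\<forall>y. y : S --> y : U --> f' y = f y"
 using smooth_onD[OF assms(1) x] by (elim exE conjE) (rule that)
 note * = *(1,2) *(3)[rule_format] *(4)[rule_format]
 have eq: "fd_within f S y = frechet_derivative f' (at y)" if "y : S" "y : U" for y
 by (rule thick_frechet_eq[OF assms(2) that(1)], rule smooth_on_ext_derivative[OF *(1) _ that *(3)[of "Suc 0"]]) (use * in auto)
 show "\<exists>U g. open U & x : U & (\<forall>k. Ck_on k U g) & (\<forall>y\<in>S Int U. g y = fd_within f S y v)"
 using * eq by (intro exI[of _ U] exI[of _ "%x. frechet_derivative f' (at x) v"])
 (auto intro: *(3)[of "Suc _", simplified, THEN conjunct2, rule_format])
qed

section \<open>Symmetry of second derivatives\<close>

text \<open>The mean value theorem twice: for \<open>phi\<close>, the difference across the side v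
  as a function of the step along u, and then for the derivative of f along u as a function of the
  step along v.\<close>

lemma second_difference_mvt:
 fixes f :: "'a::real_normed_vector => real"
 assumes C2: "Ck_on 2 U f" and h: "0 < h"
 and sub: "!!s t. 0 <= s ==> s <= h ==> 0 <= t ==> t <= h ==> x + s *\<^sub>R u + t *\<^sub>R v : U"
 obtains s t where "0 < s" "s < h" "0 < t" "t < h"
 "f (x + h *\<^sub>R u + h *\<^sub>R v) - f (x + h *\<^sub>R u) - f (x + h *\<^sub>R v) + f x =
 h * h * frechet_derivative (%y. frechet_derivative f (at y) u) (at (x + s *\<^sub>R u + t *\<^sub>R v)) v"
proof -
 have C: "Ck_on (Suc (Suc 0)) U f" using C2 by (simp add: numeral_2_eq_2)
 define D where "D = (%w y. frechet_derivative f (at y) w)"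
 have f': "(f has_derivative (%w. D w y)) (at y)" if "y : U" for y
 using Ck_on_has_derivative[OF C that] by (simp add: D_def)
 have D': "(D w has_derivative frechet_derivative (D w) (at y)) (at y)" if "y : U" for y w
 using C that by (simp add: D_def frechet_derivative_works)
 have lin: "linear (%w. D w y)" if "y : U" for y using f'[OF that] has_derivative_linear by blast
 define phi where "phi = (%s. f (x + s *\<^sub>R u + h *\<^sub>R v) - f (x + s *\<^sub>R u))"
 have dphi: "(phi has_real_derivative (D u (x + s *\<^sub>R u + h *\<^sub>R v) - D u (x + s *\<^sub>R u))) (at s)"
 if s: "0 <= s" "s <= h" for s
 proof -
 have 1: "x + s *\<^sub>R u + h *\<^sub>R v : U" "x + s *\<^sub>R u : U" using sub[of s h] sub[of s 0] s h by auto
 have a: "((%s. f (x + s *\<^sub>R u + h *\<^sub>R v)) has_derivative (%r. D (r *\<^sub>R u) (x + s *\<^sub>R u + h *\<^sub>R v))) (at s)"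
 by (rule has_derivative_compose[where f = "%s. x + s *\<^sub>R u + h *\<^sub>R v", OF _ f'[OF 1(1)]]) (auto intro!: derivative_eq_intros)
 have b: "((%s. f (x + s *\<^sub>R u)) has_derivative (%r. D (r *\<^sub>R u) (x + s *\<^sub>R u))) (at s)"
 by (rule has_derivative_compose[where f = "%s. x + s *\<^sub>R u", OF _ f'[OF 1(2)]]) (auto intro!: derivative_eq_intros)
 have "(phi has_derivative (%r. D (r *\<^sub>R u) (x + s *\<^sub>R u + h *\<^sub>R v) - D (r *\<^sub>R u) (x + s *\<^sub>R u))) (at s)"
 unfolding phi_def by (rule has_derivative_diff[OF a b])
 then show ?thesis unfolding has_field_derivative_def
 by (rule has_derivative_eq_rhs) (use linear_cmul[OF lin[OF 1(1)]] linear_cmul[OF lin[OF 1(2)]] in \<open>auto simp: fun_eq_iff right_diff_distrib left_diff_distrib mult.commute\<close>)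
 qed
 obtain s where s: "0 < s" "s < h" "phi h - phi 0 = (h - 0) * (D u (x + s *\<^sub>R u + h *\<^sub>R v) - D u (x + s *\<^sub>R u))"
 using MVT2[OF h, of phi "%s. D u (x + s *\<^sub>R u + h *\<^sub>R v) - D u (x + s *\<^sub>R u)"] dphi by blast
 define psi where "psi = (%t. D u (x + s *\<^sub>R u + t *\<^sub>R v))"
 have dpsi: "(psi has_real_derivative (frechet_derivative (D u) (at (x + s *\<^sub>R u + t *\<^sub>R v)) v)) (at t)"
 if t: "0 <= t" "t <= h" for t
 proof -
 have 1: "x + s *\<^sub>R u + t *\<^sub>R v : U" using sub[of s t] s t by auto
 have a: "(psi has_derivative (%r. frechet_derivative (D u) (at (x + s *\<^sub>R u + t *\<^sub>R v)) (r *\<^sub>R v))) (at t)"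
 unfolding psi_def by (rule has_derivative_compose[where f = "%t. x + s *\<^sub>R u + t *\<^sub>R v", OF _ D'[OF 1]]) (auto intro!: derivative_eq_intros)
 have "linear (frechet_derivative (D u) (at (x + s *\<^sub>R u + t *\<^sub>R v)))" using D'[OF 1] has_derivative_linear by blast
 with a show ?thesis unfolding has_field_derivative_def
 by (elim has_derivative_eq_rhs) (auto simp: fun_eq_iff linear_cmul algebra_simps)
 qed
 obtain t where t: "0 < t" "t < h" "psi h - psi 0 = (h - 0) * frechet_derivative (D u) (at (x + s *\<^sub>R u + t *\<^sub>R v)) v"
 using MVT2[OF h, of psi "%t. frechet_derivative (D u) (at (x + s *\<^sub>R u + t *\<^sub>R v)) v"] dpsi by blast
 show thesis
 apply (rule that[OF s(1,2) t(1,2)])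
 using s(3) t(3) unfolding phi_def psi_def D_def by (simp add: algebra_simps)
qed

text \<open>The second difference is symmetric in u and v. Taken in both orders, the preceding lemma
  equates the two mixed derivatives at two points near x, and continuity moves both points to
  x.\<close>

lemma second_derivative_symmetric_real:
 fixes f :: "'a::real_normed_vector => real"
 assumes "open U" "Ck_on 2 U f" "x : U"
 shows "frechet_derivative (%y. frechet_derivative f (at y) u) (at x) v =
 frechet_derivative (%y. frechet_derivative f (at y) v) (at x) u"
proof -
 define A where "A = (%y. frechet_derivative (%y. frechet_derivative f (at y) u) (at y) v)"
 define B where "B = (%y. frechet_derivative (%y. frechet_derivative f (at y) v) (at y) u)"
 have "continuous_on U A" "continuous_on U B" using assms(2) by (auto simp: A_def B_def numeral_2_eq_2)
 then have cont: "isCont A x" "isCont B x" using assms continuous_on_eq_continuous_at by blast+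
 have "\<bar>A x - B x\<bar> <= e" if e: "e > 0" for e
 proof -
 from cont obtain d1 d2 where d: "d1 > 0" "d2 > 0" "!!y. dist y x < d1 ==> dist (A y) (A x) < e/2"
 "!!y. dist y x < d2 ==> dist (B y) (B x) < e/2"
 using e unfolding continuous_at_eps_delta by (metis half_gt_zero_iff)
 obtain r where r: "r > 0" "ball x r <= U" using assms by (meson open_contains_ball)
 define \<delta> where "\<delta> = min r (min d1 d2)"
 \<comment> \<open>The summand 1 keeps the denominator positive when u = v = 0; the factor 2 makes
   the displacement strictly smaller than \<delta>.\<close>
 define h where "h = \<delta> / (2 * (norm u + norm v + 1))"
 have "\<delta> > 0" using d r by (simp add: \<delta>_def)
 then have h: "h > 0" unfolding h_def by (intro divide_pos_pos) (auto intro: add_nonneg_pos)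
 have near: "dist (x + s *\<^sub>R u + t *\<^sub>R v) x < \<delta>" if "0 <= s" "s <= h" "0 <= t" "t <= h" for s t
 proof -
 have "dist (x + s *\<^sub>R u + t *\<^sub>R v) x <= norm (s *\<^sub>R u) + norm (t *\<^sub>R v)"
 by (simp add: dist_norm add.assoc norm_triangle_ineq del: norm_scaleR)
 also have "\<dots> <= h * norm u + h * norm v" using that by (auto intro!: add_mono mult_right_mono)
 also have "\<dots> < h * (2 * (norm u + norm v + 1))"
 proof -
 have "norm u + norm v < 2 * (norm u + norm v + 1)" by (smt (verit) norm_ge_zero)
 from mult_strict_left_mono[OF this h] show ?thesis by (simp add: algebra_simps)
 qed
 also have "\<dots> = \<delta>" unfolding h_def by (smt (verit) norm_ge_zero nonzero_eq_divide_eq)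
 finally show ?thesis .
 qed
 have sub: "x + s *\<^sub>R u + t *\<^sub>R v : U" if "0 <= s" "s <= h" "0 <= t" "t <= h" for s t
 using near[OF that] r by (auto simp: \<delta>_def dist_commute)
 obtain s t where 1: "0 < s" "s < h" "0 < t" "t < h"
 "f (x + h *\<^sub>R u + h *\<^sub>R v) - f (x + h *\<^sub>R u) - f (x + h *\<^sub>R v) + f x = h * h * A (x + s *\<^sub>R u + t *\<^sub>R v)"
 using second_difference_mvt[OF assms(2) h sub] unfolding A_def by blast
 have sub': "x + s *\<^sub>R v + t *\<^sub>R u : U" if "0 <= s" "s <= h" "0 <= t" "t <= h" for s t
 using sub[OF that(3,4,1,2)] by (simp add: algebra_simps)
 obtain s' t' where 2: "0 < s'" "s' < h" "0 < t'" "t' < h"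
 "f (x + h *\<^sub>R v + h *\<^sub>R u) - f (x + h *\<^sub>R v) - f (x + h *\<^sub>R u) + f x = h * h * B (x + s' *\<^sub>R v + t' *\<^sub>R u)"
 using second_difference_mvt[OF assms(2) h sub'] unfolding B_def by blast
 have "h * h * A (x + s *\<^sub>R u + t *\<^sub>R v) = h * h * B (x + t' *\<^sub>R u + s' *\<^sub>R v)"
 using 1(5) 2(5) by (simp add: algebra_simps)
 then have "A (x + s *\<^sub>R u + t *\<^sub>R v) = B (x + t' *\<^sub>R u + s' *\<^sub>R v)" using h by simp
 moreover have "dist (A (x + s *\<^sub>R u + t *\<^sub>R v)) (A x) < e/2"
 using near[of s t] 1 by (intro d(3)) (auto simp: \<delta>_def)
 moreover have "dist (B (x + t' *\<^sub>R u + s' *\<^sub>R v)) (B x) < e/2"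
 using near[of t' s'] 2 by (intro d(4)) (auto simp: \<delta>_def)
 ultimately show ?thesis by (auto simp: dist_real_def abs_if split: if_splits)
 qed
 then have "\<bar>A x - B x\<bar> <= 0" by (rule field_le_epsilon) simp
 then show ?thesis by (simp add: A_def B_def)
qed

lemma second_derivative_symmetric:
 fixes f :: "'a::real_normed_vector => 'b::euclidean_space"
 assumes "open U" "Ck_on 2 U f" "x : U"
 shows "frechet_derivative (%y. frechet_derivative f (at y) u) (at x) v =
 frechet_derivative (%y. frechet_derivative f (at y) v) (at x) u"
proof (rule euclidean_eqI)
 fix b :: 'b assume "b : Basis"
 define g where "g = (%y. f y \<bullet> b)"
 have C: "Ck_on (Suc (Suc 0)) U f" using assms(2) by (simp add: numeral_2_eq_2)
 have g: "Ck_on 2 U g" unfolding g_def by (rule Ck_on_bounded_linear[OF assms(1,2) bounded_linear_inner_left])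
 have 1: "frechet_derivative g (at y) w = frechet_derivative f (at y) w \<bullet> b" if "y : U" for y w
 using bounded_linear.has_derivative[OF bounded_linear_inner_left Ck_on_has_derivative[OF C that], of b]
 unfolding g_def by (metis frechet_derivative_at)
 have 2: "frechet_derivative (%y. frechet_derivative g (at y) w) (at x) z =
 frechet_derivative (%y. frechet_derivative f (at y) w) (at x) z \<bullet> b" for w z
 proof -
 have "((%y. frechet_derivative f (at y) w) has_derivative frechet_derivative (%y. frechet_derivative f (at y) w) (at x)) (at x)"
 using C assms(3) by (simp add: frechet_derivative_works)
 from bounded_linear.has_derivative[OF bounded_linear_inner_left this, of b]
 have "((%y. frechet_derivative g (at y) w) has_derivative
 (%z. frechet_derivative (%y. frechet_derivative f (at y) w) (at x) z \<bullet> b)) (at x)"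
 by (rule has_derivative_transform_within_open[OF _ assms(1,3)]) (simp add: 1)
 then show ?thesis by (metis frechet_derivative_at)
 qed
 show "frechet_derivative (%y. frechet_derivative f (at y) u) (at x) v \<bullet> b =
 frechet_derivative (%y. frechet_derivative f (at y) v) (at x) u \<bullet> b"
 using second_derivative_symmetric_real[OF assms(1) g assms(3), of u v] by (simp add: 2)
qed

lemma fd_within_symmetric:
 fixes f :: "'a::euclidean_space => 'b::euclidean_space"
 assumes "smooth_on S f" "thick S" "x : S"
 shows "fd_within (%y. fd_within f S y u) S x v = fd_within (%y. fd_within f S y v) S x u"
proof -
 obtain U g where *: "open U" "x : U" "\<forall>k. Ck_on k U g"
 "\<forall>y. y : S --> y : U --> g y = f y"
 using smooth_onD[OF assms(1,3)] by (elim exE conjE) (rule that)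
 note * = *(1,2) *(3)[rule_format] *(4)[rule_format]
 have 1: "fd_within f S y = frechet_derivative g (at y)" if "y : S" "y : U" for y
 by (rule thick_frechet_eq[OF assms(2) that(1)], rule smooth_on_ext_derivative[OF *(1) _ that *(3)[of "Suc 0"]]) (use * in auto)
 have 2: "fd_within (%y. fd_within f S y w) S x = frechet_derivative (%y. frechet_derivative g (at y) w) (at x)" for w
 proof (rule thick_frechet_eq[OF assms(2,3)], rule smooth_on_ext_derivative[OF *(1) _ assms(3) *(2)])
 show "Ck_on (Suc 0) U (%y. frechet_derivative g (at y) w)" using *(3)[of "Suc (Suc 0)"] by simp
 qed (use 1 in auto)
 show ?thesis using second_derivative_symmetric[OF *(1,3,2)] by (simp add: 2)
qed

text \<open>The exterior derivative commutes with pullback. With l expanded in the basis, the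
  product rule gives the pulled back derivative plus l applied to the second derivative of \<Phi>;
  the latter is symmetric in u and v and drops out of the difference.\<close>

lemma ext_derivative_pullback:
 fixes \<Phi> :: "'a::euclidean_space => 'b::euclidean_space" and l :: "'b => 'b => real"
 assumes S: "thick S" and T: "thick T" and \<Phi>: "smooth_on S \<Phi>" "\<Phi> ` S <= T"
 and l: "!!y. y : T ==> linear (l y)" "!!w. smooth_on T (%y. l y w)"
 and \<kappa>: "!!x u. x : S ==> \<kappa> x u = l (\<Phi> x) (fd_within \<Phi> S x u)"
 and x: "x : S"
 shows "fd_within (%y. \<kappa> y v) S x u - fd_within (%y. \<kappa> y u) S x v =
 fd_within (%y. l y (fd_within \<Phi> S x v)) T (\<Phi> x) (fd_within \<Phi> S x u) -
 fd_within (%y. l y (fd_within \<Phi> S x u)) T (\<Phi> x) (fd_within \<Phi> S x v)"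
proof -
 define D where "D = (%x u. fd_within \<Phi> S x u)"
 define E where "E = (%b. fd_within (%y. l y b) T (\<Phi> x))"
 define D2 where "D2 = (%v u. fd_within (%y. D y v) S x u)"
 have \<Phi>x: "\<Phi> x : T" using \<Phi> x by auto
 have lsum: "l y w = (\<Sum>b\<in>Basis. (w \<bullet> b) * l y b)" if "y : T" for y w
 using linear_basis_sum[OF l(1)[OF that], of w] by simp
 have d\<Phi>: "(\<Phi> has_derivative D x) (at x within S)"
 unfolding D_def using smooth_on_has_derivative[OF \<Phi>(1) x] .
 have dl: "((%y. l y b) has_derivative E b) (at (\<Phi> x) within T)" for b
 unfolding E_def using smooth_on_has_derivative[OF l(2) \<Phi>x] .
 have dl\<Phi>: "((%y. l (\<Phi> y) b) has_derivative (%u. E b (D x u))) (at x within S)" for b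
 proof -
 have "((%y. l y b) has_derivative E b) (at (\<Phi> x) within \<Phi> ` S)"
 using dl has_derivative_subset \<Phi>(2) by blast
 then show ?thesis by (rule has_derivative_in_compose[OF d\<Phi>])
 qed
 have dD: "((%y. D y v) has_derivative D2 v) (at x within S)" for v
 unfolding D_def D2_def using smooth_on_has_derivative[OF smooth_on_derivative[OF \<Phi>(1) S] x] .
 have dT: "fd_within (%y. l y w) T (\<Phi> x) u = (\<Sum>b\<in>Basis. (w \<bullet> b) * E b u)" for w u
 proof -
 have "((%y. \<Sum>b\<in>Basis. (w \<bullet> b) * l y b) has_derivative (%u. \<Sum>b\<in>Basis. (w \<bullet> b) * E b u)) (at (\<Phi> x) within T)"
 by (intro has_derivative_sum has_derivative_mult_right dl)
 then have "((%y. l y w) has_derivative (%u. \<Sum>b\<in>Basis. (w \<bullet> b) * E b u)) (at (\<Phi> x) within T)"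
 by (rule has_derivative_transform_on[OF _ \<Phi>x]) (rule lsum)
 then show ?thesis using thick_frechet_eq[OF T \<Phi>x] by metis
 qed
 have dS: "fd_within (%y. \<kappa> y v) S x u = (\<Sum>b\<in>Basis. (D x v \<bullet> b) * E b (D x u)) + l (\<Phi> x) (D2 v u)" for v u
 proof -
 have "((%y. \<Sum>b\<in>Basis. (D y v \<bullet> b) * l (\<Phi> y) b) has_derivative
 (%u. \<Sum>b\<in>Basis. (D x v \<bullet> b) * E b (D x u) + (D2 v u \<bullet> b) * l (\<Phi> x) b)) (at x within S)"
 by (intro has_derivative_sum has_derivative_mult dl\<Phi> has_derivative_inner_left dD)
 then have "((%y. \<kappa> y v) has_derivative
 (%u. \<Sum>b\<in>Basis. (D x v \<bullet> b) * E b (D x u) + (D2 v u \<bullet> b) * l (\<Phi> x) b)) (at x within S)"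
 by (rule has_derivative_transform_on[OF _ x]) (use \<Phi>(2) in \<open>auto simp: \<kappa> D_def intro!: lsum\<close>)
 from thick_frechet_eq[OF S x this] show ?thesis by (simp add: sum.distrib lsum[OF \<Phi>x, symmetric])
 qed
 have "D2 v u = D2 u v" unfolding D2_def D_def by (rule fd_within_symmetric[OF \<Phi>(1) S x])
 then show ?thesis using dS dT unfolding D_def by simp
qed

section \<open>Alternating forms\<close>

abbreviation sg :: "(nat => nat) => real" where "sg sgm \<equiv> of_int (sign sgm)"

lemma sg_compose: "p permutes {..<d} ==> q permutes {..<d} ==> sg (p \<circ> q) = sg p * sg q"
 using sign_compose[of p q] permutes_imp_permutation[of "{..<d}"] by simp

lemma sg_mult_self [simp]: "sg p * sg p = 1"
 by (simp add: sign_def)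

lemma sg_mult_self_left [simp]: "sg p * (sg p * x) = x"
 by (simp add: sign_def)

lemma abs_sg [simp]: "\<bar>sg p\<bar> = 1"
 by (simp add: sign_def)

lemma sg_transpose: "a ~= b ==> sg (Transposition.transpose a b) = -1"
 by (simp add: sign_swap_id)

lemma transpose_permutes: "a < d ==> b < d ==> Transposition.transpose a b permutes {..<d::nat}"
 by (rule permutes_swap_id) auto

abbreviation perms :: "nat => (nat => nat) set" where "perms d \<equiv> {sgm. sgm permutes {..<d}}"

lemma perm_sum_right:
 assumes "\<rho> permutes {..<d}"
 shows "(\<Sum>sgm\<in>perms d. sg sgm * F sgm) = sg \<rho> * (\<Sum>sgm\<in>perms d. sg sgm * F (sgm \<circ> \<rho>))"
proof -
 have "(\<Sum>sgm\<in>perms d. sg sgm * F sgm) = (\<Sum>sgm\<in>perms d. sg (sgm \<circ> \<rho>) * F (sgm \<circ> \<rho>))"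
 by (rule sum_permutations_compose_right[OF assms])
 also have "\<dots> = sg \<rho> * (\<Sum>sgm\<in>perms d. sg sgm * F (sgm \<circ> \<rho>))"
 unfolding sum_distrib_left by (rule sum.cong) (auto simp: sg_compose[OF _ assms])
 finally show ?thesis .
qed

text \<open>The embedding of the permutations of l letters into those of k + l letters, acting on
  the last l. In a wedge product the permutations hidden in the right factor appear this
  way.\<close>

definition shift :: "nat => (nat => nat) => nat => nat" where
 "shift k \<pi> j = (if j < k then j else k + \<pi> (j - k))"

lemma shift_add [simp]: "shift k \<pi> (k + j) = k + \<pi> j"
 by (simp add: shift_def)

lemma shift_less [simp]: "j < k ==> shift k \<pi> j = j"
 by (simp add: shift_def)

lemma shift_sign:
 assumes "\<pi> permutes {..<l}"
 shows "shift k \<pi> permutes {..<k + l} & sg (shift k \<pi>) = sg \<pi>"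
 using assms
proof (rule permutes_induct)
 show "finite {..<l}" by simp
 have "shift k id = id" by (auto simp: shift_def fun_eq_iff)
 then show "shift k id permutes {..<k + l} & sg (shift k id) = sg id" by (simp add: permutes_id)
next
 fix a b p assume *: "a : {..<l}" "b : {..<l}" "a ~= b" "shift k p permutes {..<k + l} & sg (shift k p) = sg p"
 "p permutes {..<l}"
 have eq: "shift k (Transposition.transpose a b \<circ> p) = Transposition.transpose (k + a) (k + b) \<circ> shift k p"
 by (auto simp: shift_def fun_eq_iff Transposition.transpose_def)
 have 1: "Transposition.transpose (k + a) (k + b) permutes {..<k + l}" using * by (intro transpose_permutes) auto
 have 2: "Transposition.transpose a b permutes {..<l}" using * by (intro transpose_permutes) auto
 show "shift k (Transposition.transpose a b \<circ> p) permutes {..<k + l} &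
 sg (shift k (Transposition.transpose a b \<circ> p)) = sg (Transposition.transpose a b \<circ> p)"
 unfolding eq using * permutes_compose[OF conjunct1[OF *(4)] 1]
 by (auto simp: sg_compose[OF 1] sg_compose[OF 2] sg_transpose)
qed

lemmas shift_permutes = shift_sign[THEN conjunct1]
lemmas sg_shift = shift_sign[THEN conjunct2]

text \<open>For fixed \<pi> the substitution of \<open>sgm \<circ> shift k \<pi>\<close> for
  \<open>sgm\<close> costs the sign of \<pi>, which cancels the sign already present. So all
  \<open>fact l\<close> inner terms contribute the same sum.\<close>

lemma perm_sum_absorb:
 "(\<Sum>sgm\<in>perms (k + l). sg sgm * (\<Sum>\<pi>\<in>perms l. sg \<pi> * G (sgm \<circ> shift k \<pi>))) =
 fact l * (\<Sum>sgm\<in>perms (k + l). sg sgm * G sgm)"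
proof -
 have "(\<Sum>sgm\<in>perms (k + l). sg sgm * (\<Sum>\<pi>\<in>perms l. sg \<pi> * G (sgm \<circ> shift k \<pi>))) =
 (\<Sum>\<pi>\<in>perms l. sg \<pi> * (\<Sum>sgm\<in>perms (k + l). sg sgm * G (sgm \<circ> shift k \<pi>)))"
 unfolding sum_distrib_left by (subst sum.swap) (simp add: mult.left_commute)
 also have "\<dots> = (\<Sum>\<pi>\<in>perms l. (\<Sum>sgm\<in>perms (k + l). sg sgm * G sgm))"
 proof (rule sum.cong[OF refl])
 fix \<pi> assume "\<pi> : perms l"
 then have \<pi>: "\<pi> permutes {..<l}" by simp
 show "sg \<pi> * (\<Sum>sgm\<in>perms (k + l). sg sgm * G (sgm \<circ> shift k \<pi>)) = (\<Sum>sgm\<in>perms (k + l). sg sgm * G sgm)"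
 using perm_sum_right[OF shift_permutes[OF \<pi>, of k], of G] sg_shift[OF \<pi>, of k] by simp
 qed
 also have "\<dots> = fact l * (\<Sum>sgm\<in>perms (k + l). sg sgm * G sgm)"
 by (simp add: card_permutations[of _ l])
 finally show ?thesis .
qed

text \<open>Forms are functions of infinite sequences here, so besides linearity in each of the
  first d slots it has to be said that the remaining entries are irrelevant.\<close>

definition mlin :: "nat => ((nat => 'v::real_vector) => real) => bool" where
 "mlin d f \<longleftrightarrow> (\<forall>v i. i < d --> linear (%x. f (v(i := x)))) & (\<forall>v w. (\<forall>i<d. v i = w i) --> f v = f w)"

definition alt_form :: "nat => ((nat => 'v::real_vector) => real) => bool" where
 "alt_form d f \<longleftrightarrow> mlin d f & (\<forall>sgm v. sgm permutes {..<d} --> f (v \<circ> sgm) = sg sgm * f v)"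

lemma mlin_linear: "mlin d f ==> i < d ==> linear (%x. f (v(i := x)))"
 by (simp add: mlin_def)

lemma mlin_local: "mlin d f ==> (!!i. i < d ==> v i = w i) ==> f v = f w"
 by (simp add: mlin_def)

lemma alt_form_mlin: "alt_form d f ==> mlin d f"
 by (simp add: alt_form_def)

lemma alt_form_perm: "alt_form d f ==> sgm permutes {..<d} ==> f (%j. v (sgm j)) = sg sgm * f v"
 by (simp add: alt_form_def o_def)

lemma alt_form_repeat:
 assumes "alt_form d f" "i < d" "j < d" "i ~= j" "v i = v j" shows "f v = 0"
proof -
 have "v \<circ> Transposition.transpose i j = v" using assms(5) by (auto simp: fun_eq_iff Transposition.transpose_def)
 moreover have "f (v \<circ> Transposition.transpose i j) = - f v"
 using assms transpose_permutes[of i d j] sg_transpose[of i j] by (auto simp: alt_form_def)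
 ultimately show ?thesis by simp
qed

lemma alt_form_slot_sum:
 fixes f :: "(nat => 'v::real_vector) => real"
 assumes "alt_form d f" "i < d" "finite A" "!!w. w : A ==> \<exists>j<d. j ~= i & v j = w"
 shows "f (v(i := (\<Sum>w\<in>A. c w *\<^sub>R w))) = 0"
proof -
 have lin: "linear (%x. f (v(i := x)))" using assms alt_form_mlin mlin_linear by blast
 have "f (v(i := (\<Sum>w\<in>A. c w *\<^sub>R w))) = (\<Sum>w\<in>A. c w * f (v(i := w)))"
 by (simp add: linear_sum[OF lin] linear_cmul[OF lin])
 also have "\<dots> = 0"
 proof (rule sum.neutral, rule ballI)
 fix w assume "w : A"
 then obtain j where "j < d" "j ~= i" "v j = w" using assms(4) by blast
 then show "c w * f (v(i := w)) = 0" using alt_form_repeat[OF assms(1), of j i "v(i := w)"] assms(2) by auto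
 qed
 finally show ?thesis .
qed

lemma alt_form_dependent:
 fixes f :: "(nat => 'v::euclidean_space) => real"
 assumes f: "alt_form d f" and dep: "\<not> (inj_on v {..<d} & independent (v ` {..<d}))"
 shows "f v = 0"
proof (cases "inj_on v {..<d}")
 case False
 then obtain i j where "i < d" "j < d" "i ~= j" "v i = v j" by (auto simp: inj_on_def)
 then show ?thesis using alt_form_repeat[OF f] by blast
next
 case True
 with dep have "dependent (v ` {..<d})" by simp
 then obtain i where i: "i < d" "v i : span (v ` {..<d} - {v i})" by (auto simp: dependent_def)
 obtain c where c: "v i = (\<Sum>w\<in>v ` {..<d} - {v i}. c w *\<^sub>R w)"
 using i(2) by (subst (asm) span_finite) auto
 have "f (v(i := (\<Sum>w\<in>v ` {..<d} - {v i}. c w *\<^sub>R w))) = 0"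
 by (rule alt_form_slot_sum[OF f i(1)]) auto
 then show ?thesis using c by (metis fun_upd_triv)
qed

lemma mlin_compose_linear:
 assumes "mlin d f" "linear L" shows "mlin d (%v. f (%j. L (v j)))"
 unfolding mlin_def
proof (intro conjI allI impI)
 fix v i assume "i < d"
 have "(%j. L ((v(i := x)) j)) = (%j. L (v j))(i := L x)" for x by auto
 then show "linear (%x. f (%j. L ((v(i := x)) j)))"
 using linear_compose[OF assms(2) mlin_linear[OF assms(1) \<open>i<d\<close>]] by (simp add: o_def)
next
 fix v w :: "nat => 'b" assume "\<forall>i<d. v i = w i"
 then show "f (%j. L (v j)) = f (%j. L (w j))" by (intro mlin_local[OF assms(1)]) auto
qed

lemma alt_form_compose_linear:
 assumes "alt_form d f" "linear L" shows "alt_form d (%v. f (%j. L (v j)))"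
 unfolding alt_form_def
proof (intro conjI allI impI)
 show "mlin d (%v. f (%j. L (v j)))" using mlin_compose_linear alt_form_mlin assms by blast
 show "f (%j. L ((v \<circ> sgm) j)) = sg sgm * f (%j. L (v j))" if "sgm permutes {..<d}" for sgm v
 using alt_form_perm[OF assms(1) that, of "%j. L (v j)"] by simp
qed

lemma alt_form_scale_vectors:
 assumes "mlin d f" "m <= d"
 shows "f (%j. if j < m then c j *\<^sub>R v j else v j) = (\<Prod>j<m. c j) * f v"
 using assms(2)
proof (induction m)
 case (Suc m)
 let ?w = "%j. if j < m then c j *\<^sub>R v j else v j"
 have "(%j. if j < Suc m then c j *\<^sub>R v j else v j) = ?w(m := c m *\<^sub>R v m)" by (auto simp: fun_eq_iff less_Suc_eq)
 then have "f (%j. if j < Suc m then c j *\<^sub>R v j else v j) = c m * f (?w(m := v m))"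
 using linear_cmul[OF mlin_linear[OF assms(1), of m ?w]] Suc.prems by simp
 also have "?w(m := v m) = ?w" by auto
 finally show ?case using Suc by simp
qed simp

text \<open>Two enumerations of one set differ by a permutation, which only changes the sign. Hence
  densities do not depend on the order chosen in \<open>basis_frame\<close>.\<close>

lemma alt_form_enum:
 assumes f: "alt_form d f" and b: "bij_betw b {..<d} B" "bij_betw b' {..<d} B"
 shows "\<bar>f b\<bar> = \<bar>f b'\<bar>"
proof -
 define sgm where "sgm = (%j. if j < d then inv_into {..<d} b (b' j) else j)"
 have "bij_betw (%j. inv_into {..<d} b (b' j)) {..<d} {..<d}"
 using bij_betw_trans[OF b(2) bij_betw_inv_into[OF b(1)]] by (simp add: o_def)
 then have "bij_betw sgm {..<d} {..<d}" by (rule bij_betw_cong[THEN iffD1, rotated]) (auto simp: sgm_def)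
 then have sgm: "sgm permutes {..<d}" by (rule bij_imp_permutes) (auto simp: sgm_def)
 have "f b' = f (%j. b (sgm j))"
 proof (rule mlin_local[OF alt_form_mlin[OF f]])
 fix i assume "i < d"
 then have "b' i : b ` {..<d}" using b by (auto simp: bij_betw_def)
 then show "b' i = b (sgm i)" using \<open>i < d\<close> by (simp add: sgm_def f_inv_into_f)
 qed
 then show ?thesis using alt_form_perm[OF f sgm, of b] by (simp add: abs_mult)
qed

text \<open>By decomposition into elementary maps. The quantifier over all forms belongs to the
  induction statement: for a composite f o g the case of g is applied to the form pulled back by
  f.\<close>

lemma alt_form_linear_cart:
 fixes L :: "real^'n => real^'n"
 assumes L: "linear L" and h: "bij_betw h {..<d} (UNIV :: 'n set)"
 shows "\<forall>f. alt_form d f --> \<bar>f (%j. L (axis (h j) 1))\<bar> = \<bar>det (matrix L)\<bar> * \<bar>f (%j. axis (h j) 1)\<bar>"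
 (is "?P L")
proof (rule induct_linear_elementary[OF L])
 fix f g :: "real^'n => real^'n" assume *: "linear f" "linear g" "?P f" "?P g"
 show "?P (f \<circ> g)"
 proof (intro allI impI)
 fix F :: "(nat => real^'n) => real" assume F: "alt_form d F"
 have "\<bar>F (%j. f (g (axis (h j) 1)))\<bar> = \<bar>det (matrix g)\<bar> * \<bar>F (%j. f (axis (h j) 1))\<bar>"
 using *(4)[rule_format, OF alt_form_compose_linear[OF F *(1)]] by simp
 also have "\<dots> = \<bar>det (matrix g)\<bar> * (\<bar>det (matrix f)\<bar> * \<bar>F (%j. axis (h j) 1)\<bar>)"
 using *(3)[rule_format, OF F] by simp
 finally show "\<bar>F (%j. (f \<circ> g) (axis (h j) 1))\<bar> = \<bar>det (matrix (f \<circ> g))\<bar> * \<bar>F (%j. axis (h j) 1)\<bar>"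
 using matrix_compose[OF *(2,1)] by (simp add: det_mul abs_mult)
 qed
next
 fix g :: "real^'n => real^'n" and i assume g: "linear g" "!!x. g x $ i = 0"
 have "\<not> inj g" using g by (metis (full_types) linear_injective_imp_surjective one_neq_zero surjE vec_component)
 then have det0: "det (matrix g) = 0" using det_nz_iff_inj[OF g(1)] by blast
 show "?P g"
 proof (intro allI impI)
 fix F :: "(nat => real^'n) => real" assume F: "alt_form d F"
 \<comment> \<open>A constantly vanishing component makes the range of g a proper subspace, so the d
   image vectors are dependent.\<close>
 have "F (%j. g (axis (h j) 1)) = 0"
 proof (rule alt_form_dependent[OF F], rule notI, elim conjE)
 let ?v = "%j. g (axis (h j) 1)"
 assume inj: "inj_on ?v {..<d}" and ind: "independent (?v ` {..<d})"
 have "?v ` {..<d} <= range g" by auto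
 then have "card (?v ` {..<d}) <= dim (range g)"
 using ind independent_card_le_dim by blast
 then have "d <= dim (range g)" by (simp add: card_image[OF inj])
 moreover have "dim (range g) < CARD('n)"
 proof -
 have "dim (range g) ~= DIM(real^'n)"
 using linear_surjective_imp_injective[OF g(1)] \<open>\<not> inj g\<close> dim_eq_full linear_subspace_image[OF g(1) subspace_UNIV]
 by (metis span_eq_iff)
 then show ?thesis using dim_subset_UNIV[of "range g"] by simp
 qed
 moreover have "CARD('n) = d" using h bij_betw_same_card by fastforce
 ultimately show False by simp
 qed
 then show "\<bar>F (%j. g (axis (h j) 1))\<bar> = \<bar>det (matrix g)\<bar> * \<bar>F (%j. axis (h j) 1)\<bar>" using det0 by simp
 qed
next
 fix c :: "'n => real"
 show "?P (%x. \<chi> i. c i * x $ i)"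
 proof (intro allI impI)
 fix F :: "(nat => real^'n) => real" assume F: "alt_form d F"
 have "F (%j. \<chi> i. c i * axis (h j) 1 $ i) = F (%j. if j < d then c (h j) *\<^sub>R axis (h j) 1 else axis (h j) 1)"
 by (rule mlin_local[OF alt_form_mlin[OF F]]) (auto simp: vec_eq_iff axis_def)
 also have "\<dots> = (\<Prod>j<d. c (h j)) * F (%j. axis (h j) 1)"
 using alt_form_scale_vectors[OF alt_form_mlin[OF F], of d "%j. c (h j)" "%j. axis (h j) 1"] by simp
 also have "(\<Prod>j<d. c (h j)) = prod c UNIV" by (rule prod.reindex_bij_betw[OF h])
 finally show "\<bar>F (%j. \<chi> i. c i * axis (h j) 1 $ i)\<bar> =
 \<bar>det (matrix (%x. \<chi> i. c i * x $ i))\<bar> * \<bar>F (%j. axis (h j) 1)\<bar>"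
 by (simp add: axis_def matrix_def det_diagonal abs_mult)
 qed
next
 fix m n :: 'n assume "m ~= n"
 let ?h = "%v::real^'n. \<chi> i. v $ Transposition.transpose m n i"
 have "(\<chi> i j. if Transposition.transpose m n i = j then 1 else 0) = (\<chi> i j. if j = Transposition.transpose m n i then 1 else (0::real))"
 by (auto intro!: Cart_lambda_cong)
 then have "matrix ?h = transpose (\<chi> i j. mat 1 $ i $ Transposition.transpose m n j)"
 by (auto simp: matrix_eq transpose_def axis_def mat_def matrix_def)
 then have 1: "\<bar>det (matrix ?h)\<bar> = 1"
 by (simp add: det_permute_columns permutes_swap_id sign_swap_id abs_mult)
 show "?P ?h"
 proof (intro allI impI)
 fix F :: "(nat => real^'n) => real" assume F: "alt_form d F"
 have ax: "bij_betw (%i::'n. axis i (1::real)) UNIV (range (%i. axis i 1))"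
 by (intro inj_on_imp_bij_betw injI) (simp add: axis_eq_axis)
 have hb: "bij_betw (%j. axis (h j) (1::real)) {..<d} (range (%i. axis i 1))"
 using bij_betw_trans[OF h ax] by (simp add: o_def)
 have "?h (axis k 1) = axis (Transposition.transpose m n k) 1" for k
 by (auto simp: vec_eq_iff axis_def Transposition.transpose_def)
 moreover have "bij_betw (%j. axis (Transposition.transpose m n (h j)) (1::real)) {..<d} (range (%i. axis i 1))"
 proof -
 have "bij_betw (%j. Transposition.transpose m n (h j)) {..<d} UNIV"
 using bij_betw_trans[OF h permutes_bij[OF permutes_swap_id[of m UNIV n]]] by (simp add: o_def)
 from bij_betw_trans[OF this ax] show ?thesis by (simp add: o_def)
 qed
 ultimately show "\<bar>F (%j. ?h (axis (h j) 1))\<bar> = \<bar>det (matrix ?h)\<bar> * \<bar>F (%j. axis (h j) 1)\<bar>"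
 using alt_form_enum[OF F _ hb] 1 by simp
 qed
next
 fix m n :: 'n assume mn: "m ~= n"
 let ?h = "%v::real^'n. \<chi> i. if i = m then v $ m + v $ n else v $ i"
 have "matrix ?h = (\<chi> k. if k = m then row m (mat 1) + 1 *s row n (mat 1) else row k (mat 1))"
 by (auto simp: matrix_def axis_def row_def mat_def vec_eq_iff)
 then have 1: "det (matrix ?h) = 1" using det_row_operation[OF mn, of "mat 1" 1] by simp
 show "?P ?h"
 proof (intro allI impI)
 fix F :: "(nat => real^'n) => real" assume F: "alt_form d F"
 let ?e = "%j. axis (h j) (1::real)"
 obtain p where p: "p < d" "h p = n" using h by (metis UNIV_I bij_betw_imp_surj_on imageE lessThan_iff)
 obtain q where q: "q < d" "h q = m" using h by (metis UNIV_I bij_betw_imp_surj_on imageE lessThan_iff)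
 have "F (%j. ?h (?e j)) = F (?e(p := ?e p + ?e q))"
 proof (rule mlin_local[OF alt_form_mlin[OF F]])
 fix j assume "j < d"
 show "?h (?e j) = (?e(p := ?e p + ?e q)) j"
 proof (cases "j = p")
 case True then show ?thesis using p q mn by (auto simp: vec_eq_iff axis_def)
 next
 case False
 then have "h j ~= n" using p h \<open>j<d\<close> by (auto simp: bij_betw_def inj_on_def)
 then show ?thesis using False by (auto simp: vec_eq_iff axis_def)
 qed
 qed
 also have "\<dots> = F (?e(p := ?e p)) + F (?e(p := ?e q))"
 by (rule linear_add[OF mlin_linear[OF alt_form_mlin[OF F] p(1)]])
 also have "F (?e(p := ?e q)) = 0"
 using p q mn by (intro alt_form_repeat[OF F p(1) q(1)]) auto
 also have "?e(p := ?e p) = ?e" by (rule fun_upd_triv)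
 finally show "\<bar>F (%j. ?h (?e j))\<bar> = \<bar>det (matrix ?h)\<bar> * \<bar>F ?e\<bar>" using 1 by simp
 qed
qed

section \<open>Wedge powers of two-forms\<close>

text \<open>In the term of a permutation the varied vector stands at the single position p where
  \<open>sgm p = i\<close>; it enters \<alpha> if p < k and \<beta> otherwise, so each term is
  linear.\<close>

lemma mlin_wedge:
 assumes "mlin k \<alpha>" "mlin l \<beta>" shows "mlin (k + l) (wedge k l \<alpha> \<beta>)"
 unfolding mlin_def
proof (intro conjI allI impI)
 fix v :: "nat => 'a" and i assume i: "i < k + l"
 have "linear (%x. sg sgm * \<alpha> (%j. (v(i := x)) (sgm j)) * \<beta> (%j. (v(i := x)) (sgm (k + j))))"
 if sgm: "sgm permutes {..<k + l}" for sgm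
 proof -
 define p where "p = inv sgm i"
 have p: "sgm p = i" "p < k + l" using sgm i permutes_inverses(1)[OF sgm] permutes_in_image[OF sgm, of p] by (auto simp: p_def)
 have inj: "sgm j = i \<longleftrightarrow> j = p" for j using p permutes_inj[OF sgm] by (auto simp: inj_def)
 show ?thesis
 proof (cases "p < k")
 case True
 have 1: "(%j. (v(i := x)) (sgm j)) = (%j. v (sgm j))(p := x)" for x using inj by auto
 have 2: "(%j. (v(i := x)) (sgm (k + j))) = (%j. v (sgm (k + j)))" for x using inj True by auto
 show ?thesis unfolding 1 2 using mlin_linear[OF assms(1) True, of "%j. v (sgm j)"]
 by (auto simp: linear_iff algebra_simps)
 next
 case False
 have 1: "\<alpha> (%j. (v(i := x)) (sgm j)) = \<alpha> (%j. v (sgm j))" for x using inj False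
 by (intro mlin_local[OF assms(1)]) auto
 have 2: "(%j. (v(i := x)) (sgm (k + j))) = (%j. v (sgm (k + j)))(p - k := x)" for x
 using inj False by (auto simp: fun_eq_iff)
 show ?thesis unfolding 1 2 using mlin_linear[OF assms(2), of "p - k" "%j. v (sgm (k + j))"] False p
 by (auto simp: linear_iff algebra_simps)
 qed
 qed
 then have "linear (%x. (1 / (fact k * fact l)) *\<^sub>R (\<Sum>sgm\<in>perms (k + l). sg sgm * \<alpha> (%j. (v(i := x)) (sgm j)) * \<beta> (%j. (v(i := x)) (sgm (k + j)))))"
 by (intro linear_compose_scale_right linear_compose_sum) auto
 then show "linear (%x. wedge k l \<alpha> \<beta> (v(i := x)))" unfolding wedge_def by simp
next
 fix v w :: "nat => 'a" assume vw: "\<forall>i<k + l. v i = w i"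
 show "wedge k l \<alpha> \<beta> v = wedge k l \<alpha> \<beta> w" unfolding wedge_def
 proof (intro arg_cong2[where f = "(/)"] sum.cong refl)
 fix sgm assume "sgm : perms (k + l)"
 then have s: "sgm j < k + l" if "j < k + l" for j using that permutes_in_image[of sgm "{..<k + l}" j] by simp
 have "\<alpha> (%j. v (sgm j)) = \<alpha> (%j. w (sgm j))" using s vw by (intro mlin_local[OF assms(1)]) auto
 moreover have "\<beta> (%j. v (sgm (k + j))) = \<beta> (%j. w (sgm (k + j)))" using s vw by (intro mlin_local[OF assms(2)]) auto
 ultimately show "sg sgm * \<alpha> (%j. v (sgm j)) * \<beta> (%j. v (sgm (k + j))) =
 sg sgm * \<alpha> (%j. w (sgm j)) * \<beta> (%j. w (sgm (k + j)))" by simp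
 qed
qed

lemma alt_form_wedge:
 assumes "mlin k \<alpha>" "mlin l \<beta>" shows "alt_form (k + l) (wedge k l \<alpha> \<beta>)"
 unfolding alt_form_def
proof (intro conjI allI impI)
 show "mlin (k + l) (wedge k l \<alpha> \<beta>)" using mlin_wedge assms by blast
 fix \<tau> and v :: "nat => 'a" assume \<tau>: "\<tau> permutes {..<k + l}"
 define G where "G = (%sgm. \<alpha> (%j. v (sgm j)) * \<beta> (%j. v (sgm (k + j))))"
 have "(\<Sum>sgm\<in>perms (k + l). sg sgm * G sgm) = (\<Sum>sgm\<in>perms (k + l). sg (\<tau> \<circ> sgm) * G (\<tau> \<circ> sgm))"
 by (rule setum_permutations_compose_left[OF \<tau>])
 also have "\<dots> = sg \<tau> * (\<Sum>sgm\<in>perms (k + l). sg sgm * G (\<tau> \<circ> sgm))"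
 unfolding sum_distrib_left by (rule sum.cong) (auto simp: sg_compose[OF \<tau>])
 finally have "(\<Sum>sgm\<in>perms (k + l). sg sgm * G (\<tau> \<circ> sgm)) = sg \<tau> * (\<Sum>sgm\<in>perms (k + l). sg sgm * G sgm)" by simp
 then show "wedge k l \<alpha> \<beta> (v \<circ> \<tau>) = sg \<tau> * wedge k l \<alpha> \<beta> v"
 unfolding wedge_def G_def by (simp add: mult.assoc)
qed

definition bilin :: "('v::real_vector => 'v => real) => bool" where
 "bilin B \<longleftrightarrow> (\<forall>u. linear (B u)) & (\<forall>u. linear (%v. B v u))"

text \<open>\<open>d_power\<close> at one point, as algebra of a bilinear form on a single vector
  space; no chart enters.\<close>

definition dpow :: "('v => 'v => real) => nat => (nat => 'v) => real" where
 "dpow B m = wedge_power 2 (%v. B (v 0) (v 1)) m"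

text \<open>The form a \<and> B^m, that is, the contact volume form at one point when a = \<alpha>
  and B = d\<alpha>.\<close>

definition ctop :: "('v => real) => ('v => 'v => real) => nat => (nat => 'v) => real" where
 "ctop a B m = wedge 1 (2 * m) (%v. a (v 0)) (dpow B m)"

lemma d_power_dpow: "d_power A lam n i x = dpow (ext_d A lam i x) n"
 by (simp add: d_power_def dpow_def)

lemma contact_top_form_ctop: "contact_top_form A \<alpha> n i x = ctop (\<alpha> i x) (ext_d A \<alpha> i x) n"
 by (simp add: contact_top_form_def ctop_def d_power_dpow)

lemma mlin_bilin: assumes "bilin B" shows "mlin 2 (%v. B (v 0) (v 1))"
 unfolding mlin_def
proof (intro conjI allI impI)
 fix v :: "nat => 'a" and i :: nat assume "i < 2"
 then consider "i = 0" | "i = 1" by linarith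
 then show "linear (%x. B ((v(i := x)) 0) ((v(i := x)) 1))"
 using assms by cases (auto simp: bilin_def)
qed auto

lemma alt_form_dpow: assumes "bilin B" shows "alt_form (2 * m) (dpow B m)"
proof (induction m)
 case 0
 then show ?case by (auto simp: alt_form_def mlin_def dpow_def sign_id)
next
 case (Suc m)
 show ?case using alt_form_wedge[OF mlin_bilin[OF assms] alt_form_mlin[OF Suc]] by (simp add: dpow_def)
qed

lemma alt_form_ctop: assumes "linear a" "bilin B" shows "alt_form (1 + 2 * m) (ctop a B m)"
proof -
 have "mlin 1 (%v. a (v 0))" using assms(1) by (auto simp: mlin_def)
 then show ?thesis using alt_form_wedge alt_form_mlin[OF alt_form_dpow[OF assms(2)]] unfolding ctop_def by blast
qed

lemma dpow_pullback: "dpow B m (%j. L (v j)) = dpow (%u w. B (L u) (L w)) m v"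
proof (induction m arbitrary: v)
 case (Suc m)
 then show ?case by (simp add: dpow_def wedge_def)
qed (simp add: dpow_def)

lemma ctop_pullback: "ctop a B m (%j. L (v j)) = ctop (%u. a (L u)) (%u w. B (L u) (L w)) m v"
 unfolding ctop_def wedge_def by (simp add: dpow_pullback[of B m L])

definition pairs :: "('v => 'v => real) => nat => (nat => 'v) => (nat => nat) => real" where
 "pairs B m v sgm = (\<Prod>i<m. B (v (sgm (2 * i))) (v (sgm (2 * i + 1))))"

text \<open>Unfolding the recursion gives nested sums over permutations. The inner ones are absorbed
  and cancel the factors \<open>fact (2 * m)\<close>, so that only one factor 1/2 remains for every
  two-form.\<close>

lemma dpow_formula: "dpow B m v = (\<Sum>sgm\<in>perms (2 * m). sg sgm * pairs B m v sgm) / 2 ^ m"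
proof (induction m arbitrary: v)
 case 0
 then show ?case by (simp add: dpow_def pairs_def sign_id)
next
 case (Suc m)
 define G where "G = (%sgm. pairs B (Suc m) v sgm)"
 have G: "B (v (sgm 0)) (v (sgm 1)) * pairs B m (%j. v (sgm (2 + j))) \<pi> = G (sgm \<circ> shift 2 \<pi>)" for sgm \<pi>
 unfolding G_def pairs_def prod.lessThan_Suc_shift
 by (intro arg_cong2[where f = "(*)"] prod.cong) (auto simp: shift_def)
 have "dpow B (Suc m) v = (\<Sum>sgm\<in>perms (2 + 2 * m). sg sgm * B (v (sgm 0)) (v (sgm 1)) * dpow B m (%j. v (sgm (2 + j)))) / (2 * fact (2 * m))"
 by (simp add: dpow_def wedge_def)
 also have "(\<Sum>sgm\<in>perms (2 + 2 * m). sg sgm * B (v (sgm 0)) (v (sgm 1)) * dpow B m (%j. v (sgm (2 + j)))) =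
 (\<Sum>sgm\<in>perms (2 + 2 * m). sg sgm * (\<Sum>\<pi>\<in>perms (2 * m). sg \<pi> * G (sgm \<circ> shift 2 \<pi>))) / 2 ^ m"
 unfolding Suc sum_divide_distrib
 proof (rule sum.cong[OF refl])
 fix sgm :: "nat => nat"
 have "(\<Sum>\<pi>\<in>perms (2 * m). sg \<pi> * G (sgm \<circ> shift 2 \<pi>)) =
 B (v (sgm 0)) (v (sgm 1)) * (\<Sum>\<pi>\<in>perms (2 * m). sg \<pi> * pairs B m (%j. v (sgm (2 + j))) \<pi>)"
 unfolding G[symmetric] sum_distrib_left by (simp add: algebra_simps)
 then show "sg sgm * B (v (sgm 0)) (v (sgm 1)) * (\<Sum>\<pi>\<in>perms (2 * m). sg \<pi> * pairs B m (%j. v (sgm (2 + j))) \<pi> / 2 ^ m) =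
 sg sgm * (\<Sum>\<pi>\<in>perms (2 * m). sg \<pi> * G (sgm \<circ> shift 2 \<pi>)) / 2 ^ m"
 by (simp add: sum_divide_distrib[symmetric])
 qed
 also have "(\<Sum>sgm\<in>perms (2 + 2 * m). sg sgm * (\<Sum>\<pi>\<in>perms (2 * m). sg \<pi> * G (sgm \<circ> shift 2 \<pi>))) =
 fact (2 * m) * (\<Sum>sgm\<in>perms (2 + 2 * m). sg sgm * G sgm)"
 by (rule perm_sum_absorb)
 finally show ?case unfolding G_def by (simp add: field_simps)
qed

text \<open>Every index occurs in exactly one factor of each product, so a kernel vector annihilates
  every term.\<close>

lemma dpow_kernel:
 assumes "j < 2 * m" "!!u. B (v j) u = 0" "!!u. B u (v j) = 0"
 shows "dpow B m v = 0"
proof -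
 have "pairs B m v sgm = 0" if sgm: "sgm permutes {..<2 * m}" for sgm
 proof -
 define p where "p = inv sgm j"
 have p: "sgm p = j" "p < 2 * m" using sgm assms(1) permutes_inverses(1)[OF sgm] permutes_in_image[OF sgm, of p] by (auto simp: p_def)
 have "B (v (sgm (2 * (p div 2)))) (v (sgm (2 * (p div 2) + 1))) = 0"
 using assms(2,3) p(1) by (cases "even p") auto
 moreover have "p div 2 < m" using p(2) by auto
 ultimately show ?thesis unfolding pairs_def by (intro prod_zero) auto
 qed
 then show ?thesis by (simp add: dpow_formula)
qed

lemma perms_fixing_0: "{sgm. sgm permutes {..<1 + l} & sgm 0 = 0} = shift 1 ` perms l"
proof (intro equalityI subsetI)
 fix sgm assume "sgm : {sgm. sgm permutes {..<1 + l} & sgm 0 = 0}"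
 then have sgm: "sgm permutes {..<1 + l}" "sgm 0 = 0" by auto
 define \<pi> where "\<pi> = (%j. sgm (Suc j) - 1)"
 have pos: "sgm (Suc j) > 0" for j using sgm permutes_inj[OF sgm(1)] by (metis gr0I injD nat.distinct(1))
 have eq: "sgm = shift 1 \<pi>"
 proof
 fix j show "sgm j = shift 1 \<pi> j" using sgm(2) pos[of "j - 1"] by (cases j) (auto simp: shift_def \<pi>_def)
 qed
 have "bij_betw \<pi> {..<l} {..<l}"
 proof (rule bij_betw_imageI)
 show inj: "inj_on \<pi> {..<l}"
 proof (rule inj_onI)
 fix x y assume "\<pi> x = \<pi> y"
 then have "sgm (Suc x) = sgm (Suc y)" using pos[of x] pos[of y] unfolding \<pi>_def by linarith
 then show "x = y" using permutes_inj[OF sgm(1)] by (auto simp: inj_def)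
 qed
 have "\<pi> ` {..<l} <= {..<l}"
 proof safe
 fix x assume "x < l"
 then have "sgm (Suc x) < 1 + l" using permutes_in_image[OF sgm(1), of "Suc x"] by simp
 then show "\<pi> x < l" using pos[of x] by (simp add: \<pi>_def)
 qed
 then show "\<pi> ` {..<l} = {..<l}" using inj by (simp add: endo_inj_surj)
 qed
 moreover have "\<pi> x = x" if "x \<notin> {..<l}" for x
 using permutes_not_in[OF sgm(1), of "Suc x"] that by (simp add: \<pi>_def)
 ultimately have "\<pi> permutes {..<l}" by (rule bij_imp_permutes)
 then show "sgm : shift 1 ` perms l" using eq by auto
qed (auto simp: shift_permutes simp del: One_nat_def)

lemma inj_shift: "inj (shift k)"
proof (rule injI)
 fix x y assume "shift k x = shift k y"
 then have "shift k x (k + j) = shift k y (k + j)" for j by simp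
 then show "x = y" by auto
qed

text \<open>If a permutation moves index 0 away from the slot of a, the kernel vector
  \<open>u 0\<close> lands in the power of B and kills the term. The surviving permutations fix 0,
  and each of them gives the same value.\<close>

lemma ctop_reeb:
 assumes B: "bilin B" and R: "!!w. B (u 0) w = 0" "!!w. B w (u 0) = 0"
 shows "ctop a B m u = a (u 0) * dpow B m (%j. u (1 + j))"
proof -
 define F where "F = (%sgm. sg sgm * a (u (sgm 0)) * dpow B m (%j. u (sgm (1 + j))))"
 have zero: "F sgm = 0" if "sgm permutes {..<1 + 2 * m}" "sgm 0 ~= 0" for sgm
 proof -
 define p where "p = inv sgm 0"
 have p: "sgm p = 0" "p < 1 + 2 * m"
 using that permutes_inverses(1)[OF that(1)] permutes_in_image[OF that(1), of p] by (auto simp: p_def)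
 have "p ~= 0" using that(2) p(1) by (metis)
 have "dpow B m (%j. u (sgm (1 + j))) = 0"
 by (rule dpow_kernel[of "p - 1"]) (use \<open>p ~= 0\<close> p R in auto)
 then show ?thesis by (simp add: F_def)
 qed
 have "(\<Sum>sgm\<in>perms (1 + 2 * m). F sgm) = (\<Sum>sgm\<in>{sgm. sgm permutes {..<1 + 2 * m} & sgm 0 = 0}. F sgm)"
 by (rule sum.mono_neutral_right) (use zero finite_permutations[of "{..<1 + 2 * m}"] in auto)
 also have "\<dots> = (\<Sum>\<pi>\<in>perms (2 * m). F (shift 1 \<pi>))"
 unfolding perms_fixing_0 by (subst sum.reindex) (auto intro: inj_on_subset[OF inj_shift])
 also have "\<dots> = (\<Sum>\<pi>\<in>perms (2 * m). a (u 0) * dpow B m (%j. u (1 + j)))"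
 proof (rule sum.cong[OF refl])
 fix \<pi> assume "\<pi> : perms (2 * m)"
 then have \<pi>: "\<pi> permutes {..<2 * m}" by simp
 have "dpow B m (%j. u (1 + \<pi> j)) = sg \<pi> * dpow B m (%j. u (1 + j))"
 by (rule alt_form_perm[OF alt_form_dpow[OF B] \<pi>])
 then show "F (shift 1 \<pi>) = a (u 0) * dpow B m (%j. u (1 + j))"
 unfolding F_def shift_add sg_shift[OF \<pi>] by (simp add: algebra_simps)
 qed
 also have "\<dots> = fact (2 * m) * (a (u 0) * dpow B m (%j. u (1 + j)))"
 by (simp add: card_permutations[of _ "2 * m"])
 finally show ?thesis unfolding ctop_def wedge_def F_def by simp
qed

lemma bij_betw_sum_basis:
 fixes x :: "'e::euclidean_space"
 assumes "bij_betw e {..<d} Basis" shows "x = (\<Sum>k<d. (x \<bullet> e k) *\<^sub>R e k)"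
proof -
 have "(\<Sum>k<d. (x \<bullet> e k) *\<^sub>R e k) = (\<Sum>b\<in>Basis. (x \<bullet> b) *\<^sub>R b)" by (rule sum.reindex_bij_betw[OF assms])
 then show ?thesis by (simp add: euclidean_representation)
qed

lemma dpow_Pair: "dpow B m (%j. (0, e j)) = dpow (%x y. B (0, x) (0, y)) m e"
 using dpow_pullback[of B m "Pair 0" e] by simp

text \<open>The volume density of \<open>\<lambda> + H dt\<close>: the vector \<open>(\<partial>\<^sub>t + X) / \<tau>\<close> is the Reeb vector.\<close>

lemma ctop_suspension:
 fixes l :: "'e::euclidean_space => real" and \<omega> :: "'e => 'e => real"
 assumes l: "linear l" and \<omega>: "bilin \<omega>" "!!u v. \<omega> u v = - \<omega> v u" and dh: "linear dh" "!!u. \<omega> X u = dh u"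
 and \<tau>: "l X + h ~= 0" and e: "bij_betw e {..<2 * n} Basis"
 and a: "!!s x. a (s, x) = l x + h * s" and B: "!!s x s' x'. B (s, x) (s', x') = \<omega> x x' + dh x * s' - dh x' * s"
 and b: "bij_betw b {..<1 + 2 * n} (Basis :: (real \<times> 'e) set)"
 shows "\<bar>ctop a B n b\<bar> = \<bar>(l X + h) * dpow \<omega> n e\<bar>"
proof -
 define \<tau> where "\<tau> = l X + h"
 define R where "R = (1 / \<tau>, (1 / \<tau>) *\<^sub>R X)"
 have \<omega>l: "\<omega> (c *\<^sub>R x) y = c * \<omega> x y" "\<omega> (x + x') y = \<omega> x y + \<omega> x' y"
 "\<omega> y (c *\<^sub>R x) = c * \<omega> y x" "\<omega> y (x + x') = \<omega> y x + \<omega> y x'" for c x y x'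
 using \<omega>(1) linear_cmul[of "\<omega> y" c x] linear_cmul[of "%v. \<omega> v y" c x] linear_add[of "\<omega> y" x x'] linear_add[of "%v. \<omega> v y" x x']
 by (auto simp: bilin_def)
 have dhl: "dh (c *\<^sub>R x) = c * dh x" "dh (x + x') = dh x + dh x'" for c x x'
 using dh(1) by (auto simp: linear_iff)
 have ll: "l (c *\<^sub>R x) = c * l x" "l (x + x') = l x + l x'" for c x x'
 using l by (auto simp: linear_iff)
 have "linear a" by (auto simp: linear_iff a ll algebra_simps)
 have bB: "bilin B" by (auto simp: bilin_def linear_iff B \<omega>l dhl algebra_simps)
 have alt: "alt_form (1 + 2 * n) (ctop a B n)" using alt_form_ctop[OF \<open>linear a\<close> bB] .
 define u where "u = (%j. if j = 0 then (1, 0) else (0, e (j - 1)) :: real \<times> 'e)"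
 have ub: "bij_betw u {..<1 + 2 * n} Basis"
 proof (rule bij_betw_imageI)
 show "inj_on u {..<1 + 2 * n}"
 proof (rule inj_onI)
 fix x y assume "x : {..<1 + 2 * n}" "y : {..<1 + 2 * n}" "u x = u y"
 then show "x = y" using e by (cases x; cases y) (auto simp: u_def bij_betw_def inj_on_def)
 qed
 have S: "u ` Suc ` {..<2 * n} = Pair 0 ` e ` {..<2 * n}"
 proof -
 have "u \<circ> Suc = Pair 0 \<circ> e" by (auto simp: u_def fun_eq_iff)
 then show ?thesis unfolding image_comp by simp
 qed
 have "u ` {..<1 + 2 * n} = insert (1, 0) (Pair 0 ` e ` {..<2 * n})"
 unfolding plus_1_eq_Suc lessThan_Suc_eq_insert_0 image_insert S by (simp add: u_def)
 then show "u ` {..<1 + 2 * n} = Basis" using e by (auto simp: bij_betw_def Basis_prod_def)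
 qed
 have dX: "dh X = 0" using dh(2)[of X] \<omega>(2)[of X X] by simp
 have R0: "B R w = 0" for w
 by (cases w) (auto simp: R_def B \<omega>l dhl dh(2) dX)
 have R1: "B w R = 0" for w
 by (cases w) (auto simp: R_def B \<omega>l dhl \<omega>(2)[of _ X] dh(2) dX)
 have "a R = (l X + h) / \<tau>" by (simp add: R_def a ll add_divide_distrib)
 then have aR: "a R = 1" using \<tau> by (simp add: \<tau>_def)
 have lin0: "linear (%x. ctop a B n (u(0 := x)))" using mlin_linear[OF alt_form_mlin[OF alt]] by simp
 have X: "X = (\<Sum>k<2 * n. (X \<bullet> e k) *\<^sub>R e k)" using bij_betw_sum_basis[OF e] .
 \<comment> \<open>The unit vector in the time direction is traded for the Reeb vector R. The
   correction (0, X) is a combination of the vectors in the other slots and contributes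
   nothing.\<close>
 have eq: "u 0 = \<tau> *\<^sub>R R - (0, X)" using \<tau> by (simp add: u_def R_def \<tau>_def)
 have "ctop a B n u = ctop a B n (u(0 := \<tau> *\<^sub>R R - (0, X)))" unfolding eq[symmetric] by simp
 also have "\<dots> = \<tau> * ctop a B n (u(0 := R)) - ctop a B n (u(0 := (0, X)))"
 by (simp add: linear_diff[OF lin0] linear_cmul[OF lin0])
 also have "ctop a B n (u(0 := (0, X))) = 0"
 proof -
 have "(0, X) = (\<Sum>k<2 * n. (X \<bullet> e k) *\<^sub>R u (1 + k))"
 by (subst X) (simp add: u_def sum_prod prod_eq_iff fst_sum snd_sum)
 then have "ctop a B n (u(0 := (0, X))) = (\<Sum>k<2 * n. (X \<bullet> e k) * ctop a B n (u(0 := u (1 + k))))"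
 by (simp add: linear_sum[OF lin0] linear_cmul[OF lin0])
 also have "\<dots> = 0"
 by (intro sum.neutral ballI) (use alt_form_repeat[OF alt, of 0 "1 + _" "u(0 := u (1 + _))"] in auto)
 finally show ?thesis .
 qed
 also have "ctop a B n (u(0 := R)) = dpow B n (%j. (0, e j))"
 using ctop_reeb[OF bB, of "u(0 := R)" a n] R0 R1 aR by (simp add: u_def)
 also have "\<dots> = dpow \<omega> n e"
 unfolding dpow_Pair by (simp add: B)
 finally have "ctop a B n u = \<tau> * dpow \<omega> n e" by simp
 then show ?thesis using alt_form_enum[OF alt b ub] by (simp add: \<tau>_def)
qed

section \<open>Nondegenerate two-forms\<close>

text \<open>The Gram matrix of a symplectic frame ordered as p, q, p, q, ..., so that conjugate
  vectors have indices 2i and 2i + 1, exactly the pairing used in \<open>pairs\<close>.\<close>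

definition std_form :: "nat => nat => real" where
 "std_form i j = (if even i & j = i + 1 then 1 else if odd i & j + 1 = i then -1 else 0)"

lemma std_form_skew: "std_form i j = - std_form j i"
 by (auto simp: std_form_def)

lemma pairs_skew_swap:
 assumes skew: "!!u v. B u v = - B v u" and k: "k < m"
 shows "pairs B m v (sgm \<circ> Transposition.transpose (2 * k) (2 * k + 1)) = - pairs B m v sgm"
proof -
 let ?t = "Transposition.transpose (2 * k) (2 * k + 1)"
 have other: "?t (2 * i) = 2 * i" "?t (2 * i + 1) = 2 * i + 1" if "i ~= k" for i
 using that by (auto simp: Transposition.transpose_def)
 have "pairs B m v (sgm \<circ> ?t) = B (v (sgm (2 * k + 1))) (v (sgm (2 * k))) * (\<Prod>i\<in>{..<m} - {k}. B (v (sgm (2 * i))) (v (sgm (2 * i + 1))))"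
 unfolding pairs_def using k other by (subst prod.remove[of _ k]) (auto intro!: prod.cong)
 also have "\<dots> = - (B (v (sgm (2 * k))) (v (sgm (2 * k + 1))) * (\<Prod>i\<in>{..<m} - {k}. B (v (sgm (2 * i))) (v (sgm (2 * i + 1)))))"
 using skew[of "v (sgm (2 * k + 1))"] by simp
 also have "\<dots> = - pairs B m v sgm" unfolding pairs_def using k by (subst prod.remove[of _ k]) auto
 finally show ?thesis .
qed

text \<open>Exchanges two consecutive pairs as blocks. It consists of two transpositions, or is the
  identity, hence is even and preserves both the sign and the product \<open>pairs\<close>.\<close>

definition pair_swap :: "nat => nat => nat => nat" where
 "pair_swap k l = Transposition.transpose (2 * k) (2 * l) \<circ> Transposition.transpose (2 * k + 1) (2 * l + 1)"

lemma pair_swap: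
 assumes "k < m" "l < m"
 shows "pair_swap k l permutes {..<2 * m}" "sg (pair_swap k l) = 1"
 "pair_swap k l (2 * i) = 2 * Transposition.transpose k l i"
 "pair_swap k l (Suc (2 * i)) = Suc (2 * Transposition.transpose k l i)"
proof -
 have 1: "Transposition.transpose (2 * k) (2 * l) permutes {..<2 * m}"
 "Transposition.transpose (2 * k + 1) (2 * l + 1) permutes {..<2 * m}" using assms by (auto intro!: transpose_permutes)
 show "pair_swap k l permutes {..<2 * m}" unfolding pair_swap_def using permutes_compose[OF 1(2,1)] .
 show "sg (pair_swap k l) = 1" unfolding pair_swap_def sg_compose[OF 1]
 by (cases "k = l") (auto simp: sg_transpose)
 show "pair_swap k l (2 * i) = 2 * Transposition.transpose k l i"
 "pair_swap k l (Suc (2 * i)) = Suc (2 * Transposition.transpose k l i)"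
 by (auto simp: pair_swap_def Transposition.transpose_def)
qed

lemma pairs_pair_swap:
 assumes "k < m" "l < m" shows "pairs B m v (sgm \<circ> pair_swap k l) = pairs B m v sgm"
proof -
 have "bij_betw (Transposition.transpose k l) {..<m} {..<m}"
 using transpose_permutes[OF assms] by (rule permutes_imp_bij)
 from prod.reindex_bij_betw[OF this, of "%i. B (v (sgm (2 * i))) (v (sgm (Suc (2 * i))))"]
 show ?thesis unfolding pairs_def by (simp add: pair_swap[OF assms])
qed

text \<open>No cancellation occurs in the sum for a symplectic frame. The pair containing the last
  index is moved to the end by an even block exchange; if the last index stands first in its pair,
  flipping the pair changes both the sign and the product. Then either its partner is the conjugate
  index and the induction applies, or the product is 0.\<close>

lemma signed_std_pairs_nonneg:
 assumes "sgm permutes {..<2 * m}" shows "0 <= sg sgm * pairs std_form m (%j. j) sgm"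
 using assms
proof (induction m arbitrary: sgm)
 case 0
 then show ?case by (simp add: pairs_def sign_id)
next
 case (Suc m)
 let ?P = "pairs std_form (Suc m) (%j. j)"
 have step1: "0 <= sg sgm * ?P sgm" if sgm: "sgm permutes {..<2 * Suc m}" "sgm (2 * m + 1) = 2 * m + 1" for sgm
 proof (cases "sgm (2 * m) = 2 * m")
 case True
 have "sgm x = x" if "x : {..<2 * Suc m} - {..<2 * m}" for x
 proof -
 have "x = 2 * m \<or> x = 2 * m + 1" using that by auto
 then show ?thesis using True sgm(2) by auto
 qed
 then have "sgm permutes {..<2 * m}" using permutes_superset[OF sgm(1)] by blast
 moreover have "?P sgm = pairs std_form m (%j. j) sgm"
 using True sgm(2) by (simp add: pairs_def std_form_def)
 ultimately show ?thesis using Suc.IH by simp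
 next
 case False
 then have "std_form (sgm (2 * m)) (sgm (2 * m + 1)) = 0"
 using sgm(2) permutes_in_image[OF sgm(1), of "2 * m"] by (auto simp: std_form_def)
 then have "?P sgm = 0" by (simp add: pairs_def)
 then show ?thesis by simp
 qed
 have step2: "0 <= sg sgm * ?P sgm" if sgm: "sgm permutes {..<2 * Suc m}" "sgm (2 * k + 1) = 2 * m + 1" "k < Suc m" for sgm k
 proof -
 note ps = pair_swap[OF \<open>k < Suc m\<close>, of m]
 have "(sgm \<circ> pair_swap k m) permutes {..<2 * Suc m}" using permutes_compose[OF ps(1) sgm(1)] by simp
 then have "0 <= sg (sgm \<circ> pair_swap k m) * ?P (sgm \<circ> pair_swap k m)"
 by (rule step1) (use sgm(2) ps(4)[of m] in simp)
 then show ?thesis using sg_compose[OF sgm(1) ps(1)] ps(2) pairs_pair_swap[OF \<open>k < Suc m\<close>, of m, where B = std_form and v = "%j. j" and sgm = sgm] by simp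
 qed
 define p where "p = inv sgm (2 * m + 1)"
 have p: "sgm p = 2 * m + 1" "p < 2 * Suc m"
 using permutes_inverses(1)[OF Suc.prems] permutes_in_image[OF Suc.prems, of p] by (auto simp: p_def)
 define k where "k = p div 2"
 have k: "k < Suc m" using p(2) by (auto simp: k_def)
 show ?case
 proof (cases "odd p")
 case True
 then have "p = 2 * k + 1" by (simp add: k_def)
 then show ?thesis using step2[OF Suc.prems _ k] p by simp
 next
 case False
 then have pk: "p = 2 * k" by (simp add: k_def)
 let ?t = "Transposition.transpose (2 * k) (2 * k + 1)"
 have t: "?t permutes {..<2 * Suc m}" using k by (intro transpose_permutes) auto
 have "0 <= sg (sgm \<circ> ?t) * ?P (sgm \<circ> ?t)"
 by (rule step2[OF permutes_compose[OF t Suc.prems] _ k]) (use p pk in simp)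
 then show ?thesis using sg_compose[OF Suc.prems t] sg_transpose[of "2 * k" "2 * k + 1"]
 pairs_skew_swap[OF std_form_skew k, where v = "%j. j" and sgm = sgm] by simp
 qed
qed

text \<open>All signed terms are nonnegative and the identity permutation contributes 1.\<close>

lemma dpow_symplectic_frame:
 assumes "!!i j. i < 2 * m ==> j < 2 * m ==> \<omega> (w i) (w j) = std_form i j"
 shows "dpow \<omega> m w ~= 0"
proof -
 have eq: "pairs \<omega> m w sgm = pairs std_form m (%j. j) sgm" if "sgm permutes {..<2 * m}" for sgm
 unfolding pairs_def
 proof (rule prod.cong[OF refl])
 fix i assume "i : {..<m}"
 then have "sgm (2 * i) < 2 * m" "sgm (2 * i + 1) < 2 * m"
 using permutes_in_image[OF that, of "2 * i"] permutes_in_image[OF that, of "2 * i + 1"] by auto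
 then show "\<omega> (w (sgm (2 * i))) (w (sgm (2 * i + 1))) = std_form (sgm (2 * i)) (sgm (2 * i + 1))" by (rule assms)
 qed
 have "0 < (\<Sum>sgm\<in>perms (2 * m). sg sgm * pairs std_form m (%j. j) sgm)"
 proof (rule sum_pos2[of _ id])
 show "0 < sg id * pairs std_form m (%j. j) id" by (simp add: sign_id pairs_def std_form_def)
 qed (use finite_permutations[of "{..<2 * m}"] permutes_id signed_std_pairs_nonneg in auto)
 then show ?thesis using eq by (simp add: dpow_formula)
qed

text \<open>Symplectic Gram-Schmidt: a vector outside the span found so far is made orthogonal to
  it, a partner pairing to 1 with it exists by nondegeneracy, and the partner is made orthogonal in
  turn.\<close>

lemma symplectic_frame_exists:
 fixes \<omega> :: "'e::euclidean_space => 'e => real"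
 assumes \<omega>: "bilin \<omega>" "!!u v. \<omega> u v = - \<omega> v u" and nd: "!!u. (!!v. \<omega> u v = 0) ==> u = 0"
 and "2 * m <= DIM('e)"
 shows "\<exists>w. \<forall>i<2 * m. \<forall>j<2 * m. \<omega> (w i) (w j) = std_form i j"
 using assms(4)
proof (induction m)
 case (Suc m)
 then obtain w where w: "!!i j. i < 2 * m ==> j < 2 * m ==> \<omega> (w i) (w j) = std_form i j" by auto
 have linl: "linear (%u. \<omega> u v)" "linear (\<omega> v)" for v using \<omega>(1) by (auto simp: bilin_def)
 \<comment> \<open>The projection to the span of the frame along its symplectic complement: the
   coefficient of a frame vector is read off by pairing with its conjugate.\<close>
 define Q where "Q = (%u. \<Sum>k<m. \<omega> u (w (2 * k + 1)) *\<^sub>R w (2 * k) - \<omega> u (w (2 * k)) *\<^sub>R w (2 * k + 1))"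
 have Qin: "Q u : span (w ` {..<2 * m})" for u
 unfolding Q_def by (intro span_sum span_diff span_scale span_base) auto
 have P0: "\<omega> (u - Q u) (w j) = 0" if j: "j < 2 * m" for u j
 proof -
 define k where "k = j div 2"
 have k: "k < m" using j by (auto simp: k_def)
 have "\<omega> (Q u) (w j) = (\<Sum>i<m. \<omega> u (w (2 * i + 1)) * std_form (2 * i) j - \<omega> u (w (2 * i)) * std_form (2 * i + 1) j)"
 unfolding Q_def linear_sum[OF linl(1)] linear_diff[OF linl(1)] linear_cmul[OF linl(1)]
 using j by (intro sum.cong) (auto simp: w)
 also have "\<dots> = (\<Sum>i<m. if i = k then \<omega> u (w j) else 0)"
 proof (rule sum.cong[OF refl])
 fix i assume "i : {..<m}"
 consider "j = 2 * k" | "j = 2 * k + 1" by (cases "even j") (auto simp: k_def)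
 then show "\<omega> u (w (2 * i + 1)) * std_form (2 * i) j - \<omega> u (w (2 * i)) * std_form (2 * i + 1) j =
 (if i = k then \<omega> u (w j) else 0)"
 by cases (auto simp: std_form_def; presburger)+
 qed
 also have "\<dots> = \<omega> u (w j)" using k by simp
 finally show ?thesis by (simp add: linear_diff[OF linl(1)])
 qed
 have "dim (span (w ` {..<2 * m})) <= 2 * m"
 using dim_le_card'[of "w ` {..<2 * m}"] card_image_le[of "{..<2 * m}" w] by simp
 then have "span (w ` {..<2 * m}) ~= (UNIV :: 'e set)" using Suc.prems dim_span[of "w ` {..<2 * m}"] by (auto simp del: dim_span)
 then obtain u0 where u0: "u0 \<notin> span (w ` {..<2 * m})" by auto
 define p where "p = u0 - Q u0"
 have "p ~= 0" using u0 Qin[of u0] by (auto simp: p_def)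
 then obtain v0 where v0: "\<omega> p v0 ~= 0" using nd by blast
 define v where "v = (1 / \<omega> p v0) *\<^sub>R v0"
 have pv: "\<omega> p v = 1" using v0 by (simp add: v_def linear_cmul[OF linl(2)])
 define q where "q = v - Q v"
 have pw: "\<omega> p (w j) = 0" "\<omega> q (w j) = 0" if "j < 2 * m" for j using P0[OF that] by (auto simp: p_def q_def)
 have "\<omega> p (Q v) = 0"
 unfolding Q_def linear_sum[OF linl(2)] linear_diff[OF linl(2)] linear_cmul[OF linl(2)]
 by (intro sum.neutral) (auto simp: pw)
 then have pq: "\<omega> p q = 1" using pv by (simp add: q_def linear_diff[OF linl(2)])
 have self: "\<omega> x x = 0" for x using \<omega>(2)[of x x] by simp
 define w' where "w' = w(2 * m := p, 2 * m + 1 := q)"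
 have "\<omega> (w' i) (w' j) = std_form i j" if "i < 2 * Suc m" "j < 2 * Suc m" for i j
 proof -
 have *: "i < 2 * m \<or> i = 2 * m \<or> i = 2 * m + 1" "j < 2 * m \<or> j = 2 * m \<or> j = 2 * m + 1" using that by auto
 have par: "even k ==> Suc k ~= 2 * m" "even k ==> 2 * m ~= Suc k" for k by presburger+
 show ?thesis using * par[of i] par[of j] w[of i j] pw[of i] pw[of j] pq self \<omega>(2)[of q p] \<omega>(2)[of "w i" p] \<omega>(2)[of "w i" q]
 by (elim disjE) (auto simp: w'_def std_form_def)
 qed
 then show ?case by blast
qed simp

text \<open>An alternating form of top degree that vanishes on one basis vanishes on all tuples. It
  suffices, therefore, that the power is nonzero on a symplectic frame.\<close>

lemma dpow_nondegenerate:
 fixes \<omega> :: "'e::euclidean_space => 'e => real"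
 assumes \<omega>: "bilin \<omega>" "!!u v. \<omega> u v = - \<omega> v u" and nd: "!!u. (!!v. \<omega> u v = 0) ==> u = 0"
 and d: "DIM('e) = 2 * n" and e: "bij_betw e {..<2 * n} (Basis :: 'e set)"
 shows "dpow \<omega> n e ~= 0"
proof
 assume 0: "dpow \<omega> n e = 0"
 obtain w where w: "!!i j. i < 2 * n ==> j < 2 * n ==> \<omega> (w i) (w j) = std_form i j"
 using symplectic_frame_exists[OF \<omega> nd, of n] d by auto
 have "dpow \<omega> n w ~= 0" using dpow_symplectic_frame[of n \<omega> w] w by blast
 then have nz: "f w ~= 0" if "f = dpow \<omega> n" for f using that by simp
 text \<open>Replace the vectors of \<open>w\<close> one by one by basis vectors.\<close>
 have "f w = 0" if alt: "alt_form (2 * n) f" and f0: "f e = 0" for f :: "(nat => 'e) => real"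
 proof -
 have basis0: "f (%j. e (g j)) = 0" if g: "!!j. j < 2 * n ==> g j < 2 * n" for g
 proof (cases "inj_on g {..<2 * n}")
 case True
 then have "bij_betw g {..<2 * n} {..<2 * n}" using g by (intro bij_betw_imageI endo_inj_surj) auto
 then have "bij_betw (%j. e (g j)) {..<2 * n} Basis" using bij_betw_trans[OF _ e] by (auto simp: o_def)
 then show ?thesis using alt_form_enum[OF alt e] f0 by force
 next
 case False
 then obtain i j where "i < 2 * n" "j < 2 * n" "i ~= j" "g i = g j" by (auto simp: inj_on_def)
 then show ?thesis using alt_form_repeat[OF alt, of i j "%j. e (g j)"] by simp
 qed
 have "f (%j. if j < m then w j else e (g j)) = 0" if "!!j. j < 2 * n ==> g j < 2 * n" "m <= 2 * n" for m g
 using that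
 proof (induction m arbitrary: g)
 case 0
 then show ?case using basis0 by simp
 next
 case (Suc m)
 let ?v = "%j. if j < m then w j else e (g j)"
 have m: "m < 2 * n" using Suc.prems by simp
 have lin: "linear (%x. f (?v(m := x)))" using mlin_linear[OF alt_form_mlin[OF alt] m] .
 have "(%j. if j < Suc m then w j else e (g j)) = ?v(m := w m)" by (auto simp: less_Suc_eq)
 also have "w m = (\<Sum>k<2 * n. (w m \<bullet> e k) *\<^sub>R e k)" using bij_betw_sum_basis[OF e] .
 finally have "f (%j. if j < Suc m then w j else e (g j)) = f (?v(m := \<Sum>k<2 * n. (w m \<bullet> e k) *\<^sub>R e k))"
 by (rule arg_cong)
 also have "\<dots> = (\<Sum>k<2 * n. f (?v(m := (w m \<bullet> e k) *\<^sub>R e k)))" by (rule linear_sum[OF lin])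
 also have "\<dots> = (\<Sum>k<2 * n. (w m \<bullet> e k) * f (?v(m := e k)))"
 by (rule sum.cong[OF refl], rule linear_cmul[OF lin, unfolded real_scaleR_def])
 also have "\<dots> = 0"
 proof (intro sum.neutral ballI)
 fix k assume "k : {..<2 * n}"
 have "?v(m := e k) = (%j. if j < m then w j else e ((g(m := k)) j))" by auto
 moreover have "f (%j. if j < m then w j else e ((g(m := k)) j)) = 0"
 using \<open>k : {..<2 * n}\<close> Suc.prems by (intro Suc.IH) auto
 ultimately show "(w m \<bullet> e k) * f (?v(m := e k)) = 0" by simp
 qed
 finally show ?case .
 qed
 from this[of "%j. j" "2 * n"] have "f (%j. if j < 2 * n then w j else e j) = 0" by simp
 also have "f (%j. if j < 2 * n then w j else e j) = f w" by (rule mlin_local[OF alt_form_mlin[OF alt]]) auto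
 finally show ?thesis .
 qed
 from this[OF alt_form_dpow[OF \<omega>(1)] 0] nz show False by blast
qed

section \<open>The primitive of the volume form\<close>

text \<open>
 The coefficients of \<open>\<lambda> \<and> \<omega>\<^sup>n\<^sup>-\<^sup>1\<close>, up to a constant, as a vector field: its divergence is a multiple
 of \<open>\<omega>\<^sup>n\<close> when \<open>\<omega> = d\<lambda>\<close>.
\<close>

definition tailprod :: "('v => 'v => real) => nat => (nat => 'v) => (nat => nat) => real" where
 "tailprod B n e sgm = (\<Prod>i\<in>{1..<n}. B (e (sgm (2 * i))) (e (sgm (2 * i + 1))))"

definition prim_coeff :: "('v => real) => ('v => 'v => real) => nat => (nat => 'v) => nat => real" where
 "prim_coeff l B n e k = (\<Sum>sgm\<in>{sgm. sgm permutes {..<2 * n} & sgm 0 = k}. sg sgm * (l (e (sgm 1)) * tailprod B n e sgm))"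

lemma sum_perms_by_first:
 assumes "0 < d"
 shows "(\<Sum>sgm\<in>perms d. F sgm) = (\<Sum>k<d. \<Sum>sgm\<in>{sgm. sgm permutes {..<d} & sgm 0 = k}. F sgm)"
proof -
 have "(%sgm. sgm 0) ` perms d <= {..<d}" using permutes_in_image[of _ "{..<d}" 0] assms by auto
 from sum.group[OF finite_permutations[OF finite_lessThan] finite_lessThan this, of F] show ?thesis by simp
qed

lemma pairs_head:
 assumes "0 < n" shows "pairs B n e sgm = B (e (sgm 0)) (e (sgm 1)) * tailprod B n e sgm"
proof -
 have "{..<n} = insert 0 {1..<n}" using assms by auto
 then show ?thesis by (simp add: pairs_def tailprod_def)
qed

text \<open>Cramer's rule: putting Y into slot j of the basis multiplies the value by the j-th
  coordinate of Y.\<close>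

lemma alt_form_cramer:
 fixes Y :: "'e::euclidean_space"
 assumes alt: "alt_form d f" and e: "bij_betw e {..<d} Basis" and a: "linear a"
 shows "(\<Sum>j<d. a (e j) * f (e(j := Y))) = a Y * f e"
proof -
 have "f (e(j := Y)) = (Y \<bullet> e j) * f e" if j: "j < d" for j
 proof -
 have lin: "linear (%x. f (e(j := x)))" using mlin_linear[OF alt_form_mlin[OF alt] j] .
 have "f (e(j := Y)) = f (e(j := \<Sum>k<d. (Y \<bullet> e k) *\<^sub>R e k))" using bij_betw_sum_basis[OF e, of Y] by simp
 also have "\<dots> = (\<Sum>k<d. (Y \<bullet> e k) * f (e(j := e k)))"
 by (simp add: linear_sum[OF lin] linear_cmul[OF lin])
 also have "\<dots> = (\<Sum>k<d. if k = j then (Y \<bullet> e j) * f e else 0)"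
 by (rule sum.cong[OF refl]) (use j alt_form_repeat[OF alt j, of _ "e(j := e _)"] in auto)
 finally show ?thesis using j by simp
 qed
 then have "(\<Sum>j<d. a (e j) * f (e(j := Y))) = (\<Sum>j<d. (Y \<bullet> e j) * a (e j)) * f e"
 unfolding sum_distrib_right by (intro sum.cong) (auto simp: algebra_simps)
 also have "(\<Sum>j<d. (Y \<bullet> e j) * a (e j)) = a Y"
 using bij_betw_sum_basis[OF e, of Y] linear_sum[OF a, of "%k. (Y \<bullet> e k) *\<^sub>R e k" "{..<d}"] by (simp add: linear_cmul[OF a])
 finally show ?thesis .
qed

text \<open>The contraction of \<omega>^n with Y is n \<lambda> \<and> \<omega>^(n-1), so the
  coefficient vector is 2^(n-1)/n times the density of \<omega>^n times Y. After Cramer's rule and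
  the permutation formula, Y occupies one of 2n positions in each product, and all positions
  contribute equally.\<close>

lemma prim_coeff_contract:
 fixes \<omega> :: "'e::euclidean_space => 'e => real"
 assumes \<omega>: "bilin \<omega>" "!!u v. \<omega> u v = - \<omega> v u" and e: "bij_betw e {..<2 * n} Basis"
 and a: "linear a" and Y: "!!u. \<omega> Y u = l u" and n: "0 < n"
 shows "2 * real n * (\<Sum>k<2 * n. a (e k) * prim_coeff l \<omega> n e k) = 2 ^ n * (a Y * dpow \<omega> n e)"
proof -
 define A where "A = (%i sgm. (\<Prod>k\<in>{..<n} - {i}. \<omega> (e (sgm (2 * k))) (e (sgm (2 * k + 1)))))"
 define S where "S = (%i. \<Sum>sgm\<in>perms (2 * n). sg sgm * (a (e (sgm (2 * i))) * \<omega> Y (e (sgm (2 * i + 1))) * A i sgm))"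
 \<comment> \<open>Only the factor of the pair \<open>p div 2\<close> feels the replacement of the
   vector at position p; Y stands in its first or second argument according to the parity of
   p.\<close>
 have upd: "pairs \<omega> n (e(sgm p := Y)) sgm = (if even p then \<omega> Y (e (sgm (p + 1))) else \<omega> (e (sgm (p - 1))) Y) * A (p div 2) sgm"
 if sgm: "sgm permutes {..<2 * n}" and p: "p < 2 * n" for sgm p
 proof -
 have inj: "sgm x = sgm y \<longleftrightarrow> x = y" for x y using permutes_inj[OF sgm] by (auto simp: inj_def)
 have "p div 2 < n" using p by auto
 then have "pairs \<omega> n (e(sgm p := Y)) sgm = \<omega> ((e(sgm p := Y)) (sgm (2 * (p div 2)))) ((e(sgm p := Y)) (sgm (2 * (p div 2) + 1))) *
 (\<Prod>k\<in>{..<n} - {p div 2}. \<omega> ((e(sgm p := Y)) (sgm (2 * k))) ((e(sgm p := Y)) (sgm (2 * k + 1))))"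
 unfolding pairs_def by (subst prod.remove[of _ "p div 2"]) auto
 also have "(\<Prod>k\<in>{..<n} - {p div 2}. \<omega> ((e(sgm p := Y)) (sgm (2 * k))) ((e(sgm p := Y)) (sgm (2 * k + 1)))) = A (p div 2) sgm"
 unfolding A_def by (rule prod.cong[OF refl]) (auto simp: inj)
 also have "\<omega> ((e(sgm p := Y)) (sgm (2 * (p div 2)))) ((e(sgm p := Y)) (sgm (2 * (p div 2) + 1))) =
 (if even p then \<omega> Y (e (sgm (p + 1))) else \<omega> (e (sgm (p - 1))) Y)"
 by (cases "even p") (auto simp: inj elim!: oddE)
 finally show ?thesis .
 qed
 have "2 ^ n * (a Y * dpow \<omega> n e) = 2 ^ n * (\<Sum>j<2 * n. a (e j) * dpow \<omega> n (e(j := Y)))"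
 using alt_form_cramer[OF alt_form_dpow[OF \<omega>(1)] e a] by simp
 also have "\<dots> = (\<Sum>j<2 * n. \<Sum>sgm\<in>perms (2 * n). sg sgm * (a (e j) * pairs \<omega> n (e(j := Y)) sgm))"
 unfolding dpow_formula sum_distrib_left sum_divide_distrib by (intro sum.cong refl) (simp add: algebra_simps)
 also have "\<dots> = (\<Sum>sgm\<in>perms (2 * n). \<Sum>j<2 * n. sg sgm * (a (e j) * pairs \<omega> n (e(j := Y)) sgm))"
 by (rule sum.swap)
 also have "\<dots> = (\<Sum>sgm\<in>perms (2 * n). \<Sum>p<2 * n. sg sgm * (a (e (sgm p)) * pairs \<omega> n (e(sgm p := Y)) sgm))"
 by (intro sum.cong refl sum.reindex_bij_betw[symmetric] permutes_imp_bij) simp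
 also have "\<dots> = (\<Sum>p<2 * n. \<Sum>sgm\<in>perms (2 * n). sg sgm * (a (e (sgm p)) * pairs \<omega> n (e(sgm p := Y)) sgm))"
 by (rule sum.swap)
 also have "\<dots> = (\<Sum>p<2 * n. S (p div 2))"
 proof (rule sum.cong[OF refl])
 fix p assume "p : {..<2 * n}"
 then have p: "p < 2 * n" by simp
 define i where "i = p div 2"
 have i: "i < n" using p by (auto simp: i_def)
 show "(\<Sum>sgm\<in>perms (2 * n). sg sgm * (a (e (sgm p)) * pairs \<omega> n (e(sgm p := Y)) sgm)) = S (p div 2)"
 proof (cases "even p")
 case True
 then show ?thesis unfolding S_def by (intro sum.cong refl) (auto simp: upd p)
 next
 case False
 then have pi: "p = 2 * i + 1" by (simp add: i_def)
 then have pd: "p div 2 = i" "p - 1 = 2 * i" by simp_all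
 let ?t = "Transposition.transpose (2 * i) (2 * i + 1)"
 have t: "?t permutes {..<2 * n}" using i by (intro transpose_permutes) auto
 have At: "A i (sgm \<circ> ?t) = A i sgm" for sgm
 proof -
 have other: "?t (2 * k) = 2 * k" "?t (2 * k + 1) = 2 * k + 1" if "k ~= i" for k
 using that by (auto simp: Transposition.transpose_def)
 show ?thesis unfolding A_def by (rule prod.cong[OF refl]) (use other in auto)
 qed
 have "(\<Sum>sgm\<in>perms (2 * n). sg sgm * (a (e (sgm p)) * pairs \<omega> n (e(sgm p := Y)) sgm)) =
 (\<Sum>sgm\<in>perms (2 * n). sg sgm * (a (e (sgm (2 * i + 1))) * (- \<omega> Y (e (sgm (2 * i)))) * A i sgm))"
 proof (rule sum.cong[OF refl])
 fix sgm assume "sgm : perms (2 * n)"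
 then have "pairs \<omega> n (e(sgm p := Y)) sgm = \<omega> (e (sgm (2 * i))) Y * A i sgm" using upd[of sgm p] p False pd by simp
 then show "sg sgm * (a (e (sgm p)) * pairs \<omega> n (e(sgm p := Y)) sgm) =
 sg sgm * (a (e (sgm (2 * i + 1))) * (- \<omega> Y (e (sgm (2 * i)))) * A i sgm)"
 using \<omega>(2)[of "e (sgm (2 * i))" Y] pi by simp
 qed
 \<comment> \<open>Flipping pair i turns an odd position into an even one; the sign of the flip
   compensates the one from skew symmetry.\<close>
 also have "\<dots> = sg ?t * (\<Sum>sgm\<in>perms (2 * n). sg sgm * (a (e (sgm (2 * i))) * (- \<omega> Y (e (sgm (2 * i + 1)))) * A i sgm))"
 by (subst perm_sum_right[OF t]) (simp add: At[simplified])
 also have "\<dots> = S i"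
 using sg_transpose[of "2 * i" "2 * i + 1"] by (simp add: S_def sum_negf)
 finally show ?thesis by (simp add: i_def)
 qed
 qed
 \<comment> \<open>An even exchange of the blocks 0 and i identifies the contributions of all
   pairs.\<close>
 also have "\<dots> = (\<Sum>p<2 * n. S 0)"
 proof (rule sum.cong[OF refl])
 fix p assume "p : {..<2 * n}"
 then have i: "p div 2 < n" by auto
 define i where "i = p div 2"
 note ps = pair_swap[OF n i, folded i_def]
 have Ap: "A i (sgm \<circ> pair_swap 0 i) = A 0 sgm" for sgm
 proof -
 have "bij_betw (Transposition.transpose 0 i) ({..<n} - {i}) ({..<n} - {0})"
 proof (rule bij_betw_imageI)
 show "inj_on (Transposition.transpose 0 i) ({..<n} - {i})" by (auto simp: inj_on_def Transposition.transpose_def split: if_splits)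
 show "Transposition.transpose 0 i ` ({..<n} - {i}) = {..<n} - {0}"
 proof (intro equalityI subsetI)
 fix x assume "x : {..<n} - {0}"
 then show "x : Transposition.transpose 0 i ` ({..<n} - {i})"
 using n i by (intro image_eqI[of _ _ "Transposition.transpose 0 i x"]) (auto simp: Transposition.transpose_def i_def)
 qed (use n i in \<open>auto simp: Transposition.transpose_def i_def split: if_splits\<close>)
 qed
 from prod.reindex_bij_betw[OF this, of "%k. \<omega> (e (sgm (2 * k))) (e (sgm (Suc (2 * k))))"]
 show ?thesis unfolding A_def by (simp add: ps)
 qed
 have "S i = sg (pair_swap 0 i) * (\<Sum>sgm\<in>perms (2 * n). sg sgm * (a (e (sgm (pair_swap 0 i (2 * i)))) *
 \<omega> Y (e (sgm (pair_swap 0 i (2 * i + 1)))) * A i (sgm \<circ> pair_swap 0 i)))"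
 unfolding S_def by (subst perm_sum_right[OF ps(1)]) simp
 also have "\<dots> = S 0" unfolding S_def using ps by (simp add: Ap)
 finally show "S (p div 2) = S 0" by (simp add: i_def)
 qed
 also have "\<dots> = 2 * real n * S 0" by simp
 also have "S 0 = (\<Sum>k<2 * n. a (e k) * prim_coeff l \<omega> n e k)"
 proof -
 have A0: "A 0 sgm = tailprod \<omega> n e sgm" for sgm unfolding A_def tailprod_def by (rule prod.cong) auto
 define F where "F = (%sgm. sg sgm * (a (e (sgm 0)) * l (e (sgm 1)) * tailprod \<omega> n e sgm))"
 have "S 0 = (\<Sum>sgm\<in>perms (2 * n). F sgm)" unfolding S_def F_def by (simp add: A0 Y)
 also have "\<dots> = (\<Sum>k<2 * n. \<Sum>sgm\<in>{sgm. sgm permutes {..<2 * n} & sgm 0 = k}. F sgm)"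
 by (rule sum_perms_by_first) (use n in simp)
 finally have "S 0 = (\<Sum>k<2 * n. \<Sum>sgm\<in>{sgm. sgm permutes {..<2 * n} & sgm 0 = k}. F sgm)" .
 then show ?thesis
 unfolding prim_coeff_def sum_distrib_left F_def by (auto intro!: sum.cong)
 qed
 finally show ?thesis by simp
qed

text \<open>In the next lemma \<open>dl u v\<close> and \<open>d\<omega> u v w\<close> are the derivatives of \<open>\<lambda>(v)\<close> and \<open>\<omega>(v, w)\<close> in direction \<open>u\<close>.\<close>

lemma prim_coeff_divergence:
 assumes \<omega>: "!!u v. \<omega> u v = dl u v - dl v u" and closed: "!!u v w. d\<omega> u v w + d\<omega> v w u + d\<omega> w u v = 0"
 and skew: "!!u v w. d\<omega> u v w = - d\<omega> u w v" and n: "0 < n"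
 shows "2 * (\<Sum>k<2 * n. \<Sum>sgm\<in>{sgm. sgm permutes {..<2 * n} & sgm 0 = k}. sg sgm * (dl (e k) (e (sgm 1)) * tailprod \<omega> n e sgm +
 l (e (sgm 1)) * (\<Sum>i\<in>{1..<n}. d\<omega> (e k) (e (sgm (2 * i))) (e (sgm (2 * i + 1))) *
 (\<Prod>j\<in>{1..<n} - {i}. \<omega> (e (sgm (2 * j))) (e (sgm (2 * j + 1))))))) = 2 ^ n * dpow \<omega> n e"
proof -
 define R where "R = (%i sgm. \<Prod>j\<in>{1..<n} - {i}. \<omega> (e (sgm (2 * j))) (e (sgm (2 * j + 1))))"
 define T where "T = (%i sgm. l (e (sgm 1)) * d\<omega> (e (sgm 0)) (e (sgm (2 * i))) (e (sgm (2 * i + 1))) * R i sgm)"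
 \<comment> \<open>Antisymmetrizing \<open>dl\<close> in the two vectors of pair 0 gives \<omega> of
   that pair, hence the full product over all pairs; this accounts for the factor 2.\<close>
 have 1: "2 * (\<Sum>sgm\<in>perms (2 * n). sg sgm * (dl (e (sgm 0)) (e (sgm 1)) * tailprod \<omega> n e sgm)) = 2 ^ n * dpow \<omega> n e"
 proof -
 define F where "F = (%sgm. dl (e (sgm 0)) (e (sgm 1)) * tailprod \<omega> n e sgm)"
 let ?t = "Transposition.transpose 0 (1::nat)"
 have t: "?t permutes {..<2 * n}" using n by (intro transpose_permutes) auto
 have tp: "tailprod \<omega> n e (sgm \<circ> ?t) = tailprod \<omega> n e sgm" for sgm
 unfolding tailprod_def by (rule prod.cong[OF refl]) (auto simp: Transposition.transpose_def)
 have "(\<Sum>sgm\<in>perms (2 * n). sg sgm * F sgm) = - (\<Sum>sgm\<in>perms (2 * n). sg sgm * F (sgm \<circ> ?t))"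
 using perm_sum_right[OF t, of F] sg_transpose[of 0 1] by simp
 then have "2 * (\<Sum>sgm\<in>perms (2 * n). sg sgm * F sgm) = (\<Sum>sgm\<in>perms (2 * n). sg sgm * F sgm) - (\<Sum>sgm\<in>perms (2 * n). sg sgm * F (sgm \<circ> ?t))" by simp
 also have "\<dots> = (\<Sum>sgm\<in>perms (2 * n). sg sgm * pairs \<omega> n e sgm)"
 unfolding sum_subtractf[symmetric] F_def tp pairs_head[OF n] \<omega>
 by (intro sum.cong refl) (simp add: algebra_simps)
 finally show ?thesis by (simp add: dpow_formula F_def)
 qed
 have 2: "(\<Sum>sgm\<in>perms (2 * n). sg sgm * T i sgm) = 0" if i: "i : {1..<n}" for i
 proof -
 \<comment> \<open>The 3-cycle of the positions 0, 2i and 2i + 1. It is even and leaves the other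
   factors alone, so averaging over its powers brings in the cyclic sum of \<open>d\<omega>\<close>,
   which is 0 by closedness.\<close>
 define c where "c = Transposition.transpose 0 (2 * i) \<circ> Transposition.transpose (2 * i) (2 * i + 1)"
 have a: "Transposition.transpose 0 (2 * i) permutes {..<2 * n}" "Transposition.transpose (2 * i) (2 * i + 1) permutes {..<2 * n}"
 using i by (auto intro!: transpose_permutes)
 have c: "c permutes {..<2 * n}" unfolding c_def using permutes_compose[OF a(2,1)] .
 have sc: "sg c = 1" unfolding c_def sg_compose[OF a] using i by (simp add: sg_transpose)
 have cv: "c 0 = 2 * i" "c (2 * i) = 2 * i + 1" "c (2 * i + 1) = 0" "c 1 = 1"
 using i by (auto simp: c_def Transposition.transpose_def)
 have co: "c (2 * j) = 2 * j" "c (2 * j + 1) = 2 * j + 1" if "j : {1..<n} - {i}" for j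
 using that i by (auto simp: c_def Transposition.transpose_def)
 have R: "R i (sgm \<circ> c) = R i sgm" for sgm
 unfolding R_def by (rule prod.cong[OF refl]) (use co in auto)
 have s1: "(\<Sum>sgm\<in>perms (2 * n). sg sgm * F sgm) = (\<Sum>sgm\<in>perms (2 * n). sg sgm * F (sgm \<circ> c))" for F
 using perm_sum_right[OF c, of F] sc by simp
 have s2: "(\<Sum>sgm\<in>perms (2 * n). sg sgm * F sgm) = (\<Sum>sgm\<in>perms (2 * n). sg sgm * F (sgm \<circ> c \<circ> c))" for F
 using s1[of F] s1[of "%sgm. F (sgm \<circ> c)"] by (simp add: o_assoc)
 have "3 * (\<Sum>sgm\<in>perms (2 * n). sg sgm * T i sgm) =
 (\<Sum>sgm\<in>perms (2 * n). sg sgm * T i sgm + sg sgm * T i (sgm \<circ> c) + sg sgm * T i (sgm \<circ> c \<circ> c))"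
 unfolding sum.distrib using s1[of "T i"] s2[of "T i"] by simp
 also have "\<dots> = 0"
 proof (rule sum.neutral, rule ballI)
 fix sgm :: "nat => nat"
 have "T i sgm + T i (sgm \<circ> c) + T i (sgm \<circ> c \<circ> c) = l (e (sgm 1)) * R i sgm *
 (d\<omega> (e (sgm 0)) (e (sgm (2 * i))) (e (sgm (2 * i + 1))) + d\<omega> (e (sgm (2 * i))) (e (sgm (2 * i + 1))) (e (sgm 0)) +
 d\<omega> (e (sgm (2 * i + 1))) (e (sgm 0)) (e (sgm (2 * i))))"
 unfolding T_def R by (simp only: o_apply cv) (simp add: algebra_simps)
 then show "sg sgm * T i sgm + sg sgm * T i (sgm \<circ> c) + sg sgm * T i (sgm \<circ> c \<circ> c) = 0"
 unfolding closed by (simp add: distrib_left[symmetric])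
 qed
 finally show ?thesis by simp
 qed
 have "(\<Sum>k<2 * n. \<Sum>sgm\<in>{sgm. sgm permutes {..<2 * n} & sgm 0 = k}. sg sgm * (dl (e k) (e (sgm 1)) * tailprod \<omega> n e sgm +
 l (e (sgm 1)) * (\<Sum>i\<in>{1..<n}. d\<omega> (e k) (e (sgm (2 * i))) (e (sgm (2 * i + 1))) *
 (\<Prod>j\<in>{1..<n} - {i}. \<omega> (e (sgm (2 * j))) (e (sgm (2 * j + 1))))))) =
 (\<Sum>k<2 * n. \<Sum>sgm\<in>{sgm. sgm permutes {..<2 * n} & sgm 0 = k}. sg sgm * (dl (e (sgm 0)) (e (sgm 1)) * tailprod \<omega> n e sgm) +
 (\<Sum>i\<in>{1..<n}. sg sgm * T i sgm))"
 by (intro sum.cong refl) (auto simp: T_def R_def sum_distrib_left algebra_simps)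
 also have "\<dots> = (\<Sum>sgm\<in>perms (2 * n). sg sgm * (dl (e (sgm 0)) (e (sgm 1)) * tailprod \<omega> n e sgm) + (\<Sum>i\<in>{1..<n}. sg sgm * T i sgm))"
 by (rule sum_perms_by_first[symmetric]) (use n in simp)
 also have "\<dots> = (\<Sum>sgm\<in>perms (2 * n). sg sgm * (dl (e (sgm 0)) (e (sgm 1)) * tailprod \<omega> n e sgm)) +
 (\<Sum>i\<in>{1..<n}. \<Sum>sgm\<in>perms (2 * n). sg sgm * T i sgm)"
 unfolding sum.distrib by (subst (2) sum.swap) simp
 finally show ?thesis using 1 2 by simp
qed

section \<open>Change of variables in Euclidean spaces\<close>

text \<open>
 The change of variables theorem of the library is about \<open>real ^ 'n\<close>.  The following index type
 transfers it to arbitrary Euclidean spaces.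
\<close>

typedef (overloaded) ('a::euclidean_space) basis_ix = "{..<DIM('a)}"
 by (rule exI[of _ 0]) simp

lemma bij_Abs_basis_ix: "bij_betw (Abs_basis_ix :: nat => 'a basis_ix) {..<DIM('a::euclidean_space)} UNIV"
proof (rule bij_betw_imageI)
 show "inj_on (Abs_basis_ix :: nat => 'a basis_ix) {..<DIM('a)}" by (auto simp: inj_on_def Abs_basis_ix_inject)
 show "(Abs_basis_ix :: nat => 'a basis_ix) ` {..<DIM('a)} = UNIV"
 by (metis Abs_basis_ix_cases UNIV_eq_I image_eqI)
qed

lemma bij_Rep_basis_ix: "bij_betw (Rep_basis_ix :: 'a basis_ix => nat) UNIV {..<DIM('a::euclidean_space)}"
proof (rule bij_betw_imageI)
 show "inj (Rep_basis_ix :: 'a basis_ix => nat)" by (auto simp: inj_on_def Rep_basis_ix_inject)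
 show "range (Rep_basis_ix :: 'a basis_ix => nat) = {..<DIM('a)}"
 by (metis type_definition.Rep_range type_definition_basis_ix)
qed

text \<open>The order serves the instance \<open>wellorder\<close> below, which the change of
  variables formula demands of its index type.\<close>

instantiation basis_ix :: (euclidean_space) linorder
begin
definition "x <= y \<longleftrightarrow> Rep_basis_ix x <= Rep_basis_ix y"
definition "x < y \<longleftrightarrow> Rep_basis_ix x < Rep_basis_ix y"
instance by standard (auto simp: less_eq_basis_ix_def less_basis_ix_def Rep_basis_ix_inject)
end

instance basis_ix :: (euclidean_space) finite
proof
 have "finite ((Abs_basis_ix :: nat => 'a basis_ix) ` {..<DIM('a)})" by (rule finite_imageI) simp
 then show "finite (UNIV :: 'a basis_ix set)" unfolding bij_betw_imp_surj_on[OF bij_Abs_basis_ix] .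
qed

instance basis_ix :: (euclidean_space) wellorder
proof
 fix P :: "'a basis_ix => bool" and a
 assume step: "!!x. (!!y. y < x ==> P y) ==> P x"
 show "P a"
 proof (rule measure_induct_rule[of Rep_basis_ix P])
 fix x :: "'a basis_ix" assume "!!y. Rep_basis_ix y < Rep_basis_ix x ==> P y"
 then have "!!y. y < x ==> P y" by (simp add: less_basis_ix_def)
 then show "P x" by (rule step)
 qed
qed

lemma basis_frame_bij: "bij_betw (basis_frame :: nat => 'e) {..<DIM('e::euclidean_space)} Basis"
proof -
 have "\<exists>b :: nat => 'e. bij_betw b {..<DIM('e)} Basis"
 using ex_bij_betw_nat_finite[of "Basis :: 'e set"] by (simp add: atLeast0LessThan)
 then show ?thesis unfolding basis_frame_def by (rule someI_ex)
qed

text \<open>The coordinates of a Euclidean space \<open>'b\<close> are indexed by the dimension of a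
  possibly different type \<open>'a\<close>. A map between two spaces of equal dimension thereby
  becomes an endomorphism of one \<open>real ^ 'a basis_ix\<close>, which has a determinant.\<close>

definition from_cart :: "real ^ ('a::euclidean_space basis_ix) => 'b::euclidean_space" where
 "from_cart x = (\<Sum>i\<in>UNIV. x $ i *\<^sub>R basis_frame (Rep_basis_ix i))"

definition to_cart :: "'b::euclidean_space => real ^ ('a::euclidean_space basis_ix)" where
 "to_cart y = (\<chi> i. y \<bullet> basis_frame (Rep_basis_ix i))"

lemma linear_from_cart: "linear from_cart"
 by (rule linearI) (auto simp: from_cart_def scaleR_add_left sum.distrib scaleR_sum_right)

lemma measurable_from_cart: "from_cart : borel_measurable borel"
 by (intro borel_measurable_continuous_onI linear_continuous_on) (simp add: linear_conv_bounded_linear[symmetric] linear_from_cart)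

lemma linear_to_cart: "linear to_cart"
 by (rule linearI) (auto simp: to_cart_def vec_eq_iff inner_add_left)

context
 fixes tb :: "'b::euclidean_space itself" and ta :: "'a::euclidean_space itself"
 assumes DIM_eq: "DIM('b) = DIM('a)"
begin

lemma bij_frame_ix: "bij_betw (%i :: 'a basis_ix. basis_frame (Rep_basis_ix i) :: 'b) UNIV Basis"
 using bij_betw_trans[OF bij_Rep_basis_ix basis_frame_bij[where 'e = 'b, unfolded DIM_eq]] by (simp add: o_def)

lemma inner_frame_ix: "(basis_frame (Rep_basis_ix (i :: 'a basis_ix)) :: 'b) \<bullet> basis_frame (Rep_basis_ix j) = (if i = j then 1 else 0)"
proof -
 have "(basis_frame (Rep_basis_ix i) :: 'b) : Basis" for i :: "'a basis_ix" using bij_frame_ix by (auto simp: bij_betw_def)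
 moreover have "(basis_frame (Rep_basis_ix i) :: 'b) = basis_frame (Rep_basis_ix j) \<longleftrightarrow> i = j"
 using bij_frame_ix by (auto simp: bij_betw_def inj_on_def)
 ultimately show ?thesis by (simp add: inner_Basis)
qed

lemma to_from_cart: "to_cart (from_cart x :: 'b) = (x :: real ^ 'a basis_ix)"
 by (simp add: vec_eq_iff to_cart_def from_cart_def inner_sum_left inner_frame_ix if_distrib cong: if_cong)

lemma from_to_cart: "from_cart (to_cart y :: real ^ 'a basis_ix) = (y :: 'b)"
proof -
 have "(\<Sum>i\<in>UNIV. (y \<bullet> basis_frame (Rep_basis_ix (i :: 'a basis_ix))) *\<^sub>R basis_frame (Rep_basis_ix i)) = (\<Sum>b\<in>Basis. (y \<bullet> b) *\<^sub>R b)"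
 by (rule sum.reindex_bij_betw[OF bij_frame_ix])
 then show ?thesis by (simp add: from_cart_def to_cart_def euclidean_representation)
qed

lemma from_cart_axis: "k < DIM('a) ==> from_cart (axis (Abs_basis_ix k) 1 :: real ^ 'a basis_ix) = (basis_frame k :: 'b)"
proof -
 assume "k < DIM('a)"
 then have "Rep_basis_ix (Abs_basis_ix k :: 'a basis_ix) = k" by (simp add: Abs_basis_ix_inverse)
 moreover have "from_cart (axis j 1 :: real ^ 'a basis_ix) = (basis_frame (Rep_basis_ix j) :: 'b)" for j
 by (simp add: from_cart_def axis_def if_distrib[of "%c. c *\<^sub>R _"] cong: if_cong)
 ultimately show ?thesis by simp
qed

lemma lborel_from_cart: "distr lborel borel (from_cart :: real ^ 'a basis_ix => 'b) = lborel"
proof (rule lborel_eqI[symmetric])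
 fix l u :: 'b assume lu: "!!b. b : Basis ==> l \<bullet> b <= u \<bullet> b"
 let ?f = "from_cart :: real ^ 'a basis_ix => 'b"
 have meas: "?f : borel_measurable lborel"
 using measurable_from_cart by simp
 have fb: "basis_frame (Rep_basis_ix (i :: 'a basis_ix)) : (Basis :: 'b set)" for i
 using bij_frame_ix by (auto simp: bij_betw_def)
 have "?f -` box l u = box (to_cart l) (to_cart u)"
 proof (rule set_eqI)
 fix x :: "real ^ 'a basis_ix"
 have x: "x = to_cart (?f x)" by (simp add: to_from_cart)
 have "(\<forall>b\<in>Basis. l \<bullet> b < ?f x \<bullet> b & ?f x \<bullet> b < u \<bullet> b) \<longleftrightarrow>
 (\<forall>i. l \<bullet> basis_frame (Rep_basis_ix (i :: 'a basis_ix)) < ?f x \<bullet> basis_frame (Rep_basis_ix i) &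
 ?f x \<bullet> basis_frame (Rep_basis_ix i) < u \<bullet> basis_frame (Rep_basis_ix i))"
 proof -
 have R: "(Basis :: 'b set) = range (%i :: 'a basis_ix. basis_frame (Rep_basis_ix i))"
 using bij_frame_ix by (simp add: bij_betw_def)
 show ?thesis unfolding R by blast
 qed
 also have "\<dots> \<longleftrightarrow> x : box (to_cart l) (to_cart u)"
 proof -
 have "x $ i = ?f x \<bullet> basis_frame (Rep_basis_ix i)" for i
 using arg_cong[OF x, of "%v. v $ i"] by (simp add: to_cart_def)
 then show ?thesis by (simp add: mem_box_cart to_cart_def)
 qed
 finally show "x : ?f -` box l u \<longleftrightarrow> x : box (to_cart l) (to_cart u)" by (simp add: mem_box)
 qed
 then have "emeasure (distr lborel borel ?f) (box l u) = emeasure lborel (box (to_cart l) (to_cart u :: real ^ 'a basis_ix))"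
 using emeasure_distr[OF meas[folded measurable_lborel2], of "box l u"] by (simp add: emeasure_distr meas)
 also have "\<dots> = (\<Prod>b\<in>Basis. (to_cart u - to_cart l :: real ^ 'a basis_ix) \<bullet> b)"
 using lu fb by (subst emeasure_lborel_box) (auto simp: Basis_vec_def inner_axis to_cart_def)
 also have "(\<Prod>b\<in>Basis. (to_cart u - to_cart l :: real ^ 'a basis_ix) \<bullet> b) = (\<Prod>i\<in>(UNIV :: 'a basis_ix set). (u - l) \<bullet> basis_frame (Rep_basis_ix i))"
 by (simp add: Basis_vec_def UNION_singleton_eq_range prod.reindex axis_eq_axis inj_on_def inner_axis to_cart_def inner_diff_left)
 also have "\<dots> = (\<Prod>b\<in>Basis. (u - l) \<bullet> b)"
 by (rule prod.reindex_bij_betw[OF bij_frame_ix])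
 finally show "emeasure (distr lborel borel ?f) (box l u) = (\<Prod>b\<in>Basis. (u - l) \<bullet> b)" .
qed simp

end

text \<open>The absolute Jacobian determinant of a linear map between two Euclidean spaces of equal
  dimension, relative to their \<open>basis_frame\<close>s.\<close>

definition absdet :: "('a::euclidean_space => 'b::euclidean_space) => real" where
 "absdet L = \<bar>det (matrix (%x :: real ^ 'a basis_ix. to_cart (L (from_cart x)) :: real ^ 'a basis_ix))\<bar>"

text \<open>Ties the transformation law of top degree forms to the Jacobian of the change of
  variables formula. The determinant lemma is applied to f pulled back along the coordinate
  map.\<close>

lemma alt_form_absdet:
 fixes L :: "'a::euclidean_space => 'b::euclidean_space"
 assumes D: "DIM('b) = DIM('a)" and f: "alt_form (DIM('a)) f" and L: "linear L"
 shows "\<bar>f (%j. L (basis_frame j))\<bar> = absdet L * \<bar>f basis_frame\<bar>"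
proof -
 let ?M = "%x :: real ^ 'a basis_ix. to_cart (L (from_cart x)) :: real ^ 'a basis_ix"
 let ?h = "Abs_basis_ix :: nat => 'a basis_ix"
 have lin: "linear ?M"
 using linear_compose[OF linear_compose[OF linear_from_cart L] linear_to_cart] by (simp add: o_def)
 have fD: "alt_form (DIM('a)) (%v. f (%j. from_cart (v j :: real ^ 'a basis_ix)))"
 by (rule alt_form_compose_linear[OF f linear_from_cart])
 have "\<bar>f (%j. from_cart (?M (axis (?h j) 1)))\<bar> = \<bar>det (matrix ?M)\<bar> * \<bar>f (%j. from_cart (axis (?h j) 1 :: real ^ 'a basis_ix))\<bar>"
 using alt_form_linear_cart[OF lin bij_Abs_basis_ix, rule_format, OF fD] by simp
 moreover have "f (%j. from_cart (?M (axis (?h j) 1))) = f (%j. L (basis_frame j))"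
 by (rule mlin_local[OF alt_form_mlin[OF f]]) (simp add: from_to_cart[OF D] from_cart_axis)
 moreover have "f (%j. from_cart (axis (?h j) 1 :: real ^ 'a basis_ix)) = f basis_frame"
 by (rule mlin_local[OF alt_form_mlin[OF f]]) (simp add: from_cart_axis[OF D])
 ultimately show ?thesis by (simp add: absdet_def)
qed

text \<open>The known formula speaks of absolutely integrable vector functions, whence the detour
  through \<open>real^1\<close>. For nonnegative functions it shows that f and h are integrable
  together with equal integrals; if neither is integrable, both extended integrals are infinite by
  measurability.\<close>

lemma nn_integral_change_of_variables_cart:
 fixes g :: "real ^ 'n::{finite,wellorder} => real ^ 'n::_" and f h :: "real ^ 'n::_ => real"
 assumes S: "S : sets borel" and g': "!!x. x : S ==> (g has_derivative g' x) (at x within S)"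
 and inj: "inj_on g S" and fnn: "!!y. 0 <= f y" and hnn: "!!y. 0 <= h y"
 and fm: "(%y. indicator (g ` S) y * f y) : borel_measurable borel"
 and hm: "(%x. indicator S x * h x) : borel_measurable borel"
 and h: "!!x. x : S ==> h x = \<bar>det (matrix (g' x))\<bar> * f (g x)"
 shows "(\<integral>\<^sup>+y. ennreal (indicator (g ` S) y * f y) \<partial>lborel) = (\<integral>\<^sup>+x. ennreal (indicator S x * h x) \<partial>lborel)"
proof -
 have key: "(h integrable_on S & integral S h = b) \<longleftrightarrow> (f integrable_on (g ` S) & integral (g ` S) f = b)" for b
 proof -
 have "S : sets lebesgue" using S by simp
 from has_absolute_integral_change_of_variables[OF this g' inj, of "%y. vec (f y) :: real^1" "vec b"]
 have "(%x. \<bar>det (matrix (g' x))\<bar> * f (g x)) absolutely_integrable_on S &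
 integral S (%x. \<bar>det (matrix (g' x))\<bar> * f (g x)) = b \<longleftrightarrow>
 f absolutely_integrable_on (g ` S) & integral (g ` S) f = b"
 unfolding absolutely_integrable_on_1_iff integral_on_1_eq by (simp add: vec_eq_iff)
 moreover have "(%x. \<bar>det (matrix (g' x))\<bar> * f (g x)) absolutely_integrable_on S \<longleftrightarrow> (%x. \<bar>det (matrix (g' x))\<bar> * f (g x)) integrable_on S"
 by (rule absolutely_integrable_on_iff_nonneg) (simp add: fnn)
 moreover have "(%x. \<bar>det (matrix (g' x))\<bar> * f (g x)) integrable_on S \<longleftrightarrow> h integrable_on S"
 by (rule integrable_cong) (simp add: h)
 moreover have "integral S (%x. \<bar>det (matrix (g' x))\<bar> * f (g x)) = integral S h"
 by (rule integral_cong) (simp add: h)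
 moreover have "f absolutely_integrable_on (g ` S) \<longleftrightarrow> f integrable_on (g ` S)"
 by (rule absolutely_integrable_on_iff_nonneg) (simp add: fnn)
 ultimately show ?thesis by simp
 qed
 have fin: "(\<integral>\<^sup>+x. ennreal (indicator A x * k x) \<partial>lborel) = ennreal (integral A k)" if "k integrable_on A" "!!x. 0 <= k x"
 for A and k :: "real ^ 'n::_ => real"
 using nn_integral_has_integral_lebesgue[OF _ integrable_integral[OF that(1)]] that(2) by simp
 have inf: "k integrable_on A" if "(\<integral>\<^sup>+x. ennreal (indicator A x * k x) \<partial>lborel) < \<infinity>"
 "(%x. indicator A x * k x) : borel_measurable borel" "!!x. 0 <= k x" for A and k :: "real ^ 'n::_ => real"
 proof -
 have "(%x. indicator A x * k x) integrable_on UNIV"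
 using nn_integral_integrable_on[OF that(2) _ that(1)] that(3) by simp
 moreover have "(%x. indicator A x * k x) = (%x. if x : A then k x else 0)" by (auto simp: indicator_def fun_eq_iff)
 ultimately show ?thesis by (simp add: Henstock_Kurzweil_Integration.integrable_restrict_UNIV)
 qed
 show ?thesis
 proof (cases "h integrable_on S")
 case True
 then have "f integrable_on (g ` S)" "integral (g ` S) f = integral S h" using key[of "integral S h"] by auto
 then show ?thesis using fin[OF True hnn] fin[of f "g ` S"] fnn by simp
 next
 case False
 then have "\<not> f integrable_on (g ` S)" using key[of "integral (g ` S) f"] by auto
 then have "(\<integral>\<^sup>+x. ennreal (indicator (g ` S) x * f x) \<partial>lborel) = \<infinity>" using inf[OF _ fm fnn] by (metis infinity_ennreal_def top.not_eq_extremum)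
 moreover have "(\<integral>\<^sup>+x. ennreal (indicator S x * h x) \<partial>lborel) = \<infinity>" using False inf[OF _ hm hnn] by (metis infinity_ennreal_def top.not_eq_extremum)
 ultimately show ?thesis by simp
 qed
qed

lemma nn_integral_change_of_variables:
 fixes g :: "'a::euclidean_space => 'b::euclidean_space" and f :: "'b => real" and h :: "'a => real"
 assumes D: "DIM('b) = DIM('a)" and S: "S : sets borel"
 and g': "!!x. x : S ==> (g has_derivative g' x) (at x within S)"
 and inj: "inj_on g S" and fnn: "!!y. 0 <= f y" and hnn: "!!y. 0 <= h y"
 and fm: "(%y. indicator (g ` S) y * f y) : borel_measurable borel"
 and hm: "(%x. indicator S x * h x) : borel_measurable borel"
 and h: "!!x. x : S ==> h x = absdet (g' x) * f (g x)"
 shows "(\<integral>\<^sup>+y. ennreal (indicator (g ` S) y * f y) \<partial>lborel) = (\<integral>\<^sup>+x. ennreal (indicator S x * h x) \<partial>lborel)"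
proof -
 let ?a = "from_cart :: real ^ 'a basis_ix => 'a" and ?b = "from_cart :: real ^ 'a basis_ix => 'b"
 let ?G = "%x :: real ^ 'a basis_ix. to_cart (g (?a x)) :: real ^ 'a basis_ix"
 let ?S = "?a -` S"
 have ma [measurable]: "?a : borel_measurable borel" and mb [measurable]: "?b : borel_measurable borel"
 using measurable_from_cart by auto
 have bla: "bounded_linear ?a" and blt: "bounded_linear (to_cart :: 'b => real ^ 'a basis_ix)"
 using linear_from_cart linear_to_cart linear_conv_bounded_linear by blast+
 have inja: "inj ?a" by (rule inj_on_inverseI[of _ to_cart]) (simp add: to_from_cart)
 have injt: "inj (to_cart :: 'b => real ^ 'a basis_ix)" by (rule inj_on_inverseI[of _ from_cart]) (simp add: from_to_cart[OF D])
 have im: "?G ` ?S = ?b -` (g ` S)"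
 proof (intro equalityI subsetI)
 fix y assume "y : ?G ` ?S" then show "y : ?b -` (g ` S)" by (auto simp: from_to_cart[OF D])
 next
 fix y assume "y : ?b -` (g ` S)"
 then obtain x where "x : S" "?b y = g x" by auto
 moreover have "y = to_cart (?b y)" by (simp add: to_from_cart[OF D])
 ultimately have "y = ?G (to_cart x)" "to_cart x : ?S" by (simp_all add: from_to_cart)
 then show "y : ?G ` ?S" by blast
 qed
 have "(\<integral>\<^sup>+y. ennreal (indicator (g ` S) y * f y) \<partial>lborel) = (\<integral>\<^sup>+y. ennreal (indicator (g ` S) y * f y) \<partial>(distr lborel borel ?b))"
 by (simp add: lborel_from_cart[OF D])
 also have "\<dots> = (\<integral>\<^sup>+y. ennreal (indicator (?G ` ?S) y * f (?b y)) \<partial>lborel)"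
 unfolding im using fm by (subst nn_integral_distr) (auto simp: indicator_def)
 also have "\<dots> = (\<integral>\<^sup>+x. ennreal (indicator ?S x * h (?a x)) \<partial>lborel)"
 proof (rule nn_integral_change_of_variables_cart[where g' = "%x v. to_cart (g' (?a x) (?a v))"])
 show "?S : sets borel" using measurable_sets_borel[OF ma S] by simp
 show "(?G has_derivative (%v. to_cart (g' (?a x) (?a v)))) (at x within ?S)" if x: "x : ?S" for x
 proof -
 have "(g has_derivative g' (?a x)) (at (?a x) within ?a ` ?S)"
 by (rule has_derivative_subset[OF g']) (use x in auto)
 from has_derivative_in_compose[OF bounded_linear_imp_has_derivative[OF bla] this]
 have "((%x. g (?a x)) has_derivative (%v. g' (?a x) (?a v))) (at x within ?S)" .
 from bounded_linear.has_derivative[OF blt this] show ?thesis .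
 qed
 show "inj_on ?G ?S"
 proof (rule inj_onI)
 fix x y assume *: "x : ?S" "y : ?S" "?G x = ?G y"
 then have "g (?a x) = g (?a y)" using injt by (auto dest: injD)
 then have "?a x = ?a y" using inj * by (auto dest: inj_onD)
 then show "x = y" using inja by (auto dest: injD)
 qed
 show "(%y. indicator (?G ` ?S) y * f (?b y)) : borel_measurable borel"
 proof -
 have "(%y. indicator (g ` S) (?b y) * f (?b y)) : borel_measurable borel"
 using measurable_compose[OF mb fm] by simp
 moreover have "indicator (?G ` ?S) y = (indicator (g ` S) (?b y) :: real)" for y
 unfolding im by (simp add: indicator_def)
 ultimately show ?thesis by simp
 qed
 show "(%x. indicator ?S x * h (?a x)) : borel_measurable borel"
 proof -
 have "indicator ?S x = (indicator S (?a x) :: real)" for x by (simp add: indicator_def)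
 then show ?thesis using measurable_compose[OF ma hm] by simp
 qed
 show "h (?a x) = \<bar>det (matrix (%v. to_cart (g' (?a x) (?a v)) :: real ^ 'a basis_ix))\<bar> * f (?b (?G x))" if "x : ?S" for x
 using that h[of "?a x"] by (simp add: absdet_def from_to_cart[OF D])
 qed (use fnn hnn in auto)
 also have "\<dots> = (\<integral>\<^sup>+x. ennreal (indicator S x * h x) \<partial>(distr lborel borel ?a))"
 using hm by (subst nn_integral_distr) (auto simp: indicator_def)
 also have "\<dots> = (\<integral>\<^sup>+x. ennreal (indicator S x * h x) \<partial>lborel)"
 by (simp add: lborel_from_cart)
 finally show ?thesis .
qed

section \<open>Gluing measures\<close>

lemma emeasure_countable_partition:
 fixes C :: "nat => 'a set"
 assumes C: "!!k. C k : sets M" and B: "B : sets M" "B <= (\<Union>k. C k)"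
 shows "emeasure M B = (\<Sum>k. emeasure M (B Int disjointed C k))"
proof -
 have D: "disjointed C k : sets M" for k using sets.range_disjointed_sets[of C M] C by auto
 have "(\<Sum>k. emeasure M (B Int disjointed C k)) = emeasure M (\<Union>k. B Int disjointed C k)"
 proof (rule suminf_emeasure)
 show "range (%k. B Int disjointed C k) <= sets M" using D B by auto
 show "disjoint_family (%k. B Int disjointed C k)"
 using disjoint_family_disjointed[of C] unfolding disjoint_family_on_def by blast
 qed
 also have "(\<Union>k. B Int disjointed C k) = B" using B(2) UN_disjointed_eq[of C] by blast
 finally show ?thesis by simp
qed

lemma measure_eq_glue:
 fixes C :: "nat => 'a set"
 assumes sets: "sets M = sets N" and C: "!!k. C k : sets M" "space M <= (\<Union>k. C k)"
 and eq: "!!k B. B : sets M ==> B <= C k ==> emeasure M B = emeasure N B"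
 shows "M = N"
proof (rule measure_eqI[OF sets])
 fix B assume B: "B : sets M"
 then have BC: "B <= (\<Union>k. C k)" using C(2) sets.sets_into_space by blast
 have D: "disjointed C k : sets M" for k using sets.range_disjointed_sets[of C M] C by auto
 have "emeasure M (B Int disjointed C k) = emeasure N (B Int disjointed C k)" for k
 using B D[of k] disjointed_subset[of C k] by (intro eq[of _ k]) auto
 then show "emeasure M B = emeasure N B"
 using emeasure_countable_partition[OF C(1) B BC] emeasure_countable_partition[of C N B] C(1) B BC sets by simp
qed

text \<open>The glued measure sums the local ones over the disjoint refinement of the cover.
  Compatibility on overlaps makes it agree with every local measure on the sets of its
  patch.\<close>

lemma measure_glue:
 fixes C :: "nat => 'a set"
 assumes sets: "!!k. sets (M k) = sets N" and C: "!!k. C k : sets N" "space N <= (\<Union>k. C k)"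
 and eq: "!!k l B. B : sets N ==> B <= C k ==> B <= C l ==> emeasure (M k) B = emeasure (M l) B"
 obtains \<mu> where "sets \<mu> = sets N" "!!k B. B : sets N ==> B <= C k ==> emeasure \<mu> B = emeasure (M k) B"
proof -
 define f where "f = (%B. \<Sum>k. emeasure (M k) (B Int disjointed C k))"
 have D: "disjointed C k : sets N" for k using sets.range_disjointed_sets[of C N] C by auto
 define \<mu> where "\<mu> = measure_of (space N) (sets N) f"
 have s\<mu>: "sets \<mu> = sets N" unfolding \<mu>_def by (simp add: sets.space_closed sets.sigma_sets_eq)
 have em: "emeasure \<mu> B = f B" if "B : sets N" for B
 unfolding \<mu>_def
 proof (rule emeasure_measure_of_sigma)
 show "sigma_algebra (space N) (sets N)" by (rule sets.sigma_algebra_axioms)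
 show "positive (sets N) f" by (simp add: positive_def f_def)
 show "countably_additive (sets N) f"
 proof (rule countably_additiveI)
 fix A :: "nat => 'a set" assume A: "range A <= sets N" "disjoint_family A" "(\<Union>i. A i) : sets N"
 have "emeasure (M k) ((\<Union>i. A i) Int disjointed C k) = (\<Sum>i. emeasure (M k) (A i Int disjointed C k))" for k
 proof -
 have "(\<Sum>i. emeasure (M k) (A i Int disjointed C k)) = emeasure (M k) (\<Union>i. A i Int disjointed C k)"
 proof (rule suminf_emeasure)
 show "range (%i. A i Int disjointed C k) <= sets (M k)" using A D sets by auto
 show "disjoint_family (%i. A i Int disjointed C k)" using A(2) unfolding disjoint_family_on_def by blast
 qed
 then show ?thesis by simp
 qed
 then have "f (\<Union>i. A i) = (\<Sum>k. \<Sum>i. emeasure (M k) (A i Int disjointed C k))" by (simp add: f_def)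
 also have "\<dots> = (\<integral>\<^sup>+k. (\<Sum>i. emeasure (M k) (A i Int disjointed C k)) \<partial>count_space UNIV)"
 by (rule nn_integral_count_space_nat[symmetric])
 also have "\<dots> = (\<Sum>i. \<integral>\<^sup>+k. emeasure (M k) (A i Int disjointed C k) \<partial>count_space UNIV)"
 by (rule nn_integral_suminf) simp
 also have "\<dots> = (\<Sum>i. f (A i))" by (simp add: nn_integral_count_space_nat f_def)
 finally show "(\<Sum>i. f (A i)) = f (\<Union>i. A i)" by simp
 qed
 qed (rule that)
 have "emeasure \<mu> B = emeasure (M k) B" if B: "B : sets N" "B <= C k" for k B
 proof -
 have "emeasure (M l) (B Int disjointed C l) = emeasure (M k) (B Int disjointed C l)" for l
 using B D[of l] disjointed_subset[of C l] by (intro eq) auto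
 then have "f B = (\<Sum>l. emeasure (M k) (B Int disjointed C l))" by (simp add: f_def)
 also have "\<dots> = emeasure (M k) B"
 proof -
 have "B <= (\<Union>k. C k)" using B(2) by blast
 then show ?thesis using emeasure_countable_partition[of C "M k" B] B(1) C(1) sets by simp
 qed
 finally show ?thesis using em B by simp
 qed
 with s\<mu> that show ?thesis by blast
qed

declare split_paired_All [simp del] split_paired_Ex [simp del]

section \<open>The measure of a top degree form\<close>

lemma at_within_openin:
 assumes "openin (top_of_set S) T" "x : T" shows "at x within T = at x within S"
proof -
 obtain U where "open U" "T = S Int U" using assms(1) by (auto simp: openin_open)
 then show ?thesis using assms(2) at_within_Int_open[of U x S] by auto
qed

lemma borel_openin: "openin (top_of_set S) T ==> S : sets borel ==> T : sets borel"
 by (auto simp: openin_open)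

lemma half_space_closed: "closed (half_space :: (real \<times> 'f::euclidean_space) set)"
 unfolding half_space_def by (intro closed_Collect_le continuous_intros)

lemma borel_chart_img: "openin (top_of_set half_space) S ==> S : sets borel"
 using borel_openin half_space_closed borel_closed by blast

lemma homeomorphism_image_borel:
 assumes "homeomorphism S T f g" "S : sets borel" "T : sets borel" "B : sets borel" "B <= S"
 shows "f ` B : sets borel"
proof -
 have "f ` B = g -` B Int T"
 using assms(1,5) by (auto simp: homeomorphism_def)
 moreover have "g : borel_measurable (restrict_space borel T)"
 using assms(1) by (intro borel_measurable_continuous_on_restrict) (auto simp: homeomorphism_def)
 then have "g -` B Int T : sets (restrict_space borel T)"
 using assms(4) measurable_sets[of g "restrict_space borel T" borel B] by (simp add: space_restrict_space)
 then have "g -` B Int T : sets borel" using assms(3) by (auto simp: sets_restrict_space)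
 ultimately show ?thesis by simp
qed

text \<open>Lindelof's theorem. One arbitrary chart is added so that the countable family is
  nonempty and can be enumerated by the natural numbers.\<close>

lemma charts_countable_cover:
 fixes A :: "('i, 'w::second_countable_topology, 'e) atlas"
 assumes "!!i. i : charts A ==> openin (top_of_set (points A)) (chart_dom A i)" "charts A ~= {}"
 obtains C :: "nat => 'i" where "!!k. C k : charts A" "points A = (\<Union>k. chart_dom A (C k))"
proof -
 obtain F where F: "F <= chart_dom A ` charts A" "countable F" "\<Union>F = \<Union>(chart_dom A ` charts A)"
 using Lindelof_openin[of "chart_dom A ` charts A" "points A"] assms(1) by (metis (no_types, lifting) imageE)
 define G where "G = insert (chart_dom A (SOME i. i : charts A)) F"
 have "(SOME i. i : charts A) : charts A" using assms(2) some_in_eq by blast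
 then have G: "G <= chart_dom A ` charts A" "countable G" "\<Union>G = points A" "G ~= {}"
 using F by (auto simp: G_def points_def)
 have "\<exists>i. i : charts A & chart_dom A i = from_nat_into G k" for k
 proof -
 have "from_nat_into G k : chart_dom A ` charts A" using from_nat_into[OF G(4), of k] G(1) by blast
 then show ?thesis by (metis imageE)
 qed
 then obtain C where C: "!!k. C k : charts A" "!!k. chart_dom A (C k) = from_nat_into G k" by metis
 have "points A = (\<Union>k. chart_dom A (C k))"
 using range_from_nat_into[OF G(4,2)] G(3) C(2) by auto
 with C(1) that show ?thesis by blast
qed

text \<open>\<open>form_measure\<close> is a definite description; a measure with the right values
  in charts is unique, since countably many charts cover.\<close>

lemma form_measure_eqI:
 fixes A :: "('i, 'w::topological_space, 'e::euclidean_space) atlas" and C :: "nat => 'i"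
 assumes C: "!!k. C k : charts A" "points A = (\<Union>k. chart_dom A (C k))" "!!k. chart_dom A (C k) : sets borel"
 and \<mu>: "sets \<mu> = sets (restrict_space borel (points A))"
 and em: "!!i B. i : charts A ==> B : sets borel ==> B <= chart_dom A i ==>
 emeasure \<mu> B = (\<integral>\<^sup>+x\<in>coord A i ` B. ennreal \<bar>\<nu> i x basis_frame\<bar> \<partial>lborel)"
 shows "form_measure A \<nu> = \<mu>"
 unfolding form_measure_def
proof (rule the_equality)
 show "sets \<mu> = sets (restrict_space borel (points A)) &
 (\<forall>i\<in>charts A. \<forall>B\<in>sets borel. B <= chart_dom A i -->
 emeasure \<mu> B = (\<integral>\<^sup>+x\<in>coord A i ` B. ennreal \<bar>\<nu> i x basis_frame\<bar> \<partial>lborel))"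
 using \<mu> em by blast
 fix \<mu>' assume *: "sets \<mu>' = sets (restrict_space borel (points A)) &
 (\<forall>i\<in>charts A. \<forall>B\<in>sets borel. B <= chart_dom A i -->
 emeasure \<mu>' B = (\<integral>\<^sup>+x\<in>coord A i ` B. ennreal \<bar>\<nu> i x basis_frame\<bar> \<partial>lborel))"
 have pts: "points A : sets borel" using C by auto
 have s': "sets \<mu>' = sets (restrict_space borel (points A))" using * by blast
 have sb: "B : sets borel" if "B : sets \<mu>'" for B using that s' pts by (auto simp: sets_restrict_space)
 show "\<mu>' = \<mu>"
 proof (rule measure_eq_glue[where C = "%k. chart_dom A (C k)"])
 show "sets \<mu>' = sets \<mu>" using s' \<mu> by simp
 show "chart_dom A (C k) : sets \<mu>'" for k
 unfolding s' using C pts by (auto simp: sets_restrict_space_iff)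
 have "space \<mu>' = points A" using sets_eq_imp_space_eq[OF s'] by (simp add: space_restrict_space)
 then show "space \<mu>' <= (\<Union>k. chart_dom A (C k))" using C(2) by simp
 show "emeasure \<mu>' B = emeasure \<mu> B" if "B : sets \<mu>'" "B <= chart_dom A (C k)" for k B
 using * em[OF C(1) sb[OF that(1)] that(2)] C(1) sb[OF that(1)] that(2) by simp
 qed
qed

section \<open>Liouville domains\<close>

locale liouville =
 fixes n :: nat
 and W :: "('i, 'w::{t2_space, second_countable_topology}, real \<times> 'f::euclidean_space) atlas"
 and lam :: "('i, real \<times> 'f) oneform"
 assumes liouville: "liouville_domain n W lam"
begin

abbreviation "dm \<equiv> chart_dom W"
abbreviation "img \<equiv> chart_img W"
abbreviation "om \<equiv> ext_d W lam"
abbreviation "Ch \<equiv> charts W"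
abbreviation "Pts \<equiv> points W"
abbreviation "bfr \<equiv> basis_frame :: nat => real \<times> 'f"

lemma mfd: "manifold_with_boundary W" and compact_points: "compact Pts" and points_nonempty: "Pts ~= {}"
 and smooth_lam: "smooth_oneform W lam" and DIM_W: "DIM(real \<times> 'f) = 2 * n"
 and nondeg: "i : Ch ==> x : img i ==> (!!u. om i x v u = 0) ==> v = 0"
 using liouville unfolding liouville_domain_def by auto

lemma n_pos: "0 < n"
 using DIM_W DIM_positive[where 'a = 'f] by simp

lemma chart:
 assumes "i : Ch"
 shows dom_open: "openin (top_of_set Pts) (dm i)" and img_open: "openin (top_of_set half_space) (img i)"
 and homeo: "homeomorphism (dm i) (img i) (coord W i) (param W i)"
 using mfd assms unfolding manifold_with_boundary_def by auto

lemma transition_smooth: "i : Ch ==> j : Ch ==> smooth_on (coord W i ` (dm i Int dm j)) (coord W j \<circ> param W i)"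
 using mfd unfolding manifold_with_boundary_def by auto

lemma coord_in: "i : Ch ==> p : dm i ==> coord W i p : img i"
 by (auto simp: chart_img_def)

lemma param_coord: "i : Ch ==> p : dm i ==> param W i (coord W i p) = p"
 using homeo[of i] by (auto simp: homeomorphism_def)

lemma coord_param: "i : Ch ==> x : img i ==> coord W i (param W i x) = x"
 using homeo[of i] by (auto simp: homeomorphism_def)

lemma param_in: "i : Ch ==> x : img i ==> param W i x : dm i"
 using homeo[of i] by (auto simp: homeomorphism_def)

lemma dom_subset: "i : Ch ==> dm i <= Pts"
 by (auto simp: points_def)

lemma param_points: "i : Ch ==> x : img i ==> param W i x : Pts"
 using param_in dom_subset by blast

lemma thick_img: "i : Ch ==> thick (img i)"
 using thick_openin_half_space img_open by blast

lemma img_half_space: "i : Ch ==> img i <= half_space"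
 using img_open openin_imp_subset by blast

lemma fst_img: "i : Ch ==> x : img i ==> 0 <= fst x"
 using img_half_space by (auto simp: half_space_def)

lemma continuous_coord: "i : Ch ==> continuous_on (dm i) (coord W i)"
 using homeo[of i] by (auto simp: homeomorphism_def)

lemma continuous_param: "i : Ch ==> continuous_on (img i) (param W i)"
 using homeo[of i] by (auto simp: homeomorphism_def)

lemma points_borel: "Pts : sets borel"
 using compact_points compact_imp_closed borel_closed by blast

lemma dom_borel: "i : Ch ==> dm i : sets borel"
 using dom_open borel_openin points_borel by blast

lemma img_borel: "i : Ch ==> img i : sets borel"
 using img_open borel_chart_img by blast

lemma coord_image_borel: "i : Ch ==> B : sets borel ==> B <= dm i ==> coord W i ` B : sets borel"
 using homeomorphism_image_borel[OF homeo dom_borel img_borel] by blast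

lemma Ch_nonempty: "Ch ~= {}"
 using points_nonempty by (auto simp: points_def)

lemma some_chart: "p : Pts ==> some_chart W p : Ch & p : dm (some_chart W p)"
 unfolding some_chart_def by (rule someI_ex) (auto simp: points_def)

subsection \<open>The symplectic form\<close>

lemma lam_linear: "i : Ch ==> x : img i ==> linear (lam i x)"
 using smooth_lam unfolding smooth_oneform_def by auto

lemma lam_smooth: "i : Ch ==> smooth_on (img i) (%x. lam i x u)"
 using smooth_lam unfolding smooth_oneform_def by auto

lemma lam_has_derivative:
 "i : Ch ==> x : img i ==> ((%y. lam i y u) has_derivative fd_within (%y. lam i y u) (img i) x) (at x within img i)"
 using smooth_on_has_derivative[OF lam_smooth] by blast

lemma dlam_linear:
 assumes "i : Ch" "x : img i"
 shows "linear (%v. fd_within (%y. lam i y v) (img i) x u)" "linear (%u. fd_within (%y. lam i y v) (img i) x u)"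
proof -
 show "linear (%u. fd_within (%y. lam i y v) (img i) x u)" using lam_has_derivative[OF assms] has_derivative_linear by blast
 note eq = thick_frechet_eq[OF thick_img[OF assms(1)] assms(2)]
 have "fd_within (%y. lam i y (v + w)) (img i) x = (%u. fd_within (%y. lam i y v) (img i) x u + fd_within (%y. lam i y w) (img i) x u)" for v w
 proof (rule eq, rule has_derivative_transform_on[OF _ assms(2)])
 show "((%y. lam i y v + lam i y w) has_derivative (%u. fd_within (%y. lam i y v) (img i) x u + fd_within (%y. lam i y w) (img i) x u)) (at x within img i)"
 by (intro has_derivative_add lam_has_derivative assms)
 qed (use lam_linear[OF assms(1)] in \<open>auto simp: linear_add\<close>)
 moreover have "fd_within (%y. lam i y (c *\<^sub>R v)) (img i) x = (%u. c * fd_within (%y. lam i y v) (img i) x u)" for c v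
 proof (rule eq, rule has_derivative_transform_on[OF _ assms(2)])
 show "((%y. c * lam i y v) has_derivative (%u. c * fd_within (%y. lam i y v) (img i) x u)) (at x within img i)"
 by (intro has_derivative_mult_right lam_has_derivative assms)
 qed (use lam_linear[OF assms(1)] in \<open>auto simp: linear_cmul\<close>)
 ultimately show "linear (%v. fd_within (%y. lam i y v) (img i) x u)" by (auto intro!: linearI)
qed

lemma om_bilin: "i : Ch ==> x : img i ==> bilin (om i x)"
 unfolding bilin_def ext_d_def by (intro conjI allI linear_compose_sub dlam_linear)

lemma om_skew: "om i x u v = - om i x v u"
 by (simp add: ext_d_def)

lemma om_smooth: "i : Ch ==> smooth_on (img i) (%x. om i x u v)"
proof -
 assume i: "i : Ch"
 have "smooth_on (img i) (%x. fd_within (%y. lam i y v) (img i) x u + - fd_within (%y. lam i y u) (img i) x v)"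
 by (intro smooth_on_add smooth_on_derivative lam_smooth i thick_img smooth_on_bounded_linear[OF _ bounded_linear_minus[OF bounded_linear_ident]])
 then show ?thesis by (simp add: ext_d_def)
qed

lemma om_linear: assumes "i : Ch" "x : img i" shows "linear (om i x u)" "linear (%v. om i x v u)"
 using om_bilin[OF assms] by (auto simp: bilin_def)

text \<open>Nondegeneracy makes v -> \<omega>(v, .) injective, hence bijective in finite dimension.
  The definite descriptions \<open>liouville_vec\<close> and \<open>ham_vec\<close> become
  meaningful by this.\<close>

lemma om_solve:
 assumes i: "i : Ch" "x : img i" and a: "linear a"
 shows "\<exists>!v. \<forall>u. om i x v u = a u"
proof -
 define F where "F = (%v. \<Sum>b\<in>Basis. om i x v b *\<^sub>R b)"
 have lF: "linear F"
 proof (rule linearI)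
 show "F (v + w) = F v + F w" for v w
 unfolding F_def linear_add[OF om_linear(2)[OF i]] by (simp add: scaleR_add_left sum.distrib)
 show "F (c *\<^sub>R v) = c *\<^sub>R F v" for c v
 unfolding F_def linear_cmul[OF om_linear(2)[OF i]] by (simp add: scaleR_sum_right)
 qed
 have Fb: "F v \<bullet> b = om i x v b" if "b : Basis" for v b using that by (simp add: F_def)
 have om_sum: "om i x v u = (\<Sum>b\<in>Basis. (u \<bullet> b) * om i x v b)" for v u
 using linear_basis_sum[OF om_linear(1)[OF i], of v u] by simp
 have zero: "v = 0" if "F v = 0" for v
 proof (rule nondeg[OF i])
 fix u have "om i x v b = 0" if "b : Basis" for b using Fb[OF that, of v] \<open>F v = 0\<close> by simp
 then show "om i x v u = 0" using om_sum[of v u] by simp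
 qed
 have "inj F" using linear_injective_0[OF lF] zero by blast
 then have "surj F" using linear_injective_imp_surjective[OF lF] by blast
 then obtain v where v: "F v = (\<Sum>b\<in>Basis. a b *\<^sub>R b)" by (metis surjD)
 have "om i x v u = a u" for u
 proof -
 have "om i x v b = a b" if "b : Basis" for b using Fb[OF that, of v] v that by simp
 then show ?thesis using om_sum[of v u] linear_basis_sum[OF a, of u] by simp
 qed
 moreover have "v' = v" if "\<forall>u. om i x v' u = a u" for v'
 proof -
 have "om i x (v' - v) u = 0" for u using that calculation[of u] linear_diff[OF om_linear(2)[OF i]] by simp
 then show ?thesis using nondeg[OF i, of "v' - v"] by simp
 qed
 ultimately show ?thesis by blast
qed

abbreviation "Y \<equiv> liouville_vec W lam"

lemma Y: assumes "i : Ch" "x : img i" shows "om i x (Y i x) u = lam i x u"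
 using theI'[OF om_solve[OF assms lam_linear[OF assms]]] unfolding liouville_vec_def by blast

lemma Y_unique: "i : Ch ==> x : img i ==> (!!u. om i x v u = lam i x u) ==> v = Y i x"
 using om_solve[OF _ _ lam_linear] Y by blast

definition diffW :: "('w => real) => bool" where
 "diffW h \<longleftrightarrow> (\<forall>i\<in>Ch. \<forall>x\<in>img i. (h \<circ> param W i) differentiable (at x within img i))"

abbreviation "dW h i x \<equiv> fd_within (h \<circ> param W i) (img i) x"

lemma dW: "diffW h ==> i : Ch ==> x : img i ==> ((h \<circ> param W i) has_derivative dW h i x) (at x within img i)"
 unfolding diffW_def using frechet_derivative_works by blast

lemma dW_linear: "diffW h ==> i : Ch ==> x : img i ==> linear (dW h i x)"
 using dW has_derivative_linear by blast

lemma ham_vec: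
 assumes "diffW h" "i : Ch" "x : img i" shows "om i x (ham_vec W lam h i x) u = dW h i x u"
 using theI'[OF om_solve[OF assms(2,3) dW_linear[OF assms]]] unfolding ham_vec_def by blast

text \<open>\<lambda>(X) = \<omega>(Y, X) = -\<omega>(X, Y) = -dh(Y). Thus \<tau> involves only the
  derivative of H along the Liouville field.\<close>

lemma lam_ham_vec:
 assumes "diffW h" "i : Ch" "x : img i"
 shows "lam i x (ham_vec W lam h i x) = - dW h i x (Y i x)"
 using Y[OF assms(2,3)] ham_vec[OF assms] om_skew[of i x] by metis

subsection \<open>Transition maps\<close>

definition trans_dom :: "'i => 'i => (real \<times> 'f) set" where
 "trans_dom i j = coord W i ` (dm i Int dm j)"

definition tran :: "'i => 'i => real \<times> 'f => real \<times> 'f" where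
 "tran i j x = coord W j (param W i x)"

abbreviation "dtrans i j x \<equiv> fd_within (tran i j) (img i) x"

context
 fixes i j assumes i: "i : Ch" and j: "j : Ch"
begin

lemma trans_dom_eq: "trans_dom i j = {x : img i. param W i x : dm j}"
 using param_coord[OF i] coord_param[OF i] param_in[OF i] unfolding trans_dom_def chart_img_def by force

lemma trans_dom_openin: "openin (top_of_set (img i)) (trans_dom i j)"
proof -
 have "openin (top_of_set (dm i)) (dm i Int dm j)"
 by (rule openin_subset_trans[OF openin_Int[OF dom_open[OF i] dom_open[OF j]] _ dom_subset[OF i]]) auto
 then show ?thesis using homeomorphism_imp_open_map[OF homeo[OF i]] unfolding trans_dom_def by blast
qed

lemma trans_dom_half_space: "openin (top_of_set half_space) (trans_dom i j)"
 using openin_trans[OF trans_dom_openin img_open[OF i]] .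

lemma trans_in: "x : trans_dom i j ==> tran i j x : img j"
 using coord_in[OF j] by (auto simp: trans_dom_eq tran_def)

lemma param_trans: "x : trans_dom i j ==> param W j (tran i j x) = param W i x"
 using param_coord[OF j] by (auto simp: trans_dom_eq tran_def)

lemma trans_smooth: "smooth_on (trans_dom i j) (tran i j)"
 using transition_smooth[OF i j] unfolding trans_dom_def tran_def by (simp add: o_def)

lemma at_within_trans_dom: "x : trans_dom i j ==> at x within trans_dom i j = at x within img i"
 by (rule at_within_openin[OF trans_dom_openin])

lemma dtrans: "x : trans_dom i j ==> (tran i j has_derivative dtrans i j x) (at x within img i)"
 using smooth_on_has_derivative[OF trans_smooth] at_within_trans_dom by metis

lemma dtrans_linear: "x : trans_dom i j ==> linear (dtrans i j x)"
 using dtrans has_derivative_linear by blast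

lemma lam_trans: "x : trans_dom i j ==> lam i x u = lam j (tran i j x) (dtrans i j x u)"
proof -
 assume "x : trans_dom i j"
 then obtain p where p: "p : dm i" "p : dm j" "x = coord W i p" by (auto simp: trans_dom_def)
 have eq: "coord W j \<circ> param W i = tran i j" by (rule ext) (simp add: tran_def)
 have tp: "tran i j x = coord W j p" using p param_coord[OF i p(1)] by (simp add: tran_def)
 have "lam i (coord W i p) u =
 lam j (coord W j p) (fd_within (coord W j \<circ> param W i) (img i) (coord W i p) u)"
 using smooth_lam i j p(1,2) unfolding smooth_oneform_def by blast
 then show ?thesis unfolding eq tp p(3)[symmetric] .
qed

lemma om_trans:
 assumes x: "x : trans_dom i j" shows "om i x u v = om j (tran i j x) (dtrans i j x u) (dtrans i j x v)"
proof -
 have "fd_within (%y. lam i y v) (trans_dom i j) x u - fd_within (%y. lam i y u) (trans_dom i j) x v =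
 fd_within (%y. lam j y (fd_within (tran i j) (trans_dom i j) x v)) (img j) (tran i j x) (fd_within (tran i j) (trans_dom i j) x u) -
 fd_within (%y. lam j y (fd_within (tran i j) (trans_dom i j) x u)) (img j) (tran i j x) (fd_within (tran i j) (trans_dom i j) x v)"
 proof (rule ext_derivative_pullback[where l = "lam j" and \<kappa> = "lam i", OF _ _ trans_smooth _ _ _ _ x])
 show "lam i y u = lam j (tran i j y) (fd_within (tran i j) (trans_dom i j) y u)" if "y : trans_dom i j" for y u
 using lam_trans[OF that] at_within_trans_dom[OF that] by simp
 qed (use thick_openin_half_space[OF trans_dom_half_space] thick_img[OF j] trans_in lam_linear[OF j] lam_smooth[OF j] in auto)
 then show ?thesis unfolding ext_d_def at_within_trans_dom[OF x] .
qed

text \<open>A vector killed by the derivative of a transition map would lie in the kernel of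
  \<omega>, since \<omega> is pulled back by it.\<close>

lemma dtrans_surj: assumes x: "x : trans_dom i j" shows "surj (dtrans i j x)"
proof -
 have "inj (dtrans i j x)"
 proof (rule linear_injective_0[OF dtrans_linear[OF x], THEN iffD2], intro allI impI)
 fix v assume 0: "dtrans i j x v = 0"
 have xi: "x : img i" using x by (simp add: trans_dom_eq)
 show "v = 0"
 proof (rule nondeg[OF i xi])
 show "om i x v u = 0" for u unfolding om_trans[OF x] 0
 using linear_0[OF om_linear(2)[OF j trans_in[OF x]]] .
 qed
 qed
 then show ?thesis using linear_injective_imp_surjective[OF dtrans_linear[OF x]] by blast
qed

lemma dW_trans:
 assumes "diffW h" and x: "x : trans_dom i j"
 shows "dW h i x u = dW h j (tran i j x) (dtrans i j x u)"
proof -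
 have xi: "x : img i" using x by (simp add: trans_dom_eq)
 have "((h \<circ> param W j) has_derivative dW h j (tran i j x)) (at (tran i j x) within tran i j ` trans_dom i j)"
 by (rule has_derivative_subset[OF dW[OF assms(1) j trans_in[OF x]]]) (use trans_in in auto)
 moreover have "(tran i j has_derivative dtrans i j x) (at x within trans_dom i j)"
 unfolding at_within_trans_dom[OF x] by (rule dtrans[OF x])
 ultimately
 have "((%y. (h \<circ> param W j) (tran i j y)) has_derivative (%u. dW h j (tran i j x) (dtrans i j x u))) (at x within trans_dom i j)"
 using has_derivative_in_compose by blast
 then have "((h \<circ> param W i) has_derivative (%u. dW h j (tran i j x) (dtrans i j x u))) (at x within trans_dom i j)"
 by (rule has_derivative_transform_on[OF _ x]) (simp add: param_trans)
 then show ?thesis unfolding at_within_trans_dom[OF x]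
 using thick_frechet_eq[OF thick_img[OF i] xi] by metis
qed

lemma Y_trans: assumes x: "x : trans_dom i j" shows "dtrans i j x (Y i x) = Y j (tran i j x)"
proof (rule Y_unique[OF j trans_in[OF x]])
 fix u
 obtain v where v: "u = dtrans i j x v" using dtrans_surj[OF x] by (metis surjD)
 have xi: "x : img i" using x by (simp add: trans_dom_eq)
 show "om j (tran i j x) (dtrans i j x (Y i x)) u = lam j (tran i j x) u"
 unfolding v om_trans[OF x, symmetric] lam_trans[OF x, symmetric] by (rule Y[OF i xi])
qed

end

lemma dW_Y_chart:
 assumes "diffW h" "i : Ch" "j : Ch" "p : dm i" "p : dm j"
 shows "dW h i (coord W i p) (Y i (coord W i p)) = dW h j (coord W j p) (Y j (coord W j p))"
proof -
 have x: "coord W i p : trans_dom i j" using assms by (auto simp: trans_dom_def)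
 have "tran i j (coord W i p) = coord W j p" using param_coord[OF assms(2,4)] by (simp add: tran_def)
 then show ?thesis using dW_trans[OF assms(2,3,1) x] Y_trans[OF assms(2,3) x] by simp
qed

text \<open>The derivative of h along the Liouville field. The chart is chosen arbitrarily here;
  invariance under transition maps makes any chart admissible.\<close>

definition LY :: "('w => real) => 'w => real" where
 "LY h p = (let i = some_chart W p; x = coord W i p in dW h i x (Y i x))"

lemma LY_chart:
 assumes "diffW h" "i : Ch" "p : dm i" shows "LY h p = dW h i (coord W i p) (Y i (coord W i p))"
proof -
 have "p : Pts" using assms dom_subset by blast
 then have s: "some_chart W p : Ch" "p : dm (some_chart W p)" using some_chart by blast+
 show ?thesis unfolding LY_def Let_def by (rule dW_Y_chart[OF assms(1) s(1) assms(2) s(2) assms(3)])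
qed

lemma LY_param:
 assumes "diffW h" "i : Ch" "x : img i" shows "LY h (param W i x) = dW h i x (Y i x)"
 using LY_chart[OF assms(1,2) param_in[OF assms(2,3)]] coord_param[OF assms(2,3)] by simp

lemma ham_tau_LY:
 assumes "diffW (H t)" "p : Pts" shows "ham_tau W lam H t p = H t p - LY (H t) p"
 using lam_ham_vec[OF assms(1), of "some_chart W p" "coord W (some_chart W p) p"] some_chart[OF assms(2)] coord_in
 by (simp add: ham_tau_def LY_def Let_def)

text \<open>Invariance of the boundary without topology: at an interior point of chart i that is a
  boundary point of chart j, the first coordinate of the transition map would have a local minimum,
  so its derivative would vanish, against surjectivity.\<close>

lemma bdry_coord:
 assumes "i : Ch" "p : dm i" shows "p : bdry W \<longleftrightarrow> fst (coord W i p) = 0"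
proof
 assume "p : bdry W"
 then obtain j where j: "j : Ch" "p : dm j" "fst (coord W j p) = 0" by (auto simp: bdry_def)
 let ?x = "coord W i p"
 have x: "?x : trans_dom i j" using assms j by (auto simp: trans_dom_def)
 have tx: "fst (tran i j ?x) = 0" using param_coord[OF assms] j by (simp add: tran_def)
 show "fst ?x = 0"
 proof (rule ccontr)
 assume "fst ?x ~= 0"
 then have pos: "fst ?x > 0" using fst_img[OF assms(1) coord_in[OF assms]] by simp
 obtain U where U: "open U" "trans_dom i j = half_space Int U" using trans_dom_half_space[OF assms(1) j(1)] by (auto simp: openin_open)
 let ?V = "U Int {x. 0 < fst x}"
 have oV: "open ({x. 0 < fst x} :: (real \<times> 'f) set)" by (intro open_Collect_less continuous_intros)
 have V: "open ?V" "?x : ?V" "?V <= trans_dom i j"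
 proof -
 show "open ?V" using U(1) oV by blast
 show "?x : ?V" using x U(2) pos by simp
 show "?V <= trans_dom i j" unfolding U(2) half_space_def by auto
 qed
 obtain r where r: "r > 0" "ball ?x r <= ?V" using V open_contains_ball by blast
 have "at ?x within img i = at ?x"
 proof -
 have "at ?x within trans_dom i j Int ?V = at ?x within trans_dom i j" by (rule at_within_Int_open[OF V(1,2)])
 moreover have "trans_dom i j Int ?V = ?V" using V(3) by blast
 ultimately show ?thesis using at_within_trans_dom[OF assms(1) j(1) x] at_within_open[OF V(2,1)] by simp
 qed
 then have "((%y. fst (tran i j y)) has_derivative (%v. fst (dtrans i j ?x v))) (at ?x)"
 using dtrans[OF assms(1) j(1) x] has_derivative_fst by fastforce
 moreover have "fst (tran i j ?x) <= fst (tran i j y)" if "y : ball ?x r" for y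
 proof -
 have "y : trans_dom i j" using that r(2) V(3) by blast
 from fst_img[OF j(1) trans_in[OF assms(1) j(1) this]] show ?thesis using tx by simp
 qed
 ultimately have "(%v. fst (dtrans i j ?x v)) = (%v. 0)"
 by (intro has_derivative_local_min[of "%y. fst (tran i j y)" _ ?x] eventually_mono[OF eventually_at_ball[OF r(1)]]) auto
 moreover obtain v where "dtrans i j ?x v = (1, 0)" using dtrans_surj[OF assms(1) j(1) x] by (metis surjD)
 ultimately show False by (auto dest: fun_cong[of _ _ v])
 qed
qed (use assms in \<open>auto simp: bdry_def\<close>)

subsection \<open>The volume measure\<close>

definition vol :: "'i => real \<times> 'f => real" where "vol i x = dpow (om i x) n basis_frame"

lemma vol_d_power: "d_power W lam n i x basis_frame = vol i x"
 by (simp add: vol_def d_power_dpow)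

lemma bfr_bij: "bij_betw bfr {..<2 * n} Basis"
 using basis_frame_bij[where 'e = "real \<times> 'f"] DIM_W by simp

lemma vol_nonzero: assumes "i : Ch" "x : img i" shows "vol i x ~= 0"
 unfolding vol_def
proof (rule dpow_nondegenerate[OF om_bilin[OF assms] om_skew _ DIM_W bfr_bij])
 show "u = 0" if "!!v. om i x u v = 0" for u using nondeg[OF assms that] .
qed

lemma om_continuous: "i : Ch ==> continuous_on (img i) (%x. om i x u v)"
 using smooth_on_continuous[OF om_smooth] .

lemma vol_continuous: "i : Ch ==> continuous_on (img i) (vol i)"
 unfolding vol_def dpow_formula pairs_def by (intro continuous_intros om_continuous) auto

lemma vol_trans:
 assumes "i : Ch" "j : Ch" and x: "x : trans_dom i j"
 shows "\<bar>vol i x\<bar> = absdet (dtrans i j x) * \<bar>vol j (tran i j x)\<bar>"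
proof -
 let ?D = "dtrans i j x" and ?y = "tran i j x"
 have "alt_form (DIM(real \<times> 'f)) (dpow (om j ?y) n)"
 unfolding DIM_W by (rule alt_form_dpow[OF om_bilin[OF assms(2) trans_in[OF assms]]])
 from alt_form_absdet[OF refl this dtrans_linear[OF assms]]
 have "\<bar>dpow (om j ?y) n (%k. ?D (basis_frame k))\<bar> = absdet ?D * \<bar>vol j ?y\<bar>" by (simp add: vol_def)
 moreover have "dpow (om j ?y) n (%k. ?D (basis_frame k)) = vol i x"
 proof -
 have "(%u w. om j ?y (?D u) (?D w)) = om i x" by (intro ext om_trans[OF assms, symmetric])
 then show ?thesis unfolding dpow_pullback vol_def by simp
 qed
 ultimately show ?thesis by simp
qed

text \<open>The arbitrary point taken outside the chart image only makes the map total and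
  measurable; the density is 0 there.\<close>

definition chart_measure :: "'i => 'w measure" where
 "chart_measure i = distr (density lborel (%x. ennreal (indicator (img i) x * \<bar>vol i x\<bar>)))
 (restrict_space borel Pts) (%x. if x : img i then param W i x else (SOME p. p : Pts))"

lemma vol_measurable: "i : Ch ==> (%x. indicator (img i) x * \<bar>vol i x\<bar>) : borel_measurable borel"
 using borel_measurable_continuous_on_indicator[OF img_borel, of i "%x. \<bar>vol i x\<bar>"]
 continuous_on_rabs[OF vol_continuous] by simp

lemma param_measurable:
 assumes "i : Ch"
 shows "(%x. if x : img i then param W i x else (SOME p. p : Pts)) : measurable borel (restrict_space borel Pts)"
proof (rule measurable_restrict_space2)
 show "(%x. if x : img i then param W i x else (SOME p. p : Pts)) : space borel \<rightarrow> Pts"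
 using param_points[OF assms] some_in_eq[of Pts] points_nonempty by (simp add: Pi_iff)
 show "(%x. if x : img i then param W i x else (SOME p. p : Pts)) : borel_measurable borel"
 by (rule borel_measurable_continuous_on_if[OF img_borel[OF assms] continuous_param[OF assms] continuous_on_const])
qed

lemma nn_integral_chart_measure:
 assumes "i : Ch" and f: "f : borel_measurable (restrict_space borel Pts)"
 shows "(\<integral>\<^sup>+p. f p \<partial>chart_measure i) = (\<integral>\<^sup>+x. ennreal (indicator (img i) x * \<bar>vol i x\<bar>) * f (param W i x) \<partial>lborel)"
proof -
 let ?q = "%x. if x : img i then param W i x else (SOME p. p : Pts)"
 have q: "?q : measurable (density lborel (%x. ennreal (indicator (img i) x * \<bar>vol i x\<bar>))) (restrict_space borel Pts)"
 using param_measurable[OF assms(1)] by simp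
 have qf: "(%x. f (?q x)) : borel_measurable lborel"
 using measurable_compose[OF param_measurable[OF assms(1)] f] by simp
 have "(\<integral>\<^sup>+p. f p \<partial>chart_measure i) = (\<integral>\<^sup>+x. f (?q x) \<partial>density lborel (%x. ennreal (indicator (img i) x * \<bar>vol i x\<bar>)))"
 unfolding chart_measure_def using f by (subst nn_integral_distr[OF q]) auto
 also have "\<dots> = (\<integral>\<^sup>+x. ennreal (indicator (img i) x * \<bar>vol i x\<bar>) * f (?q x) \<partial>lborel)"
 using vol_measurable[OF assms(1)] qf by (intro nn_integral_density) auto
 also have "\<dots> = (\<integral>\<^sup>+x. ennreal (indicator (img i) x * \<bar>vol i x\<bar>) * f (param W i x) \<partial>lborel)"
 by (rule nn_integral_cong) (auto simp: indicator_def)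
 finally show ?thesis .
qed

lemma sets_chart_measure: "sets (chart_measure i) = sets (restrict_space borel Pts)"
 by (simp add: chart_measure_def)

lemma borel_restrict: "B : sets (restrict_space borel Pts) \<longleftrightarrow> B : sets borel & B <= Pts"
 using points_borel by (auto simp: sets_restrict_space_iff)

lemma emeasure_chart_measure:
 assumes i: "i : Ch" and B: "B : sets borel" "B <= dm i"
 shows "emeasure (chart_measure i) B = (\<integral>\<^sup>+x. ennreal (indicator (coord W i ` B) x * \<bar>vol i x\<bar>) \<partial>lborel)"
proof -
 have Bs: "B : sets (restrict_space borel Pts)" using B dom_subset[OF i] by (auto simp: borel_restrict)
 have "emeasure (chart_measure i) B = (\<integral>\<^sup>+p. indicator B p \<partial>chart_measure i)"
 using Bs by (simp add: sets_chart_measure)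
 also have "\<dots> = (\<integral>\<^sup>+x. ennreal (indicator (img i) x * \<bar>vol i x\<bar>) * indicator B (param W i x) \<partial>lborel)"
 by (rule nn_integral_chart_measure[OF i borel_measurable_indicator[OF Bs]])
 also have "\<dots> = (\<integral>\<^sup>+x. ennreal (indicator (coord W i ` B) x * \<bar>vol i x\<bar>) \<partial>lborel)"
 proof (rule nn_integral_cong)
 fix x
 have "x : coord W i ` B \<longleftrightarrow> x : img i & param W i x : B"
 proof
 assume "x : coord W i ` B"
 then obtain q where q: "q : B" "x = coord W i q" by blast
 then show "x : img i & param W i x : B" using B(2) param_coord[OF i, of q] coord_in[OF i, of q] by auto
 next
 assume "x : img i & param W i x : B"
 then show "x : coord W i ` B" using coord_param[OF i, of x] image_eqI[of x "coord W i" "param W i x" B] by simp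
 qed
 then show "ennreal (indicator (img i) x * \<bar>vol i x\<bar>) * indicator B (param W i x) = ennreal (indicator (coord W i ` B) x * \<bar>vol i x\<bar>)"
 by (auto simp: indicator_def)
 qed
 finally show ?thesis .
qed

text \<open>The densities transform by the absolute Jacobian, so this is the change of variables
  formula for the transition map.\<close>

lemma chart_measure_compat:
 assumes i: "i : Ch" and j: "j : Ch" and B: "B : sets borel" "B <= dm i" "B <= dm j"
 shows "emeasure (chart_measure i) B = emeasure (chart_measure j) B"
proof -
 let ?S = "coord W i ` B"
 have im: "tran i j ` ?S = coord W j ` B" unfolding image_image using B param_coord[OF i] by (auto simp: tran_def intro!: image_cong)
 have sub: "?S <= trans_dom i j" using B by (auto simp: trans_dom_def)
 have meas: "(%x. indicator (coord W k ` B) x * \<bar>vol k x\<bar>) : borel_measurable borel" if "k : Ch" "B <= dm k" for k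
 proof -
 have "(%x. indicator (coord W k ` B) x * (indicator (img k) x * \<bar>vol k x\<bar>)) : borel_measurable borel"
 using coord_image_borel[OF that(1) B(1) that(2)] vol_measurable[OF that(1)] by simp
 moreover have "indicator (coord W k ` B) x * (indicator (img k) x * \<bar>vol k x\<bar>) = indicator (coord W k ` B) x * \<bar>vol k x\<bar>" for x
 using coord_in[OF that(1)] that(2) by (auto simp: indicator_def)
 ultimately show ?thesis by simp
 qed
 have "(\<integral>\<^sup>+y. ennreal (indicator (tran i j ` ?S) y * \<bar>vol j y\<bar>) \<partial>lborel) = (\<integral>\<^sup>+x. ennreal (indicator ?S x * \<bar>vol i x\<bar>) \<partial>lborel)"
 proof (rule nn_integral_change_of_variables[OF refl, where g' = "%x. dtrans i j x"])
 show "?S : sets borel" by (rule coord_image_borel[OF i B(1,2)])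
 show "(tran i j has_derivative dtrans i j x) (at x within ?S)" if "x : ?S" for x
 proof -
 have "x : trans_dom i j" using that sub by blast
 moreover have "?S <= img i" using B(2) coord_in[OF i] by auto
 ultimately show ?thesis using dtrans[OF i j] has_derivative_subset by blast
 qed
 show "inj_on (tran i j) ?S"
 proof (rule inj_onI)
 fix x y assume *: "x : ?S" "y : ?S" "tran i j x = tran i j y"
 then have "param W i x = param W i y" using param_trans[OF i j] sub by (metis subsetD)
 moreover have "x : img i" "y : img i" using * B(2) coord_in[OF i] by auto
 ultimately show "x = y" using coord_param[OF i] by metis
 qed
 show "\<bar>vol i x\<bar> = absdet (dtrans i j x) * \<bar>vol j (tran i j x)\<bar>" if "x : ?S" for x
 using vol_trans[OF i j] that sub by blast
 qed (use meas[OF i B(2)] meas[OF j B(3)] in \<open>simp_all add: im\<close>)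
 then show ?thesis using emeasure_chart_measure[OF i B(1,2)] emeasure_chart_measure[OF j B(1,3)] im by simp
qed

definition \<mu> :: "'w measure" where "\<mu> = form_measure W (d_power W lam n)"

text \<open>Existence of the measure described by \<open>form_measure\<close>: the measures of a
  countable family of charts are glued.\<close>

lemma mu_charts:
 shows sets_mu: "sets \<mu> = sets (restrict_space borel Pts)"
 and emeasure_mu: "i : Ch ==> B : sets borel ==> B <= dm i ==> emeasure \<mu> B = emeasure (chart_measure i) B"
proof -
 obtain C :: "nat => 'i" where C: "!!k. C k : Ch" "Pts = (\<Union>k. dm (C k))"
 using charts_countable_cover[of W] dom_open Ch_nonempty by blast
 obtain m where m: "sets m = sets (restrict_space borel Pts)"
 "!!k B. B : sets (restrict_space borel Pts) ==> B <= dm (C k) ==> emeasure m B = emeasure (chart_measure (C k)) B"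
 proof (rule measure_glue[where M = "%k. chart_measure (C k)" and C = "%k. dm (C k)" and N = "restrict_space borel Pts"])
 show "dm (C k) : sets (restrict_space borel Pts)" for k
 using dom_borel[OF C(1)] dom_subset[OF C(1)] by (simp add: borel_restrict)
 show "space (restrict_space borel Pts) <= (\<Union>k. dm (C k))" using C(2) by (simp add: space_restrict_space)
 show "emeasure (chart_measure (C k)) B = emeasure (chart_measure (C l)) B"
 if "B : sets (restrict_space borel Pts)" "B <= dm (C k)" "B <= dm (C l)" for k l B
 using chart_measure_compat[OF C(1) C(1) _ that(2,3)] that(1) by (simp add: borel_restrict)
 qed (auto simp: sets_chart_measure)
 \<comment> \<open>The formula is required in every chart, not just in those of the cover, so B is
   cut along the cover and compared piece by piece.\<close>
 have em: "emeasure m B = emeasure (chart_measure i) B" if i: "i : Ch" "B : sets borel" "B <= dm i" for i B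
 proof -
 have BP: "B <= (\<Union>k. dm (C k))" using i dom_subset C(2) by blast
 have ms: "dm (C k) : sets borel" for k using dom_borel[OF C(1)] .
 have D: "disjointed (%k. dm (C k)) k : sets borel" for k
 using sets.range_disjointed_sets[of "%k. dm (C k)" borel] ms by auto
 have r: "A : sets borel ==> A <= Pts ==> A : sets m" "A : sets borel ==> A <= Pts ==> A : sets (chart_measure i)" for A
 by (simp_all add: m(1) sets_chart_measure borel_restrict)
 have eq: "emeasure m (B Int disjointed (%k. dm (C k)) k) = emeasure (chart_measure i) (B Int disjointed (%k. dm (C k)) k)" for k
 proof -
 let ?B = "B Int disjointed (%k. dm (C k)) k"
 have "?B : sets borel" "?B <= dm (C k)" "?B <= dm i" "?B <= Pts"
 using D i dom_subset disjointed_subset[of "%k. dm (C k)" k] by auto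
 then show ?thesis using m(2)[of ?B k] chart_measure_compat[OF C(1) i(1), of ?B k] by (simp add: borel_restrict)
 qed
 have BPts: "B <= Pts" using i dom_subset by blast
 have "emeasure m B = (\<Sum>k. emeasure m (B Int disjointed (%k. dm (C k)) k))"
 by (rule emeasure_countable_partition) (use r ms dom_subset C i BP BPts in auto)
 also have "\<dots> = (\<Sum>k. emeasure (chart_measure i) (B Int disjointed (%k. dm (C k)) k))" by (simp add: eq)
 also have "\<dots> = emeasure (chart_measure i) B"
 by (rule emeasure_countable_partition[symmetric]) (use r ms dom_subset C i BP BPts in auto)
 finally show ?thesis .
 qed
 have "\<mu> = m" unfolding \<mu>_def
 proof (rule form_measure_eqI[OF C dom_borel[OF C(1)] m(1)])
 show "emeasure m B = (\<integral>\<^sup>+x\<in>coord W i ` B. ennreal \<bar>d_power W lam n i x basis_frame\<bar> \<partial>lborel)"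
 if "i : Ch" "B : sets borel" "B <= dm i" for i B
 unfolding em[OF that] emeasure_chart_measure[OF that] vol_d_power
 by (rule nn_integral_cong) (auto simp: indicator_def)
 qed
 then show "sets \<mu> = sets (restrict_space borel Pts)"
 "i : Ch ==> B : sets borel ==> B <= dm i ==> emeasure \<mu> B = emeasure (chart_measure i) B"
 using m(1) em by auto
qed

lemma space_mu: "space \<mu> = Pts"
 using sets_eq_imp_space_eq[OF sets_mu] by (simp add: space_restrict_space)

lemma density_mu_dom:
 assumes i: "i : Ch" shows "density \<mu> (indicator (dm i)) = chart_measure i"
proof -
 have di: "dm i : sets \<mu>" using dom_borel[OF i] dom_subset[OF i] by (simp add: sets_mu borel_restrict)
 show ?thesis
 proof (rule measure_eqI)
 show "sets (density \<mu> (indicator (dm i))) = sets (chart_measure i)" by (simp add: sets_mu sets_chart_measure)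
 fix A assume "A : sets (density \<mu> (indicator (dm i)))"
 then have A: "A : sets \<mu>" "A : sets (restrict_space borel Pts)" by (simp_all add: sets_mu)
 have "emeasure (density \<mu> (indicator (dm i))) A = emeasure \<mu> (dm i Int A)"
 proof -
 have "emeasure (density \<mu> (indicator (dm i))) A = (\<integral>\<^sup>+p. indicator (dm i) p * indicator A p \<partial>\<mu>)"
 using A di by (simp add: emeasure_density)
 also have "\<dots> = (\<integral>\<^sup>+p. indicator (dm i Int A) p \<partial>\<mu>)" by (simp add: indicator_inter_arith)
 also have "\<dots> = emeasure \<mu> (dm i Int A)" using A di by (intro nn_integral_indicator sets.Int)
 finally show ?thesis .
 qed
 also have "\<dots> = emeasure (chart_measure i) (dm i Int A)"
 using A dom_borel[OF i] by (intro emeasure_mu[OF i]) (auto simp: borel_restrict)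
 also have "\<dots> = (\<integral>\<^sup>+p. indicator (dm i Int A) p \<partial>chart_measure i)"
 using A di by (intro nn_integral_indicator[symmetric]) (simp add: sets_chart_measure sets_mu)
 also have "\<dots> = (\<integral>\<^sup>+p. indicator A p \<partial>chart_measure i)"
 proof -
 have "(\<integral>\<^sup>+p. indicator D p \<partial>chart_measure i) = (\<integral>\<^sup>+x. ennreal (indicator (img i) x * \<bar>vol i x\<bar>) * indicator D (param W i x) \<partial>lborel)"
 if "D : sets (restrict_space borel Pts)" for D
 by (rule nn_integral_chart_measure[OF i borel_measurable_indicator[OF that]])
 moreover have "(\<integral>\<^sup>+x. ennreal (indicator (img i) x * \<bar>vol i x\<bar>) * indicator (dm i Int A) (param W i x) \<partial>lborel) =
 (\<integral>\<^sup>+x. ennreal (indicator (img i) x * \<bar>vol i x\<bar>) * indicator A (param W i x) \<partial>lborel)"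
 by (rule nn_integral_cong) (use param_in[OF i] in \<open>auto simp: indicator_def\<close>)
 ultimately show ?thesis using A di by (simp add: sets_mu sets.Int)
 qed
 also have "\<dots> = emeasure (chart_measure i) A" using A by (simp add: sets_chart_measure)
 finally show "emeasure (density \<mu> (indicator (dm i))) A = emeasure (chart_measure i) A" .
 qed
qed

lemma nn_integral_mu_chart:
 assumes i: "i : Ch" and f: "f : borel_measurable (restrict_space borel Pts)" and supp: "!!p. p : Pts ==> p \<notin> dm i ==> f p = 0"
 shows "(\<integral>\<^sup>+p. f p \<partial>\<mu>) = (\<integral>\<^sup>+x. ennreal (indicator (img i) x * \<bar>vol i x\<bar>) * f (param W i x) \<partial>lborel)"
proof -
 have di: "dm i : sets \<mu>" using dom_borel[OF i] dom_subset[OF i] by (simp add: sets_mu borel_restrict)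
 have f\<mu>: "f : borel_measurable \<mu>" using f measurable_cong_sets[OF sets_mu refl] by blast
 have "(\<integral>\<^sup>+p. f p \<partial>chart_measure i) = (\<integral>\<^sup>+p. indicator (dm i) p * f p \<partial>\<mu>)"
 unfolding density_mu_dom[OF i, symmetric] using di f\<mu> by (simp add: nn_integral_density)
 also have "\<dots> = (\<integral>\<^sup>+p. f p \<partial>\<mu>)"
 by (rule nn_integral_cong) (use supp in \<open>auto simp: indicator_def space_mu\<close>)
 finally show ?thesis using nn_integral_chart_measure[OF i f] by simp
qed

lemma bdry_closedin: "closedin (top_of_set Pts) (bdry W)"
proof -
 have "openin (top_of_set Pts) (Pts - bdry W)"
 proof (subst openin_subopen, intro ballI)
 fix p assume p: "p : Pts - bdry W"
 then obtain i where i: "i : Ch" "p : dm i" by (auto simp: points_def)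
 have "openin (top_of_set (dm i)) (dm i Int coord W i -` {x. fst x ~= 0})"
 by (rule continuous_openin_preimage_gen[OF continuous_coord[OF i(1)]]) (intro open_Collect_neq continuous_intros)
 then have "openin (top_of_set Pts) (dm i Int coord W i -` {x. fst x ~= 0})"
 using openin_trans[OF _ dom_open[OF i(1)]] by blast
 moreover have "dm i Int coord W i -` {x. fst x ~= 0} <= Pts - bdry W"
 using bdry_coord[OF i(1)] dom_subset[OF i(1)] by auto
 moreover have "p : dm i Int coord W i -` {x. fst x ~= 0}" using bdry_coord[OF i] i p by auto
 ultimately show "\<exists>T. openin (top_of_set Pts) T & p : T & T <= Pts - bdry W" by blast
 qed
 moreover have "bdry W <= Pts" by (auto simp: bdry_def points_def)
 ultimately show ?thesis by (simp add: closedin_def)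
qed

lemma bdry_subset: "bdry W <= Pts"
 by (auto simp: bdry_def points_def)

lemma bdry_compact: "compact (bdry W)"
 using bdry_closedin compact_points closedin_compact by blast

lemma bdry_borel: "bdry W : sets borel"
 using bdry_compact compact_imp_closed borel_closed by blast

lemma borel_fst_0: "{x :: real \<times> 'f. fst x = 0} : sets borel"
 by (intro borel_closed closed_Collect_eq continuous_intros)

lemma negligible_fst_0: "emeasure lborel {x :: real \<times> 'f. fst x = 0} = 0"
proof -
 have "{x :: real \<times> 'f. fst x = 0} = {x. x \<bullet> (1, 0) = 0}" by (auto simp: inner_prod_def)
 moreover have "negligible {x :: real \<times> 'f. x \<bullet> (1, 0) = 0}"
 using negligible_standard_hyperplane[of "(1, 0) :: real \<times> 'f" 0] by (simp add: Basis_prod_def inner_commute)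
 ultimately have "{x :: real \<times> 'f. fst x = 0} : null_sets lebesgue" by (simp add: negligible_iff_null_sets)
 then have "{x :: real \<times> 'f. fst x = 0} : null_sets lborel" using borel_fst_0 by (simp add: null_sets_completion_iff)
 then show ?thesis by (rule null_setsD1)
qed

text \<open>In each chart the boundary lies in the hyperplane where the first coordinate vanishes, a
  Lebesgue null set; countably many charts suffice.\<close>

lemma mu_bdry: "emeasure \<mu> (bdry W) = 0"
proof -
 obtain C :: "nat => 'i" where C: "!!k. C k : Ch" "Pts = (\<Union>k. dm (C k))"
 using charts_countable_cover[of W] dom_open Ch_nonempty by blast
 have "emeasure \<mu> (bdry W Int dm (C k)) = 0" for k
 proof -
 have b: "bdry W Int dm (C k) : sets borel" using bdry_borel dom_borel[OF C(1)] by auto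
 have "emeasure \<mu> (bdry W Int dm (C k)) = (\<integral>\<^sup>+x. ennreal (indicator (coord W (C k) ` (bdry W Int dm (C k))) x * \<bar>vol (C k) x\<bar>) \<partial>lborel)"
 using emeasure_mu[OF C(1) b] emeasure_chart_measure[OF C(1) b] by simp
 also have "\<dots> = (\<integral>\<^sup>+x. 0 \<partial>(lborel :: (real \<times> 'f) measure))"
 proof (rule nn_integral_cong_AE)
 have "{x :: real \<times> 'f. fst x = 0} : null_sets lborel" using negligible_fst_0 borel_fst_0
 by (intro null_setsI) simp_all
 then have "AE x in (lborel :: (real \<times> 'f) measure). x \<notin> {x. fst x = 0}" by (rule AE_not_in)
 then show "AE x in lborel. ennreal (indicator (coord W (C k) ` (bdry W Int dm (C k))) x * \<bar>vol (C k) x\<bar>) = 0"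
 by eventually_elim (use bdry_coord[OF C(1)] in \<open>auto simp: indicator_def\<close>)
 qed
 finally show ?thesis by simp
 qed
 then have "(\<Union>k. bdry W Int dm (C k)) : null_sets \<mu>"
 using bdry_borel dom_borel[OF C(1)] bdry_subset
 by (intro null_sets_UN' countableI_type) (auto simp: null_sets_def sets_mu borel_restrict)
 moreover have "(\<Union>k. bdry W Int dm (C k)) = bdry W" using C(2) bdry_subset by blast
 ultimately show ?thesis by (simp add: null_setsD1)
qed

text \<open>The density is continuous, so every point has a neighborhood of finite measure, and
  compactness leaves finitely many of them.\<close>

lemma mu_finite: "emeasure \<mu> Pts < \<infinity>"
proof -
 have "\<exists>U. openin (top_of_set Pts) U & p : U & emeasure \<mu> U < \<infinity>" if p: "p : Pts" for p
 proof -
 obtain i where i: "i : Ch" "p : dm i" using p by (auto simp: points_def)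
 let ?x = "coord W i p"
 obtain O' where O': "open O'" "img i = half_space Int O'" using img_open[OF i(1)] by (auto simp: openin_open)
 obtain r where r: "r > 0" "cball ?x r <= O'" using O' coord_in[OF i] open_contains_cball by blast
 let ?K = "half_space Int cball ?x r"
 have K: "compact ?K" "?K <= img i" using half_space_closed O' r by (auto simp: closed_Int_compact)
 obtain M where M: "\<forall>x\<in>?K. \<bar>vol i x\<bar> <= M"
 using compact_imp_bounded[OF compact_continuous_image[OF continuous_on_subset[OF vol_continuous[OF i(1)] K(2)] K(1)]]
 by (auto simp: bounded_iff)
 define U where "U = dm i Int coord W i -` ball ?x r"
 have U: "openin (top_of_set (dm i)) U" unfolding U_def
 by (rule continuous_openin_preimage_gen[OF continuous_coord[OF i(1)]]) simp
 then have Uo: "openin (top_of_set Pts) U" using openin_trans dom_open[OF i(1)] by blast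
 have Ub: "U : sets borel" "U <= dm i" using borel_openin[OF Uo points_borel] by (auto simp: U_def)
 have sub: "coord W i ` U <= ?K"
 proof (rule image_subsetI)
 fix q assume q: "q : U"
 then have "coord W i q : half_space" using coord_in[OF i(1)] img_half_space[OF i(1)] by (auto simp: U_def)
 then show "coord W i q : ?K" using q by (simp add: U_def less_imp_le)
 qed
 have "emeasure \<mu> U = (\<integral>\<^sup>+x. ennreal (indicator (coord W i ` U) x * \<bar>vol i x\<bar>) \<partial>lborel)"
 using emeasure_mu[OF i(1) Ub] emeasure_chart_measure[OF i(1) Ub] by simp
 also have "\<dots> <= (\<integral>\<^sup>+x. ennreal M * indicator (cball ?x r) x \<partial>lborel)"
 by (rule nn_integral_mono) (use sub M in \<open>auto simp: indicator_def intro!: ennreal_leI\<close>)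
 also have "\<dots> = ennreal M * emeasure lborel (cball ?x r)" by (simp add: nn_integral_cmult_indicator)
 also have "\<dots> < \<infinity>" using emeasure_bounded_finite[of "cball ?x r"] by (simp add: ennreal_mult_less_top)
 finally have "emeasure \<mu> U < \<infinity>" .
 moreover have "p : U" using i r by (auto simp: U_def)
 ultimately show ?thesis using Uo by blast
 qed
 then obtain U where U: "!!p. p : Pts ==> openin (top_of_set Pts) (U p) & p : U p & emeasure \<mu> (U p) < \<infinity>" by metis
 then obtain V where V: "!!p. p : Pts ==> open (V p) & U p = Pts Int V p" unfolding openin_open by metis
 obtain D where D: "D <= Pts" "finite D" "Pts <= (\<Union>p\<in>D. V p)"
 proof (rule compactE_image[OF compact_points, of Pts V])
 show "open (V p)" if "p : Pts" for p using V that by blast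
 show "Pts <= (\<Union>p\<in>Pts. V p)" using U V by blast
 qed blast
 have Us: "U p : sets \<mu>" if "p : Pts" for p
 using U[OF that] borel_openin[of Pts "U p"] points_borel openin_imp_subset[of euclidean Pts "U p"] by (simp add: sets_mu borel_restrict)
 have "emeasure \<mu> Pts <= emeasure \<mu> (\<Union>p\<in>D. U p)"
 proof (rule emeasure_mono)
 show "Pts <= (\<Union>p\<in>D. U p)"
 proof
 fix q assume q: "q : Pts"
 then obtain p where "p : D" "q : V p" using D(3) by blast
 then show "q : (\<Union>p\<in>D. U p)" using V[of p] D(1) q by blast
 qed
 show "(\<Union>p\<in>D. U p) : sets \<mu>" using D(1,2) Us by (intro sets.finite_UN) blast+
 qed
 also have "\<dots> <= (\<Sum>p\<in>D. emeasure \<mu> (U p))"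
 using D Us by (intro emeasure_subadditive_finite) auto
 also have "\<dots> < \<infinity>" using D U by (auto simp: less_top[symmetric] subset_iff)
 finally show ?thesis .
qed

lemma finite_measure_mu: "finite_measure \<mu>"
 using mu_finite by (intro finite_measureI) (simp add: space_mu)

end

section \<open>Integrals of derivatives\<close>

text \<open>By translation invariance every difference quotient has integral 0, and the Lipschitz
  bound with bounded support permits dominated convergence. A derivative almost everywhere is
  enough, which admits functions with a kink along a hyperplane.\<close>

lemma integral_difference_quotient_zero:
 fixes phi :: "'a::euclidean_space => real"
 assumes lip: "!!x y. \<bar>phi x - phi y\<bar> <= L * norm (x - y)" and bd: "!!x. \<bar>phi x\<bar> <= M"
 and supp: "!!x. norm x > R ==> phi x = 0" and psi: "psi : borel_measurable borel"
 and lim: "AE x in lborel. ((%h. (phi (x + h *\<^sub>R b) - phi x) / h) \<longlongrightarrow> psi x) (at 0)"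
 shows "integrable lborel psi" "(\<integral>x. psi x \<partial>lborel) = 0"
proof -
 have L: "0 <= L"
 proof -
 obtain u :: 'a where "u : Basis" using nonempty_Basis by blast
 then have "norm (u - 0) = 1" by simp
 then show ?thesis using lip[of u 0] by simp
 qed
 have "continuous_on UNIV phi"
 proof (rule lipschitz_on_continuous_on)
 show "L-lipschitz_on UNIV phi" using lip L by (auto simp: lipschitz_on_def dist_norm)
 qed
 then have phim [measurable]: "phi : borel_measurable borel" by (rule borel_measurable_continuous_onI)
 have [measurable]: "psi : borel_measurable borel" by (rule psi)
 have int_cball: "integrable lborel (%x::'a. C * indicator (cball 0 r) x)" for C r :: real
 using emeasure_bounded_finite[of "cball (0::'a) r"] by (intro integrable_mult_right integrable_real_indicator) auto
 have phii: "integrable lborel phi"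
 proof (rule Bochner_Integration.integrable_bound[OF int_cball[of M R]])
 have "norm (phi x) <= norm (M * indicator (cball 0 R) x)" for x
 using bd[of x] supp[of x] by (cases "norm x <= R") auto
 then show "AE x in lborel. norm (phi x) <= norm (M * indicator (cball 0 R) x)" by (intro AE_I2)
 qed simp
 define f where "f = (%m x. (phi (x + (1 / real (Suc m)) *\<^sub>R b) - phi x) / (1 / real (Suc m)))"
 have fm [measurable]: "f m : borel_measurable lborel" for m unfolding f_def by measurable
 have shift: "integrable lborel (%x. phi (x + c))" "(\<integral>x. phi (x + c) \<partial>lborel) = (\<integral>x. phi x \<partial>lborel)" for c
 proof -
 have d: "distr lborel borel ((+) c) = (lborel :: 'a measure)" by (rule lborel_distr_plus)
 have "(\<integral>x. phi x \<partial>lborel) = (\<integral>x. phi x \<partial>(distr lborel borel ((+) c)))" by (simp add: d)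
 also have "\<dots> = (\<integral>x. phi (c + x) \<partial>lborel)" by (rule integral_distr) auto
 finally show "(\<integral>x. phi (x + c) \<partial>lborel) = (\<integral>x. phi x \<partial>lborel)" by (simp add: add.commute)
 have "integrable (distr lborel borel ((+) c)) phi" using phii by (simp add: d)
 then have "integrable lborel (%x. phi (c + x))" by (rule integrable_distr[rotated]) auto
 then show "integrable lborel (%x. phi (x + c))" by (simp add: add.commute)
 qed
 have f0: "(\<integral>x. f m x \<partial>lborel) = 0" for m
 unfolding f_def using shift phii by simp
 let ?w = "%x. (L * norm b) * indicator (cball (0::'a) (R + norm b)) x"
 have dom: "norm (f m x) <= ?w x" for m x
 proof (cases "norm x <= R + norm b")
 case True
 have "\<bar>phi (x + (1 / real (Suc m)) *\<^sub>R b) - phi x\<bar> <= L * (1 / real (Suc m) * norm b)"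
 using lip[of "x + (1 / real (Suc m)) *\<^sub>R b" x] by simp
 then have "\<bar>f m x\<bar> <= L * norm b" unfolding f_def abs_divide by (simp add: field_simps)
 then show ?thesis using True by simp
 next
 case False
 have "norm ((1 / real (Suc m)) *\<^sub>R b) <= 1 * norm b" unfolding norm_scaleR by (rule mult_right_mono) auto
 then have "norm (x + (1 / real (Suc m)) *\<^sub>R b) > R"
 using False norm_diff_ineq[of x "(1 / real (Suc m)) *\<^sub>R b"] by linarith
 moreover have "norm x > R" using False norm_ge_zero[of b] by linarith
 ultimately have "f m x = 0" unfolding f_def using supp by simp
 then show ?thesis using L by simp
 qed
 have hlim: "filterlim (%m. 1 / real (Suc m)) (at 0) sequentially"
 unfolding filterlim_at using LIMSEQ_inverse_real_of_nat by (auto simp: inverse_eq_divide)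
 have ae: "AE x in lborel. (%m. f m x) \<longlonglongrightarrow> psi x"
 using lim
 proof eventually_elim
 case (elim x)
 show ?case unfolding f_def using filterlim_compose[OF elim hlim] by simp
 qed
 have "integrable lborel ?w" by (rule int_cball)
 show "integrable lborel psi"
 by (rule integrable_dominated_convergence[OF _ _ \<open>integrable lborel ?w\<close> ae]) (use dom in auto)
 have "(%m. \<integral>x. f m x \<partial>lborel) \<longlonglongrightarrow> (\<integral>x. psi x \<partial>lborel)"
 by (rule integral_dominated_convergence[OF _ _ \<open>integrable lborel ?w\<close> ae]) (use dom in auto)
 then show "(\<integral>x. psi x \<partial>lborel) = 0" unfolding f0 using LIMSEQ_unique tendsto_const by blast
qed

text \<open>Stokes' theorem is proved for functions of class C1, since the cutoff functions used to
  localize it are only C1.\<close>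

definition C1_on :: "'a::euclidean_space set => ('a => real) => bool" where
 "C1_on S f \<longleftrightarrow> (\<forall>x\<in>S. (f has_derivative fd_within f S x) (at x within S)) & (\<forall>v. continuous_on S (%x. fd_within f S x v))"

lemma C1_onI:
 assumes "thick S" "!!x. x : S ==> (f has_derivative f' x) (at x within S)" "!!v. continuous_on S (%x. f' x v)"
 shows "C1_on S f"
proof -
 have eq: "fd_within f S x = f' x" if "x : S" for x using thick_frechet_eq[OF assms(1) that assms(2)[OF that]] .
 have "continuous_on S (%x. fd_within f S x v)" for v
 using assms(3)[of v] by (rule continuous_on_eq) (simp add: eq)
 then show ?thesis using assms(2) eq by (simp add: C1_on_def)
qed

lemma C1_on_derivative: "C1_on S f ==> x : S ==> (f has_derivative fd_within f S x) (at x within S)"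
 by (simp add: C1_on_def)

lemma C1_on_derivative_continuous: "C1_on S f ==> continuous_on S (%x. fd_within f S x v)"
 by (simp add: C1_on_def)

lemma C1_on_continuous: "C1_on S f ==> continuous_on S f"
 unfolding continuous_on_eq_continuous_within using C1_on_derivative has_derivative_continuous by blast

lemma C1_on_const: "thick S ==> C1_on S (%x. c)"
 by (rule C1_onI[where f' = "%x v. 0"]) auto

lemma C1_on_add: "thick S ==> C1_on S f ==> C1_on S g ==> C1_on S (%x. f x + g x)"
 by (rule C1_onI[where f' = "%x v. fd_within f S x v + fd_within g S x v"])
 (auto intro!: has_derivative_add C1_on_derivative continuous_on_add C1_on_derivative_continuous)

lemma C1_on_sum: "thick S ==> (!!i. i : I ==> C1_on S (f i)) ==> C1_on S (%x. \<Sum>i\<in>I. f i x)"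
 by (induction I rule: infinite_finite_induct) (auto intro: C1_on_const C1_on_add)

lemma C1_on_mult:
 assumes "thick S" "C1_on S f" "C1_on S g" shows "C1_on S (%x. f x * g x)"
proof (rule C1_onI[OF assms(1), where f' = "%x v. f x * fd_within g S x v + fd_within f S x v * g x"])
 show "((%x. f x * g x) has_derivative (%v. f x * fd_within g S x v + fd_within f S x v * g x)) (at x within S)"
 if "x : S" for x
 using has_derivative_mult[OF C1_on_derivative[OF assms(2) that] C1_on_derivative[OF assms(3) that]] .
 show "continuous_on S (%x. f x * fd_within g S x v + fd_within f S x v * g x)" for v
 using assms C1_on_continuous C1_on_derivative_continuous by (intro continuous_intros) blast+
qed

lemma C1_on_divide:
 assumes "thick S" "C1_on S f" "C1_on S g" "!!x. x : S ==> g x ~= 0" shows "C1_on S (%x. f x / g x)"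
proof (rule C1_onI[OF assms(1), where f' = "%x v. - f x * (inverse (g x) * fd_within g S x v * inverse (g x)) + fd_within f S x v / g x"])
 show "((%x. f x / g x) has_derivative (%v. - f x * (inverse (g x) * fd_within g S x v * inverse (g x)) + fd_within f S x v / g x)) (at x within S)"
 if "x : S" for x
 using has_derivative_divide[OF C1_on_derivative[OF assms(2) that] C1_on_derivative[OF assms(3) that] assms(4)[OF that]] .
 show "continuous_on S (%x. - f x * (inverse (g x) * fd_within g S x v * inverse (g x)) + fd_within f S x v / g x)" for v
 using assms C1_on_continuous C1_on_derivative_continuous by (intro continuous_intros) blast+
qed

lemma C1_on_local:
 assumes "thick S" "!!x. x : S ==> \<exists>T. openin (top_of_set S) T & x : T & C1_on T f"
 shows "C1_on S f"
 unfolding C1_on_def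
proof (intro conjI ballI allI)
 have *: "(f has_derivative fd_within f T x) (at x within S)" "fd_within f T x = fd_within f S x"
 if "openin (top_of_set S) T" "x : T" "C1_on T f" for x T
 using C1_on_derivative[OF that(3,2)] at_within_openin[OF that(1,2)] by simp_all
 show "(f has_derivative fd_within f S x) (at x within S)" if "x : S" for x
 using assms(2)[OF that] * by metis
 fix v
 show "continuous_on S (%x. fd_within f S x v)"
 unfolding continuous_on_eq_continuous_within
 proof
 fix x assume "x : S"
 then obtain T where T: "openin (top_of_set S) T" "x : T" "C1_on T f" using assms(2) by blast
 have "continuous_on T (%x. fd_within f S x v)"
 by (rule continuous_on_eq[OF C1_on_derivative_continuous[OF T(3)]]) (use *(2)[OF T(1) _ T(3)] in simp)
 then have "continuous (at x within T) (%x. fd_within f S x v)" using T(2) by (simp add: continuous_on_eq_continuous_within)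
 then show "continuous (at x within S) (%x. fd_within f S x v)" using at_within_openin[OF T(1,2)] by simp
 qed
qed

text \<open>The square of the positive part is continuously differentiable on the line, with
  derivative 2 max(0, u); this yields a bump with an explicit derivative.\<close>

lemma bump_derivative:
 fixes c z :: "'a::euclidean_space"
 shows "((%z. (max 0 (r - (z - c) \<bullet> (z - c)))\<^sup>2) has_derivative
 (%v. 2 * max 0 (r - (z - c) \<bullet> (z - c)) * (- 2 * ((z - c) \<bullet> v)))) (at z)"
proof -
 have sq: "((%u::real. (max 0 u)\<^sup>2) has_real_derivative 2 * max 0 u) (at u)" for u
 proof -
 consider "u < 0" | "u > 0" | "u = 0" by linarith
 then show ?thesis
 proof cases
 case 1
 have "((%u::real. 0) has_real_derivative 0) (at u)" by simp
 then have "((%u::real. (max 0 u)\<^sup>2) has_real_derivative 0) (at u)"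
 by (rule has_field_derivative_transform_within_open[of _ _ _ "{..<0}"]) (use 1 in auto)
 then show ?thesis using 1 by simp
 next
 case 2
 have "((%u::real. u\<^sup>2) has_real_derivative 2 * u) (at u)" by (auto intro!: derivative_eq_intros)
 then have "((%u::real. (max 0 u)\<^sup>2) has_real_derivative 2 * u) (at u)"
 by (rule has_field_derivative_transform_within_open[of _ _ _ "{0<..}"]) (use 2 in auto)
 then show ?thesis using 2 by simp
 next
 case 3
 have "((%h. ((max 0 (0 + h))\<^sup>2 - (max 0 0)\<^sup>2) / h) \<longlongrightarrow> 0) (at (0::real))"
 proof (rule tendsto_0_le[where K = 1])
 show "((%h. h) \<longlongrightarrow> 0) (at (0::real))" by (rule tendsto_ident_at)
 show "\<forall>\<^sub>F h in at (0::real). norm (((max 0 (0 + h))\<^sup>2 - (max 0 0)\<^sup>2) / h) <= norm h * 1"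
 by (rule always_eventually) (auto simp: max_def power2_eq_square)
 qed
 then show ?thesis using 3 by (simp add: DERIV_def)
 qed
 qed
 have "((%z. r - (z - c) \<bullet> (z - c)) has_derivative (%v. - 2 * ((z - c) \<bullet> v))) (at z)"
 by (auto intro!: derivative_eq_intros simp: inner_commute)
 from has_derivative_compose[OF this sq[unfolded has_field_derivative_def]]
 show ?thesis by simp
qed

context liouville
begin

section \<open>Stokes' theorem on a Liouville domain\<close>

text \<open>A function vanishing on the hyperplane and off a compact set stays Lipschitz when
  continued by zero beyond the half-space. It is differentiable off the hyperplane, so the lemma on
  difference quotients applies and no boundary term arises.\<close>

lemma chart_integral_derivative:
 fixes phi :: "real \<times> 'f => real" and phi' :: "real \<times> 'f => real \<times> 'f => real"
 assumes i: "i : Ch" and K: "compact K" "K <= img i" and supp: "!!x. x \<notin> K ==> phi x = 0"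
 and bdry0: "!!x. fst x = 0 ==> phi x = 0"
 and phi': "!!x. x : img i ==> (phi has_derivative phi' x) (at x within img i)" "!!v. continuous_on (img i) (%x. phi' x v)"
 shows "integrable lborel (%x. indicator (img i) x * phi' x b)" "(\<integral>x. indicator (img i) x * phi' x b \<partial>lborel) = 0"
proof -
 define D where "D = (%x. if x : img i then phi' x else (%v. 0))"
 have zero_der: "(phi has_derivative (%v. 0)) (at x)" if "x \<notin> K" for x
 proof -
 have "open (- K)" using K(1) compact_imp_closed by blast
 then show ?thesis
 using has_derivative_transform_within_open[of "%x. 0" "%v. 0" x UNIV "- K" phi] supp that by auto
 qed
 have wi: "at x within img i = at x within half_space" if "x : img i" for x
 using at_within_openin[OF img_open[OF i] that] .
 have phi'0: "phi' x = (%v. 0)" if "x : img i" "x \<notin> K" for x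
 using thick_derivative_unique[OF thick_img[OF i] that(1) phi'(1)[OF that(1)] has_derivative_at_withinI[OF zero_der[OF that(2)]]] .
 have der: "(phi has_derivative D x) (at x within half_space)" if "x : half_space" for x
 proof (cases "x : img i")
 case True
 then show ?thesis using phi'(1)[OF True] wi[OF True] by (simp add: D_def)
 next
 case False
 then show ?thesis using has_derivative_at_withinI[OF zero_der[of x]] K(2) by (auto simp: D_def)
 qed
 obtain B where B: "!!x. onorm (D x) <= B"
 proof -
 have "\<exists>M. \<forall>x\<in>K. \<bar>phi' x u\<bar> <= M" for u
 proof -
 have "compact ((%x. phi' x u) ` K)" by (rule compact_continuous_image[OF continuous_on_subset[OF phi'(2) K(2)] K(1)])
 then show ?thesis using compact_imp_bounded bounded_iff by (metis image_eqI real_norm_def)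
 qed
 then obtain M where M: "!!u. \<forall>x\<in>K. \<bar>phi' x u\<bar> <= M u" by metis
 have "onorm (D x) <= (\<Sum>u\<in>Basis. \<bar>M u\<bar>)" for x
 proof (cases "x : K")
 case True
 then have xi: "x : img i" using K by blast
 have lin: "linear (phi' x)" using phi'(1)[OF xi] has_derivative_linear by blast
 show ?thesis
 proof (rule onorm_bound)
 show "0 <= (\<Sum>u\<in>Basis. \<bar>M u\<bar>)" by (intro sum_nonneg) simp
 fix v
 have "\<bar>phi' x v\<bar> = \<bar>\<Sum>u\<in>Basis. (v \<bullet> u) * phi' x u\<bar>" using linear_basis_sum[OF lin, of v] by simp
 also have "\<dots> <= (\<Sum>u\<in>Basis. \<bar>v \<bullet> u\<bar> * \<bar>phi' x u\<bar>)" by (rule order_trans[OF sum_abs]) (simp add: abs_mult)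
 also have "\<dots> <= (\<Sum>u\<in>Basis. norm v * \<bar>M u\<bar>)"
 using M True by (intro sum_mono mult_mono) (auto simp: Basis_le_norm intro: order_trans[OF _ abs_ge_self])
 finally show "norm (D x v) <= (\<Sum>u\<in>Basis. \<bar>M u\<bar>) * norm v"
 using xi by (simp add: D_def sum_distrib_left[symmetric] mult.commute)
 qed
 next
 case False
 then have "D x = (%v. 0)" using phi'0[of x] by (simp add: D_def)
 then have "onorm (D x) = 0" by (simp add: onorm_zero)
 then show ?thesis using sum_nonneg[of Basis "%u. \<bar>M u\<bar>"] by simp
 qed
 then show thesis using that by blast
 qed
 have Bnn: "0 <= B"
 proof -
 obtain p where "p : img i \<or> p \<notin> img i" by blast
 have "0 : (half_space :: (real \<times> 'f) set)" by (simp add: half_space_def)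
 then have "0 <= onorm (D 0)" using der has_derivative_bounded_linear onorm_pos_le by blast
 then show ?thesis using B[of 0] by linarith
 qed
 have hs: "\<bar>phi x - phi y\<bar> <= B * norm (x - y)" if "x : half_space" "y : half_space" for x y
 proof -
 have "convex (half_space :: (real \<times> 'f) set)"
 by (rule convexI) (auto simp: half_space_def)
 from differentiable_bound[OF this der B, of x y] that show ?thesis by simp
 qed
 have neg0: "phi x = 0" if "x \<notin> half_space" for x
 using that supp[of x] K(2) img_half_space[OF i] by blast
 \<comment> \<open>The segment between the two points meets the hyperplane in q, where phi vanishes
   like at y; only the part from x to q has to be estimated.\<close>
 have cross: "\<bar>phi x - phi y\<bar> <= B * norm (x - y)" if x: "x : half_space" and y: "y \<notin> half_space" for x y
 proof -
 have f: "0 <= fst x" "fst y < 0" using x y by (auto simp: half_space_def)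
 define t where "t = fst x / (fst x - fst y)"
 have t: "0 <= t" "t <= 1" using f by (auto simp: t_def field_simps)
 define q where "q = x + t *\<^sub>R (y - x)"
 have q0: "fst q = 0" using f by (simp add: q_def t_def field_simps)
 have "\<bar>phi x - phi y\<bar> = \<bar>phi x - phi q\<bar>" using neg0[OF y] bdry0[OF q0] by simp
 also have "\<dots> <= B * norm (x - q)" using hs[OF x] q0 by (simp add: half_space_def)
 also have "\<dots> <= B * norm (x - y)"
 proof (rule mult_left_mono[OF _ Bnn])
 have "norm (x - q) = t * norm (x - y)" using t by (simp add: q_def norm_minus_commute)
 then show "norm (x - q) <= norm (x - y)" using t by (simp add: mult_left_le_one_le)
 qed
 finally show ?thesis .
 qed
 have lip: "\<bar>phi x - phi y\<bar> <= B * norm (x - y)" for x y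
 proof -
 consider "x : half_space" "y : half_space" | "x : half_space" "y \<notin> half_space" | "x \<notin> half_space" "y : half_space" | "x \<notin> half_space" "y \<notin> half_space" by blast
 then show ?thesis
 proof cases
 case 3
 then show ?thesis using cross[of y x] by (simp add: norm_minus_commute abs_minus_commute)
 qed (use hs cross neg0 Bnn in auto)
 qed
 obtain R where R: "!!x. x : K ==> norm x <= R" using compact_imp_bounded[OF K(1)] by (metis bounded_iff)
 have cont: "continuous_on UNIV phi"
 using lip Bnn by (intro lipschitz_on_continuous_on[of B] lipschitz_onI) (auto simp: dist_norm)
 obtain M where M: "!!x. x : K ==> \<bar>phi x\<bar> <= M"
 proof -
 have "compact (phi ` K)" by (rule compact_continuous_image[OF continuous_on_subset[OF cont] K(1)]) simp
 then show thesis using that compact_imp_bounded bounded_iff by (metis image_eqI real_norm_def)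
 qed
 have bd: "\<bar>phi x\<bar> <= max M 0" for x using M[of x] supp[of x] by (cases "x : K") auto
 have meas: "(%x. indicator (img i) x * phi' x b) : borel_measurable borel"
 using borel_measurable_continuous_on_indicator[OF img_borel[OF i] phi'(2)] by simp
 have ae: "AE x in lborel. ((%h. (phi (x + h *\<^sub>R b) - phi x) / h) \<longlongrightarrow> indicator (img i) x * phi' x b) (at 0)"
 proof -
 have "{x :: real \<times> 'f. fst x = 0} : null_sets lborel" using negligible_fst_0 borel_fst_0
 by (intro null_setsI) simp_all
 then have "AE x in (lborel :: (real \<times> 'f) measure). x \<notin> {x. fst x = 0}" by (rule AE_not_in)
 then show ?thesis
 proof eventually_elim
 case (elim x)
 have "(phi has_derivative D x) (at x)"
 proof (cases "x : half_space")
 case True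
 then have "fst x > 0" using elim by (auto simp: half_space_def)
 have "open ({x. 0 < fst x} :: (real \<times> 'f) set)" by (intro open_Collect_less continuous_intros)
 then have "x : interior half_space"
 by (rule interiorI) (use \<open>fst x > 0\<close> in \<open>auto simp: half_space_def\<close>)
 then have "at x within half_space = at x" by (rule at_within_interior)
 then show ?thesis using der[OF True] by simp
 next
 case False
 then have "x \<notin> img i" "x \<notin> K" using K(2) img_half_space[OF i] by auto
 then show ?thesis using zero_der by (simp add: D_def)
 qed
 then have d: "(phi has_derivative D x) (at (x + 0 *\<^sub>R b))" by simp
 have "((%h. phi (x + h *\<^sub>R b)) has_derivative (%h. D x (h *\<^sub>R b))) (at 0)"
 by (rule has_derivative_compose[where f = "%h. x + h *\<^sub>R b", OF _ d]) (auto intro!: derivative_eq_intros)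
 moreover have "linear (D x)" using d has_derivative_linear by blast
 then have "D x (h *\<^sub>R b) = h * D x b" for h by (simp add: linear_cmul)
 ultimately have "((%h. phi (x + h *\<^sub>R b)) has_real_derivative D x b) (at 0)"
 by (simp add: has_field_derivative_def mult.commute[of _ "D x b"])
 moreover have "D x b = indicator (img i) x * phi' x b" by (simp add: D_def indicator_def)
 ultimately show ?case by (simp add: DERIV_def)
 qed
 qed
 show "integrable lborel (%x. indicator (img i) x * phi' x b)" "(\<integral>x. indicator (img i) x * phi' x b \<partial>lborel) = 0"
 by (rule integral_difference_quotient_zero[OF lip bd _ meas ae, of R]; use R supp in force)+
qed

subsection \<open>The divergence identity\<close>

text \<open>In coordinates, a constant multiple of the Liouville field times the volume density. It
  is a polynomial in the coefficients of \<lambda> and \<omega>, so it can be differentiated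
  although Y is given only by a description.\<close>

definition eta :: "'i => nat => real \<times> 'f => real" where
 "eta i k x = prim_coeff (lam i x) (om i x) n basis_frame k"

abbreviation "dlam i x u v \<equiv> fd_within (%y. lam i y v) (img i) x u"
abbreviation "dom3 i x u v w \<equiv> fd_within (%y. om i y v w) (img i) x u"

lemma dom3_eq:
 assumes "i : Ch" "x : img i"
 shows "dom3 i x u v w = fd_within (%y. fd_within (%z. lam i z w) (img i) y v) (img i) x u - fd_within (%y. fd_within (%z. lam i z v) (img i) y w) (img i) x u"
proof -
 have d: "((%y. fd_within (%z. lam i z w) (img i) y v) has_derivative fd_within (%y. fd_within (%z. lam i z w) (img i) y v) (img i) x) (at x within img i)" for v w
 using smooth_on_has_derivative[OF smooth_on_derivative[OF lam_smooth thick_img] assms(2)] assms(1) by blast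
 have "((%y. om i y v w) has_derivative (%u. fd_within (%y. fd_within (%z. lam i z w) (img i) y v) (img i) x u - fd_within (%y. fd_within (%z. lam i z v) (img i) y w) (img i) x u)) (at x within img i)"
 unfolding ext_d_def by (rule has_derivative_diff[OF d d])
 from thick_frechet_eq[OF thick_img[OF assms(1)] assms(2) this] show ?thesis by simp
qed

text \<open>d(d\<lambda>) = 0: after expansion into second derivatives of the coefficients of
  \<lambda>, the terms cancel by symmetry.\<close>

lemma om_closed:
 assumes "i : Ch" "x : img i" shows "dom3 i x u v w + dom3 i x v w u + dom3 i x w u v = 0"
 unfolding dom3_eq[OF assms]
 using fd_within_symmetric[OF lam_smooth[OF assms(1)] thick_img[OF assms(1)] assms(2)] by (simp add: algebra_simps)

lemma dom3_skew: assumes "i : Ch" "x : img i" shows "dom3 i x u v w = - dom3 i x u w v"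
 unfolding dom3_eq[OF assms] by simp

text \<open>The product rule applied to \<open>eta\<close>, written in the shape of the algebraic
  divergence formula.\<close>

definition deta :: "'i => nat => real \<times> 'f => real \<times> 'f => real" where
 "deta i k x u = (\<Sum>sgm\<in>{sgm. sgm permutes {..<2 * n} & sgm 0 = k}. sg sgm * (dlam i x u (bfr (sgm 1)) * tailprod (om i x) n bfr sgm +
 lam i x (bfr (sgm 1)) * (\<Sum>j\<in>{1..<n}. dom3 i x u (bfr (sgm (2 * j))) (bfr (sgm (2 * j + 1))) *
 (\<Prod>l\<in>{1..<n} - {j}. om i x (bfr (sgm (2 * l))) (bfr (sgm (2 * l + 1)))))))"

lemma om_has_derivative:
 "i : Ch ==> x : img i ==> ((%y. om i y v w) has_derivative (%u. dom3 i x u v w)) (at x within img i)"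
 using smooth_on_has_derivative[OF om_smooth] by blast

lemma eta_has_derivative:
 assumes "i : Ch" "x : img i" shows "(eta i k has_derivative deta i k x) (at x within img i)"
proof -
 have tp: "((%y. tailprod (om i y) n bfr sgm) has_derivative (%u. \<Sum>j\<in>{1..<n}. dom3 i x u (bfr (sgm (2 * j))) (bfr (sgm (2 * j + 1))) *
 (\<Prod>l\<in>{1..<n} - {j}. om i x (bfr (sgm (2 * l))) (bfr (sgm (2 * l + 1)))))) (at x within img i)" for sgm
 unfolding tailprod_def by (rule has_derivative_prod) (rule om_has_derivative[OF assms])
 have "((%y. \<Sum>sgm\<in>{sgm. sgm permutes {..<2 * n} & sgm 0 = k}. sg sgm * (lam i y (bfr (sgm 1)) * tailprod (om i y) n bfr sgm)) has_derivative
 (%u. \<Sum>sgm\<in>{sgm. sgm permutes {..<2 * n} & sgm 0 = k}. sg sgm * (lam i x (bfr (sgm 1)) * (\<Sum>j\<in>{1..<n}. dom3 i x u (bfr (sgm (2 * j))) (bfr (sgm (2 * j + 1))) *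
 (\<Prod>l\<in>{1..<n} - {j}. om i x (bfr (sgm (2 * l))) (bfr (sgm (2 * l + 1))))) + dlam i x u (bfr (sgm 1)) * tailprod (om i x) n bfr sgm))) (at x within img i)"
 by (intro has_derivative_sum has_derivative_mult_right has_derivative_mult tp lam_has_derivative assms)
 then show ?thesis unfolding eta_def prim_coeff_def deta_def by (simp add: add.commute)
qed

lemma lam_continuous: "i : Ch ==> continuous_on (img i) (%x. lam i x u)"
 using smooth_on_continuous[OF lam_smooth] .

lemma deta_continuous: "i : Ch ==> continuous_on (img i) (%x. deta i k x u)"
 unfolding deta_def tailprod_def
 by (intro continuous_intros om_continuous lam_continuous smooth_on_continuous[OF smooth_on_derivative] lam_smooth om_smooth thick_img)

lemma eta_continuous: "i : Ch ==> continuous_on (img i) (eta i k)"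
 unfolding eta_def prim_coeff_def tailprod_def
 by (intro continuous_intros om_continuous lam_continuous)

lemma eta_contract:
 assumes "i : Ch" "x : img i" "linear a"
 shows "2 * real n * (\<Sum>k<2 * n. a (bfr k) * eta i k x) = 2 ^ n * (a (Y i x) * vol i x)"
 unfolding eta_def vol_def
 by (rule prim_coeff_contract[OF om_bilin[OF assms(1,2)] om_skew bfr_bij assms(3) Y[OF assms(1,2)] n_pos])

text \<open>Together with \<open>eta_contract\<close> this says that the divergence of
  \<open>vol\<close> times Y is n times \<open>vol\<close>, the infinitesimal form of the scaling of
  (d\<lambda>)^n under the Liouville flow.\<close>

lemma eta_divergence:
 assumes "i : Ch" "x : img i"
 shows "2 * (\<Sum>k<2 * n. deta i k x (bfr k)) = 2 ^ n * vol i x"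
 unfolding deta_def vol_def
 by (rule prim_coeff_divergence[where \<omega> = "om i x" and dl = "%u v. dlam i x u v" and d\<omega> = "%u v w. dom3 i x u v w",
 OF _ om_closed[OF assms] dom3_skew[OF assms] n_pos]) (simp add: ext_d_def)

text \<open>Contraction with a coordinate functional expresses the components of Y as
  \<open>eta\<close> divided by the nonvanishing \<open>vol\<close>, up to a constant.\<close>

lemma Y_continuous: assumes "i : Ch" shows "continuous_on (img i) (%x. Y i x \<bullet> b)"
proof -
 have "Y i x \<bullet> b = 2 * real n * (\<Sum>k<2 * n. (bfr k \<bullet> b) * eta i k x) / (2 ^ n * vol i x)" if "x : img i" for x
 using eta_contract[OF assms that bounded_linear.linear[OF bounded_linear_inner_left[of b]]] vol_nonzero[OF assms that] by (simp add: field_simps)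
 moreover have "continuous_on (img i) (%x. 2 * real n * (\<Sum>k<2 * n. (bfr k \<bullet> b) * eta i k x) / (2 ^ n * vol i x))"
 using vol_nonzero[OF assms] by (intro continuous_intros eta_continuous vol_continuous assms) auto
 ultimately show ?thesis by (metis (no_types, lifting) continuous_on_cong)
qed

definition C1W :: "('w => real) => bool" where
 "C1W h \<longleftrightarrow> (\<forall>i\<in>Ch. C1_on (img i) (h \<circ> param W i))"

lemma C1W_diffW: "C1W h ==> diffW h"
 unfolding C1W_def diffW_def differentiable_def using C1_on_derivative by blast

lemma C1W_add: "C1W f ==> C1W g ==> C1W (%p. f p + g p)"
 unfolding C1W_def o_def by (intro ballI C1_on_add thick_img) simp_all

lemma C1W_sum: "(!!j. j : I ==> C1W (f j)) ==> C1W (%p. \<Sum>j\<in>I. f j p)"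
 unfolding C1W_def o_def by (intro ballI C1_on_sum thick_img) simp_all

lemma C1W_mult: "C1W f ==> C1W g ==> C1W (%p. f p * g p)"
 unfolding C1W_def o_def by (intro ballI C1_on_mult thick_img) simp_all

lemma C1W_divide: "C1W f ==> C1W g ==> (!!p. p : Pts ==> g p ~= 0) ==> C1W (%p. f p / g p)"
 unfolding C1W_def o_def by (intro ballI C1_on_divide thick_img) (simp_all add: param_points)

lemma dW_Y_continuous:
 assumes "C1W h" and i: "i : Ch" shows "continuous_on (img i) (%x. dW h i x (Y i x))"
proof -
 have "dW h i x (Y i x) = (\<Sum>b\<in>Basis. (Y i x \<bullet> b) * dW h i x b)" if "x : img i" for x
 using linear_basis_sum[OF dW_linear[OF C1W_diffW[OF assms(1)] i that], of "Y i x"] by simp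
 moreover have "continuous_on (img i) (%x. dW h i x b)" for b
 using assms(1) i C1_on_derivative_continuous[of "img i" "h \<circ> param W i"] by (simp add: C1W_def)
 then have "continuous_on (img i) (%x. \<Sum>b\<in>Basis. (Y i x \<bullet> b) * dW h i x b)"
 by (intro continuous_intros Y_continuous i)
 ultimately show ?thesis by (metis (no_types, lifting) continuous_on_cong)
qed

lemma continuous_on_Pts_charts:
 assumes "!!i. i : Ch ==> continuous_on (img i) (%x. f (param W i x))"
 shows "continuous_on Pts f"
 unfolding continuous_on_eq_continuous_within
proof
 fix p assume "p : Pts"
 then obtain i where i: "i : Ch" "p : dm i" by (auto simp: points_def)
 have "continuous_on (dm i) (%q. f (param W i (coord W i q)))"
 by (rule continuous_on_compose2[OF assms[OF i(1)] continuous_coord[OF i(1)]]) (use coord_in[OF i(1)] in auto)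
 then have "continuous_on (dm i) f" by (rule continuous_on_eq) (simp add: param_coord[OF i(1)])
 then have "continuous (at p within dm i) f" using i by (simp add: continuous_on_eq_continuous_within)
 then show "continuous (at p within Pts) f" using at_within_openin[OF dom_open[OF i(1)] i(2)] by simp
qed

lemma LY_continuous: assumes "C1W h" shows "continuous_on Pts (LY h)"
proof (rule continuous_on_Pts_charts)
 fix i assume i: "i : Ch"
 show "continuous_on (img i) (%x. LY h (param W i x))"
 by (rule continuous_on_eq[OF dW_Y_continuous[OF assms i]]) (simp add: LY_param[OF C1W_diffW[OF assms] i])
qed

lemma C1W_continuous: "C1W h ==> continuous_on Pts h"
 unfolding C1W_def o_def by (rule continuous_on_Pts_charts) (simp add: C1_on_continuous)

lemma continuous_integrable_mu:
 fixes f :: "'w => real"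
 assumes "continuous_on Pts f" shows "integrable \<mu> f"
proof -
 obtain M where M: "!!p. p : Pts ==> \<bar>f p\<bar> <= M"
 using compact_imp_bounded[OF compact_continuous_image[OF assms compact_points]] unfolding bounded_iff
 by (metis image_eqI real_norm_def)
 have "f : borel_measurable (restrict_space borel Pts)" by (rule borel_measurable_continuous_on_restrict[OF assms])
 then have "f : borel_measurable \<mu>" using measurable_cong_sets[OF sets_mu refl] by blast
 moreover have "AE p in \<mu>. norm (f p) <= M" using M by (intro AE_I2) (simp add: space_mu)
 ultimately show ?thesis by (intro finite_measure.integrable_const_bound[OF finite_measure_mu])
qed

lemma integral_mu_chart:
 fixes f :: "'w => real"
 assumes i: "i : Ch" and f: "continuous_on Pts f" and supp: "!!p. p : Pts ==> p \<notin> dm i ==> f p = 0"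
 shows "(\<integral>p. f p \<partial>\<mu>) = (\<integral>x. indicator (img i) x * \<bar>vol i x\<bar> * f (param W i x) \<partial>lborel)"
proof -
 have fm: "f : borel_measurable (restrict_space borel Pts)" by (rule borel_measurable_continuous_on_restrict[OF f])
 then have f\<mu>: "f : borel_measurable \<mu>" using measurable_cong_sets[OF sets_mu refl] by blast
 let ?q = "%x. if x : img i then param W i x else (SOME p. p : Pts)"
 have di: "dm i : sets \<mu>" using dom_borel[OF i] dom_subset[OF i] by (simp add: sets_mu borel_restrict)
 have "(\<integral>p. f p \<partial>\<mu>) = (\<integral>p. indicator (dm i) p *\<^sub>R f p \<partial>\<mu>)"
 by (rule Bochner_Integration.integral_cong) (use supp in \<open>auto simp: space_mu indicator_def\<close>)
 also have "\<dots> = (\<integral>p. f p \<partial>density \<mu> (%p. ennreal (indicator (dm i) p)))"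
 using f\<mu> di by (intro integral_density[symmetric]) auto
 also have "density \<mu> (%p. ennreal (indicator (dm i) p)) = chart_measure i"
 using density_mu_dom[OF i] by (simp add: ennreal_indicator)
 also have "(\<integral>p. f p \<partial>chart_measure i) = (\<integral>x. f (?q x) \<partial>density lborel (%x. ennreal (indicator (img i) x * \<bar>vol i x\<bar>)))"
 unfolding chart_measure_def using param_measurable[OF i] fm by (intro integral_distr) auto
 also have "\<dots> = (\<integral>x. (indicator (img i) x * \<bar>vol i x\<bar>) *\<^sub>R f (?q x) \<partial>lborel)"
 using vol_measurable[OF i] measurable_compose[OF param_measurable[OF i] fm] by (intro integral_density) auto
 also have "\<dots> = (\<integral>x. indicator (img i) x * \<bar>vol i x\<bar> * f (param W i x) \<partial>lborel)"
 by (rule Bochner_Integration.integral_cong) (auto simp: indicator_def)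
 finally show ?thesis .
qed

text \<open>The divergence theorem for the vector field \<open>h Y\<close>, with \<open>h\<close> supported in one chart.\<close>

lemma stokes_chart:
 assumes i: "i : Ch" and h: "C1W h" and K: "compact K" "K <= dm i" and supp: "!!p. p : Pts ==> p \<notin> K ==> h p = 0"
 and bdry0: "!!p. p : bdry W ==> h p = 0"
 shows "(\<integral>p. LY h p + real n * h p \<partial>\<mu>) = 0"
proof -
 define K' where "K' = coord W i ` K"
 have K': "compact K'" "K' <= img i" unfolding K'_def
 using compact_continuous_image[OF continuous_on_subset[OF continuous_coord[OF i] K(2)] K(1)] K(2) coord_in[OF i] by auto
 have inK: "param W i x : K ==> x : img i ==> x : K'" for x
 unfolding K'_def using coord_param[OF i] by (metis image_eqI)
 \<comment> \<open>Charts may reverse the orientation while the measure uses the absolute density.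
   The sign is locally constant, so it passes through derivatives and turns \<open>vol\<close> into
   its absolute value.\<close>
 define s where "s = (%x. sgn (vol i x))"
 define phi where "phi = (%k x. if x : img i then s x * (h (param W i x) * eta i k x) else 0)"
 define phi' where "phi' = (%k x v. s x * (h (param W i x) * deta i k x v + dW h i x v * eta i k x))"
 have hd: "C1_on (img i) (h \<circ> param W i)" using h i by (simp add: C1W_def)
 have sc: "\<exists>T. openin (top_of_set (img i)) T & x : T & (\<forall>y\<in>T. s y = s x)" if x: "x : img i" for x
 proof -
 define T where "T = img i Int vol i -` (if vol i x > 0 then {0<..} else {..<0})"
 have "openin (top_of_set (img i)) T" unfolding T_def
 by (rule continuous_openin_preimage_gen[OF vol_continuous[OF i]]) auto
 moreover have "x : T" using vol_nonzero[OF i x] x by (auto simp: T_def)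
 moreover have "\<forall>y\<in>T. s y = s x" using vol_nonzero[OF i x] by (auto simp: T_def s_def split: if_splits)
 ultimately show ?thesis by blast
 qed
 have scont: "continuous_on (img i) s"
 unfolding s_def using vol_nonzero[OF i] by (intro continuous_on_sgn vol_continuous i) auto
 have der: "(phi k has_derivative phi' k x) (at x within img i)" if x: "x : img i" for k x
 proof -
 obtain T where T: "openin (top_of_set (img i)) T" "x : T" "\<forall>y\<in>T. s y = s x" using sc[OF x] by blast
 have "((%y. s x * ((h \<circ> param W i) y * eta i k y)) has_derivative phi' k x) (at x within img i)"
 unfolding phi'_def o_apply[symmetric, of h "param W i"]
 by (intro has_derivative_mult_right has_derivative_mult C1_on_derivative[OF hd x] eta_has_derivative[OF i x])
 then have "((%y. s x * ((h \<circ> param W i) y * eta i k y)) has_derivative phi' k x) (at x within T)"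
 using at_within_openin[OF T(1,2)] by simp
 then have "(phi k has_derivative phi' k x) (at x within T)"
 proof (rule has_derivative_transform_on[OF _ T(2)])
 fix y assume "y : T"
 then have "y : img i" "s y = s x" using T(3) openin_imp_subset[OF T(1)] by blast+
 then show "phi k y = s x * ((h \<circ> param W i) y * eta i k y)" unfolding phi_def by simp
 qed
 then show ?thesis using at_within_openin[OF T(1,2)] by simp
 qed
 have cont: "continuous_on (img i) (%x. phi' k x v)" for k v
 unfolding phi'_def using C1_on_continuous[OF hd] C1_on_derivative_continuous[OF hd]
 by (intro continuous_intros scont deta_continuous eta_continuous i) (auto simp: o_def)
 have phi0: "phi k x = 0" if "x \<notin> K'" for k x
 using that inK[of x] supp[OF param_points[OF i, of x]] by (auto simp: phi_def)
 have phib: "phi k x = 0" if "fst x = 0" for k x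
 proof (cases "x : img i")
 case True
 then have "param W i x : bdry W" using bdry_coord[OF i param_in[OF i True]] coord_param[OF i True] that by simp
 then show ?thesis using bdry0 by (simp add: phi_def)
 qed (simp add: phi_def)
 note cid = chart_integral_derivative[OF i K' phi0 phib der cont]
 \<comment> \<open>The divergence of sgn(\<open>vol\<close>) h \<open>eta\<close>: the product rule
   gives dh contracted with \<open>eta\<close>, that is dh(Y), and h times the divergence of
   \<open>eta\<close>, that is n h. The constant 2^n / (2n) is the normalization of
   \<open>eta\<close>.\<close>
 have sumk: "(\<Sum>k<2 * n. indicator (img i) x * phi' k x (bfr k)) =
 2 ^ n / (2 * real n) * (indicator (img i) x * \<bar>vol i x\<bar> * (LY h (param W i x) + real n * h (param W i x)))" for x
 proof (cases "x : img i")
 case True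
 have "(\<Sum>k<2 * n. phi' k x (bfr k)) = s x * (h (param W i x) * (\<Sum>k<2 * n. deta i k x (bfr k)) + (\<Sum>k<2 * n. dW h i x (bfr k) * eta i k x))"
 unfolding phi'_def by (simp add: sum_distrib_left sum.distrib distrib_left)
 also have "(\<Sum>k<2 * n. dW h i x (bfr k) * eta i k x) = 2 ^ n / (2 * real n) * (dW h i x (Y i x) * vol i x)"
 using eta_contract[OF i True dW_linear[OF C1W_diffW[OF h] i True]] n_pos by (simp add: field_simps)
 also have "(\<Sum>k<2 * n. deta i k x (bfr k)) = 2 ^ n / (2 * real n) * (real n * vol i x)"
 using eta_divergence[OF i True] n_pos by (simp add: field_simps)
 finally have "(\<Sum>k<2 * n. phi' k x (bfr k)) = 2 ^ n / (2 * real n) * ((s x * vol i x) * (dW h i x (Y i x) + real n * h (param W i x)))"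
 by (simp only: distrib_left distrib_right mult.assoc mult.commute mult.left_commute add.commute)
 also have "s x * vol i x = \<bar>vol i x\<bar>" by (simp add: s_def abs_sgn mult.commute)
 finally show ?thesis using True LY_param[OF C1W_diffW[OF h] i True] by (simp add: o_def)
 qed simp
 have "(\<integral>p. LY h p + real n * h p \<partial>\<mu>) = (\<integral>x. indicator (img i) x * \<bar>vol i x\<bar> * (LY h (param W i x) + real n * h (param W i x)) \<partial>lborel)"
 proof (rule integral_mu_chart[OF i])
 show "continuous_on Pts (%p. LY h p + real n * h p)" by (intro continuous_intros LY_continuous C1W_continuous h)
 fix p assume p: "p : Pts" "p \<notin> dm i"
 have "LY h p = 0"
 proof -
 obtain j where j: "j : Ch" "p : dm j" using p by (auto simp: points_def)
 let ?T = "img j Int param W j -` (- K)"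
 have T: "openin (top_of_set (img j)) ?T"
 by (rule continuous_openin_preimage_gen[OF continuous_param[OF j(1)]]) (use K(1) compact_imp_closed in auto)
 have xT: "coord W j p : ?T" using p K(2) coord_in[OF j] param_coord[OF j] by auto
 have "((h \<circ> param W j) has_derivative (%v. 0)) (at (coord W j p) within ?T)"
 by (rule has_derivative_transform_on[OF has_derivative_const[of 0] xT]) (use supp param_points[OF j(1)] in auto)
 then have "((h \<circ> param W j) has_derivative (%v. 0)) (at (coord W j p) within img j)"
 using at_within_openin[OF T xT] by simp
 from thick_frechet_eq[OF thick_img[OF j(1)] coord_in[OF j] this]
 show ?thesis using LY_chart[OF C1W_diffW[OF h] j] by simp
 qed
 then show "LY h p + real n * h p = 0" using supp[of p] p K by auto
 qed
 also have "2 ^ n / (2 * real n) * \<dots> = (\<integral>x. (\<Sum>k<2 * n. indicator (img i) x * phi' k x (bfr k)) \<partial>lborel)"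
 unfolding sumk by simp
 also have "\<dots> = (\<Sum>k<2 * n. (\<integral>x. indicator (img i) x * phi' k x (bfr k) \<partial>lborel))"
 by (rule Bochner_Integration.integral_sum) (rule cid(1))
 also have "\<dots> = 0" by (simp add: cid(2))
 finally show ?thesis using n_pos by simp
qed

end

section \<open>Localization and the global form of Stokes' theorem\<close>

context liouville
begin

lemma interior_at:
 assumes "i : Ch" "x : img i" "0 < fst x" shows "at x within img i = at x"
proof -
 have "open ({x. 0 < fst x} :: (real \<times> 'f) set)" by (intro open_Collect_less continuous_intros)
 then have "x : interior half_space"
 by (rule interiorI) (use assms(3) in \<open>auto simp: half_space_def\<close>)
 then show ?thesis using at_within_interior[of x half_space] at_within_openin[OF img_open[OF assms(1)] assms(2)] by simp
qed

text \<open>The squared positive part of r^2 - |z - c|^2 in one chart, continued by 0. It is C1 in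
  every other chart as well: on the overlap by composition with the transition map, and elsewhere
  because it vanishes off a compact, hence closed, set.\<close>

lemma bump_exists:
 assumes p: "p : Pts"
 shows "\<exists>\<beta> K i U. i : Ch & compact K & K <= dm i & C1W \<beta> & (\<forall>q\<in>Pts. 0 <= \<beta> q) & (\<forall>q\<in>Pts - K. \<beta> q = 0) &
 openin (top_of_set Pts) U & p : U & (\<forall>q\<in>U. 0 < \<beta> q)"
proof -
 obtain i where i: "i : Ch" "p : dm i" using p by (auto simp: points_def)
 define c where "c = coord W i p"
 obtain O' where O': "open O'" "img i = half_space Int O'" using img_open[OF i(1)] by (auto simp: openin_open)
 have "c : O'" using O'(2) coord_in[OF i] by (simp add: c_def)
 then obtain r where r: "r > 0" "cball c r <= O'" using O'(1) open_contains_cball by blast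
 define K' where "K' = half_space Int cball c r"
 have K': "compact K'" "K' <= img i" using half_space_closed O'(2) r(2) by (auto simp: K'_def closed_Int_compact)
 define K where "K = param W i ` K'"
 have K: "compact K" "K <= dm i"
 using compact_continuous_image[OF continuous_on_subset[OF continuous_param[OF i(1)] K'(2)] K'(1)] K'(2) param_in[OF i(1)]
 by (auto simp: K_def)
 define b where "b = (%z :: real \<times> 'f. (max 0 (r\<^sup>2 - (z - c) \<bullet> (z - c)))\<^sup>2)"
 define \<beta> where "\<beta> = (%q. if q : dm i then b (coord W i q) else 0)"
 have sq: "(z - c) \<bullet> (z - c) = (dist z c)\<^sup>2" for z by (simp add: dist_norm power2_norm_eq_inner)
 have b0: "b z = 0" if "z \<notin> cball c r" for z
 proof -
 have "r\<^sup>2 <= (dist z c)\<^sup>2" using that r(1) by (intro power_mono) (auto simp: dist_commute)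
 then show ?thesis by (simp add: b_def sq)
 qed
 have bpos: "0 < b z" if "z : ball c r" for z
 proof -
 have "(dist z c)\<^sup>2 < r\<^sup>2" using that by (intro power_strict_mono) (auto simp: dist_commute)
 then show ?thesis by (simp add: b_def sq)
 qed
 have supp: "\<beta> q = 0" if "q \<notin> K" for q
 proof (cases "q : dm i")
 case True
 have "coord W i q \<notin> cball c r"
 proof
 assume "coord W i q : cball c r"
 then have "coord W i q : K'" using coord_in[OF i(1) True] img_half_space[OF i(1)] by (auto simp: K'_def)
 then have "q : K" unfolding K_def using param_coord[OF i(1) True] by (metis image_eqI)
 then show False using that by simp
 qed
 then show ?thesis using b0 by (simp add: \<beta>_def)
 qed (simp add: \<beta>_def)
 have "C1_on (img j) (\<beta> \<circ> param W j)" if j: "j : Ch" for j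
 proof (rule C1_on_local[OF thick_img[OF j]])
 fix x assume x: "x : img j"
 show "\<exists>T. openin (top_of_set (img j)) T & x : T & C1_on T (\<beta> \<circ> param W j)"
 proof (cases "param W j x : dm i")
 case True
 let ?T = "trans_dom j i"
 have th: "thick ?T" using thick_openin_half_space[OF trans_dom_half_space[OF j i(1)]] .
 note sm = trans_smooth[OF j i(1)]
 have "C1_on ?T (\<beta> \<circ> param W j)"
 proof (rule C1_onI[OF th, where f' = "%y v. 2 * max 0 (r\<^sup>2 - (tran j i y - c) \<bullet> (tran j i y - c)) * (- 2 * ((tran j i y - c) \<bullet> fd_within (tran j i) ?T y v))"])
 fix y assume y: "y : ?T"
 have "((%y. b (tran j i y)) has_derivative (%v. 2 * max 0 (r\<^sup>2 - (tran j i y - c) \<bullet> (tran j i y - c)) * (- 2 * ((tran j i y - c) \<bullet> fd_within (tran j i) ?T y v)))) (at y within ?T)"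
 unfolding b_def by (rule has_derivative_compose[OF smooth_on_has_derivative[OF sm y] bump_derivative])
 then show "(\<beta> \<circ> param W j has_derivative (%v. 2 * max 0 (r\<^sup>2 - (tran j i y - c) \<bullet> (tran j i y - c)) * (- 2 * ((tran j i y - c) \<bullet> fd_within (tran j i) ?T y v)))) (at y within ?T)"
 by (rule has_derivative_transform_on[OF _ y]) (simp add: \<beta>_def trans_dom_eq[OF j i(1)] tran_def)
 next
 fix v
 show "continuous_on ?T (%y. 2 * max 0 (r\<^sup>2 - (tran j i y - c) \<bullet> (tran j i y - c)) * (- 2 * ((tran j i y - c) \<bullet> fd_within (tran j i) ?T y v)))"
 by (intro continuous_intros smooth_on_continuous[OF sm] smooth_on_continuous[OF smooth_on_derivative[OF sm th]])
 qed
 then show ?thesis using trans_dom_openin[OF j i(1)] x True trans_dom_eq[OF j i(1)] by blast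
 next
 case False
 let ?T = "img j Int param W j -` (- K)"
 have T: "openin (top_of_set (img j)) ?T"
 by (rule continuous_openin_preimage_gen[OF continuous_param[OF j]]) (use K(1) compact_imp_closed in blast)
 have "thick ?T" using thick_openin_half_space[OF openin_trans[OF T img_open[OF j]]] .
 then have "C1_on ?T (\<beta> \<circ> param W j)"
 proof (rule C1_onI[where f' = "%x v. 0"])
 show "(\<beta> \<circ> param W j has_derivative (%v. 0)) (at y within ?T)" if "y : ?T" for y
 by (rule has_derivative_transform_on[OF has_derivative_const[of 0] that]) (simp add: supp)
 qed simp
 moreover have "x : ?T" using x False K(2) by auto
 ultimately show ?thesis using T by blast
 qed
 qed
 then have "C1W \<beta>" by (simp add: C1W_def)
 moreover have "\<forall>q\<in>Pts. 0 <= \<beta> q" by (simp add: \<beta>_def b_def)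
 moreover have "\<forall>q\<in>Pts - K. \<beta> q = 0" using supp by simp
 moreover define U where "U = dm i Int coord W i -` ball c r"
 have "openin (top_of_set (dm i)) U" unfolding U_def
 by (rule continuous_openin_preimage_gen[OF continuous_coord[OF i(1)]]) simp
 then have "openin (top_of_set Pts) U" using openin_trans[OF _ dom_open[OF i(1)]] by blast
 moreover have "p : U" using i(2) r(1) by (simp add: U_def c_def)
 moreover have "\<forall>q\<in>U. 0 < \<beta> q" using bpos by (simp add: \<beta>_def U_def)
 ultimately show ?thesis using i(1) K by blast
qed

lemma LY_add:
 assumes "C1W f" "C1W g" "p : Pts" shows "LY (%p. f p + g p) p = LY f p + LY g p"
proof -
 obtain i where i: "i : Ch" "p : dm i" using assms(3) by (auto simp: points_def)
 let ?x = "coord W i p"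
 have x: "?x : img i" using coord_in[OF i] .
 have "((%y. (f \<circ> param W i) y + (g \<circ> param W i) y) has_derivative (%v. dW f i ?x v + dW g i ?x v)) (at ?x within img i)"
 by (intro has_derivative_add dW[OF C1W_diffW i(1) x] assms)
 then have "dW (%p. f p + g p) i ?x = (%v. dW f i ?x v + dW g i ?x v)"
 by (intro thick_frechet_eq[OF thick_img[OF i(1)] x]) (simp add: o_def)
 then show ?thesis using LY_chart[OF C1W_diffW i] assms C1W_add[OF assms(1,2)] by simp
qed

lemma LY_zero: "p : Pts ==> LY (%p. 0) p = 0"
 by (simp add: LY_def Let_def o_def frechet_derivative_const thick_frechet_eq[OF thick_img coord_in has_derivative_const] some_chart)

lemma LY_sum:
 assumes "finite D" "!!j. j : D ==> C1W (f j)" "p : Pts"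
 shows "LY (%p. \<Sum>j\<in>D. f j p) p = (\<Sum>j\<in>D. LY (f j) p)"
 using assms(1,2)
proof (induction D rule: finite_induct)
 case empty
 then show ?case using LY_zero[OF assms(3)] by simp
next
 case (insert j D)
 have "C1W (%p. \<Sum>j\<in>D. f j p)" using insert.prems by (intro C1W_sum) simp
 then have "LY (%p. f j p + (\<Sum>j\<in>D. f j p)) p = LY (f j) p + LY (%p. \<Sum>j\<in>D. f j p) p"
 using insert.prems by (intro LY_add assms(3)) simp_all
 then show ?case using insert by simp
qed

lemma LY_cong:
 assumes "C1W f" "C1W g" "!!q. q : Pts ==> f q = g q" "p : Pts" shows "LY f p = LY g p"
proof -
 obtain i where i: "i : Ch" "p : dm i" using assms(4) by (auto simp: points_def)
 let ?x = "coord W i p"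
 have x: "?x : img i" using coord_in[OF i] .
 have "(g \<circ> param W i has_derivative dW f i ?x) (at ?x within img i)"
 by (rule has_derivative_transform_on[OF dW[OF C1W_diffW[OF assms(1)] i(1) x] x]) (simp add: assms(3) param_points[OF i(1)])
 then have "dW g i ?x = dW f i ?x" by (rule thick_frechet_eq[OF thick_img[OF i(1)] x])
 then show ?thesis using LY_chart[OF C1W_diffW[OF assms(1)] i] LY_chart[OF C1W_diffW[OF assms(2)] i] by simp
qed

text \<open>Finitely many bumps are positive somewhere at each point, so dividing h by their sum and
  multiplying back splits h into pieces supported in single charts and still vanishing on the
  boundary.\<close>

theorem stokes:
 assumes h: "C1W h" and bdry0: "!!p. p : bdry W ==> h p = 0"
 shows "(\<integral>p. LY h p + real n * h p \<partial>\<mu>) = 0"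
proof -
 obtain \<beta> K i U where B: "!!p. p : Pts ==> i p : Ch & compact (K p) & K p <= dm (i p) & C1W (\<beta> p) & (\<forall>q\<in>Pts. 0 <= \<beta> p q) & (\<forall>q\<in>Pts - K p. \<beta> p q = 0) &
 openin (top_of_set Pts) (U p) & p : U p & (\<forall>q\<in>U p. 0 < \<beta> p q)"
 using bump_exists by metis
 have B: "i p : Ch" "compact (K p)" "K p <= dm (i p)" "C1W (\<beta> p)" "\<forall>q\<in>Pts. 0 <= \<beta> p q" "\<forall>q\<in>Pts - K p. \<beta> p q = 0"
 "openin (top_of_set Pts) (U p)" "p : U p" "\<forall>q\<in>U p. 0 < \<beta> p q" if "p : Pts" for p
 using B[OF that] by - (elim conjE; assumption)+
 have "\<exists>V. open V & U p = Pts Int V" if "p : Pts" for p using B(7)[OF that] by (simp add: openin_open)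
 then obtain V where V: "!!p. p : Pts ==> open (V p) & U p = Pts Int V p" by metis
 obtain D where D: "D <= Pts" "finite D" "Pts <= (\<Union>p\<in>D. V p)"
 proof (rule compactE_image[OF compact_points, of Pts V])
 show "open (V p)" if "p : Pts" for p using V that by blast
 show "Pts <= (\<Union>p\<in>Pts. V p)"
 proof
 fix q assume q: "q : Pts"
 then have "q : V q" using B(8)[OF q] V[OF q] by blast
 then show "q : (\<Union>p\<in>Pts. V p)" using q by blast
 qed
 qed blast
 define \<Sigma> where "\<Sigma> = (%q. \<Sum>p\<in>D. \<beta> p q)"
 have DB: "C1W (\<beta> p)" if "p : D" for p using B(4) D(1) that by blast
 have \<Sigma>C: "C1W \<Sigma>" unfolding \<Sigma>_def by (rule C1W_sum) (rule DB)
 have \<Sigma>pos: "\<Sigma> q ~= 0" if q: "q : Pts" for q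
 proof -
 obtain p where p: "p : D" "q : V p" using D(3) q by blast
 then have pP: "p : Pts" using D(1) by blast
 then have "0 < \<beta> p q" using B(9)[OF pP] V[OF pP] p q by blast
 moreover have "0 <= \<beta> p' q" if "p' : D" for p' using B(5)[of p'] D(1) that q by blast
 ultimately have "0 < \<Sigma> q" unfolding \<Sigma>_def using p D(2) by (intro sum_pos2[of _ p]) simp_all
 then show ?thesis by simp
 qed
 define g where "g = (%q. h q / \<Sigma> q)"
 have g: "C1W g" unfolding g_def by (rule C1W_divide[OF h \<Sigma>C \<Sigma>pos])
 define f where "f = (%p q. \<beta> p q * g q)"
 have f: "C1W (f p)" if "p : D" for p unfolding f_def by (rule C1W_mult[OF DB[OF that] g])
 have hf: "h q = (\<Sum>p\<in>D. f p q)" if "q : Pts" for q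
 proof -
 have "(\<Sum>p\<in>D. f p q) = \<Sigma> q * g q" unfolding f_def \<Sigma>_def by (rule sum_distrib_right[symmetric])
 then show ?thesis using \<Sigma>pos[OF that] by (simp add: g_def)
 qed
 have "LY h q = (\<Sum>p\<in>D. LY (f p) q)" if "q : Pts" for q
 using LY_cong[OF h C1W_sum[of D f] hf that] LY_sum[OF D(2) f that] f by simp
 then have "(\<integral>q. LY h q + real n * h q \<partial>\<mu>) = (\<integral>q. (\<Sum>p\<in>D. LY (f p) q + real n * f p q) \<partial>\<mu>)"
 by (intro Bochner_Integration.integral_cong) (simp_all add: space_mu hf sum.distrib sum_distrib_left)
 also have "\<dots> = (\<Sum>p\<in>D. \<integral>q. LY (f p) q + real n * f p q \<partial>\<mu>)"
 by (intro Bochner_Integration.integral_sum continuous_integrable_mu continuous_intros LY_continuous C1W_continuous f)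
 also have "\<dots> = 0"
 proof (intro sum.neutral ballI)
 fix p assume p: "p : D"
 then have pP: "p : Pts" using D(1) by blast
 show "(\<integral>q. LY (f p) q + real n * f p q \<partial>\<mu>) = 0"
 proof (rule stokes_chart[OF B(1)[OF pP] f[OF p] B(2)[OF pP] B(3)[OF pP]])
 show "f p q = 0" if "q : Pts" "q \<notin> K p" for q using B(6)[OF pP] that by (simp add: f_def)
 show "f p q = 0" if "q : bdry W" for q using bdry0[OF that] by (simp add: f_def g_def)
 qed
 qed
 finally show ?thesis .
qed

end

section \<open>Hamiltonians\<close>

locale ham = liouville n W lam
 for n :: nat
 and W :: "('i, 'w::{t2_space, second_countable_topology}, real \<times> 'f::euclidean_space) atlas"
 and lam :: "('i, real \<times> 'f) oneform" +
 fixes H :: "real => 'w => real"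
 assumes ham: "H : hamiltonians W lam"
begin

lemma H_periodic: "w : Pts ==> H (t + 1) w = H t w"
 and H_smooth: "i : Ch ==> smooth_on (UNIV \<times> img i) (%(t, x). H t (param W i x))"
 and H_autonomous: "\<exists>U. openin (top_of_set Pts) U & bdry W <= U & (\<forall>w\<in>U. \<forall>s t. H s w = H t w)"
 and H_bdry: "w : bdry W ==> H t w = 0"
 and tau_pos: "w : Pts ==> 0 < ham_tau W lam H t w"
 using ham unfolding hamiltonians_def by blast+

text \<open>Time and space are kept in one argument, since the angle of the tube is a function of
  the point and H is differentiated along both.\<close>

definition Hc :: "'i => real \<times> (real \<times> 'f) => real" where
 "Hc i = (%(t, x). H t (param W i x))"

definition DH :: "'i => real \<times> (real \<times> 'f) => real \<times> (real \<times> 'f) => real" where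
 "DH i = fd_within (Hc i) (UNIV \<times> img i)"

lemma Hc_smooth: "i : Ch ==> smooth_on (UNIV \<times> img i) (Hc i)"
 using H_smooth by (simp add: Hc_def)

lemma thick_UNIV_img: "i : Ch ==> thick ((UNIV :: real set) \<times> img i)"
 by (intro thick_Times thick_open thick_img) auto

lemma Hc_derivative: "i : Ch ==> x : img i ==> (Hc i has_derivative DH i (t, x)) (at (t, x) within UNIV \<times> img i)"
 unfolding DH_def by (intro smooth_on_has_derivative Hc_smooth) auto

lemma DH_linear: "i : Ch ==> x : img i ==> linear (DH i (t, x))"
 using Hc_derivative has_derivative_linear by blast

lemma DH_continuous: "i : Ch ==> continuous_on (UNIV \<times> img i) (%y. DH i y v)"
 unfolding DH_def by (intro smooth_on_continuous smooth_on_derivative Hc_smooth thick_UNIV_img)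

lemma Ht_derivative:
 assumes "i : Ch" "x : img i" shows "((H t \<circ> param W i) has_derivative (%u. DH i (t, x) (0, u))) (at x within img i)"
proof -
 have 1: "((%y. (t, y)) has_derivative (%u. (0, u))) (at x within img i)"
 by (auto intro!: derivative_eq_intros)
 have "(Hc i has_derivative DH i (t, x)) (at (t, x) within (%y. (t, y)) ` img i)"
 by (rule has_derivative_subset[OF Hc_derivative[OF assms]]) auto
 from has_derivative_in_compose[OF 1 this] show ?thesis by (simp add: Hc_def o_def)
qed

lemma dW_H: "i : Ch ==> x : img i ==> dW (H t) i x = (%u. DH i (t, x) (0, u))"
 using thick_frechet_eq[OF thick_img _ Ht_derivative] by blast

lemma C1W_H: "C1W (H t)"
 unfolding C1W_def
proof
 fix i assume i: "i : Ch"
 show "C1_on (img i) (H t \<circ> param W i)"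
 proof (rule C1_onI[OF thick_img[OF i] Ht_derivative[OF i]])
 show "continuous_on (img i) (%x. DH i (t, x) (0, v))" for v
 by (rule continuous_on_compose2[OF DH_continuous[OF i], of _ "%x. (t, x)"]) (auto intro!: continuous_intros)
 qed
qed

definition tau :: "real => 'w => real" where "tau t w = ham_tau W lam H t w"

lemma tau_LY: "w : Pts ==> tau t w = H t w - LY (H t) w"
 unfolding tau_def by (rule ham_tau_LY[OF C1W_diffW[OF C1W_H]])

lemma tau_chart:
 assumes "i : Ch" "x : img i"
 shows "tau t (param W i x) = Hc i (t, x) - DH i (t, x) (0, Y i x)"
 using tau_LY[OF param_points[OF assms]] LY_param[OF C1W_diffW[OF C1W_H] assms] dW_H[OF assms] by (simp add: Hc_def)

lemma continuous_on_prod_charts: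
 fixes f :: "real => 'w => real"
 assumes "!!i. i : Ch ==> continuous_on (UNIV \<times> img i) (%y. f (fst y) (param W i (snd y)))"
 shows "continuous_on (UNIV \<times> Pts) (%y. f (fst y) (snd y))"
 unfolding continuous_on_eq_continuous_within
proof
 fix y :: "real \<times> 'w" assume y: "y : UNIV \<times> Pts"
 then obtain i where i: "i : Ch" "snd y : dm i" by (auto simp: points_def)
 have op: "openin (top_of_set (UNIV \<times> Pts)) ((UNIV :: real set) \<times> dm i)"
 by (rule openin_Times[OF _ dom_open[OF i(1)]]) simp
 have cc: "continuous_on ((UNIV :: real set) \<times> dm i) (%y. (fst y, coord W i (snd y)))"
 by (intro continuous_intros continuous_on_compose2[OF continuous_coord[OF i(1)]]) auto
 have "continuous_on (UNIV \<times> dm i) (%y. f (fst (fst y, coord W i (snd y))) (param W i (snd (fst y, coord W i (snd y)))))"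
 by (rule continuous_on_compose2[OF assms[OF i(1)] cc]) (use coord_in[OF i(1)] in auto)
 then have "continuous_on (UNIV \<times> dm i) (%y. f (fst y) (snd y))"
 by (rule continuous_on_eq) (auto simp: param_coord[OF i(1)])
 moreover have yd: "y : UNIV \<times> dm i" using i y by (cases y) auto
 ultimately have "continuous (at y within UNIV \<times> dm i) (%y. f (fst y) (snd y))"
 by (rule continuous_on_eq_continuous_within[THEN iffD1, rule_format])
 then show "continuous (at y within UNIV \<times> Pts) (%y. f (fst y) (snd y))"
 unfolding at_within_openin[OF op yd] .
qed

lemma H_continuous: "continuous_on (UNIV \<times> Pts) (%y. H (fst y) (snd y))"
proof (rule continuous_on_prod_charts)
 fix i assume "i : Ch"
 then show "continuous_on (UNIV \<times> img i) (%y. H (fst y) (param W i (snd y)))"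
 using smooth_on_continuous[OF Hc_smooth] by (simp add: Hc_def case_prod_unfold)
qed

lemma tau_continuous: "continuous_on (UNIV \<times> Pts) (%y. tau (fst y) (snd y))"
proof (rule continuous_on_prod_charts)
 fix i assume i: "i : Ch"
 have "continuous_on (UNIV \<times> img i) (%y. Hc i y - (\<Sum>b\<in>Basis. (Y i (snd y) \<bullet> b) * DH i y (0, b)))"
 by (intro continuous_intros smooth_on_continuous[OF Hc_smooth] DH_continuous i
 continuous_on_compose2[OF Y_continuous[OF i], of _ snd]) auto
 then show "continuous_on (UNIV \<times> img i) (%y. tau (fst y) (param W i (snd y)))"
 proof (rule continuous_on_eq)
 fix y assume "y : (UNIV :: real set) \<times> img i"
 then have x: "snd y : img i" by auto
 have "linear (%u. DH i (fst y, snd y) (0, u))" using dW_linear[OF C1W_diffW[OF C1W_H] i x, of "fst y"] unfolding dW_H[OF i x, of "fst y"] .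
 from linear_basis_sum[OF this, of "Y i (snd y)"] tau_chart[OF i x, of "fst y"]
 show "Hc i y - (\<Sum>b\<in>Basis. (Y i (snd y) \<bullet> b) * DH i y (0, b)) = tau (fst y) (param W i (snd y))" by simp
 qed
qed

text \<open>If H were nonpositive somewhere inside, it would have a nonpositive minimum inside, as
  it vanishes on the boundary. There dH = 0, so \<tau> = H, against positivity of \<tau>.\<close>

lemma H_pos: assumes w: "w : Pts" "w \<notin> bdry W" shows "0 < H t w"
proof (rule ccontr)
 assume "\<not> 0 < H t w"
 obtain q0 where q0: "q0 : Pts" "!!q. q : Pts ==> H t q0 <= H t q"
 using continuous_attains_inf[OF compact_points points_nonempty C1W_continuous[OF C1W_H]] by blast
 obtain q where q: "q : Pts" "q \<notin> bdry W" "H t q <= 0" "!!q'. q' : Pts ==> H t q <= H t q'"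
 proof (cases "q0 : bdry W")
 case True
 then have "H t q0 = 0" by (rule H_bdry)
 then show thesis using that[of w] w \<open>\<not> 0 < H t w\<close> q0 by force
 next
 case False
 then show thesis using that[of q0] q0 w \<open>\<not> 0 < H t w\<close> by force
 qed
 obtain i where i: "i : Ch" "q : dm i" using q(1) by (auto simp: points_def)
 let ?x = "coord W i q"
 have x: "?x : img i" using coord_in[OF i] .
 have "fst ?x ~= 0" using bdry_coord[OF i] q(2) by simp
 then have pos: "0 < fst ?x" using fst_img[OF i(1) x] by simp
 have at: "at ?x within img i = at ?x" by (rule interior_at[OF i(1) x pos])
 have "((H t \<circ> param W i) has_derivative (%u. DH i (t, ?x) (0, u))) (at ?x)"
 using Ht_derivative[OF i(1) x] at by simp
 moreover have "\<forall>\<^sub>F y in at ?x. (H t \<circ> param W i) ?x <= (H t \<circ> param W i) y"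
 proof -
 have "\<forall>\<^sub>F y in at ?x within img i. y : img i" by (simp add: eventually_at_filter)
 then have "\<forall>\<^sub>F y in at ?x. y : img i" using at by simp
 then show ?thesis by eventually_elim (use q(4) param_points[OF i(1)] param_coord[OF i] in simp)
 qed
 ultimately have "(%u. DH i (t, ?x) (0, u)) = (%u. 0)" by (rule has_derivative_local_min)
 then have "DH i (t, ?x) (0, Y i ?x) = 0" by (rule fun_cong)
 then have "tau t q = H t q" using tau_chart[OF i(1) x, of t] param_coord[OF i] by (simp add: Hc_def)
 then show False using tau_pos[OF q(1), of t] q(3) by (simp add: tau_def)
qed

lemma H_nonneg: "w : Pts ==> 0 <= H t w"
 using H_pos[of w t] H_bdry[of w t] by fastforce

lemma H_zero_iff: "w : Pts ==> H t w = 0 \<longleftrightarrow> w : bdry W"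
 using H_pos[of w t] H_bdry[of w t] by fastforce

lemma H_periodic_int: assumes "w : Pts" shows "H (t + real_of_int k) w = H t w"
proof (induction k rule: int_induct[where k = 0])
 case (step1 k)
 then show ?case using H_periodic[OF assms, of "t + real_of_int k"] by (simp add: add.assoc)
next
 case (step2 k)
 then show ?case using H_periodic[OF assms, of "t + real_of_int (k - 1)"] by (simp add: algebra_simps)
qed simp

lemma tau_min_le: "w : Pts ==> tau_min W lam H <= tau t w"
 unfolding tau_min_def tau_def by (rule cInf_lower) (auto intro!: bdd_belowI[of _ 0] less_imp_le tau_pos)

lemma tau_min_nonneg: "0 <= tau_min W lam H"
 unfolding tau_min_def using points_nonempty by (intro cInf_greatest) (auto intro: less_imp_le tau_pos)

text \<open>\<tau> = (n + 1) H - (Y(H) + n H), and Stokes' theorem removes the bracket.\<close>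

lemma integral_tau: "(\<integral>p. tau t p \<partial>\<mu>) = real (n + 1) * (\<integral>p. H t p \<partial>\<mu>)"
proof -
 have iH: "integrable \<mu> (H t)" and iL: "integrable \<mu> (LY (H t))"
 using continuous_integrable_mu C1W_continuous LY_continuous C1W_H by blast+
 have "(\<integral>p. tau t p \<partial>\<mu>) = (\<integral>p. real (n + 1) * H t p - (LY (H t) p + real n * H t p) \<partial>\<mu>)"
 by (intro Bochner_Integration.integral_cong) (simp_all add: space_mu tau_LY algebra_simps)
 also have "\<dots> = (\<integral>p. real (n + 1) * H t p \<partial>\<mu>) - (\<integral>p. LY (H t) p + real n * H t p \<partial>\<mu>)"
 by (intro Bochner_Integration.integral_diff integrable_mult_right Bochner_Integration.integrable_add iH iL)
 finally show ?thesis using stokes[OF C1W_H H_bdry] by simp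
qed

text \<open>The measure dt times (d\<lambda>)^n; the half-open interval contains each element of the
  circle once.\<close>

definition M0 :: "(real \<times> 'w) measure" where "M0 = restrict_space lborel {0..<1} \<Otimes>\<^sub>M \<mu>"

lemma space_M0: "space M0 = {0..<1} \<times> Pts"
 by (simp add: M0_def space_pair_measure space_restrict_space space_mu)

lemma M0_measurable_id: "(%y. y) : measurable M0 borel"
proof -
 have "fst : measurable M0 borel"
 unfolding M0_def using measurable_compose[OF measurable_fst measurable_restrict_space1[of "%x. x" lborel borel "{0..<1}"]] by simp
 moreover have "snd : measurable M0 borel"
 proof -
 have idm: "(%x. x) : measurable \<mu> borel"
 unfolding measurable_cong_sets[OF sets_mu refl] by (rule measurable_restrict_space1) simp
 show ?thesis unfolding M0_def by (rule measurable_compose[OF measurable_snd idm])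
 qed
 ultimately have "(%y. (fst y, snd y)) : measurable M0 (borel \<Otimes>\<^sub>M borel)" by (rule measurable_Pair)
 then show ?thesis by (simp add: borel_prod)
qed

lemma M0_measurable:
 fixes f :: "real \<times> 'w => 'b::topological_space"
 assumes "continuous_on (UNIV \<times> Pts) f" shows "f : borel_measurable M0"
proof -
 have c: "UNIV \<times> Pts : sets (borel :: (real \<times> 'w) measure)"
 using compact_imp_closed[OF compact_points] by (intro borel_closed closed_Times) auto
 have "(%y. if y : UNIV \<times> Pts then f y else f (SOME y. True)) : borel_measurable borel"
 by (rule borel_measurable_continuous_on_if[OF c assms continuous_on_const])
 from measurable_compose[OF M0_measurable_id this]
 have "(%y. if y : UNIV \<times> Pts then f y else f (SOME y. True)) : borel_measurable M0" .
 then show ?thesis by (rule measurable_cong[THEN iffD1, rotated]) (auto simp: space_M0)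
qed

lemma finite_restrict: "finite_measure (restrict_space lborel {0..<1::real})"
 by (rule finite_measureI) (simp add: space_restrict_space emeasure_restrict_space)

lemma pair_sf: "pair_sigma_finite (restrict_space lborel {0..<1::real}) \<mu>"
 unfolding pair_sigma_finite_def
 using finite_measure.axioms(1)[OF finite_restrict] finite_measure.axioms(1)[OF finite_measure_mu] by blast

lemma M0_integrable:
 fixes f :: "real \<times> 'w => real"
 assumes "continuous_on (UNIV \<times> Pts) f" shows "integrable M0 f"
proof -
 have "compact ({0..1::real} \<times> Pts)" by (intro compact_Times compact_points) simp
 moreover have "continuous_on ({0..1} \<times> Pts) f" by (rule continuous_on_subset[OF assms]) auto
 ultimately have "compact (f ` ({0..1} \<times> Pts))" using compact_continuous_image by blast
 from compact_imp_bounded[OF this] obtain M where "\<forall>v\<in>f ` ({0..1} \<times> Pts). norm v <= M"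
 unfolding bounded_iff by blast
 then have M: "norm (f y) <= M" if "y : {0..1} \<times> Pts" for y using that by blast
 have "finite_measure M0" unfolding M0_def
 using finite_measure_mu finite_restrict by (rule finite_measure_pair_measure)
 moreover have "AE y in M0. norm (f y) <= M"
 by (rule AE_I2, rule M) (auto simp: space_M0)
 ultimately show ?thesis using M0_measurable[OF assms] by (intro finite_measure.integrable_const_bound)
qed

lemma integral_tau_Cal: "(\<integral>y. tau (fst y) (snd y) \<partial>M0) = real (n + 1) * Cal n W lam H"
proof -
 have Cal: "Cal n W lam H = (\<integral>y. H (fst y) (snd y) \<partial>M0)"
 by (simp add: Cal_def M0_def \<mu>_def case_prod_unfold)
 have "(\<integral>y. tau (fst y) (snd y) \<partial>M0) = (\<integral>t. (\<integral>p. tau t p \<partial>\<mu>) \<partial>restrict_space lborel {0..<1})"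
 using pair_sigma_finite.integral_fst'[OF pair_sf M0_integrable[OF tau_continuous, unfolded M0_def]] by (simp add: M0_def)
 also have "\<dots> = (\<integral>t. real (n + 1) * (\<integral>p. H t p \<partial>\<mu>) \<partial>restrict_space lborel {0..<1})"
 by (simp only: integral_tau)
 also have "\<dots> = real (n + 1) * (\<integral>t. (\<integral>p. H t p \<partial>\<mu>) \<partial>restrict_space lborel {0..<1})"
 by simp
 also have "(\<integral>t. (\<integral>p. H t p \<partial>\<mu>) \<partial>restrict_space lborel {0..<1}) = (\<integral>y. H (fst y) (snd y) \<partial>M0)"
 using pair_sigma_finite.integral_fst'[OF pair_sf M0_integrable[OF H_continuous, unfolded M0_def]] by (simp add: M0_def)
 finally show ?thesis by (simp add: Cal)
qed

end

section \<open>Straightening a regular hypersurface\<close>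

lemma Ck_on_local:
 assumes "open S" "!!x. x : S ==> \<exists>U g. open U & x : U & Ck_on k U g & (\<forall>y. y : S --> y : U --> g y = f y)"
 shows "Ck_on k S f"
 using assms(2)
proof (induction k arbitrary: f)
 case 0
 show ?case unfolding Ck_on.simps continuous_on_eq_continuous_at[OF assms(1)]
 proof
 fix x assume x: "x : S"
 obtain U g where U: "open U" "x : U" "Ck_on 0 U g" "\<forall>y. y : S --> y : U --> g y = f y"
 using 0[OF x] by (elim exE conjE) (rule that)
 have SU: "open (S Int U)" "x : S Int U" using assms(1) U x by auto
 have "continuous_on U g" using U(3) by simp
 then have "continuous_on (S Int U) g" by (rule continuous_on_subset) simp
 then have "continuous_on (S Int U) f" by (rule continuous_on_eq) (use U(4) in simp)
 then show "isCont f x" using continuous_on_eq_continuous_at[OF SU(1)] SU(2) by blast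
 qed
next
 case (Suc k)
 have key: "\<exists>U g. open U & x : U & U <= S & Ck_on (Suc k) U g & (\<forall>y\<in>U. g y = f y) &
 (\<forall>y\<in>U. (f has_derivative frechet_derivative g (at y)) (at y))" if x: "x : S" for x
 proof -
 obtain U g where U: "open U" "x : U" "Ck_on (Suc k) U g" "\<forall>y. y : S --> y : U --> g y = f y"
 using Suc.prems[OF x] by (elim exE conjE) (rule that)
 have SU: "open (S Int U)" "x : S Int U" "Ck_on (Suc k) (S Int U) g" using assms(1) U(1,2) x Ck_on_subset[OF U(3)] by blast+
 have "(f has_derivative frechet_derivative g (at y)) (at y)" if y: "y : S Int U" for y
 by (rule has_derivative_transform_within_open[OF Ck_on_has_derivative[OF SU(3) y] SU(1) y]) (use U(4) in simp)
 then show ?thesis using SU U(4) by (intro exI[of _ "S Int U"] exI[of _ g]) simp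
 qed
 have "f differentiable (at x)" if x: "x : S" for x
 using key[OF x] unfolding differentiable_def by blast
 moreover have "Ck_on k S (%x. frechet_derivative f (at x) v)" for v
 proof (rule Suc.IH)
 fix x assume "x : S"
 from key[OF this] obtain U g where U: "open U" "x : U" "Ck_on (Suc k) U g"
 "\<forall>y\<in>U. (f has_derivative frechet_derivative g (at y)) (at y)" by (elim exE conjE) (rule that)
 have "frechet_derivative g (at y) v = frechet_derivative f (at y) v" if "y : U" for y
 using frechet_derivative_at[OF U(4)[rule_format, OF that]] by simp
 moreover have "Ck_on k U (%x. frechet_derivative g (at x) v)" using U(3) by simp
 ultimately show "\<exists>U g. open U & x : U & Ck_on k U g & (\<forall>y. y : S --> y : U --> g y = frechet_derivative f (at y) v)"
 using U(1,2) by (intro exI[of _ U] exI[of _ "%x. frechet_derivative g (at x) v"]) simp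
 qed
 ultimately show ?case by simp
qed

lemma smooth_on_open_Ck: "open S ==> smooth_on S f ==> Ck_on k S f"
proof (rule Ck_on_local)
 fix x assume "open S" "smooth_on S f" "x : S"
 obtain U g where U: "open U" "x : U" "\<forall>k. Ck_on k U g" "\<forall>y. y : S --> y : U --> g y = f y"
 using smooth_onD[OF \<open>smooth_on S f\<close> \<open>x : S\<close>] by (elim exE conjE) (rule that)
 then show "\<exists>U g. open U & x : U & Ck_on k U g & (\<forall>y. y : S --> y : U --> g y = f y)"
 by (intro exI[of _ U] exI[of _ g] conjI) (simp_all only: )
qed

text \<open>The inverse function theorem for the map that replaces the first coordinate by F,
  together with all higher orders of smoothness of the inverse.\<close>

lemma straighten_aux:
 fixes F :: "real \<times> 'g::euclidean_space => real"
 assumes Om: "open Om" "y0 : Om" and F: "!!k. Ck_on k Om F" and nz: "frechet_derivative F (at y0) (1, 0) ~= 0"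
 shows "\<exists>U V g. open U & y0 : U & U <= Om & open V & homeomorphism U V (%y. (F y, snd y)) g & (\<forall>k. Ck_on k V g)"
proof -
 let ?f = "%y. (F y, snd y)"
 define DF where "DF = (%y. frechet_derivative F (at y))"
 have FD: "(F has_derivative DF y) (at y)" if "y : Om" for y
 unfolding DF_def by (rule Ck_on_has_derivative[OF F[of "Suc 0"] that])
 have DFl: "linear (DF y)" if "y : Om" for y using FD[OF that] has_derivative_linear by blast
 have DFC: "Ck_on k Om (%y. DF y v)" for k v unfolding DF_def using F[of "Suc k"] by simp
 define L where "L = (%y v. (DF y v, snd v))"
 have fD: "(?f has_derivative L y) (at y)" if "y : Om" for y
 unfolding L_def by (intro has_derivative_Pair FD[OF that] has_derivative_snd has_derivative_ident)
 have Lb: "bounded_linear (L y)" if "y : Om" for y using fD[OF that] by (rule has_derivative_bounded_linear)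
 define f' where "f' = (%y. Blinfun (L y))"
 have f'L: "blinfun_apply (f' y) = L y" if "y : Om" for y unfolding f'_def by (rule bounded_linear_Blinfun_apply[OF Lb[OF that]])
 have contf': "continuous_on Om f'"
 proof (rule continuous_on_blinfun_componentwise)
 fix b :: "real \<times> 'g"
 have "continuous_on Om (%y. L y b)"
 unfolding L_def using Ck_on_continuous[OF DFC[of 0 b]] by (intro continuous_intros)
 then show "continuous_on Om (%y. blinfun_apply (f' y) b)" by (rule continuous_on_eq) (simp add: f'L)
 qed
 define a where "a = DF y0 (1, 0)"
 have a: "a ~= 0" using nz by (simp add: a_def DF_def)
 have split: "DF y (s, v) = s * DF y (1, 0) + DF y (0, v)" if "y : Om" for y s v
 proof -
 have "(s, v) = s *\<^sub>R (1, 0) + (0, v)" by simp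
 then show ?thesis using linear_add[OF DFl[OF that]] linear_cmul[OF DFl[OF that]] by (metis real_scaleR_def)
 qed
 \<comment> \<open>The inverse of (s, v) -> (DF(s, v), v) at the base point, obtained by solving the
   first component for s.\<close>
 define M where "M = (%v :: real \<times> 'g. ((fst v - DF y0 (0, snd v)) / a, snd v))"
 have l0: "linear (%v. DF y0 (0, v))"
 using linear_compose[OF _ DFl[OF Om(2)], of "%v. (0, v)"] by (simp add: o_def linear_iff)
 have "linear M" unfolding M_def
 by (rule linearI) (simp_all add: linear_add[OF l0] linear_cmul[OF l0] add_divide_distrib diff_divide_distrib right_diff_distrib)
 then have Mb: "bounded_linear M" by (simp add: linear_conv_bounded_linear)
 have inv: "Blinfun M o\<^sub>L f' y0 = id_blinfun"
 proof (rule blinfun_eqI)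
 fix v :: "real \<times> 'g"
 have "M (L y0 v) = v" using split[OF Om(2), of "fst v" "snd v"] a by (simp add: M_def L_def a_def)
 then show "blinfun_apply (Blinfun M o\<^sub>L f' y0) v = blinfun_apply id_blinfun v"
 by (simp add: f'L[OF Om(2)] bounded_linear_Blinfun_apply[OF Mb])
 qed
 have derf: "(?f has_derivative blinfun_apply (f' y)) (at y)" if "y : Om" for y using fD[OF that] by (simp add: f'L[OF that])
 obtain U V g g' where UV: "open U" "U <= Om" "y0 : U" "open V" "homeomorphism U V ?f g"
 and g': "!!y. y : V ==> (g has_derivative (g' y)) (at y)" "!!y. y : V ==> g' y = inv (blinfun_apply (f' (g y)))"
 "!!y. y : V ==> bij (blinfun_apply (f' (g y)))"
 by (rule inverse_function_theorem[OF Om(1) derf contf' Om(2) inv]) (assumption | rule that)+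
 have gO: "g y : Om" if "y : V" for y using UV(2) homeomorphism_image2[OF UV(5)] that by blast
 have bij: "bij (L (g y))" if "y : V" for y using g'(3)[OF that] f'L[OF gO[OF that]] by simp
 have nz1: "DF (g y) (1, 0) ~= 0" if y: "y : V" for y
 proof
 assume "DF (g y) (1, 0) = 0"
 then have "L (g y) (1, 0) = L (g y) (0, 0)" using linear_0[OF DFl[OF gO[OF y]]] by (simp add: L_def zero_prod_def)
 then show False using bij[OF y] unfolding bij_def by (metis injD prod.inject zero_neq_one)
 qed
 \<comment> \<open>The same inverse at the moving point, with division written through
   \<open>inverse\<close> so that the closure lemmas for \<open>Ck_on\<close> apply.\<close>
 define G where "G = (%y v. ((fst v - DF (g y) (0, snd v)) * inverse (DF (g y) (1, 0)), snd v))"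
 have g'G: "g' y = G y" if y: "y : V" for y
 proof
 fix v
 have "L (g y) (G y v) = v" using split[OF gO[OF y], of "fst (G y v)" "snd (G y v)"] nz1[OF y]
 by (simp add: L_def G_def prod_eq_iff mult.assoc)
 then have "inv (L (g y)) v = G y v" using bij[OF y] by (metis bij_inv_eq_iff)
 then show "g' y v = G y v" using g'(2)[OF y] f'L[OF gO[OF y]] by simp
 qed
 \<comment> \<open>Bootstrapping: the derivative of g is a rational expression in partial
   derivatives of F at g(y), so it has every degree of smoothness that g has.\<close>
 have "Ck_on k V g" for k
 proof (induction k)
 case 0
 then show ?case using UV(5) by (simp add: homeomorphism_def)
 next
 case (Suc k)
 show ?case
 proof (rule Ck_on_SucI[OF UV(4)])
 show "(g has_derivative G y) (at y)" if "y : V" for y using g'(1)[OF that] g'G[OF that] by simp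
 have DFg: "Ck_on k V (%y. DF (g y) w)" for w
 by (rule Ck_on_compose[OF UV(4) Om(1) _ Suc DFC]) (use gO in auto)
 show "Ck_on k V (%y. G y v)" for v
 unfolding G_def by (intro Ck_on_Pair Ck_on_mult Ck_on_diff Ck_on_const Ck_on_inverse UV(4) DFg nz1)
 qed
 qed
 then show ?thesis using UV by - (rule exI[of _ U], rule exI[of _ V], rule exI[of _ g], simp)
qed

text \<open>Swapping the first coordinate with another one makes the first partial derivative nonzero.\<close>

lemma straighten:
 fixes F :: "real \<times> 'g::euclidean_space => real"
 assumes Om: "open Om" "y0 : Om" and F: "!!k. Ck_on k Om F" and nz: "frechet_derivative F (at y0) u0 ~= 0"
 shows "\<exists>U V (psi :: real \<times> 'g => real \<times> 'g) g. open U & y0 : U & U <= Om & open V & homeomorphism U V psi g & (\<forall>k. Ck_on k U psi) &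
 (\<forall>k. Ck_on k V g) & (\<forall>y\<in>U. fst (psi y) = F y)"
proof -
 have FD: "(F has_derivative frechet_derivative F (at y0)) (at y0)"
 by (rule Ck_on_has_derivative[OF F[of "Suc 0"] Om(2)])
 then have lin: "linear (frechet_derivative F (at y0))" using has_derivative_linear by blast
 have "\<exists>e\<in>Basis. frechet_derivative F (at y0) e ~= 0"
 proof (rule ccontr)
 assume "\<not> ?thesis"
 then show False using linear_basis_sum[OF lin, of u0] nz by simp
 qed
 then obtain e where e: "e : Basis" "frechet_derivative F (at y0) e ~= 0" by (elim bexE) (rule that)
 obtain P :: "real \<times> 'g => real \<times> 'g" where P: "bounded_linear P" "!!y. P (P y) = y" "P (1, 0) = e"
 proof (cases "e = (1, 0)")
 case True
 then show thesis using that[of "%y. y"] by (simp add: bounded_linear_ident)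
 next
 case False
 then obtain u where u: "u : Basis" "e = (0, u)" using e(1) by (auto simp: Basis_prod_def)
 \<comment> \<open>The linear involution that exchanges the first coordinate with the component
   along u.\<close>
 define P where "P = (%y :: real \<times> 'g. (snd y \<bullet> u, snd y + (fst y - snd y \<bullet> u) *\<^sub>R u))"
 have "linear P" by (rule linearI) (auto simp: P_def inner_add_left algebra_simps)
 then have "bounded_linear P" by (simp add: linear_conv_bounded_linear)
 moreover have "P (P y) = y" for y
 proof -
 have "u \<bullet> u = 1" using u(1) by simp
 then show ?thesis by (simp add: P_def prod_eq_iff inner_add_left scaleR_left_distrib[symmetric])
 qed
 moreover have "P (1, 0) = e" using u by (simp add: P_def)
 ultimately show thesis using that by blast
 qed
 define F1 where "F1 = (%y. F (P y))"
 have Pc: "continuous_on UNIV P" using P(1) by (rule linear_continuous_on)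
 define O1 where "O1 = P -` Om"
 have O1: "open O1" "P y0 : O1" unfolding O1_def using open_vimage[OF Om(1) Pc] Om(2) by (simp_all add: P(2))
 have PC: "open A ==> Ck_on k A P" for A k by (rule Ck_on_linear_self[OF _ P(1)])
 have F1C: "Ck_on k O1 F1" for k
 unfolding F1_def by (rule Ck_on_compose[OF O1(1) Om(1) _ PC[OF O1(1)] F]) (auto simp: O1_def)
 have "(F has_derivative frechet_derivative F (at y0)) (at (P (P y0)))" using FD by (simp add: P(2))
 from has_derivative_compose[OF bounded_linear_imp_has_derivative[OF P(1)] this]
 have "(F1 has_derivative (%v. frechet_derivative F (at y0) (P v))) (at (P y0))" unfolding F1_def .
 then have "frechet_derivative F1 (at (P y0)) = (%v. frechet_derivative F (at y0) (P v))"
 by (rule frechet_derivative_at[symmetric])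
 then have "frechet_derivative F1 (at (P y0)) (1, 0) ~= 0" using e(2) by (simp add: P(3))
 from straighten_aux[OF O1 F1C this] obtain U V g where UV: "open U" "P y0 : U" "U <= O1" "open V"
 "homeomorphism U V (%y. (F1 y, snd y)) g" "\<forall>k. Ck_on k V g" by (elim exE conjE) (rule that)
 define U' where "U' = P -` U"
 have U': "open U'" "y0 : U'" "U' <= Om" unfolding U'_def
 subgoal by (rule open_vimage[OF UV(1) Pc])
 subgoal using UV(2) by simp
 subgoal using UV(3) P(2) unfolding O1_def by (metis subsetD subsetI vimageD vimageI)
 done
 define psi where "psi = (%y. (F y, snd (P y)))"
 have hom: "homeomorphism U' V psi (%y. P (g y))"
 proof (rule homeomorphismI)
 have f1: "F1 (P y) = F y" for y by (simp add: F1_def P(2))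
 have hU: "!!x. x : U ==> g (F1 x, snd x) = x" "!!x. x : V ==> (F1 (g x), snd (g x)) = x" "continuous_on V g"
 "(%y. (F1 y, snd y)) ` U = V" "g ` V = U" "continuous_on U (%y. (F1 y, snd y))"
 using homeomorphism_apply1[OF UV(5)] homeomorphism_apply2[OF UV(5)] homeomorphism_cont1[OF UV(5)] homeomorphism_cont2[OF UV(5)]
 homeomorphism_image1[OF UV(5)] homeomorphism_image2[OF UV(5)] by simp_all
 have "continuous_on U' (%y. (F1 (P y), snd (P y)))"
 by (rule continuous_on_compose2[OF hU(6) continuous_on_subset[OF Pc]]) (use U'_def in blast)+
 then show "continuous_on U' psi" by (simp add: psi_def f1)
 show "continuous_on V (%y. P (g y))" by (rule continuous_on_compose2[OF Pc hU(3)]) simp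
 show "psi ` U' <= V"
 proof (rule image_subsetI)
 fix y assume "y : U'"
 then have "(F1 (P y), snd (P y)) : V" unfolding hU(4)[symmetric] U'_def by blast
 then show "psi y : V" by (simp add: psi_def f1)
 qed
 show "(%y. P (g y)) ` V <= U'"
 proof (rule image_subsetI)
 fix y assume "y : V"
 then have "g y : U" unfolding hU(5)[symmetric] by (rule imageI)
 then show "P (g y) : U'" by (simp add: U'_def P(2))
 qed
 show "P (g (psi y)) = y" if "y : U'" for y
 using hU(1)[of "P y"] that by (simp add: psi_def U'_def f1 P(2))
 show "psi (P (g y)) = y" if "y : V" for y
 using hU(2)[OF that] by (simp add: psi_def P(2) F1_def)
 qed
 moreover have "Ck_on k U' psi" for k
 unfolding psi_def
 by (intro Ck_on_Pair U'(1) Ck_on_subset[OF F U'(3)] Ck_on_bounded_linear[OF _ _ bounded_linear_snd] PC)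
 moreover have "Ck_on k V (%y. P (g y))" for k
 by (rule Ck_on_bounded_linear[OF UV(4) UV(6)[rule_format] P(1)])
 moreover have "\<forall>y\<in>U'. fst (psi y) = F y" by (simp add: psi_def)
 ultimately show ?thesis using U' UV(4)
 by - (rule exI[of _ U'], rule exI[of _ V], rule exI[of _ psi], rule exI[of _ "%y. P (g y)"], simp)
qed

text \<open>The complement is open by the tube lemma. It will be used with K = [0, 1] to eliminate
  the angle from descriptions of the tube.\<close>

lemma closed_projection:
 fixes A :: "('a::topological_space \<times> 'b::topological_space) set"
 assumes "compact K" "closed A" shows "closed {x. \<exists>k\<in>K. (x, k) : A}"
proof -
 have "open (- {x. \<exists>k\<in>K. (x, k) : A})"
 proof (subst open_subopen, intro ballI)
 fix x assume "x : - {x. \<exists>k\<in>K. (x, k) : A}"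
 then have "{x} \<times> K <= - A" by auto
 from Elementary_Topology.tube_lemma[OF assms(1) _ this] assms(2) obtain X where X: "x : X" "open X" "X \<times> K <= - A" by auto
 then have "X <= - {x. \<exists>k\<in>K. (x, k) : A}" by auto
 then show "\<exists>T. open T & x : T & T <= - {x. \<exists>k\<in>K. (x, k) : A}" using X by blast
 qed
 then show ?thesis by (simp add: closed_def)
qed

text \<open>The charts of a domain are required to have \<open>inv_into\<close> as their inverse,
  while constructions produce other inverse maps.\<close>

lemma homeomorphism_inv_into: "homeomorphism S T f g ==> homeomorphism S T f (inv_into S f)"
 unfolding homeomorphism_def
proof (elim conjE, intro conjI)
 assume *: "\<forall>x\<in>S. g (f x) = x" "f ` S = T" "continuous_on S f" "\<forall>y\<in>T. f (g y) = y" "g ` T = S" "continuous_on T g"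
 have inj: "inj_on f S" using *(1) by (metis inj_on_inverseI)
 have eq: "inv_into S f y = g y" if "y : T" for y
 using *(4,5) that inj by (metis image_eqI inv_into_f_f)
 show "continuous_on T (inv_into S f)" by (rule continuous_on_eq[OF *(6)]) (simp add: eq)
 show "inv_into S f ` T = S" using *(5) eq by (metis image_cong)
 show "\<forall>x\<in>S. inv_into S f (f x) = x" using inj by simp
 show "\<forall>y\<in>T. f (inv_into S f y) = y" using *(4) eq by simp
qed

section \<open>The product with the complex plane\<close>

text \<open>The chart coordinates of the product are nested with the boundary coordinate outermost.
  \<open>fp\<close>, \<open>zp\<close> and \<open>asc\<close> split them into the W part and the
  complex part and join these again.\<close>

definition fp :: "real \<times> ('f \<times> complex) => real \<times> 'f" where "fp y = (fst y, fst (snd y))"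
definition zp :: "real \<times> ('f \<times> complex) => complex" where "zp y = snd (snd y)"
definition asc :: "real \<times> 'f => complex => real \<times> ('f \<times> complex)" where "asc x z = (fst x, (snd x, z))"

lemma fp_asc [simp]: "fp (asc x z) = x" and zp_asc [simp]: "zp (asc x z) = z" and asc_fp_zp [simp]: "asc (fp y) (zp y) = y"
 and fst_fp [simp]: "fst (fp y) = fst y" and fst_asc [simp]: "fst (asc x z) = fst x"
 by (simp_all add: fp_def zp_def asc_def)

lemma bounded_linear_fp: "bounded_linear (fp :: real \<times> ('f::euclidean_space \<times> complex) => real \<times> 'f)"
 unfolding linear_conv_bounded_linear[symmetric] by (rule linearI) (simp_all add: fp_def)

lemma bounded_linear_zp: "bounded_linear (zp :: real \<times> ('f::euclidean_space \<times> complex) => complex)"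
 unfolding linear_conv_bounded_linear[symmetric] by (rule linearI) (simp_all add: zp_def)

lemma bounded_linear_asc: "bounded_linear (%p. asc (fst p) (snd p) :: real \<times> ('f::euclidean_space \<times> complex))"
 unfolding linear_conv_bounded_linear[symmetric] by (rule linearI) (simp_all add: asc_def)

lemma fp_simps [simp]: "fp (u + v) = fp u + fp v" "fp (c *\<^sub>R u) = c *\<^sub>R fp u" "fp 0 = 0"
 and zp_simps [simp]: "zp (u + v) = zp u + zp v" "zp (c *\<^sub>R u) = c *\<^sub>R zp u" "zp 0 = 0"
 by (simp_all add: fp_def zp_def zero_prod_def)

lemma has_derivative_asc:
 fixes f :: "_ => real \<times> 'f::euclidean_space"
 assumes "(f has_derivative f') (at x within S)" "(g has_derivative g') (at x within S)"
 shows "((%x. asc (f x) (g x)) has_derivative (%v. asc (f' v) (g' v))) (at x within S)"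
 using bounded_linear.has_derivative[OF bounded_linear_asc has_derivative_Pair[OF assms]] by simp

text \<open>The area form of the plane, Im(cnj a * b). Half of it, evaluated at z and a tangent
  vector, is \<pi> r^2 dt.\<close>

definition wC :: "complex => complex => real" where "wC a b = Re a * Im b - Im a * Re b"

lemma wC_linear [simp]: "wC (a + a') b = wC a b + wC a' b" "wC (c *\<^sub>R a) b = c * wC a b" "wC a (b + b') = wC a b + wC a b'"
 "wC a (c *\<^sub>R b) = c * wC a b" "wC 0 b = 0" "wC a 0 = 0" "wC a a = 0"
 by (simp_all add: wC_def algebra_simps)

lemma wC_skew: "wC a b = - wC b a"
 by (simp add: wC_def)

context liouville
begin

abbreviation "imgN i \<equiv> {y. fp y : img i}"
abbreviation "dmN i \<equiv> dm i \<times> (UNIV :: complex set)"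
abbreviation "N \<equiv> times_complex W"

definition coordN :: "'i => 'w \<times> complex => real \<times> ('f \<times> complex)" where
 "coordN i p = asc (coord W i (fst p)) (snd p)"

text \<open>An explicit inverse of \<open>coordN\<close>; it agrees with \<open>param N\<close> on
  coordinates of points of the chart.\<close>

definition paramN :: "'i => real \<times> ('f \<times> complex) => 'w \<times> complex" where
 "paramN i y = (param W i (fp y), zp y)"

lemma charts_N [simp]: "charts N = Ch" and chart_dom_N [simp]: "chart_dom N i = dmN i" and coord_N [simp]: "coord N i = coordN i"
 by (simp_all add: times_complex_def coordN_def asc_def fun_eq_iff case_prod_unfold)

context
 fixes i assumes i: "i : Ch"
begin

lemma coordN_in: "p : dmN i ==> coordN i p : imgN i"
 using coord_in[OF i, of "fst p"] by (simp add: coordN_def mem_Times_iff)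

lemma param_coordN: "p : dmN i ==> paramN i (coordN i p) = p"
 using param_coord[OF i, of "fst p"] by (simp add: coordN_def paramN_def mem_Times_iff)

lemma coord_paramN: "y : imgN i ==> coordN i (paramN i y) = y"
 using coord_param[OF i, of "fp y"] by (simp add: coordN_def paramN_def)

lemma paramN_in: "y : imgN i ==> paramN i y : dmN i"
 using param_in[OF i, of "fp y"] by (simp add: paramN_def mem_Times_iff)

lemma continuous_coordN: "continuous_on (dmN i) (coordN i)"
 unfolding coordN_def
proof -
 have "continuous_on (dmN i) (%p. (coord W i (fst p), snd p))"
 by (intro continuous_intros continuous_on_compose2[OF continuous_coord[OF i]]) auto
 from continuous_on_compose2[OF linear_continuous_on[OF bounded_linear_asc] this subset_UNIV]
 show "continuous_on (dmN i) (%p. asc (coord W i (fst p)) (snd p))" by simp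
qed

lemma continuous_paramN: "continuous_on (imgN i) (paramN i)"
 unfolding paramN_def
 by (intro continuous_intros continuous_on_compose2[OF continuous_param[OF i] linear_continuous_on[OF bounded_linear_fp]]
 linear_continuous_on[OF bounded_linear_zp]) auto

lemma param_N: "p : dmN i ==> param N i (coordN i p) = p"
 unfolding param_def by (simp add: inv_into_f_f[OF inj_on_inverseI[of _ "paramN i"]] param_coordN)

lemma openin_fp: assumes "openin (top_of_set half_space) A"
 shows "openin (top_of_set half_space) {y :: real \<times> ('f \<times> complex). fp y : A}"
proof -
 obtain T where T: "open T" "A = half_space Int T" using assms by (auto simp: openin_open)
 have "open (fp -` T :: (real \<times> ('f \<times> complex)) set)"
 by (rule open_vimage[OF T(1) linear_continuous_on[OF bounded_linear_fp]])
 moreover have "{y :: real \<times> ('f \<times> complex). fp y : A} = half_space Int fp -` T" using T(2) by (auto simp: half_space_def)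
 ultimately show ?thesis by (auto simp: openin_open)
qed

lemma imgN_open: "openin (top_of_set half_space) (imgN i)"
 by (rule openin_fp[OF img_open[OF i]])

lemma thick_imgN: "thick (imgN i)"
 by (rule thick_openin_half_space[OF imgN_open])

lemma dmN_open: "openin (top_of_set (Pts \<times> UNIV)) (dmN i)"
 by (rule openin_Times[OF dom_open[OF i]]) simp

end

definition tranN :: "'i => 'i => real \<times> ('f \<times> complex) => real \<times> ('f \<times> complex)" where
 "tranN i j y = asc (tran i j (fp y)) (zp y)"

lemma tranN_smooth:
 assumes "i : Ch" "j : Ch" shows "smooth_on {y. fp y : trans_dom i j} (tranN i j)"
proof -
 have l: "smooth_on A L" if "bounded_linear L" for A :: "(real \<times> ('f \<times> complex)) set" and L :: "_ => 'c::euclidean_space"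
 by (rule smooth_on_subset[OF smooth_on_open[OF open_UNIV Ck_on_linear_self[OF open_UNIV that]]]) simp
 have 1: "smooth_on {y. fp y : trans_dom i j} (%y. tran i j (fp y))"
 by (rule smooth_on_compose[OF l[OF bounded_linear_fp] trans_smooth[OF assms]]) auto
 have "smooth_on {y. fp y : trans_dom i j} (%y. (tran i j (fp y), zp y))"
 by (rule smooth_on_Pair[OF 1 l[OF bounded_linear_zp]])
 from smooth_on_bounded_linear[OF this bounded_linear_asc] show ?thesis unfolding tranN_def by simp
qed

lemma tranN_coordN: "i : Ch ==> p : dmN i ==> tranN i j (coordN i p) = coordN j p"
 using param_coord[of i "fst p"] by (simp add: tranN_def coordN_def tran_def mem_Times_iff)

definition lamN :: "'i => real \<times> ('f \<times> complex) => real \<times> ('f \<times> complex) => real" where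
 "lamN i y u = lam i (fp y) (fp u) + wC (zp y) (zp u) / 2"

definition omN :: "'i => real \<times> ('f \<times> complex) => real \<times> ('f \<times> complex) => real \<times> ('f \<times> complex) => real" where
 "omN i y u v = om i (fp y) (fp u) (fp v) + wC (zp u) (zp v)"

lemma hat_form_lamN: "hat_form lam i = lamN i"
 by (simp add: hat_form_def lamN_def fp_def zp_def wC_def fun_eq_iff case_prod_unfold)

lemma lamN_linear: "i : Ch ==> y : imgN i ==> linear (lamN i y)"
 using lam_linear[of i "fp y"] by (intro linearI) (simp_all add: lamN_def linear_add linear_cmul algebra_simps add_divide_distrib)

lemma wC_bounded_linear: "bounded_linear (%a. wC a b)" "bounded_linear (wC a)"
 unfolding linear_conv_bounded_linear[symmetric] by (rule linearI; simp)+

lemma smooth_on_linear_any: "bounded_linear L ==> smooth_on A (L :: real \<times> ('f \<times> complex) => 'c::real_normed_vector)"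
 using smooth_on_subset[OF smooth_on_open[OF open_UNIV Ck_on_linear_self[OF open_UNIV]]] by blast

lemma lamN_smooth: assumes "i : Ch" shows "smooth_on (imgN i) (%y. lamN i y u)"
 unfolding lamN_def
proof (rule smooth_on_add)
 show "smooth_on (imgN i) (%y. lam i (fp y) (fp u))"
 by (rule smooth_on_compose[OF smooth_on_linear_any[OF bounded_linear_fp] lam_smooth[OF assms]]) auto
 show "smooth_on (imgN i) (%y. wC (zp y) (zp u) / 2)"
 using smooth_on_linear_any[OF bounded_linear_compose[OF bounded_linear_compose[OF bounded_linear_divide wC_bounded_linear(1)] bounded_linear_zp]] .
qed

text \<open>The part on the plane is half the bilinear form \<open>wC\<close>, whose antisymmetrized
  derivative is \<open>wC\<close> itself.\<close>

lemma dlamN: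
 assumes i: "i : Ch" and y: "y : imgN i"
 shows "fd_within (%y. lamN i y v) (imgN i) y u - fd_within (%y. lamN i y u) (imgN i) y v = omN i y u v"
proof -
 have x: "fp y : img i" using y by simp
 have eq: "fd_within (%y. lamN i y v) (imgN i) y u = fd_within (%x. lam i x (fp v)) (img i) (fp y) (fp u) + wC (zp u) (zp v) / 2" for u v
 proof -
 have "((%x. lam i x (fp v)) has_derivative fd_within (%x. lam i x (fp v)) (img i) (fp y)) (at (fp y) within fp ` imgN i)"
 by (rule has_derivative_subset[OF lam_has_derivative[OF i x]]) auto
 from has_derivative_in_compose[OF bounded_linear_imp_has_derivative[OF bounded_linear_fp] this]
 have 1: "((%y. lam i (fp y) (fp v)) has_derivative (%u. fd_within (%x. lam i x (fp v)) (img i) (fp y) (fp u))) (at y within imgN i)" .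
 have 2: "((%y. wC (zp y) (zp v) / 2) has_derivative (%u. wC (zp u) (zp v) / 2)) (at y within imgN i)"
 by (rule bounded_linear_imp_has_derivative[OF bounded_linear_compose[OF bounded_linear_compose[OF bounded_linear_divide wC_bounded_linear(1)] bounded_linear_zp]])
 from thick_frechet_eq[OF thick_imgN[OF i] y has_derivative_add[OF 1 2]]
 show ?thesis unfolding lamN_def by simp
 qed
 show ?thesis unfolding eq omN_def ext_d_def using wC_skew[of "zp v" "zp u"] by simp
qed

lemma omN_bilin: "i : Ch ==> y : imgN i ==> bilin (omN i y)"
 unfolding bilin_def
 by (intro conjI allI linearI)
 (simp_all add: omN_def linear_add[OF om_linear(1)] linear_add[OF om_linear(2)] linear_cmul[OF om_linear(1)] linear_cmul[OF om_linear(2)]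
 distrib_left)

end

text \<open>Restriction to the line: the constant function of one variable has derivative 0, and on
  an open set of parameters this derivative is unique. It is applied to lines tangent to a boundary
  and to the time direction.\<close>

lemma has_derivative_const_line:
 fixes f :: "'a::real_normed_vector => real"
 assumes "(f has_derivative f') (at x within X)" "open R" "0 : R" "!!r. r : R ==> x + r *\<^sub>R v : X & f (x + r *\<^sub>R v) = f x"
 shows "f' v = 0"
proof -
 have 1: "((%r. x + r *\<^sub>R v) has_derivative (%r. r *\<^sub>R v)) (at 0 within R)"
 by (auto intro!: derivative_eq_intros)
 have "(f has_derivative f') (at (x + 0 *\<^sub>R v) within (%r. x + r *\<^sub>R v) ` R)"
 by (simp, rule has_derivative_subset[OF assms(1)]) (use assms(4) in auto)
 from has_derivative_in_compose[OF 1 this]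
 have "((%r. f (x + r *\<^sub>R v)) has_derivative (%r. f' (r *\<^sub>R v))) (at 0 within R)" .
 then have 2: "((%r. f x) has_derivative (%r. f' (r *\<^sub>R v))) (at 0 within R)"
 by (rule has_derivative_transform_on[OF _ assms(3)]) (use assms(4) in simp)
 from thick_derivative_unique[OF thick_open[OF assms(2)] assms(3) this has_derivative_const]
 have "(%r. f' (r *\<^sub>R v)) = (%r. 0)" .
 from fun_cong[OF this, of 1] show ?thesis by simp
qed

section \<open>Angles\<close>

text \<open>The angle is measured in full turns, and every real number is an angle of z = 0.\<close>

definition ang :: "complex => real => bool" where
 "ang z t \<longleftrightarrow> z = of_real (cmod z) * cis (2 * pi * t)"

lemma ang_zero [simp]: "ang 0 t"
 by (simp add: ang_def)

lemma ang_int: "ang z t ==> ang z (t + of_int k)"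
proof -
 have "cis (2 * pi * (t + of_int k)) = cis (2 * pi * t) * cis (2 * pi * of_int k)"
 by (simp only: cis_mult distrib_left)
 also have "cis (2 * pi * of_int k) = 1" by (rule cis_multiple_2pi) simp
 finally show "ang z t ==> ang z (t + of_int k)" by (simp add: ang_def)
qed

lemma ang_unique:
 assumes "z ~= 0" "ang z t" "ang z t'" shows "\<exists>k. t' = t + of_int k"
proof -
 have "of_real (cmod z) * cis (2 * pi * t') = of_real (cmod z) * cis (2 * pi * t)"
 using assms(2,3) unfolding ang_def by simp
 then have "cis (2 * pi * t') = cis (2 * pi * t)" using assms(1) by simp
 then have "cis (2 * pi * t' - 2 * pi * t) = 1" by (simp add: cis_divide[symmetric])
 then have "Re (cis (2 * pi * t' - 2 * pi * t)) = Re 1" by simp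
 then have "cos (2 * pi * t' - 2 * pi * t) = 1" by simp
 then obtain k :: int where "2 * pi * t' - 2 * pi * t = of_int k * 2 * pi" using cos_one_2pi_int by blast
 then have "2 * pi * (t' - t - of_int k) = 0" by (simp add: algebra_simps)
 then show ?thesis by (intro exI[of _ k]) simp
qed

lemma ang_exists: "\<exists>t\<in>{0..1}. ang z t"
proof -
 have "ang z (Arg z / (2 * pi))" using rcis_cmod_Arg[of z] by (simp add: ang_def rcis_def)
 from ang_int[OF this, of "- \<lfloor>Arg z / (2 * pi)\<rfloor>"] show ?thesis
 by (intro bexI[of _ "frac (Arg z / (2 * pi))"]) (auto simp: frac_def intro: less_imp_le[OF frac_lt_1[unfolded frac_def]])
qed

text \<open>The principal logarithm of z/z0 continues a given angle of z0. Near z0 it does so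
  smoothly, which supplies the local angle function used below.\<close>

lemma ang_Ln:
 assumes "z0 ~= 0" "ang z0 t" "z ~= 0" shows "ang z (t + Im (Ln (z / z0)) / (2 * pi))"
proof -
 let ?L = "Ln (z / z0)"
 have "z = z0 * exp ?L" using assms by simp
 also have "\<dots> = of_real (cmod z0 * exp (Re ?L)) * cis (2 * pi * t + Im ?L)"
 using assms(2) unfolding ang_def by (subst exp_eq_polar) (metis (no_types, lifting) cis_mult mult.assoc mult.left_commute of_real_mult)
 finally have z: "z = of_real (cmod z0 * exp (Re ?L)) * cis (2 * pi * t + Im ?L)" .
 then have "cmod z = cmod (of_real (cmod z0 * exp (Re ?L)) * cis (2 * pi * t + Im ?L))" by simp
 also have "\<dots> = cmod z0 * exp (Re ?L)" unfolding norm_mult norm_of_real norm_cis by simp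
 finally have "cmod z = cmod z0 * exp (Re ?L)" .
 then show ?thesis using z by (simp add: ang_def distrib_left)
qed

lemma wC_Im_divide: "z0 ~= 0 ==> Im (z / z0) = wC z0 z / (cmod z0)\<^sup>2"
 by (simp add: Im_divide wC_def cmod_power2 mult.commute)

lemma inner_self_cmod: "z \<bullet> z = (cmod z)\<^sup>2"
 by (simp add: power2_norm_eq_inner)

section \<open>The tube and its boundary\<close>

context ham
begin

definition S :: "('w \<times> complex) set" where "S = tube_set W H"

definition Bd :: "('w \<times> complex) set" where
 "Bd = {p. fst p : Pts & (\<exists>t. ang (snd p) t & pi * (cmod (snd p))\<^sup>2 = H t (fst p))}"

lemma H_ang: "w : Pts ==> z ~= 0 ==> ang z t ==> ang z t' ==> H t' w = H t w"
 using ang_unique[of z t t'] H_periodic_int by metis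

text \<open>One angle decides membership: for z nonzero the angles differ by integers and H is
  periodic, while at z = 0 the condition reduces to H >= 0, which holds at every time.\<close>

lemma S_iff: assumes "ang (snd p) t" shows "p : S \<longleftrightarrow> fst p : Pts & pi * (cmod (snd p))\<^sup>2 <= H t (fst p)"
proof -
 have "p : S \<longleftrightarrow> fst p : Pts & (\<exists>r t. 0 <= r & snd p = of_real r * cis (2 * pi * t) & pi * (cmod (snd p))\<^sup>2 <= H t (fst p))"
 by (simp add: S_def tube_set_def case_prod_unfold)
 also have "\<dots> \<longleftrightarrow> fst p : Pts & (\<exists>t. ang (snd p) t & pi * (cmod (snd p))\<^sup>2 <= H t (fst p))"
 proof -
 have "cmod (snd p) = r" if "0 <= r" "snd p = of_real r * cis (2 * pi * t)" for r t
 using that by (simp add: norm_mult)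
 then have "(\<exists>r. 0 <= r & snd p = of_real r * cis (2 * pi * t)) \<longleftrightarrow> ang (snd p) t" for t
 unfolding ang_def using norm_ge_zero[of "snd p"] by metis
 then show ?thesis by blast
 qed
 also have "\<dots> \<longleftrightarrow> fst p : Pts & pi * (cmod (snd p))\<^sup>2 <= H t (fst p)"
 proof (cases "snd p = 0")
 case True then show ?thesis using H_nonneg by auto
 next
 case False
 have "H s (fst p) = H t (fst p)" if "fst p : Pts" "ang (snd p) s" for s by (rule H_ang[OF that(1) False assms that(2)])
 with assms show ?thesis by metis
 qed
 finally show ?thesis .
qed

lemma Bd_iff: assumes "ang (snd p) t" shows "p : Bd \<longleftrightarrow> fst p : Pts & pi * (cmod (snd p))\<^sup>2 = H t (fst p)"
proof (cases "snd p = 0")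
 case True then show ?thesis using H_zero_iff[of "fst p"] unfolding Bd_def by (auto simp: eq_commute[of 0])
next
 case False
 have "H s (fst p) = H t (fst p)" if "fst p : Pts" "ang (snd p) s" for s by (rule H_ang[OF that(1) False assms that(2)])
 with assms show ?thesis unfolding Bd_def mem_Collect_eq by metis
qed

lemma Bd_subset: "Bd <= S"
proof
 fix p assume "p : Bd"
 moreover obtain t where "ang (snd p) t" using ang_exists by blast
 ultimately show "p : S" using S_iff Bd_iff by simp
qed

lemma Bd_points: "p : Bd ==> fst p : Pts"
 by (simp add: Bd_def)

lemma Bd_z_zero: "p : Bd ==> snd p = 0 ==> fst p : bdry W"
 using Bd_iff[of p 0] H_zero_iff[of "fst p" 0] by simp

lemma Bd_bdry: "p : Bd ==> fst p : bdry W ==> snd p = 0"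
 unfolding Bd_def using H_bdry by auto

lemma bdry_Bd: "w : bdry W ==> (w, 0) : Bd"
 using Bd_iff[of "(w, 0)" 0] H_bdry bdry_subset by auto

lemma closed_ang_le:
 assumes f: "continuous_on ((Pts \<times> UNIV) \<times> UNIV) (f :: ('w \<times> complex) \<times> real => real)" and g: "continuous_on ((Pts \<times> UNIV) \<times> UNIV) g"
 shows "closed {y : (Pts \<times> UNIV) \<times> UNIV. ang (snd (fst y)) (snd y) & f y <= g y}"
proof -
 have cP: "closed ((Pts \<times> UNIV) \<times> UNIV :: (('w \<times> complex) \<times> real) set)"
 by (intro closed_Times compact_imp_closed[OF compact_points] closed_UNIV)
 have "closed {y :: ('w \<times> complex) \<times> real. ang (snd (fst y)) (snd y)}"
 unfolding ang_def cis_conv_exp by (intro closed_Collect_eq continuous_intros)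
 from closed_Int[OF this continuous_on_closed_Collect_le[OF f g cP]] show ?thesis
 by (simp add: Int_def conj_commute conj_left_commute)
qed

text \<open>Angles may be taken from the compact interval [0, 1], so this presents the set as a
  projection along a compact factor; closedness follows.\<close>

lemma Bd_eq: "Bd = {p. \<exists>t\<in>{0..1}. (p, t) : {y : (Pts \<times> UNIV) \<times> UNIV. ang (snd (fst y)) (snd y) & H (snd y) (fst (fst y)) <= pi * (cmod (snd (fst y)))\<^sup>2}
 Int {y : (Pts \<times> UNIV) \<times> UNIV. ang (snd (fst y)) (snd y) & pi * (cmod (snd (fst y)))\<^sup>2 <= H (snd y) (fst (fst y))}}"
proof (intro set_eqI)
 fix p :: "'w \<times> complex"
 obtain t where t: "t : {0..1}" "ang (snd p) t" using ang_exists by blast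
 show "p : Bd \<longleftrightarrow> p : {p. \<exists>t\<in>{0..1}. (p, t) : {y : (Pts \<times> UNIV) \<times> UNIV. ang (snd (fst y)) (snd y) & H (snd y) (fst (fst y)) <= pi * (cmod (snd (fst y)))\<^sup>2}
 Int {y : (Pts \<times> UNIV) \<times> UNIV. ang (snd (fst y)) (snd y) & pi * (cmod (snd (fst y)))\<^sup>2 <= H (snd y) (fst (fst y))}}"
 proof
 assume "p : Bd"
 then show "p : {p. \<exists>t\<in>{0..1}. (p, t) : {y : (Pts \<times> UNIV) \<times> UNIV. ang (snd (fst y)) (snd y) & H (snd y) (fst (fst y)) <= pi * (cmod (snd (fst y)))\<^sup>2}
 Int {y : (Pts \<times> UNIV) \<times> UNIV. ang (snd (fst y)) (snd y) & pi * (cmod (snd (fst y)))\<^sup>2 <= H (snd y) (fst (fst y))}}"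
 using Bd_iff[OF t(2)] t by (intro CollectI bexI[OF _ t(1)]) (simp add: mem_Times_iff)
 next
 assume "p : {p. \<exists>t\<in>{0..1}. (p, t) : {y : (Pts \<times> UNIV) \<times> UNIV. ang (snd (fst y)) (snd y) & H (snd y) (fst (fst y)) <= pi * (cmod (snd (fst y)))\<^sup>2}
 Int {y : (Pts \<times> UNIV) \<times> UNIV. ang (snd (fst y)) (snd y) & pi * (cmod (snd (fst y)))\<^sup>2 <= H (snd y) (fst (fst y))}}"
 then obtain s where "fst p : Pts" "ang (snd p) s" "H s (fst p) <= pi * (cmod (snd p))\<^sup>2" "pi * (cmod (snd p))\<^sup>2 <= H s (fst p)"
 by (auto simp: mem_Times_iff)
 then show "p : Bd" using Bd_iff[of p s] by simp
 qed
qed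

lemma continuous_H_prod: "continuous_on ((Pts \<times> (UNIV :: complex set)) \<times> UNIV) (%y. H (snd y) (fst (fst y)))"
proof -
 have "continuous_on ((Pts \<times> (UNIV :: complex set)) \<times> UNIV) (%y. (snd y, fst (fst y)))" by (intro continuous_intros)
 from continuous_on_compose2[OF H_continuous this] show ?thesis by (auto simp: mem_Times_iff image_subset_iff)
qed

lemma closed_Bd: "closed Bd"
 unfolding Bd_eq by (intro closed_projection closed_Int closed_ang_le continuous_H_prod continuous_intros) auto

lemma Pos_open: "\<exists>U. open U & S - Bd = (Pts \<times> UNIV) Int U"
proof -
 let ?C = "{y : (Pts \<times> UNIV) \<times> UNIV. ang (snd (fst y)) (snd y) & H (snd y) (fst (fst y)) <= pi * (cmod (snd (fst y)))\<^sup>2}"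
 let ?A = "{p. \<exists>t\<in>{0..1}. (p, t) : ?C}"
 have "closed ?A" by (intro closed_projection closed_ang_le continuous_H_prod continuous_intros) auto
 moreover have "S - Bd = (Pts \<times> UNIV) Int - ?A"
 proof (intro set_eqI)
 fix p :: "'w \<times> complex"
 obtain t where t: "t : {0..1}" "ang (snd p) t" using ang_exists by blast
 have "p : S - Bd \<longleftrightarrow> fst p : Pts & pi * (cmod (snd p))\<^sup>2 < H s (fst p)" if "ang (snd p) s" for s
 using S_iff[OF that] Bd_iff[OF that] by auto
 then have "p : S - Bd \<longleftrightarrow> fst p : Pts & (\<forall>s\<in>{0..1}. ang (snd p) s --> pi * (cmod (snd p))\<^sup>2 < H s (fst p))"
 using t by blast
 then show "p : S - Bd \<longleftrightarrow> p : (Pts \<times> UNIV) Int - ?A" by (auto simp: mem_Times_iff not_le)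
 qed
 ultimately show ?thesis by (intro exI[of _ "- ?A"]) (simp add: open_Compl)
qed

section \<open>Local defining functions of the boundary of the tube\<close>

lemma DH_time:
 assumes "i : Ch" "x : img i" "!!r. Hc i (r, x) = Hc i (t, x)" shows "DH i (t, x) (s, 0) = 0"
 by (rule has_derivative_const_line[OF Hc_derivative[OF assms(1,2)] open_UNIV UNIV_I]) (use assms in simp)

lemma Hc_bdry: "i : Ch ==> x : img i ==> fst x = 0 ==> Hc i (t, x) = 0"
 using H_bdry bdry_coord[OF _ param_in] coord_param by (simp add: Hc_def)

text \<open>H vanishes identically on the boundary, so only the normal derivative survives. Then
  \<tau> equals minus the first component of Y times that derivative, and outwardness means this
  component is negative.\<close>

lemma DH_bdry:
 assumes i: "i : Ch" and x: "x : img i" and x0: "fst x = 0"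
 shows "DH i (t, x) (s, 0) = 0" "DH i (t, x) (0, (0, b)) = 0" "0 < DH i (t, x) (0, (1, 0))"
proof -
 note l = DH_linear[OF i x, of t]
 show "DH i (t, x) (s, 0) = 0" by (rule DH_time[OF i x]) (use Hc_bdry[OF i x x0] in simp)
 obtain T where T: "open T" "img i = half_space Int T" using img_open[OF i] by (auto simp: openin_open)
 have tang: "DH i (t, x) (0, (0, b)) = 0" for b
 proof (rule has_derivative_const_line[OF Ht_derivative[OF i x], of "(%r. x + r *\<^sub>R (0, b)) -` T" "(0, b)"])
 show "open ((%r. x + r *\<^sub>R (0, b)) -` T)" by (intro open_vimage T(1) continuous_intros)
 show "0 : (%r. x + r *\<^sub>R (0, b)) -` T" using x T(2) by (simp add: zero_prod_def[symmetric])
 fix r assume "r : (%r. x + r *\<^sub>R (0, b)) -` T"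
 then have xr: "x + r *\<^sub>R (0, b) : img i" using T(2) x0 by (simp add: half_space_def)
 then show "x + r *\<^sub>R (0, b) : img i & (H t \<circ> param W i) (x + r *\<^sub>R (0, b)) = (H t \<circ> param W i) x"
 using Hc_bdry[OF i xr, of t] Hc_bdry[OF i x x0, of t] x0 by (simp add: Hc_def)
 qed
 show "DH i (t, x) (0, (0, b)) = 0" by (rule tang)
 have Y1: "fst (Y i x) < 0" using liouville i x x0 unfolding liouville_domain_def by blast
 have "(0, Y i x) = fst (Y i x) *\<^sub>R (0, (1, 0)) + (0 :: real, (0, snd (Y i x)))" by (simp add: prod_eq_iff)
 then have "DH i (t, x) (0, Y i x) = fst (Y i x) * DH i (t, x) (0, (1, 0)) + DH i (t, x) (0, (0, snd (Y i x)))"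
 using linear_add[OF l] linear_cmul[OF l] by (metis real_scaleR_def)
 then have "tau t (param W i x) = - fst (Y i x) * DH i (t, x) (0, (1, 0))"
 using tau_chart[OF i x, of t] Hc_bdry[OF i x x0, of t] tang by simp
 moreover have "0 < tau t (param W i x)" unfolding tau_def by (rule tau_pos[OF param_points[OF i x]])
 ultimately show "0 < DH i (t, x) (0, (1, 0))" using Y1 by (simp add: mult_less_0_iff)
qed

text \<open>The derivative of H(angle of z, w) - \<pi>|z|^2, where the angle changes at rate
  \<open>wC z z' / (2 * pi * \<bar>z\<bar>\<^sup>2)\<close> along z'. At z = 0 division by zero
  makes the time component 0, which is the correct value there because H is autonomous near the
  boundary.\<close>

definition dF :: "'i => real => real \<times> ('f \<times> complex) => real \<times> ('f \<times> complex) => real" where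
 "dF i t y u = DH i (t, fp y) (wC (zp y) (zp u) / (2 * pi * (cmod (zp y))\<^sup>2), fp u) - 2 * pi * (zp y \<bullet> zp u)"

text \<open>The set \<open>Om\<close> is open in the whole coordinate space. F has to be negative
  also beyond the half-space, so that F >= 0 alone describes the tube and F can become the boundary
  coordinate of a chart.\<close>

definition local_fn :: "'i => real => 'w \<times> complex => (real \<times> ('f \<times> complex)) set => (real \<times> ('f \<times> complex) => real) => bool" where
 "local_fn i t p Om F \<longleftrightarrow> open Om & coordN i p : Om & (\<forall>k. Ck_on k Om F) &
 (\<forall>y\<in>Om. (y : imgN i & paramN i y : S \<longleftrightarrow> 0 <= F y) & (y : imgN i & paramN i y : Bd \<longleftrightarrow> F y = 0)) &
 (F has_derivative dF i t (coordN i p)) (at (coordN i p))"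

lemma fp_coordN [simp]: "fp (coordN i p) = coord W i (fst p)" and zp_coordN [simp]: "zp (coordN i p) = snd p"
 and fst_coordN [simp]: "fst (coordN i p) = fst (coord W i (fst p))"
 by (simp_all add: coordN_def)

text \<open>Where z is nonzero the point of W lies off the boundary, so the coordinates fill an open
  set, and a logarithm supplies a smooth angle near z.\<close>

lemma local_fn_nonzero:
 assumes i: "i : Ch" and p: "p : Bd" "p : dmN i" "ang (snd p) t" and z: "snd p ~= 0"
 shows "\<exists>Om F. local_fn i t p Om F"
proof -
 let ?x = "coord W i (fst p)" and ?z = "snd p"
 have dp: "fst p : dm i" using p(2) by (simp add: mem_Times_iff)
 have x: "?x : img i" by (rule coord_in[OF i dp])
 have "fst p \<notin> bdry W" using Bd_bdry[OF p(1)] z by blast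
 then have pos: "0 < fst ?x" using bdry_coord[OF i dp] fst_img[OF i x] by simp
 obtain T where T: "open T" "img i = half_space Int T" using img_open[OF i] by (auto simp: openin_open)
 define X where "X = img i Int {x. 0 < fst x}"
 have "X = T Int {x. 0 < fst x}" unfolding X_def T(2) by (auto simp: half_space_def)
 then have X: "open X" using T(1) by (auto intro!: open_Int open_Collect_less continuous_intros)
 have UX: "open ((UNIV :: real set) \<times> X)" by (intro open_Times X open_UNIV)
 define Om where "Om = fp -` X Int (%y. zp y / ?z) -` (- \<real>\<^sub>\<le>\<^sub>0)"
 define th where "th = (%z. t + Im (Ln (z / ?z)) / (2 * pi))"
 define F where "F = (%y. Hc i (th (zp y), fp y) - pi * (zp y \<bullet> zp y))"
 have zb: "bounded_linear (%y :: real \<times> ('f \<times> complex). zp y / ?z)"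
 by (rule bounded_linear_compose[OF bounded_linear_divide bounded_linear_zp])
 have Om: "open Om" unfolding Om_def
 by (intro open_Int open_vimage X linear_continuous_on[OF bounded_linear_fp] linear_continuous_on[OF zb] open_Compl closed_nonpos_Reals_complex)
 have inOm: "fp y : X" "zp y / ?z \<notin> \<real>\<^sub>\<le>\<^sub>0" "zp y ~= 0" if "y : Om" for y using that unfolding Om_def by auto
 have y0: "coordN i p : Om" unfolding Om_def X_def using x pos z by simp
 have HcC: "Ck_on k (UNIV \<times> X) (Hc i)" for k
 by (rule smooth_on_open_Ck[OF UX smooth_on_subset[OF Hc_smooth[OF i]]]) (auto simp: X_def)
 have thb: "bounded_linear (%c. Im c / (2 * pi))" by (rule bounded_linear_compose[OF bounded_linear_divide bounded_linear_Im])
 have thC: "Ck_on k Om (%y. th (zp y))" for k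
 unfolding th_def
 proof (intro Ck_on_add Om Ck_on_const)
 have "Ck_on k Om (%y. Ln (zp y / ?z))"
 by (rule Ck_on_compose[OF Om _ _ Ck_on_linear_self[OF Om zb] Ck_on_Ln])
 (use inOm(2) in \<open>auto intro: open_Compl closed_nonpos_Reals_complex\<close>)
 from Ck_on_bounded_linear[OF Om this thb] show "Ck_on k Om (%y. Im (Ln (zp y / ?z)) / (2 * pi))" .
 qed
 have FC: "Ck_on k Om F" for k
 unfolding F_def
 proof (rule Ck_on_diff[OF Om])
 show "Ck_on k Om (%y. pi * (zp y \<bullet> zp y))"
 by (intro Om Ck_on_mult Ck_on_const Ck_on_inner Ck_on_linear_self bounded_linear_zp)
 show "Ck_on k Om (%y. Hc i (th (zp y), fp y))"
 by (rule Ck_on_compose[OF Om UX _ Ck_on_Pair[OF Om thC Ck_on_linear_self[OF Om bounded_linear_fp]] HcC])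
 (use inOm(1) in auto)
 qed
 have iff: "(y : imgN i & paramN i y : S \<longleftrightarrow> 0 <= F y) & (y : imgN i & paramN i y : Bd \<longleftrightarrow> F y = 0)" if y: "y : Om" for y
 proof -
 have fy: "fp y : img i" using inOm(1)[OF y] by (simp add: X_def)
 have "ang (snd (paramN i y)) (th (zp y))" unfolding th_def using ang_Ln[OF z p(3) inOm(3)[OF y]] by (simp add: paramN_def)
 note S_iff[OF this] Bd_iff[OF this]
 then show ?thesis using fy param_points[OF i fy] by (auto simp: paramN_def F_def Hc_def inner_self_cmod)
 qed
 have th0: "th ?z = t" using z by (simp add: th_def)
 have dth: "((%y. th (zp y)) has_derivative (%u. wC ?z (zp u) / (2 * pi * (cmod ?z)\<^sup>2))) (at (coordN i p))"
 proof -
 have "(*) (1 :: complex) = (%h. h)" by (simp add: fun_eq_iff)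
 then have "(Ln has_derivative (%h. h)) (at (zp (coordN i p) / ?z))"
 using has_field_derivative_Ln[of 1] z by (simp add: has_field_derivative_def)
 from bounded_linear.has_derivative[OF thb has_derivative_compose[OF bounded_linear_imp_has_derivative[OF zb] this]]
 have "((%y. Im (Ln (zp y / ?z)) / (2 * pi)) has_derivative (%u. Im (zp u / ?z) / (2 * pi))) (at (coordN i p))" .
 from has_derivative_add[OF has_derivative_const this, of t] show ?thesis
 unfolding th_def wC_Im_divide[OF z] by (simp add: mult.commute)
 qed
 have "(Hc i has_derivative DH i (t, ?x)) (at (t, ?x) within UNIV \<times> X)"
 by (rule has_derivative_subset[OF Hc_derivative[OF i x]]) (auto simp: X_def)
 then have "(Hc i has_derivative DH i (t, ?x)) (at (th (zp (coordN i p)), fp (coordN i p)))"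
 using at_within_open[OF _ UX, of "(t, ?x)"] x pos by (simp add: th0 X_def)
 from has_derivative_compose[OF has_derivative_Pair[OF dth bounded_linear_imp_has_derivative[OF bounded_linear_fp]] this]
 have 1: "((%y. Hc i (th (zp y), fp y)) has_derivative (%u. DH i (t, ?x) (wC ?z (zp u) / (2 * pi * (cmod ?z)\<^sup>2), fp u))) (at (coordN i p))" .
 have 2: "((%y. pi * (zp y \<bullet> zp y)) has_derivative (%u. 2 * pi * (?z \<bullet> zp u))) (at (coordN i p))"
 by (rule has_derivative_eq_rhs[OF has_derivative_mult_right[OF has_derivative_inner[OF bounded_linear_imp_has_derivative[OF bounded_linear_zp] bounded_linear_imp_has_derivative[OF bounded_linear_zp]]]])
 (simp add: fun_eq_iff inner_commute)
 have "(F has_derivative dF i t (coordN i p)) (at (coordN i p))"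
 unfolding F_def using has_derivative_diff[OF 1 2] by (simp add: dF_def[abs_def])
 then show ?thesis unfolding local_fn_def using Om y0 FC iff by (intro exI[of _ Om] exI[of _ F]) simp
qed

lemma local_fn_zero:
 assumes i: "i : Ch" and p: "p : Bd" "p : dmN i" and z: "snd p = 0"
 shows "\<exists>Om F. local_fn i t p Om F"
proof -
 let ?x = "coord W i (fst p)"
 have dp: "fst p : dm i" using p(2) by (simp add: mem_Times_iff)
 have x: "?x : img i" by (rule coord_in[OF i dp])
 have x0: "fst ?x = 0" using bdry_coord[OF i dp] Bd_z_zero[OF p(1) z] by simp
 obtain U0 where U0: "openin (top_of_set Pts) U0" "bdry W <= U0" "\<forall>w\<in>U0. \<forall>s t. H s w = H t w"
 using H_autonomous by (elim exE conjE) (rule that)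
 have "openin (top_of_set (img i)) (img i Int param W i -` U0)"
 by (rule continuous_openin_preimage[OF continuous_param[OF i] _ U0(1)]) (use param_points[OF i] in auto)
 from openin_trans[OF this img_open[OF i]] obtain T where T: "open T" "img i Int param W i -` U0 = half_space Int T"
 by (auto simp: openin_open)
 have "param W i ?x : U0" using param_coord[OF i dp] Bd_z_zero[OF p(1) z] U0(2) by auto
 then have xT: "?x : T" using x T(2) by blast
 have "smooth_on (img i) (%x. (t, x))"
 by (rule smooth_on_subset[OF smooth_on_open[OF open_UNIV Ck_on_Pair[OF open_UNIV Ck_on_const Ck_on_ident]]]) auto
 from smooth_on_compose[OF this Hc_smooth[OF i]] have sm: "smooth_on (img i) (%x. Hc i (t, x))" by auto
 obtain U1 g where g: "open U1" "?x : U1" "\<forall>k. Ck_on k U1 g" "\<forall>y. y : img i --> y : U1 --> g y = Hc i (t, y)"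
 using smooth_onD[OF sm x] by (elim exE conjE) (rule that)
 define g' where "g' = (%y. frechet_derivative g (at y))"
 have gD: "(g has_derivative g' y) (at y)" if "y : U1" for y
 unfolding g'_def by (rule Ck_on_has_derivative[OF g(3)[rule_format, of "Suc 0"] that])
 have "((%x. Hc i (t, x)) has_derivative g' ?x) (at ?x within img i)"
 unfolding g'_def by (rule smooth_on_ext_derivative[OF g(1) _ x g(2) g(3)[rule_format, of "Suc 0"]]) (use g(4) in simp)
 then have g'x: "g' ?x = (%u. DH i (t, ?x) (0, u))"
 using thick_derivative_unique[OF thick_img[OF i] x _ Ht_derivative[OF i x, of t]] by (simp add: Hc_def o_def)
 have "continuous_on U1 (%y. g' y (1, 0))"
 unfolding g'_def by (rule Ck_on_continuous[of 0]) (use g(3)[rule_format, of "Suc 0"] in simp)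
 then have "open (U1 Int (%y. g' y (1, 0)) -` {0<..})" by (rule continuous_open_preimage[OF _ g(1)]) simp
 \<comment> \<open>The ball is taken inside the region where H is autonomous, g is defined and the
   first partial derivative of g is positive.\<close>
 then have "open (T Int (U1 Int (%y. g' y (1, 0)) -` {0<..}))" using T(1) by blast
 moreover have "?x : T Int (U1 Int (%y. g' y (1, 0)) -` {0<..})" using xT g(2) DH_bdry(3)[OF i x x0] g'x by simp
 ultimately obtain e where e: "0 < e" "ball ?x e <= T Int (U1 Int (%y. g' y (1, 0)) -` {0<..})"
 by (meson open_contains_ball)
 have e1: "y : T" "y : U1" "0 < g' y (1, 0)" if "y : ball ?x e" for y using e(2) that by auto
 define Om where "Om = (fp -` ball ?x e :: (real \<times> ('f \<times> complex)) set)"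
 have Om: "open Om" unfolding Om_def by (rule open_vimage[OF open_ball linear_continuous_on[OF bounded_linear_fp]])
 have y0: "coordN i p : Om" unfolding Om_def using e(1) by simp
 define F where "F = (%y. g (fp y) - pi * (zp y \<bullet> zp y))"
 have FC: "Ck_on k Om F" for k
 unfolding F_def
 proof (rule Ck_on_diff[OF Om])
 show "Ck_on k Om (%y. pi * (zp y \<bullet> zp y))"
 by (intro Om Ck_on_mult Ck_on_const Ck_on_inner Ck_on_linear_self bounded_linear_zp)
 show "Ck_on k Om (%y. g (fp y))"
 by (rule Ck_on_compose[OF Om g(1) _ Ck_on_linear_self[OF Om bounded_linear_fp] g(3)[rule_format]]) (rule image_subsetI, rule e1(2), simp add: Om_def)
 qed
 have iff: "(y : imgN i & paramN i y : S \<longleftrightarrow> 0 <= F y) & (y : imgN i & paramN i y : Bd \<longleftrightarrow> F y = 0)" if y: "y : Om" for y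
 proof (cases "0 <= fst y")
 case True
 have b: "fp y : ball ?x e" using y by (simp add: Om_def)
 then have "fp y : img i Int param W i -` U0" unfolding T(2) using e1(1) True by (simp add: half_space_def)
 then have fy: "fp y : img i" "param W i (fp y) : U0" by auto
 obtain s where s: "ang (zp y) s" using ang_exists by blast
 have "H s (param W i (fp y)) = g (fp y)" using U0(3) fy(2) g(4) fy(1) e1(2)[OF b] by (metis (no_types, lifting) Hc_def case_prod_conv)
 moreover have "ang (snd (paramN i y)) s" using s by (simp add: paramN_def)
 note S_iff[OF this] Bd_iff[OF this]
 ultimately show ?thesis using fy param_points[OF i fy(1)] by (auto simp: paramN_def F_def inner_self_cmod)
 next
 case False
 let ?b = "snd (fp y)"
 have inb: "(r, ?b) : ball ?x e" if "fst y <= r" "r <= 0" for r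
 proof -
 have "(dist (fst ?x) r)\<^sup>2 <= (dist (fst ?x) (fst y))\<^sup>2" by (rule power_mono) (use that x0 in \<open>auto simp: dist_real_def\<close>)
 then have "dist ?x (r, ?b) <= dist ?x (fp y)" by (simp add: dist_prod_def)
 moreover have "dist ?x (fp y) < e" using y by (simp add: Om_def)
 ultimately show ?thesis by simp
 qed
 \<comment> \<open>Beyond the half-space g increases towards the hyperplane, where it agrees with H
   = 0; hence F is negative there.\<close>
 have "g (fst y, ?b) < g (0, ?b)"
 proof (rule DERIV_pos_imp_increasing[of "fst y" 0 "%r. g (r, ?b)"])
 show "fst y < 0" using False by simp
 fix r assume r: "fst y <= r" "r <= 0"
 have "((%r. (r, ?b)) has_derivative (%h. h *\<^sub>R (1, 0))) (at r)" by (auto intro!: derivative_eq_intros)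
 from has_derivative_compose[OF this gD[OF e1(2)[OF inb[OF r]]]]
 have "((%r. g (r, ?b)) has_derivative (%h. g' (r, ?b) (h *\<^sub>R (1, 0)))) (at r)" .
 moreover have "(%h. g' (r, ?b) (h *\<^sub>R (1, 0))) = (*) (g' (r, ?b) (1, 0))"
 unfolding linear_cmul[OF has_derivative_linear[OF gD[OF e1(2)[OF inb[OF r]]]]] by (rule ext) (simp only: real_scaleR_def mult.commute)
 ultimately have "((%r. g (r, ?b)) has_real_derivative g' (r, ?b) (1, 0)) (at r)"
 unfolding has_field_derivative_def by (simp only:)
 with e1(3)[OF inb[OF r]] show "\<exists>d. ((%r. g (r, ?b)) has_real_derivative d) (at r) & 0 < d" by blast
 qed
 moreover have "g (0, ?b) = 0"
 proof -
 have b0: "(0, ?b) : ball ?x e" using inb[of 0] False by simp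
 then have "(0, ?b) : img i Int param W i -` U0" unfolding T(2) using e1(1) by (simp add: half_space_def)
 then show ?thesis using g(4)[rule_format, OF _ e1(2)[OF b0]] Hc_bdry[OF i, of "(0, ?b)" t] by simp
 qed
 moreover have "(fst y, ?b) = fp y" by (metis fst_fp prod.collapse)
 ultimately have "g (fp y) < 0" by simp
 then have "F y < 0" unfolding F_def using inner_ge_zero[of "zp y"] mult_nonneg_nonneg[OF pi_ge_zero inner_ge_zero[of "zp y"]] by linarith
 moreover have "y \<notin> imgN i" using False fst_img[OF i, of "fp y"] by auto
 ultimately show ?thesis by auto
 qed
 have 1: "((%y. g (fp y)) has_derivative (%u. DH i (t, ?x) (0, fp u))) (at (coordN i p))"
 using has_derivative_compose[OF bounded_linear_imp_has_derivative[OF bounded_linear_fp] gD, of "coordN i p"] g(2) by (simp add: g'x)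
 have 2: "((%y. pi * (zp y \<bullet> zp y)) has_derivative (%u. 0)) (at (coordN i p))"
 by (rule has_derivative_eq_rhs[OF has_derivative_mult_right[OF has_derivative_inner[OF bounded_linear_imp_has_derivative[OF bounded_linear_zp] bounded_linear_imp_has_derivative[OF bounded_linear_zp]]]])
 (simp add: fun_eq_iff z)
 have "(F has_derivative dF i t (coordN i p)) (at (coordN i p))"
 unfolding F_def using has_derivative_diff[OF 1 2] by (simp add: dF_def[abs_def] z)
 then show ?thesis unfolding local_fn_def using Om y0 FC iff
 by - (rule exI[of _ Om], rule exI[of _ F], simp)
qed

lemma local_fn_exists:
 assumes "i : Ch" "p : Bd" "p : dmN i" "ang (snd p) t" shows "\<exists>Om F. local_fn i t p Om F"
 using local_fn_zero[OF assms(1-3)] local_fn_nonzero[OF assms] by blast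

text \<open>At z = 0 the inward normal direction works, and elsewhere the radial direction z, along
  which the angle is constant and only -2 \<pi>|z|^2 remains.\<close>

lemma dF_nonzero:
 assumes "i : Ch" "p : Bd" "p : dmN i" shows "\<exists>u. dF i t (coordN i p) u ~= 0"
proof (cases "snd p = 0")
 case True
 have dp: "fst p : dm i" using assms(3) by (simp add: mem_Times_iff)
 have x0: "fst (coord W i (fst p)) = 0" using bdry_coord[OF assms(1) dp] Bd_z_zero[OF assms(2) True] by simp
 show ?thesis
 by (rule exI[of _ "asc (1, 0) 0"]) (use DH_bdry(3)[OF assms(1) coord_in[OF assms(1) dp] x0, of t] True in \<open>simp add: dF_def\<close>)
next
 case False
 have dp: "fst p : dm i" using assms(3) by (simp add: mem_Times_iff)
 show ?thesis
 by (rule exI[of _ "asc 0 (snd p)"])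
 (use linear_0[OF DH_linear[OF assms(1) coord_in[OF assms(1) dp], of t]] False in \<open>simp add: dF_def zero_prod_def\<close>)
qed

end

section \<open>Charts of the tube\<close>

context ham
begin

abbreviation "TB \<equiv> tube W H"

lemma charts_tube: "c : charts TB \<longleftrightarrow>
 openin (top_of_set S) (fst c) & openin (top_of_set half_space) (snd c ` fst c) &
 homeomorphism (fst c) (snd c ` fst c) (snd c) (inv_into (fst c) (snd c)) &
 (\<forall>i\<in>Ch. smooth_on (coordN i ` (fst c Int dmN i)) (snd c \<circ> param N i) &
 smooth_on (snd c ` (fst c Int dmN i)) (coordN i \<circ> inv_into (fst c) (snd c)))"
 and chart_dom_tube: "chart_dom TB c = fst c" and coord_tube: "coord TB c = snd c"
 unfolding tube_def domain_atlas_def S_def by (simp_all add: case_prod_unfold)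

lemma S_chart: "p : S ==> \<exists>i. i : Ch & p : dmN i"
proof -
 assume "p : S"
 moreover obtain t where "ang (snd p) t" using ang_exists by blast
 ultimately have "fst p : Pts" using S_iff by blast
 then show ?thesis by (auto simp: points_def mem_Times_iff)
qed

lemma S_Pts: "S <= Pts \<times> UNIV"
proof
 fix p assume "p : S"
 moreover obtain t where "ang (snd p) t" using ang_exists by blast
 ultimately show "p : Pts \<times> UNIV" using S_iff by (simp add: mem_Times_iff)
qed

context
 fixes c assumes c: "c : charts TB"
begin

abbreviation "V \<equiv> fst c"
abbreviation "psi \<equiv> snd c"
abbreviation "invpsi \<equiv> inv_into V psi"

lemma V_open: "openin (top_of_set S) V" and T_open: "openin (top_of_set half_space) (psi ` V)"
 and psi_hom: "homeomorphism V (psi ` V) psi invpsi"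
 using c unfolding charts_tube by blast+

lemma V_S: "V <= S" using openin_imp_subset[OF V_open] .

lemma inv_psi: "p : V ==> invpsi (psi p) = p"
 using homeomorphism_apply1[OF psi_hom] .

lemma fst_psi: "p : V ==> 0 <= fst (psi p)"
 using openin_imp_subset[OF T_open] by (auto simp: half_space_def)

definition Ti :: "'i => (real \<times> ('f \<times> complex)) set" where "Ti i = psi ` (V Int dmN i)"

definition Phi :: "'i => real \<times> ('f \<times> complex) => real \<times> ('f \<times> complex)" where
 "Phi i = coordN i \<circ> invpsi"

definition Dt :: "'i => real \<times> ('f \<times> complex) => real \<times> ('f \<times> complex) => real \<times> ('f \<times> complex)" where
 "Dt i y = fd_within (Phi i) (psi ` V) y"

lemma Phi_psi: "p : V ==> Phi i (psi p) = coordN i p"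
 by (simp add: Phi_def inv_psi)

context
 fixes i assumes i: "i : Ch"
begin

lemma Vi_open: "openin (top_of_set V) (V Int dmN i)"
proof -
 obtain U where "open U" "dmN i = (Pts \<times> UNIV) Int U" using dmN_open[OF i] by (auto simp: openin_open)
 then have "V Int dmN i = V Int U" using V_S S_Pts by blast
 with \<open>open U\<close> show ?thesis by (simp add: openin_open_Int)
qed

lemma Ti_openin: "openin (top_of_set (psi ` V)) (Ti i)"
 unfolding Ti_def using homeomorphism_imp_open_map[OF psi_hom Vi_open] .

lemma Ti_half: "openin (top_of_set half_space) (Ti i)"
 using openin_trans[OF Ti_openin T_open] .

lemma Phi_smooth: "smooth_on (Ti i) (Phi i)"
 using c i unfolding charts_tube Ti_def Phi_def by blast

lemma Phi_img: "y : Ti i ==> Phi i y : imgN i"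
 unfolding Ti_def using coordN_in[OF i] Phi_psi by auto

lemma at_Ti: "y : Ti i ==> at y within psi ` V = at y within Ti i"
 using at_within_openin[OF Ti_openin] by simp

lemma Dt_Ti: "y : Ti i ==> Dt i y = fd_within (Phi i) (Ti i) y"
 by (simp add: Dt_def at_Ti)

lemma Phi_derivative: "y : Ti i ==> (Phi i has_derivative Dt i y) (at y within Ti i)"
 unfolding Dt_Ti by (rule smooth_on_has_derivative[OF Phi_smooth])

lemma Dt_linear: "y : Ti i ==> linear (Dt i y)"
 using has_derivative_linear[OF Phi_derivative] .

text \<open>A chart of the tube extends smoothly to an open set of product coordinates.
  Differentiating the identity g o \<open>Phi\<close> = id on a thick set shows that the derivative
  of the extension inverts \<open>Dt\<close> from the left.\<close>

lemma psi_ext: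
 assumes p: "p : V" "p : dmN i"
 shows "\<exists>U g. open U & coordN i p : U & (\<forall>k. Ck_on k U g) & (\<forall>q. q : V --> q : dmN i --> coordN i q : U --> g (coordN i q) = psi q) &
 (\<forall>u. frechet_derivative g (at (coordN i p)) (Dt i (psi p) u) = u)"
proof -
 have sm: "smooth_on (coordN i ` (V Int dmN i)) (psi \<circ> param N i)" using c i unfolding charts_tube by blast
 have "coordN i p : coordN i ` (V Int dmN i)" using p by blast
 from smooth_onD[OF sm this] obtain U g where g: "open U" "coordN i p : U" "\<forall>k. Ck_on k U g"
 "\<forall>y. y : coordN i ` (V Int dmN i) --> y : U --> g y = (psi \<circ> param N i) y" by (elim exE conjE) (rule that)
 have gq: "g (coordN i q) = psi q" if "q : V" "q : dmN i" "coordN i q : U" for q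
 proof -
 have "coordN i q : coordN i ` (V Int dmN i)" using that by blast
 then show ?thesis using g(4) that param_N[OF i that(2)] by simp
 qed
 have y: "psi p : Ti i" using p by (auto simp: Ti_def)
 define X where "X = Ti i Int Phi i -` U"
 have X: "openin (top_of_set (Ti i)) X" unfolding X_def
 by (rule continuous_openin_preimage_gen[OF smooth_on_continuous[OF Phi_smooth] g(1)])
 have yX: "psi p : X" using y g(2) Phi_psi[OF p(1)] by (simp add: X_def)
 have tX: "thick X" by (rule thick_openin_half_space[OF openin_trans[OF X Ti_half]])
 have 1: "(Phi i has_derivative Dt i (psi p)) (at (psi p) within X)"
 by (rule has_derivative_subset[OF Phi_derivative[OF y]]) (simp add: X_def)
 have "(g has_derivative frechet_derivative g (at (coordN i p))) (at (Phi i (psi p)) within Phi i ` X)"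
 unfolding Phi_psi[OF p(1)] by (rule has_derivative_at_withinI[OF Ck_on_has_derivative[OF g(3)[rule_format, of "Suc 0"] g(2)]])
 from has_derivative_in_compose[OF 1 this]
 have "((%y. g (Phi i y)) has_derivative (%u. frechet_derivative g (at (coordN i p)) (Dt i (psi p) u))) (at (psi p) within X)" .
 then have "((%y. y) has_derivative (%u. frechet_derivative g (at (coordN i p)) (Dt i (psi p) u))) (at (psi p) within X)"
 proof (rule has_derivative_transform_on[OF _ yX])
 fix y assume y: "y : X"
 then obtain q where "q : V" "q : dmN i" "y = psi q" by (auto simp: X_def Ti_def)
 then show "y = g (Phi i y)" using gq[of q] y by (simp add: X_def Phi_psi)
 qed
 from thick_derivative_unique[OF tX yX this has_derivative_ident]
 have "(%u. frechet_derivative g (at (coordN i p)) (Dt i (psi p) u)) = (%u. u)" .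
 then have "\<forall>u. frechet_derivative g (at (coordN i p)) (Dt i (psi p) u) = u" by (simp add: fun_eq_iff)
 then show ?thesis using g(1-3) gq by - (rule exI[of _ U], rule exI[of _ g], simp)
qed

lemma Dt_surj:
 assumes p: "p : V" "p : dmN i" shows "surj (Dt i (psi p))"
proof -
 obtain g where g: "\<forall>u. frechet_derivative g (at (coordN i p)) (Dt i (psi p) u) = u"
 using psi_ext[OF p] by (elim exE conjE) (rule that)
 have y: "psi p : Ti i" using p by (auto simp: Ti_def)
 have "inj (Dt i (psi p))" by (rule inj_on_inverseI[of _ "frechet_derivative g (at (coordN i p))"]) (simp add: g)
 then show ?thesis by (rule linear_injective_imp_surjective[OF Dt_linear[OF y]]) simp
qed

end

text \<open>Off \<open>Bd\<close> a neighborhood in the product belongs to the tube, so the first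
  chart coordinate, which is 0 at p, has a local minimum there. Its derivative then vanishes,
  against the left inverse of \<open>Dt\<close>.\<close>

lemma zero_fst_Bd:
 assumes p: "p : V" "fst (psi p) = 0" shows "p : Bd"
proof (rule ccontr)
 assume np: "p \<notin> Bd"
 have pS: "p : S" using p V_S by blast
 obtain i where i: "i : Ch" "p : dmN i" using S_chart[OF pS] by (elim exE conjE) (rule that)
 let ?x = "coord W i (fst p)"
 have dp: "fst p : dm i" using i(2) by (simp add: mem_Times_iff)
 have x: "?x : img i" by (rule coord_in[OF i(1) dp])
 obtain t where t: "ang (snd p) t" using ang_exists by blast
 have "fst p \<notin> bdry W"
 proof
 assume w: "fst p : bdry W"
 then have "pi * (cmod (snd p))\<^sup>2 <= 0" using S_iff[OF t] pS H_bdry by simp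
 then have "snd p = 0" using pi_gt_zero by (auto simp: mult_le_0_iff)
 then show False using np bdry_Bd[OF w] by (metis prod.collapse)
 qed
 then have pos: "0 < fst ?x" using bdry_coord[OF i(1) dp] fst_img[OF i(1) x] by simp
 obtain U where U: "open U" "S - Bd = (Pts \<times> UNIV) Int U" using Pos_open by (elim exE conjE) (rule that)
 obtain O2 where O2: "open O2" "V = S Int O2" using V_open by (auto simp: openin_open)
 obtain T where T: "open T" "img i = half_space Int T" using img_open[OF i(1)] by (auto simp: openin_open)
 define X where "X = fp -` (T Int {x. 0 < fst x})"
 have oX: "open X" unfolding X_def
 by (rule open_vimage[OF _ linear_continuous_on[OF bounded_linear_fp]]) (intro open_Int T(1) open_Collect_less continuous_intros)
 have Xi: "X <= imgN i" unfolding X_def T(2) by (auto simp: half_space_def)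
 define X' where "X' = X Int paramN i -` (U Int O2)"
 have oX': "open X'" unfolding X'_def
 by (rule continuous_open_preimage[OF continuous_on_subset[OF continuous_paramN[OF i(1)] Xi] oX open_Int[OF U(1) O2(1)]])
 obtain Ug g where g: "open Ug" "coordN i p : Ug" "\<forall>k. Ck_on k Ug g" "\<forall>q. q : V --> q : dmN i --> coordN i q : Ug --> g (coordN i q) = psi q"
 "\<forall>u. frechet_derivative g (at (coordN i p)) (Dt i (psi p) u) = u" using psi_ext[OF i(1) p(1) i(2)] by (elim exE conjE) (rule that)
 have inX: "coordN i p : X'" unfolding X'_def X_def using x pos T(2) U(2) O2(2) pS np p(1) param_coordN[OF i(1,2)] by simp blast
 have "(g has_derivative frechet_derivative g (at (coordN i p))) (at (coordN i p))"
 by (rule Ck_on_has_derivative[OF g(3)[rule_format, of "Suc 0"] g(2)])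
 from has_derivative_fst[OF this]
 have d: "((%y. fst (g y)) has_derivative (%u. fst (frechet_derivative g (at (coordN i p)) u))) (at (coordN i p))" .
 have "\<forall>\<^sub>F y in at (coordN i p). y : X' Int Ug"
 by (rule eventually_at_in_open'[OF open_Int[OF oX' g(1)]]) (use inX g(2) in simp)
 then have "\<forall>\<^sub>F y in at (coordN i p). fst (g (coordN i p)) <= fst (g y)"
 proof eventually_elim
 fix y assume y: "y : X' Int Ug"
 then have yi: "y : imgN i" using Xi by (auto simp: X'_def)
 have "paramN i y : (Pts \<times> UNIV) Int U" using y param_points[OF i(1)] yi by (simp add: X'_def paramN_def)
 then have "paramN i y : V" using U(2) O2(2) y by (auto simp: X'_def)
 then have "g y = psi (paramN i y)" "0 <= fst (psi (paramN i y))" using g(4) y coord_paramN[OF i(1) yi] paramN_in[OF i(1) yi] fst_psi by force+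
 moreover have "g (coordN i p) = psi p" using g(2,4) p(1) i(2) by blast
 ultimately show "fst (g (coordN i p)) <= fst (g y)" using p(2) by simp
 qed
 from has_derivative_local_min[OF d this]
 have "fst (frechet_derivative g (at (coordN i p)) (Dt i (psi p) (1, 0))) = 0" by (rule fun_cong)
 then show False using g(5) by simp
qed

text \<open>The converse minimum argument: at an interior point of the chart, F in chart coordinates
  is nonnegative nearby and 0 at p, so \<open>dF\<close> vanishes on the range of \<open>Dt\<close>,
  which is everything.\<close>

lemma Bd_fst_zero:
 assumes p: "p : V" "p : Bd" shows "fst (psi p) = 0"
proof (rule ccontr)
 assume "fst (psi p) ~= 0"
 then have pos: "0 < fst (psi p)" using fst_psi[OF p(1)] by simp
 obtain i where i: "i : Ch" "p : dmN i" using S_chart[of p] V_S p(1) by blast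
 obtain t where t: "ang (snd p) t" using ang_exists by blast
 obtain Om F where LF: "local_fn i t p Om F" using local_fn_exists[OF i(1) p(2) i(2) t] by (elim exE) (rule that)
 note L = LF[unfolded local_fn_def]
 have y: "psi p : Ti i" using p(1) i(2) by (auto simp: Ti_def)
 obtain T where T: "open T" "Ti i = half_space Int T" using Ti_half[OF i(1)] by (auto simp: openin_open)
 define X where "X = T Int {x. 0 < fst x}"
 have oX: "open X" unfolding X_def by (intro open_Int T(1) open_Collect_less continuous_intros)
 have yX: "psi p : X" using y T(2) pos by (simp add: X_def)
 have XT: "X <= Ti i" unfolding X_def T(2) by (auto simp: half_space_def)
 have Pd: "(Phi i has_derivative Dt i (psi p)) (at (psi p))"
 using has_derivative_subset[OF Phi_derivative[OF i(1) y] XT] at_within_open[OF yX oX] by simp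
 have FD: "(F has_derivative dF i t (coordN i p)) (at (Phi i (psi p)))" using L by (simp add: Phi_psi[OF p(1)])
 from has_derivative_compose[OF Pd FD]
 have d: "((%y. F (Phi i y)) has_derivative (%u. dF i t (coordN i p) (Dt i (psi p) u))) (at (psi p))" .
 have "continuous_on X (Phi i)" using continuous_on_subset[OF smooth_on_continuous[OF Phi_smooth[OF i(1)]] XT] .
 then have oX': "open (X Int Phi i -` Om)" using L by (intro continuous_open_preimage[OF _ oX]) simp_all
 have "\<forall>\<^sub>F y in at (psi p). y : X Int Phi i -` Om"
 by (rule eventually_at_in_open'[OF oX']) (use yX L Phi_psi[OF p(1)] in simp)
 then have "\<forall>\<^sub>F y in at (psi p). F (Phi i (psi p)) <= F (Phi i y)"
 proof eventually_elim
 fix y assume y: "y : X Int Phi i -` Om"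
 then have "y : psi ` (V Int dmN i)" using XT unfolding Ti_def by blast
 then obtain q where q: "q : V" "q : dmN i" "y = psi q" by blast
 have "paramN i (Phi i y) = q" unfolding q(3) Phi_psi[OF q(1)] by (rule param_coordN[OF i(1) q(2)])
 then have "paramN i (Phi i y) : S" using q(1) V_S by blast
 moreover have "Phi i y : imgN i" unfolding q(3) Phi_psi[OF q(1)] by (rule coordN_in[OF i(1) q(2)])
 moreover note y
 ultimately have "0 <= F (Phi i y)" using L by blast
 moreover have "F (Phi i (psi p)) = 0"
 proof -
 have "paramN i (coordN i p) : Bd" "coordN i p : imgN i" using p(2) param_coordN[OF i] coordN_in[OF i] by (simp_all del: fp_coordN)
 then show ?thesis using L Phi_psi[OF p(1)] by metis
 qed
 ultimately show "F (Phi i (psi p)) <= F (Phi i y)" by simp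
 qed
 from has_derivative_local_min[OF d this] have z: "dF i t (coordN i p) (Dt i (psi p) u) = 0" for u by (rule fun_cong)
 obtain u where "dF i t (coordN i p) u ~= 0" using dF_nonzero[OF i(1) p(2) i(2)] by blast
 moreover obtain u' where "u = Dt i (psi p) u'" using Dt_surj[OF i(1) p(1) i(2)] by (metis surjD)
 ultimately show False using z by simp
qed

text \<open>The hyperplane of a tube chart is carried into the zero set of F, so \<open>dF\<close>
  pulled back to the chart kills all directions with first component 0. It is nonzero, as
  \<open>Dt\<close> is surjective.\<close>

lemma dF_Dt:
 assumes p: "p : V" "p : Bd" and i: "i : Ch" "p : dmN i" and t: "ang (snd p) t"
 shows "\<exists>a. a ~= 0 & (\<forall>u. dF i t (coordN i p) (Dt i (psi p) u) = a * fst u)"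
proof -
 obtain Om F where LF: "local_fn i t p Om F" using local_fn_exists[OF i(1) p(2) i(2) t] by (elim exE) (rule that)
 note L = LF[unfolded local_fn_def]
 have y: "psi p : Ti i" using p(1) i(2) by (auto simp: Ti_def)
 have y0: "fst (psi p) = 0" by (rule Bd_fst_zero[OF p])
 obtain T where T: "open T" "Ti i = half_space Int T" using Ti_half[OF i(1)] by (auto simp: openin_open)
 have "openin (top_of_set (Ti i)) (Ti i Int Phi i -` Om)"
 by (rule continuous_openin_preimage_gen[OF smooth_on_continuous[OF Phi_smooth[OF i(1)]]]) (use L in simp)
 from openin_trans[OF this Ti_half[OF i(1)]] obtain T where T: "open T" "Ti i Int Phi i -` Om = half_space Int T"
 by (auto simp: openin_open)
 have Fz: "F (Phi i y) = 0" if "y : half_space Int T" "fst y = 0" for y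
 proof -
 have "y : psi ` (V Int dmN i)" "Phi i y : Om" using that(1) unfolding T(2)[symmetric] Ti_def by blast+
 then obtain q where q: "q : V" "q : dmN i" "y = psi q" "Phi i y : Om" by blast
 have "q : Bd" using zero_fst_Bd[OF q(1)] q(3) that(2) by simp
 then have "paramN i (coordN i q) : Bd" "coordN i q : imgN i" using param_coordN[OF i(1) q(2)] coordN_in[OF i(1) q(2)] by (simp_all del: fp_coordN)
 then show ?thesis using L q Phi_psi[OF q(1)] by metis
 qed
 have FD: "(F has_derivative dF i t (coordN i p)) (at (Phi i (psi p)) within Phi i ` Ti i)"
 using L by (simp add: Phi_psi[OF p(1)] has_derivative_at_withinI)
 from has_derivative_in_compose[OF Phi_derivative[OF i(1) y] this]
 have d: "((%y. F (Phi i y)) has_derivative (%u. dF i t (coordN i p) (Dt i (psi p) u))) (at (psi p) within Ti i)" .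
 have yT: "psi p : half_space Int T" unfolding T(2)[symmetric] using y L Phi_psi[OF p(1)] by simp
 have tang: "dF i t (coordN i p) (Dt i (psi p) (0, b)) = 0" for b
 proof (rule has_derivative_const_line[OF d, of "(%r. psi p + r *\<^sub>R (0, b)) -` T"])
 show "open ((%r. psi p + r *\<^sub>R (0, b)) -` T)" by (intro open_vimage T(1) continuous_intros)
 show "0 : (%r. psi p + r *\<^sub>R (0, b)) -` T" using yT by (simp add: zero_prod_def[symmetric])
 fix r assume "r : (%r. psi p + r *\<^sub>R (0, b)) -` T"
 then have h: "psi p + r *\<^sub>R (0, b) : half_space Int T" using y0 by (simp add: half_space_def)
 then have "psi p + r *\<^sub>R (0, b) : Ti i" using T(2) by blast
 then show "psi p + r *\<^sub>R (0, b) : Ti i & F (Phi i (psi p + r *\<^sub>R (0, b))) = F (Phi i (psi p))"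
 using Fz[OF h] Fz[OF yT y0] y0 by simp
 qed
 have l: "linear (%u. dF i t (coordN i p) (Dt i (psi p) u))" using has_derivative_linear[OF d] .
 have eq: "dF i t (coordN i p) (Dt i (psi p) u) = dF i t (coordN i p) (Dt i (psi p) (1, 0)) * fst u" for u
 proof -
 have "u = fst u *\<^sub>R (1, 0) + (0, snd u)" by (simp add: prod_eq_iff)
 then show ?thesis using linear_add[OF l] linear_cmul[OF l] tang by (metis add.right_neutral mult.commute real_scaleR_def)
 qed
 obtain u where u: "dF i t (coordN i p) u ~= 0" using dF_nonzero[OF i(1) p(2) i(2)] by blast
 obtain u' where u': "u = Dt i (psi p) u'" using Dt_surj[OF i(1) p(1) i(2)] by (metis surjD)
 have "dF i t (coordN i p) (Dt i (psi p) (1, 0)) ~= 0" using u eq[of u'] u' by auto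
 with eq show ?thesis by blast
qed

end

lemma bdry_tube: "c : charts TB ==> fst c Int bdry TB = fst c Int Bd"
 unfolding bdry_def chart_dom_tube coord_tube using zero_fst_Bd Bd_fst_zero by blast

text \<open>The defining function F becomes the first coordinate after straightening. The part of
  the straightened neighborhood lying in the half-space is then exactly the tube.\<close>

lemma chart_exists:
 assumes p: "p : Bd" shows "\<exists>c\<in>charts TB. p : fst c"
proof -
 obtain i where i: "i : Ch" "p : dmN i" using S_chart[of p] Bd_subset p by blast
 obtain t where t: "ang (snd p) t" using ang_exists by blast
 obtain Om F where LF: "local_fn i t p Om F" using local_fn_exists[OF i(1) p i(2) t] by (elim exE) (rule that)
 note L = LF[unfolded local_fn_def]
 have "frechet_derivative F (at (coordN i p)) = dF i t (coordN i p)" using L by (simp add: frechet_derivative_at[symmetric])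
 then obtain u where u: "frechet_derivative F (at (coordN i p)) u ~= 0" using dF_nonzero[OF i(1) p i(2), of t] by auto
 have L1: "open Om" "coordN i p : Om" "!!k. Ck_on k Om F" using L by blast+
 obtain U V0 g and psi0 :: "real \<times> ('f \<times> complex) => real \<times> ('f \<times> complex)" where U: "open U" "coordN i p : U" "U <= Om" "open V0" "homeomorphism U V0 psi0 g" "\<forall>k. Ck_on k U psi0"
 "\<forall>k. Ck_on k V0 g" "\<forall>y\<in>U. fst (psi0 y) = F y"
 using straighten[OF L1 u] by (elim exE conjE) (rule that)
 note hom = homeomorphism_apply1[OF U(5)] homeomorphism_apply2[OF U(5)] homeomorphism_image1[OF U(5)] homeomorphism_image2[OF U(5)]
 define V where "V = {q. q : S & q : dmN i & coordN i q : U}"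
 define psi where "psi = (%q. psi0 (coordN i q))"
 have Vd: "q : S" "q : dmN i" "coordN i q : U" if "q : V" for q using that unfolding V_def by blast+
 have VI: "paramN i y : V" "coordN i (paramN i y) = y" if "y : U" "0 <= F y" for y
 proof -
 have "y : imgN i & paramN i y : S" using L U(3) that by blast
 then show "paramN i y : V" "coordN i (paramN i y) = y" using that(1) paramN_in[OF i(1)] coord_paramN[OF i(1)] unfolding V_def by auto
 qed
 have VF: "0 <= F (coordN i q)" if "q : V" for q
 proof -
 have "coordN i q : imgN i & paramN i (coordN i q) : S" using Vd[OF that] coordN_in[OF i(1)] param_coordN[OF i(1)] by metis
 then show ?thesis using L U(3) Vd(3)[OF that] by blast
 qed
 have psiV: "psi ` V = half_space Int V0"
 proof (intro equalityI subsetI)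
 fix y assume "y : psi ` V"
 then obtain q where q: "q : V" "y = psi q" by blast
 have "y : V0" using hom(3) Vd(3)[OF q(1)] unfolding q(2) psi_def by blast
 moreover have "0 <= fst y" using U(8) Vd(3)[OF q(1)] VF[OF q(1)] unfolding q(2) psi_def by simp
 ultimately show "y : half_space Int V0" by (simp add: half_space_def)
 next
 fix y assume y: "y : half_space Int V0"
 have gU: "g y : U" using hom(4) y by blast
 have "fst (psi0 (g y)) = F (g y)" using U(8) gU by blast
 moreover have "psi0 (g y) = y" by (rule hom(2)) (use y in blast)
 ultimately have "F (g y) = fst y" by simp
 then have F: "0 <= F (g y)" using y by (simp add: half_space_def)
 have "y = psi (paramN i (g y))" unfolding psi_def VI(2)[OF gU F] using hom(2) y by simp
 then show "y : psi ` V" using VI(1)[OF gU F] by blast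
 qed
 have cV: "continuous_on V (coordN i)" by (rule continuous_on_subset[OF continuous_coordN[OF i(1)]]) (use Vd(2) in blast)
 have gpsi: "g (psi q) = coordN i q" if "q : V" for q unfolding psi_def by (rule hom(1)[OF Vd(3)[OF that]])
 have hm: "homeomorphism V (psi ` V) psi (%y. paramN i (g y))"
 proof (rule homeomorphismI)
 show "continuous_on V psi" unfolding psi_def
 by (rule continuous_on_compose2[OF homeomorphism_cont1[OF U(5)] cV]) (use Vd(3) in blast)
 have "continuous_on (psi ` V) g" by (rule continuous_on_subset[OF homeomorphism_cont2[OF U(5)]]) (use psiV in blast)
 then show "continuous_on (psi ` V) (%y. paramN i (g y))"
 proof (rule continuous_on_compose2[OF continuous_paramN[OF i(1)]])
 show "g ` psi ` V <= imgN i"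
 unfolding image_image
 proof (intro image_subsetI)
 fix q assume "q : V"
 then show "g (psi q) : imgN i" unfolding gpsi[OF \<open>q : V\<close>] by (intro coordN_in[OF i(1)] Vd(2))
 qed
 qed
 show pc: "paramN i (g (psi q)) = q" if "q : V" for q unfolding gpsi[OF that] by (rule param_coordN[OF i(1) Vd(2)[OF that]])
 show "(%y. paramN i (g y)) ` psi ` V <= V"
 unfolding image_image
 proof (intro image_subsetI)
 fix q assume "q : V" then show "paramN i (g (psi q)) : V" using pc by simp
 qed
 show "psi (paramN i (g y)) = y" if yV: "y : psi ` V" for y
 proof -
 obtain q where "q : V" "y = psi q" using yV by blast
 then show ?thesis using pc by simp
 qed
 qed simp
 have iv: "inv_into V psi (psi q) = q" if "q : V" for q
 using homeomorphism_apply1[OF homeomorphism_inv_into[OF hm] that] .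
 have "(V, psi) : charts TB"
 unfolding charts_tube fst_conv snd_conv
 proof (intro conjI ballI)
 obtain O1 where O1: "open O1" "dmN i = (Pts \<times> UNIV) Int O1" using dmN_open[OF i(1)] by (auto simp: openin_open)
 have 1: "openin (top_of_set S) (S Int dmN i)" using O1 S_Pts by (metis (no_types, lifting) Int_absorb2 Int_assoc openin_open_Int)
 have "continuous_on (S Int dmN i) (coordN i)" by (rule continuous_on_subset[OF continuous_coordN[OF i(1)]]) simp
 from continuous_openin_preimage_gen[OF this U(1)] have "openin (top_of_set (S Int dmN i)) ((S Int dmN i) Int coordN i -` U)" .
 moreover have "(S Int dmN i) Int coordN i -` U = V" unfolding V_def by blast
 ultimately show "openin (top_of_set S) V" using openin_trans[OF _ 1] by simp
 show "openin (top_of_set half_space) (psi ` V)" unfolding psiV using U(4) by (simp add: openin_open_Int)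
 show "homeomorphism V (psi ` V) psi (inv_into V psi)" by (rule homeomorphism_inv_into[OF hm])
 fix j assume j: "j : Ch"
 let ?A = "coordN j ` (V Int dmN j)"
 have Aj: "?A <= {y. fp y : trans_dom j i}"
 proof (intro image_subsetI CollectI)
 fix q assume "q : V Int dmN j"
 then have "fst q : dm j Int dm i" using Vd(2) by (auto simp: mem_Times_iff)
 then show "fp (coordN j q) : trans_dom j i" unfolding fp_coordN trans_dom_def by blast
 qed
 have tj: "tranN j i (coordN j q) = coordN i q" if "q : V Int dmN j" for q using tranN_coordN[OF j] that by blast
 have "smooth_on ?A (%y. psi0 (tranN j i y))"
 proof (rule smooth_on_compose[OF smooth_on_subset[OF tranN_smooth[OF j i(1)] Aj] smooth_on_open[OF U(1) U(6)[rule_format]]])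
 show "tranN j i ` ?A <= U"
 unfolding image_image
 proof (intro image_subsetI)
 fix q assume q: "q : V Int dmN j" then show "tranN j i (coordN j q) : U" unfolding tj[OF q] using Vd(3) by blast
 qed
 qed
 then show "smooth_on ?A (psi \<circ> param N j)"
 proof (rule smooth_on_cong)
 fix y assume "y : ?A"
 then obtain q where q: "q : V Int dmN j" "y = coordN j q" by blast
 have "param N j (coordN j q) = q" using param_N[OF j] q(1) by blast
 then show "psi0 (tranN j i y) = (psi \<circ> param N j) y" unfolding q(2) tj[OF q(1)] psi_def o_def by simp
 qed
 let ?B = "psi ` (V Int dmN j)"
 have "smooth_on ?B g" by (rule smooth_on_subset[OF smooth_on_open[OF U(4) U(7)[rule_format]]]) (use psiV in blast)
 then have "smooth_on ?B (%y. tranN i j (g y))"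
 proof (rule smooth_on_compose[OF _ tranN_smooth[OF i(1) j]])
 show "g ` ?B <= {y. fp y : trans_dom i j}"
 unfolding image_image
 proof (intro image_subsetI CollectI)
 fix q assume q: "q : V Int dmN j"
 then have "fst q : dm i Int dm j" using Vd(2) by (auto simp: mem_Times_iff)
 then have "fp (coordN i q) : trans_dom i j" unfolding fp_coordN trans_dom_def by blast
 then show "fp (g (psi q)) : trans_dom i j" using gpsi q by simp
 qed
 qed
 then show "smooth_on ?B (coordN j \<circ> inv_into V psi)"
 proof (rule smooth_on_cong)
 fix y assume "y : ?B"
 then obtain q where q: "q : V Int dmN j" "y = psi q" by blast
 then have "inv_into V psi y = q" "g y = coordN i q" using iv gpsi by auto
 moreover have "tranN i j (coordN i q) = coordN j q" using tranN_coordN[OF i(1) Vd(2)] q(1) by blast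
 ultimately show "tranN i j (g y) = (coordN j \<circ> inv_into V psi) y" by simp
 qed
 qed
 moreover have "p : V" unfolding V_def using p Bd_subset i(2) U(2) by blast
 ultimately show ?thesis by (intro bexI[of _ "(V, psi)"]) simp_all
qed

abbreviation "BA \<equiv> bdry_atlas TB"

lemma BA_simps: "charts BA = charts TB" "chart_dom BA c = fst c Int bdry TB" "coord BA c p = snd (snd c p)"
 by (simp_all add: bdry_atlas_def chart_dom_tube coord_tube)

lemma dom_BA: "c : charts TB ==> chart_dom BA c = fst c Int Bd"
 by (simp add: BA_simps bdry_tube)

lemma points_BA: "points BA = Bd"
 unfolding points_def BA_simps(1) using dom_BA chart_exists by blast

section \<open>The contact form in charts\<close>

abbreviation "\<beta> \<equiv> bdry_form (tube_form W lam)"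

lemma fd_tranN:
 assumes i: "i : Ch" "j : Ch" and y: "fp y : trans_dom i j"
 shows "(tranN i j has_derivative (%u. asc (dtrans i j (fp y) (fp u)) (zp u))) (at y within {y. fp y : trans_dom i j})"
proof -
 have "(tran i j has_derivative dtrans i j (fp y)) (at (fp y) within fp ` {y. fp y : trans_dom i j})"
 by (rule has_derivative_subset[OF dtrans[OF i y]]) (use trans_dom_eq[OF i] in blast)
 from has_derivative_in_compose[OF bounded_linear_imp_has_derivative[OF bounded_linear_fp] this]
 have "((%y. tran i j (fp y)) has_derivative (%u. dtrans i j (fp y) (fp u))) (at y within {y. fp y : trans_dom i j})" .
 from has_derivative_asc[OF this bounded_linear_imp_has_derivative[OF bounded_linear_zp]] show ?thesis
 unfolding tranN_def .
qed

context
 fixes c assumes c: "c : charts TB"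
begin

text \<open>The pullback of the product form to a chart of the tube is the same through any two
  product charts: compare the derivatives of the transition maps on the overlap.\<close>

lemma lamN_Dt:
 assumes p: "p : fst c" and i: "i : Ch" "p : dmN i" and j: "j : Ch" "p : dmN j"
 shows "lamN i (coordN i p) (Dt c i (snd c p) u) = lamN j (coordN j p) (Dt c j (snd c p) u)"
proof -
 let ?y = "snd c p"
 have yi: "?y : Ti c i" "?y : Ti c j" using p i j unfolding Ti_def[OF c] by blast+
 define X where "X = Ti c i Int Ti c j"
 have X: "openin (top_of_set half_space) X" unfolding X_def by (rule openin_Int[OF Ti_half[OF c i(1)] Ti_half[OF c j(1)]])
 have XE: "\<exists>q. q : fst c & q : dmN i & q : dmN j & y = snd c q" if yX: "y : X" for y
 proof -
 obtain q q' where q: "q : fst c" "q : dmN i" "y = snd c q" "q' : fst c" "q' : dmN j" "y = snd c q'"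
 using yX unfolding X_def Ti_def[OF c] by blast
 then have "q = q'" using inv_psi[OF c q(1)] inv_psi[OF c q(4)] by simp
 then show ?thesis using q by blast
 qed
 have tr: "fp (Phi c i y) : trans_dom i j" "tranN i j (Phi c i y) = Phi c j y" if yX: "y : X" for y
 proof -
 obtain q where q: "q : fst c" "q : dmN i" "q : dmN j" "y = snd c q" using XE[OF yX] by (elim exE conjE) (rule that)
 have "fst q : dm i Int dm j" using q by (auto simp: mem_Times_iff)
 then show "fp (Phi c i y) : trans_dom i j" unfolding q(4) Phi_psi[OF c q(1)] fp_coordN trans_dom_def by blast
 show "tranN i j (Phi c i y) = Phi c j y" unfolding q(4) Phi_psi[OF c q(1)] by (rule tranN_coordN[OF i(1) q(2)])
 qed
 have yX: "?y : X" using yi by (simp add: X_def)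
 have 1: "(Phi c i has_derivative Dt c i ?y) (at ?y within X)"
 by (rule has_derivative_subset[OF Phi_derivative[OF c i(1) yi(1)]]) (simp add: X_def)
 have "(tranN i j has_derivative (%u. asc (dtrans i j (fp (Phi c i ?y)) (fp u)) (zp u))) (at (Phi c i ?y) within Phi c i ` X)"
 by (rule has_derivative_subset[OF fd_tranN[OF i(1) j(1) tr(1)[OF yX]]]) (use tr(1) in blast)
 from has_derivative_in_compose[OF 1 this]
 have "((%y. tranN i j (Phi c i y)) has_derivative (%u. asc (dtrans i j (fp (Phi c i ?y)) (fp (Dt c i ?y u))) (zp (Dt c i ?y u)))) (at ?y within X)" .
 then have 2: "(Phi c j has_derivative (%u. asc (dtrans i j (fp (Phi c i ?y)) (fp (Dt c i ?y u))) (zp (Dt c i ?y u)))) (at ?y within X)"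
 by (rule has_derivative_transform_on[OF _ yX]) (simp add: tr(2))
 have "(Phi c j has_derivative Dt c j ?y) (at ?y within X)"
 by (rule has_derivative_subset[OF Phi_derivative[OF c j(1) yi(2)]]) (simp add: X_def)
 from thick_derivative_unique[OF thick_openin_half_space[OF X] yX this 2]
 have D: "Dt c j ?y u = asc (dtrans i j (coord W i (fst p)) (fp (Dt c i ?y u))) (zp (Dt c i ?y u))"
 by (simp add: Phi_psi[OF c p])
 have "coord W i (fst p) : trans_dom i j" using tr(1)[OF yX] by (simp add: Phi_psi[OF c p])
 from lam_trans[OF i(1) j(1) this] show ?thesis
 using param_coord[OF i(1), of "fst p"] i(2) by (simp add: lamN_def D tran_def mem_Times_iff)
qed

text \<open>The definition of the form picks an unspecified product chart; this replaces it by any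
  chart at hand.\<close>

lemma beta_chart:
 assumes p: "p : fst c" "p : Bd" and i: "i : Ch" "p : dmN i"
 shows "\<beta> c (snd (snd c p)) u = lamN i (coordN i p) (Dt c i (snd c p) (0, u))"
proof -
 have z: "(0, snd (snd c p)) = snd c p" using Bd_fst_zero[OF c p] by (metis prod.collapse)
 have "p : points N" unfolding points_def using i by auto
 define j where "j = some_chart N p"
 have "j : Ch & p : dmN j" unfolding j_def some_chart_def charts_N chart_dom_N by (rule someI[of _ i]) (use i in simp)
 then have j: "j : Ch" "p : dmN j" by auto
 have "\<beta> c (snd (snd c p)) u = lamN j (coordN j p) (Dt c j (snd c p) (0, u))"
 unfolding bdry_form_def z tube_form_def domain_form_def case_prod_unfold Let_def inv_psi[OF c p(1)] j_def[symmetric]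
 hat_form_lamN coord_N Dt_def[OF c] Phi_def[OF c] ..
 then show ?thesis using lamN_Dt[OF p(1) i j] by simp
qed

lemma chart_img_BA: "chart_img BA c = {y. (0, y) : snd c ` fst c}"
proof (intro set_eqI iffI)
 fix y assume "y : chart_img BA c"
 then obtain p where p: "p : fst c" "p : Bd" "y = snd (snd c p)" unfolding chart_img_def dom_BA[OF c] BA_simps(3) by blast
 then have "(0, y) = snd c p" using Bd_fst_zero[OF c p(1,2)] by (metis prod.collapse)
 then show "y : {y. (0, y) : snd c ` fst c}" using p(1) by blast
next
 fix y assume "y : {y. (0, y) : snd c ` fst c}"
 then obtain p where p: "p : fst c" "(0, y) = snd c p" by blast
 have "p : Bd" by (rule zero_fst_Bd[OF c p(1)]) (simp add: p(2)[symmetric])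
 then have "p : fst c Int Bd" "y = snd (snd c p)" using p by (auto simp: p(2)[symmetric])
 then show "y : chart_img BA c" unfolding chart_img_def dom_BA[OF c] BA_simps(3) by blast
qed

text \<open>The part of the image of the boundary chart c that the product chart i sees; it is open,
  and \<open>Phi\<close> restricted to it parametrizes the hypersurface.\<close>

definition Bi :: "'i => ('f \<times> complex) set" where "Bi i = {y. (0, y) : Ti c i}"

lemma open_slice: "openin (top_of_set half_space) A ==> open {y :: 'f \<times> complex. (0, y) : A}"
proof -
 assume "openin (top_of_set half_space) A"
 then obtain T where T: "open T" "A = half_space Int T" by (auto simp: openin_open)
 have "{y :: 'f \<times> complex. (0, y) : A} = (%y. (0, y)) -` T" unfolding T(2) by (auto simp: half_space_def)
 then show ?thesis using open_vimage[OF T(1), of "%y. (0, y)"] by (simp add: continuous_intros)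
qed

context
 fixes i assumes i: "i : Ch"
begin

lemma Bi_open: "open (Bi i)"
 unfolding Bi_def by (rule open_slice[OF Ti_half[OF c i]])

lemma Bi_E: assumes "y : Bi i" shows "\<exists>p. p : fst c & p : Bd & p : dmN i & snd c p = (0, y)"
proof -
 obtain p where p: "p : fst c" "p : dmN i" "snd c p = (0, y)" using assms unfolding Bi_def Ti_def[OF c] by auto
 then show ?thesis using zero_fst_Bd[OF c p(1)] by auto
qed

lemma Bi_derivative:
 assumes y: "y : Bi i" shows "fd_within (%y. Phi c i (0, y)) (Bi i) y u = Dt c i (0, y) (0, u)"
proof -
 have 1: "((%y. (0, y)) has_derivative (%u. (0, u))) (at y within Bi i)" by (auto intro!: derivative_eq_intros)
 have "(Phi c i has_derivative Dt c i (0, y)) (at (0, y) within (%y. (0, y)) ` Bi i)"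
 by (rule has_derivative_subset[OF Phi_derivative[OF c i]]) (use y in \<open>auto simp: Bi_def\<close>)
 from has_derivative_in_compose[OF 1 this]
 have "((%y. Phi c i (0, y)) has_derivative (%u. Dt c i (0, y) (0, u))) (at y within Bi i)" .
 from thick_frechet_eq[OF thick_open[OF Bi_open] y this] show ?thesis by simp
qed

lemma Bi_smooth: "smooth_on (Bi i) (%y. Phi c i (0, y))"
proof (rule smooth_on_compose[OF _ Phi_smooth[OF c i]])
 show "smooth_on (Bi i) (%y. (0, y))"
 by (rule smooth_on_open[OF Bi_open]) (intro Ck_on_Pair Bi_open Ck_on_const Ck_on_ident)
 show "(%y. (0, y)) ` Bi i <= Ti c i" by (auto simp: Bi_def)
qed

lemma beta_Bi:
 assumes y: "y : Bi i" shows "\<beta> c y u = lamN i (Phi c i (0, y)) (Dt c i (0, y) (0, u))"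
proof -
 obtain p where p: "p : fst c" "p : Bd" "p : dmN i" "snd c p = (0, y)" using Bi_E[OF y] by (elim exE conjE) (rule that)
 from beta_chart[OF p(1,2) i p(3), of u] Phi_psi[OF c p(1), of i] show ?thesis by (simp add: p(4))
qed

text \<open>Naturality of the exterior derivative along the parametrization y ->
  \<open>Phi c i (0, y)\<close> of the hypersurface.\<close>

lemma dbeta_Bi:
 assumes y: "y : Bi i"
 shows "ext_d BA \<beta> c y u v = omN i (Phi c i (0, y)) (Dt c i (0, y) (0, u)) (Dt c i (0, y) (0, v))"
proof -
 have sub: "Phi c i (0, y) : imgN i" if "y : Bi i" for y using Phi_img[OF c i, of "(0, y)"] that by (simp add: Bi_def)
 have op: "open (chart_img BA c)" unfolding chart_img_BA by (rule open_slice[OF T_open[OF c]])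
 have yc: "y : chart_img BA c" unfolding chart_img_BA using y Ti_def[OF c] by (auto simp: Bi_def)
 have at: "at y within chart_img BA c = at y within Bi i"
 unfolding at_within_open[OF yc op] at_within_open[OF y Bi_open] ..
 have "(%y. Phi c i (0, y)) ` Bi i <= imgN i" using sub by blast
 from ext_derivative_pullback[OF thick_open[OF Bi_open] thick_imgN[OF i] Bi_smooth this lamN_linear[OF i] lamN_smooth[OF i] _ y,
 of "\<beta> c" v u]
 have "ext_d BA \<beta> c y u v = omN i (Phi c i (0, y)) (fd_within (%y. Phi c i (0, y)) (Bi i) y u) (fd_within (%y. Phi c i (0, y)) (Bi i) y v)"
 unfolding ext_d_def at dlamN[OF i sub[OF y]] using beta_Bi Bi_derivative by simp
 then show ?thesis unfolding Bi_derivative[OF y] .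
qed

end

end

end

section \<open>Reeb orbits on the boundary of the tube\<close>

context ham
begin

context
 fixes i p t v k
 assumes i: "i : Ch" "p : dmN i" and p: "p : Bd" and t: "ang (snd p) t"
 and om: "!!b. omN i (coordN i p) v b = k * dF i t (coordN i p) b" and lm: "lamN i (coordN i p) v = 1"
begin

text \<open>Throughout this block v is a vector normalized by the product form whose contraction
  with the symplectic form is k \<open>dF\<close>; Reeb vectors turn out to be of this kind. Here
  the relation is tested on vectors without complex component.\<close>

lemma reeb_om: "om i (coord W i (fst p)) (fp v) a = k * DH i (t, coord W i (fst p)) (0, a)"
 using om[of "asc a 0"] by (simp add: omN_def dF_def)

lemma reeb_in: "coord W i (fst p) : img i"
 by (rule coord_in[OF i(1)]) (use i(2) in \<open>simp add: mem_Times_iff\<close>)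

text \<open>The relation tested on the radial vector z. Dividing by |z|^2 shows that the orbit turns
  with angular speed 2 \<pi> k.\<close>

lemma reeb_wC: "wC (snd p) (zp v) = 2 * pi * k * (cmod (snd p))\<^sup>2"
proof -
 have "om i (coord W i (fst p)) (fp v) 0 = 0" by (rule linear_0[OF om_linear(1)[OF i(1) reeb_in]])
 moreover have "DH i (t, coord W i (fst p)) 0 = 0" by (rule linear_0[OF DH_linear[OF i(1) reeb_in]])
 ultimately have "wC (zp v) (snd p) = - (2 * pi * k * (cmod (snd p))\<^sup>2)"
 using om[of "asc 0 (snd p)"] by (simp add: omN_def dF_def inner_self_cmod zero_prod_def)
 then show ?thesis using wC_skew[of "snd p" "zp v"] by simp
qed

text \<open>The W part contributes \<lambda>(v) = \<omega>(Y, v) = -k dH(Y) and the plane part k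
  \<pi>|z|^2 = k H. Together they are k \<tau>, and the normalization of v makes this 1.\<close>

lemma reeb_tau: "k * tau t (fst p) = 1"
proof -
 let ?x = "coord W i (fst p)"
 have "lam i ?x (fp v) = om i ?x (Y i ?x) (fp v)" using Y[OF i(1) reeb_in] by simp
 also have "\<dots> = - om i ?x (fp v) (Y i ?x)" by (rule om_skew)
 finally have "lam i ?x (fp v) = - k * DH i (t, ?x) (0, Y i ?x)" by (simp add: reeb_om)
 then have "k * (pi * (cmod (snd p))\<^sup>2 - DH i (t, ?x) (0, Y i ?x)) = 1"
 using lm reeb_wC by (simp add: lamN_def algebra_simps)
 moreover have "tau t (fst p) = pi * (cmod (snd p))\<^sup>2 - DH i (t, ?x) (0, Y i ?x)"
 using tau_chart[OF i(1) reeb_in, of t] param_coord[OF i(1), of "fst p"] i(2) Bd_iff[OF t] p by (simp add: Hc_def mem_Times_iff)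
 ultimately show ?thesis by simp
qed

text \<open>The relation tested on the complex component of v itself: the area term vanishes,
  autonomy removes the time term, and k is nonzero. So |z| does not change to first order.\<close>

lemma reeb_radial:
 assumes "!!r. H r (fst p) = H t (fst p)" shows "snd p \<bullet> zp v = 0"
proof -
 have par: "param W i (coord W i (fst p)) = fst p" using param_coord[OF i(1), of "fst p"] i(2) by (simp add: mem_Times_iff)
 have "DH i (t, coord W i (fst p)) (s, 0) = 0" for s
 by (rule DH_time[OF i(1) reeb_in]) (use assms in \<open>simp add: Hc_def par\<close>)
 moreover have "om i (coord W i (fst p)) (fp v) 0 = 0" by (rule linear_0[OF om_linear(1)[OF i(1) reeb_in]])
 ultimately have "k * (2 * pi * (snd p \<bullet> zp v)) = 0" using om[of "asc 0 (zp v)"] by (simp add: omN_def dF_def)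
 then show ?thesis using reeb_tau by auto
qed

end

text \<open>A Reeb vector pushed to the product annihilates, through the symplectic form, all
  vectors tangent to the boundary, which form the kernel of \<open>dF\<close>. Its contraction is
  therefore a multiple of \<open>dF\<close>.\<close>

lemma reeb_curve:
 assumes gam: "reeb_orbit BA \<beta> gam" and i: "i : Ch" "gam s : dmN i" and t: "ang (snd (gam s)) t"
 shows "\<exists>v k. (coordN i \<circ> gam has_vector_derivative v) (at s) & lamN i (coordN i (gam s)) v = 1 &
 (\<forall>b. omN i (coordN i (gam s)) v b = k * dF i t (coordN i (gam s)) b)"
proof -
 have cont: "continuous_on UNIV gam" and Bd: "gam r : Bd" for r using gam unfolding reeb_orbit_def points_BA by blast+
 obtain c where c: "c : charts TB" "gam s : fst c" using chart_exists[OF Bd, of s] by blast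
 let ?c = "%r. snd (snd c (gam r))"
 have "gam s : chart_dom BA c" unfolding dom_BA[OF c(1)] using c(2) Bd by blast
 then obtain u where u: "(coord BA c \<circ> gam has_vector_derivative u) (at s)" "reeb_vector BA \<beta> c (coord BA c (gam s)) u"
 using gam c(1) unfolding reeb_orbit_def BA_simps(1) by blast
 have u1: "(?c has_vector_derivative u) (at s)" using u(1) by (simp add: BA_simps o_def)
 obtain O1 where O1: "open O1" "fst c = S Int O1" using V_open[OF c(1)] by (auto simp: openin_open)
 obtain O2 where O2: "open O2" "dmN i = (Pts \<times> UNIV) Int O2" using dmN_open[OF i(1)] by (auto simp: openin_open)
 define R where "R = gam -` (O1 Int O2)"
 have R: "open R" unfolding R_def by (rule open_vimage[OF open_Int[OF O1(1) O2(1)] cont])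
 have sR: "s : R" unfolding R_def using c(2)[unfolded O1(2)] i(2)[unfolded O2(2)] by simp
 have Sgam: "gam r : S" "gam r : Pts \<times> UNIV" for r using Bd Bd_subset S_Pts by blast+
 have inR: "gam r : fst c" "gam r : dmN i" if "r : R" for r
 unfolding O1(2) O2(2) using that Sgam[of r] unfolding R_def by simp_all
 have z: "snd c (gam r) = (0, ?c r)" if "r : R" for r using Bd_fst_zero[OF c(1) inR(1)[OF that] Bd] by (metis prod.collapse)
 let ?y = "snd c (gam s)"
 define v where "v = Dt c i ?y (0, u)"
 have yT: "snd c (gam r) : Ti c i" if "r : R" for r unfolding Ti_def[OF c(1)] by (rule imageI[OF IntI[OF inR[OF that]]])
 have "((%r. (0, ?c r)) has_derivative (%h. (0, h *\<^sub>R u))) (at s within R)"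
 using has_derivative_at_withinI[OF u1[unfolded has_vector_derivative_def]] by (intro has_derivative_Pair has_derivative_const)
 then have 1: "((%r. snd c (gam r)) has_derivative (%h. (0, h *\<^sub>R u))) (at s within R)"
 by (rule has_derivative_transform_on[OF _ sR z])
 have "(Phi c i has_derivative Dt c i ?y) (at ?y within (%r. snd c (gam r)) ` R)"
 by (rule has_derivative_subset[OF Phi_derivative[OF c(1) i(1) yT[OF sR]]]) (rule image_subsetI, rule yT)
 from has_derivative_in_compose[OF 1 this]
 have "((%r. Phi c i (snd c (gam r))) has_derivative (%h. Dt c i ?y (0, h *\<^sub>R u))) (at s within R)" .
 then have "((%r. coordN i (gam r)) has_derivative (%h. Dt c i ?y (0, h *\<^sub>R u))) (at s within R)"
 by (rule has_derivative_transform_on[OF _ sR]) (use inR(1) Phi_psi[OF c(1)] in simp)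
 moreover have "Dt c i ?y (0, h *\<^sub>R u) = h *\<^sub>R v" for h
 using linear_cmul[OF Dt_linear[OF c(1) i(1) yT[OF sR]], of h "(0, u)"] by (simp add: v_def)
 ultimately have 2: "(coordN i \<circ> gam has_vector_derivative v) (at s)"
 unfolding has_vector_derivative_def at_within_open[OF sR R] by (simp add: o_def)
 have Bi: "?c s : Bi c i" unfolding Bi_def[OF c(1)] using yT[OF sR] z[OF sR] by simp
 have rv: "\<beta> c (?c s) u = 1" "!!b. ext_d BA \<beta> c (?c s) u b = 0" using u(2) unfolding reeb_vector_def BA_simps(3) by blast+
 have 3: "lamN i (coordN i (gam s)) v = 1" using rv(1) beta_chart[OF c(1) c(2) Bd i] by (simp add: v_def)
 have om0: "omN i (coordN i (gam s)) v (Dt c i ?y (0, b)) = 0" for b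
 using rv(2)[of b] unfolding dbeta_Bi[OF c(1) i(1) Bi] z[OF sR, symmetric] Phi_psi[OF c(1,2)] v_def .
 obtain a where a: "a ~= 0" "\<forall>u. dF i t (coordN i (gam s)) (Dt c i ?y u) = a * fst u"
 using dF_Dt[OF c Bd i t] by (elim exE conjE) (rule that)
 have oml: "linear (omN i (coordN i (gam s)) v)" using omN_bilin[OF i(1) coordN_in[OF i]] unfolding bilin_def by blast
 \<comment> \<open>The multiple is read off on the direction (1, 0) of the chart, transversal to the
   boundary, where \<open>dF\<close> takes the value a.\<close>
 define k where "k = omN i (coordN i (gam s)) v (Dt c i ?y (1, 0)) / a"
 have "omN i (coordN i (gam s)) v b = k * dF i t (coordN i (gam s)) b" for b
 proof -
 obtain b' where b': "b = Dt c i ?y b'" using Dt_surj[OF c(1) i(1) c(2) i(2)] by (metis surjD)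
 have "b = Dt c i ?y (fst b' *\<^sub>R (1, 0) + (0, snd b'))" unfolding b' by (simp add: prod_eq_iff)
 also have "\<dots> = fst b' *\<^sub>R Dt c i ?y (1, 0) + Dt c i ?y (0, snd b')"
 unfolding linear_add[OF Dt_linear[OF c(1) i(1) yT[OF sR]]] linear_cmul[OF Dt_linear[OF c(1) i(1) yT[OF sR]]] ..
 finally have "omN i (coordN i (gam s)) v b = fst b' * omN i (coordN i (gam s)) v (Dt c i ?y (1, 0))"
 by (simp add: linear_add[OF oml] linear_cmul[OF oml] om0)
 then show ?thesis using a unfolding b' k_def by simp
 qed
 then have "\<forall>b. omN i (coordN i (gam s)) v b = k * dF i t (coordN i (gam s)) b" by (rule allI)
 with 2 3 show ?thesis by - (rule exI[of _ v], rule exI[of _ k], intro conjI; assumption)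
qed

lemma chart_img_bdry_W: "i : Ch ==> chart_img (bdry_atlas W) i = {y. (0, y) : img i}"
proof (intro set_eqI iffI)
 fix y assume i: "i : Ch" and "y : chart_img (bdry_atlas W) i"
 then have "y : (%p. snd (coord W i p)) ` (dm i Int bdry W)" by (simp add: chart_img_def bdry_atlas_def)
 then obtain p where p: "p : dm i" "p : bdry W" "y = snd (coord W i p)" by blast
 then have "(0, y) = coord W i p" using bdry_coord[OF i p(1)] by (metis prod.collapse)
 then show "y : {y. (0, y) : img i}" using coord_in[OF i p(1)] by simp
next
 fix y assume i: "i : Ch" and "y : {y. (0, y) : img i}"
 then have y: "(0, y) : img i" by simp
 have "param W i (0, y) : dm i Int bdry W" "y = snd (coord W i (param W i (0, y)))"
 using bdry_coord[OF i param_in[OF i y]] param_in[OF i y] coord_param[OF i y] by simp_all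
 then have "y : (%p. snd (coord W i p)) ` (dm i Int bdry W)" by blast
 then show "y : chart_img (bdry_atlas W) i" by (simp add: chart_img_def bdry_atlas_def)
qed

lemma ext_d_bdry_W:
 assumes i: "i : Ch" and x: "(0, y) : img i"
 shows "ext_d (bdry_atlas W) (bdry_form lam) i y u v = om i (0, y) (0, u) (0, v)"
proof -
 let ?B = "chart_img (bdry_atlas W) i"
 obtain T where T: "open T" "img i = half_space Int T" using img_open[OF i] by (auto simp: openin_open)
 have "?B = (%y. (0, y)) -` T" unfolding chart_img_bdry_W[OF i] T(2) by (auto simp: half_space_def)
 then have op: "open ?B" using open_vimage[OF T(1), of "%y. (0, y)"] by (simp add: continuous_intros)
 have y: "y : ?B" unfolding chart_img_bdry_W[OF i] using x by simp
 have "fd_within (%y. bdry_form lam i y v) ?B y u = fd_within (%x. lam i x (0, v)) (img i) (0, y) (0, u)" for u v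
 proof -
 have 1: "((%y. (0, y)) has_derivative (%u. (0, u))) (at y within ?B)" by (auto intro!: derivative_eq_intros)
 have "((%x. lam i x (0, v)) has_derivative fd_within (%x. lam i x (0, v)) (img i) (0, y)) (at (0, y) within (%y. (0, y)) ` ?B)"
 by (rule has_derivative_subset[OF lam_has_derivative[OF i x]]) (use chart_img_bdry_W[OF i] in blast)
 from thick_frechet_eq[OF thick_open[OF op] y has_derivative_in_compose[OF 1 this]] show ?thesis unfolding bdry_form_def by simp
 qed
 then show ?thesis unfolding ext_d_def by simp
qed

lemma points_bdry_W: "points (bdry_atlas W) = bdry W"
 using bdry_subset unfolding points_def bdry_atlas_def by auto

lemma bdry_W_simps: "charts (bdry_atlas W) = Ch" "chart_dom (bdry_atlas W) i = dm i Int bdry W" "coord (bdry_atlas W) i w = snd (coord W i w)"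
 by (simp_all add: bdry_atlas_def)

text \<open>The curve is transported to a tube chart by a smooth extension of that chart. Both Reeb
  conditions then reduce to those on the boundary of W.\<close>

lemma binding_orbit:
 assumes gam: "reeb_orbit (bdry_atlas W) (bdry_form lam) gam" shows "reeb_orbit BA \<beta> (%s. (gam s, 0))"
 unfolding reeb_orbit_def
proof (intro conjI allI ballI impI)
 have cont: "continuous_on UNIV gam" and bd: "gam r : bdry W" for r using gam unfolding reeb_orbit_def points_bdry_W by blast+
 show "continuous_on UNIV (%s. (gam s, 0))" by (intro continuous_intros cont)
 show "range (%s. (gam s, 0)) <= points BA" unfolding points_BA using bdry_Bd bd by blast
 fix s c assume "c : charts BA" "(gam s, 0) : chart_dom BA c"
 then have c: "c : charts TB" "(gam s, 0) : fst c" "(gam s, 0) : Bd" using dom_BA by (auto simp: BA_simps(1))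
 let ?p = "(gam s, 0 :: complex)"
 obtain i where i: "i : Ch" "?p : dmN i" using S_chart[of ?p] Bd_subset c(3) by blast
 have di: "gam s : dm i" using i(2) by simp
 let ?x = "coord W i (gam s)"
 have x: "?x : img i" by (rule coord_in[OF i(1) di])
 have cz: "coord W i (gam r) = (0, snd (coord W i (gam r)))" if "gam r : dm i" for r using bdry_coord[OF i(1) that] bd by (metis prod.collapse)
 obtain v where v: "(coord (bdry_atlas W) i \<circ> gam has_vector_derivative v) (at s)"
 "reeb_vector (bdry_atlas W) (bdry_form lam) i (coord (bdry_atlas W) i (gam s)) v"
 using gam i(1) di bd unfolding reeb_orbit_def bdry_W_simps by blast
 have v1: "((%r. snd (coord W i (gam r))) has_vector_derivative v) (at s)" using v(1) by (simp add: bdry_W_simps o_def)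
 have xin: "(0, snd ?x) : img i" using x cz[OF di] by simp
 have v2: "lam i ?x (0, v) = 1" "om i ?x (0, v) (0, b) = 0" for b
 using v(2) ext_d_bdry_W[OF i(1) xin, of v b] cz[OF di] unfolding reeb_vector_def bdry_W_simps(3) bdry_form_def by simp_all
 obtain U g where g: "open U" "coordN i ?p : U" "\<forall>k. Ck_on k U g" "\<forall>q. q : fst c --> q : dmN i --> coordN i q : U --> g (coordN i q) = snd c q"
 "\<forall>u. frechet_derivative g (at (coordN i ?p)) (Dt c i (snd c ?p) u) = u" using psi_ext[OF c(1) i(1) c(2) i(2)] by (elim exE conjE) (rule that)
 obtain O1 where O1: "open O1" "fst c = S Int O1" using V_open[OF c(1)] by (auto simp: openin_open)
 obtain O2 where O2: "open O2" "dmN i = (Pts \<times> UNIV) Int O2" using dmN_open[OF i(1)] by (auto simp: openin_open)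
 define R where "R = (%r. (gam r, 0 :: complex)) -` (O1 Int O2)"
 have R: "open R" unfolding R_def by (rule open_vimage[OF open_Int[OF O1(1) O2(1)]]) (intro continuous_intros cont)
 have sR: "s : R" unfolding R_def using c(2)[unfolded O1(2)] i(2)[unfolded O2(2)] by simp
 have Sgam: "(gam r, 0) : S" "(gam r, 0 :: complex) : Pts \<times> UNIV" for r using bdry_Bd[OF bd] Bd_subset S_Pts by blast+
 have inR: "(gam r, 0) : fst c" "(gam r, 0 :: complex) : dmN i" if "r : R" for r
 unfolding O1(2) O2(2) using that Sgam[of r] unfolding R_def by simp_all
 have cc: "continuous_on R (%r. coordN i (gam r, 0))"
 by (rule continuous_on_compose2[OF continuous_coordN[OF i(1)]]) (use inR(2) in \<open>auto intro!: continuous_intros continuous_on_subset[OF cont]\<close>)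
 define R' where "R' = R Int (%r. coordN i (gam r, 0)) -` U"
 have R': "open R'" unfolding R'_def by (rule continuous_open_preimage[OF cc R g(1)])
 have sR': "s : R'" unfolding R'_def using sR g(2) by blast
 define w where "w = asc (0, v) (0 :: complex)"
 have "((%r. asc (0, snd (coord W i (gam r))) 0) has_derivative (%h. asc (0, h *\<^sub>R v) 0)) (at s within R')"
 by (intro has_derivative_asc has_derivative_Pair has_derivative_const has_derivative_at_withinI[OF v1[unfolded has_vector_derivative_def]])
 then have 1: "((%r. coordN i (gam r, 0)) has_derivative (%h. asc (0, h *\<^sub>R v) 0)) (at s within R')"
 proof (rule has_derivative_transform_on[OF _ sR'])
 fix r assume "r : R'"
 then have "gam r : dm i" using inR(2) unfolding R'_def by blast
 from cz[OF this] show "coordN i (gam r, 0) = asc (0, snd (coord W i (gam r))) 0" by (simp add: coordN_def)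
 qed
 let ?G = "frechet_derivative g (at (coordN i ?p))"
 have gD: "(g has_derivative ?G) (at (coordN i ?p))" by (rule Ck_on_has_derivative[OF g(3)[rule_format, of "Suc 0"] g(2)])
 from has_derivative_in_compose[OF 1 has_derivative_at_withinI[OF gD]]
 have "((%r. g (coordN i (gam r, 0))) has_derivative (%h. ?G (asc (0, h *\<^sub>R v) 0))) (at s within R')" .
 then have 2: "((%r. snd c (gam r, 0)) has_derivative (%h. ?G (asc (0, h *\<^sub>R v) 0))) (at s within R')"
 by (rule has_derivative_transform_on[OF _ sR']) (use g(4) inR in \<open>simp add: R'_def\<close>)
 have Gh: "?G (asc (0, h *\<^sub>R v) 0) = h *\<^sub>R ?G w" for h
 using linear_cmul[OF has_derivative_linear[OF gD], of h w] by (simp add: w_def asc_def)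
 from has_derivative_snd[OF 2[unfolded Gh at_within_open[OF sR' R']]]
 have 3: "(coord BA c \<circ> (%s. (gam s, 0)) has_vector_derivative snd (?G w)) (at s)"
 unfolding has_vector_derivative_def by (simp add: BA_simps o_def)
 obtain b where b: "w = Dt c i (snd c ?p) b" using Dt_surj[OF c(1) i(1) c(2) i(2)] by (metis surjD)
 have Gw: "?G w = b" unfolding b using g(5) by simp
 have t: "ang (snd ?p) 0" by simp
 obtain a where a: "a ~= 0" "\<forall>u. dF i 0 (coordN i ?p) (Dt c i (snd c ?p) u) = a * fst u"
 using dF_Dt[OF c i t] by (elim exE conjE) (rule that)
 have x0: "fst ?x = 0" using cz[OF di] by (metis fst_conv)
 have dFw: "dF i 0 (coordN i ?p) u = DH i (0, ?x) (0, fp u)" for u by (simp add: dF_def)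
 have "dF i 0 (coordN i ?p) w = 0" unfolding dFw w_def fp_asc by (rule DH_bdry(2)[OF i(1) x x0])
 then have "fst b = 0" using a b by simp
 then have bb: "b = (0, snd b)" by (simp add: prod_eq_iff)
 have wD: "w = Dt c i (snd c ?p) (0, snd b)" unfolding b using bb by simp
 have yT: "snd c ?p : Ti c i" unfolding Ti_def[OF c(1)] by (rule imageI[OF IntI[OF c(2) i(2)]])
 have y0: "snd c ?p = (0, snd (snd c ?p))" using Bd_fst_zero[OF c] by (metis prod.collapse)
 have Bi: "snd (snd c ?p) : Bi c i" unfolding Bi_def[OF c(1)] using yT y0 by simp
 have "\<beta> c (snd (snd c ?p)) (snd b) = lamN i (coordN i ?p) w" unfolding wD by (rule beta_chart[OF c i])
 also have "\<dots> = 1" using v2(1) by (simp add: lamN_def w_def)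
 finally have 4: "\<beta> c (snd (snd c ?p)) (snd b) = 1" .
 \<comment> \<open>At z = 0 \<open>dF\<close> is a nonzero multiple of the normal component in W.
   Tangent vectors of the tube boundary thus have W part tangent to the boundary of W, where the
   Reeb condition on W applies.\<close>
 have 5: "ext_d BA \<beta> c (snd (snd c ?p)) (snd b) u = 0" for u
 proof -
 let ?u = "Dt c i (snd c ?p) (0, u)"
 have "DH i (0, ?x) (0, fp ?u) = 0" using a(2)[rule_format, of "(0, u)"] dFw by simp
 moreover have "(0 :: real, fp ?u) = fst (fp ?u) *\<^sub>R (0, (1, 0)) + (0, (0, snd (fp ?u)))" by (simp add: prod_eq_iff)
 then have "DH i (0, ?x) (0, fp ?u) = fst (fp ?u) * DH i (0, ?x) (0, (1, 0)) + DH i (0, ?x) (0, (0, snd (fp ?u)))"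
 using linear_add[OF DH_linear[OF i(1) x]] linear_cmul[OF DH_linear[OF i(1) x]] by (metis real_scaleR_def)
 ultimately have "fst (fp ?u) = 0" using DH_bdry(2,3)[OF i(1) x x0, of 0] by simp
 then have "fp ?u = (0, snd (fp ?u))" by (simp add: prod_eq_iff)
 then have "om i ?x (0, v) (fp ?u) = 0" using v2(2) by metis
 then have "omN i (coordN i ?p) w ?u = 0" by (simp add: omN_def w_def)
 then show ?thesis unfolding dbeta_Bi[OF c(1) i(1) Bi] y0[symmetric] Phi_psi[OF c(1,2)] wD[symmetric] .
 qed
 show "\<exists>v. (coord BA c \<circ> (%s. (gam s, 0)) has_vector_derivative v) (at s) & reeb_vector BA \<beta> c (coord BA c (gam s, 0)) v"
 using 3 4 5 unfolding Gw reeb_vector_def BA_simps(3) by blast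
qed

lemma Sys_tube_le: "Sys TB (tube_form W lam) <= Sys W lam"
 unfolding Sys_def min_period_def
proof (rule Inf_superset_mono, rule subsetI)
 fix x assume "x : {ereal T |T. 0 < T & (\<exists>gam. reeb_orbit (bdry_atlas W) (bdry_form lam) gam & (\<forall>s. gam (s + T) = gam s))}"
 then obtain T gam where T: "x = ereal T" "0 < T" "reeb_orbit (bdry_atlas W) (bdry_form lam) gam" "\<forall>s. gam (s + T) = gam s" by blast
 show "x : {ereal T |T. 0 < T & (\<exists>gam. reeb_orbit BA \<beta> gam & (\<forall>s. gam (s + T) = gam s))}"
 by (intro CollectI exI[of _ T] conjI T(1,2) exI[of _ "%s. (gam s, 0)"] binding_orbit[OF T(3)]) (simp add: T(4))
qed

end

section \<open>Closed orbits in the binding and orbits winding around it\<close>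

context ham
begin

context
 fixes gam assumes gam: "reeb_orbit BA \<beta> gam"
begin

lemma orbit_Bd: "gam r : Bd" and orbit_continuous: "continuous_on UNIV gam"
 using gam unfolding reeb_orbit_def points_BA by blast+

lemma orbit_z:
 shows "\<exists>z' k \<tau>. ((%r. snd (gam r)) has_vector_derivative z') (at s) & wC (snd (gam s)) z' = 2 * pi * k * (cmod (snd (gam s)))\<^sup>2 &
 k * \<tau> = 1 & 0 < \<tau> & tau_min W lam H <= \<tau> & ((\<forall>r r'. H r (fst (gam s)) = H r' (fst (gam s))) --> snd (gam s) \<bullet> z' = 0)"
proof -
 obtain i where i: "i : Ch" "gam s : dmN i" using S_chart[OF subsetD[OF Bd_subset orbit_Bd[of s]]] by (elim exE conjE) (rule that)
 obtain t where t: "ang (snd (gam s)) t" using ang_exists by blast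
 obtain v k where v: "(coordN i \<circ> gam has_vector_derivative v) (at s)" "lamN i (coordN i (gam s)) v = 1"
 "\<forall>b. omN i (coordN i (gam s)) v b = k * dF i t (coordN i (gam s)) b" using reeb_curve[OF gam i t] by (elim exE conjE) (rule that)
 note R = i orbit_Bd t v(3)[rule_format] v(2)
 have "((%r. zp (coordN i (gam r))) has_vector_derivative zp v) (at s)"
 using bounded_linear.has_vector_derivative[OF bounded_linear_zp v(1)] by (simp add: o_def)
 then have z: "((%r. snd (gam r)) has_vector_derivative zp v) (at s)" by simp
 have P: "fst (gam s) : Pts" by (rule Bd_points[OF orbit_Bd])
 have "0 < tau t (fst (gam s))" "tau_min W lam H <= tau t (fst (gam s))" using tau_pos[OF P] tau_min_le[OF P] by (simp_all add: tau_def)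
 moreover have "(\<forall>r r'. H r (fst (gam s)) = H r' (fst (gam s))) --> snd (gam s) \<bullet> zp v = 0"
 using reeb_radial[OF R] by simp
 ultimately show ?thesis using z reeb_wC[OF R] reeb_tau[OF R]
 by - (rule exI[of _ "zp v"], rule exI[of _ k], rule exI[of _ "tau t (fst (gam s))"], intro conjI; assumption)
qed

text \<open>The set of times with z = 0 is closed, and open because H is autonomous near the
  boundary, so |z|^2 has derivative 0 near such a time. The real line is connected.\<close>

lemma orbit_zero_dichotomy: "(\<forall>s. snd (gam s) = 0) \<or> (\<forall>s. snd (gam s) ~= 0)"
proof -
 let ?Z = "{s. snd (gam s) = 0}"
 have zc: "continuous_on UNIV (%s. snd (gam s))" by (intro continuous_intros orbit_continuous)
 have "closed ?Z" by (intro closed_Collect_eq zc continuous_on_const)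
 moreover have "open ?Z"
 proof (subst open_contains_ball, intro ballI)
 fix s assume s: "s : ?Z"
 obtain U0 where U0: "openin (top_of_set Pts) U0" "bdry W <= U0" "\<forall>w\<in>U0. \<forall>s t. H s w = H t w"
 using H_autonomous by (elim exE conjE) (rule that)
 obtain O1 where O1: "open O1" "U0 = Pts Int O1" using U0(1) by (auto simp: openin_open)
 have "open ((%s. fst (gam s)) -` O1)" by (rule open_vimage[OF O1(1)]) (intro continuous_intros orbit_continuous)
 moreover have "s : (%s. fst (gam s)) -` O1" using Bd_z_zero[OF orbit_Bd, of s] s U0(2) O1(2) by auto
 ultimately obtain e where e: "0 < e" "ball s e <= (%s. fst (gam s)) -` O1" by (meson open_contains_ball)
 have "((%r. snd (gam r) \<bullet> snd (gam r)) has_derivative (%h. 0)) (at r within ball s e)" if r: "r : ball s e" for r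
 proof -
 obtain z' where z': "((%r. snd (gam r)) has_vector_derivative z') (at r)"
 "(\<forall>q q'. H q (fst (gam r)) = H q' (fst (gam r))) --> snd (gam r) \<bullet> z' = 0" using orbit_z[of r] by (elim exE conjE) (rule that)
 have "fst (gam r) : U0" using e(2) r O1(2) Bd_points[OF orbit_Bd, of r] by auto
 then have o: "snd (gam r) \<bullet> z' = 0" using z'(2) U0(3) by blast
 show ?thesis
 by (rule has_derivative_eq_rhs[OF has_derivative_inner[OF has_derivative_at_withinI[OF z'(1)[unfolded has_vector_derivative_def]] has_derivative_at_withinI[OF z'(1)[unfolded has_vector_derivative_def]]]])
 (simp add: fun_eq_iff o inner_commute[of z'])
 qed
 from has_derivative_zero_constant[OF convex_ball this] obtain q where "!!r. r : ball s e ==> snd (gam r) \<bullet> snd (gam r) = q" by blast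
 then have "snd (gam r) \<bullet> snd (gam r) = snd (gam s) \<bullet> snd (gam s)" if "r : ball s e" for r using that e(1) by (metis centre_in_ball)
 then have "ball s e <= ?Z" using s by auto
 with e(1) show "\<exists>e>0. ball s e <= ?Z" by blast
 qed
 ultimately have "?Z = {} \<or> ?Z = UNIV" using clopen[of ?Z] by blast
 then show ?thesis by blast
qed

text \<open>With z = 0 throughout, the velocity is tangent to the boundary of W, and
  \<open>dF\<close> vanishes on the tangent directions against which the Reeb condition is
  tested.\<close>

lemma orbit_in_binding:
 assumes z: "\<forall>s. snd (gam s) = 0" shows "reeb_orbit (bdry_atlas W) (bdry_form lam) (%s. fst (gam s))"
 unfolding reeb_orbit_def
proof (intro conjI allI ballI impI)
 have bd: "fst (gam r) : bdry W" for r using Bd_z_zero[OF orbit_Bd] z by blast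
 show cf: "continuous_on UNIV (%s. fst (gam s))" by (intro continuous_intros orbit_continuous)
 show "range (%s. fst (gam s)) <= points (bdry_atlas W)" unfolding points_bdry_W using bd by blast
 fix s i assume "i : charts (bdry_atlas W)" "fst (gam s) : chart_dom (bdry_atlas W) i"
 then have i: "i : Ch" and di: "fst (gam s) : dm i" unfolding bdry_W_simps by blast+
 have i2: "gam s : dmN i" using di by (simp add: mem_Times_iff)
 let ?x = "coord W i (fst (gam s))"
 have x: "?x : img i" by (rule coord_in[OF i di])
 have x0: "fst (coord W i (fst (gam r))) = 0" if "fst (gam r) : dm i" for r using bdry_coord[OF i that] bd by blast
 have t: "ang (snd (gam s)) 0" using z by simp
 obtain v k where v: "(coordN i \<circ> gam has_vector_derivative v) (at s)" "lamN i (coordN i (gam s)) v = 1"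
 "\<forall>b. omN i (coordN i (gam s)) v b = k * dF i 0 (coordN i (gam s)) b" using reeb_curve[OF gam i i2 t] by (elim exE conjE) (rule that)
 have "((%r. fp (coordN i (gam r))) has_vector_derivative fp v) (at s)"
 using bounded_linear.has_vector_derivative[OF bounded_linear_fp v(1)] by (simp add: o_def)
 then have d: "((%r. coord W i (fst (gam r))) has_vector_derivative fp v) (at s)" by simp
 have d1: "((%r. fst (coord W i (fst (gam r)))) has_vector_derivative fst (fp v)) (at s)"
 and d2: "((%r. snd (coord W i (fst (gam r)))) has_vector_derivative snd (fp v)) (at s)"
 using bounded_linear.has_vector_derivative[OF bounded_linear_fst d] bounded_linear.has_vector_derivative[OF bounded_linear_snd d] by simp_all
 obtain O1 where O1: "open O1" "dm i = Pts Int O1" using dom_open[OF i] by (auto simp: openin_open)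
 have R: "open ((%s. fst (gam s)) -` O1)" by (rule open_vimage[OF O1(1) cf])
 have "((%r. 0) has_vector_derivative fst (fp v)) (at s)"
 by (rule has_vector_derivative_transform_within_open[OF d1 R])
 (use di O1(2) x0 Bd_points[OF orbit_Bd] in auto)
 then have "fst (fp v) = 0" using vector_derivative_unique_at has_vector_derivative_const by blast
 then have fv: "fp v = (0, snd (fp v))" by (simp add: prod_eq_iff)
 have xx: "?x = (0, snd ?x)" using x0[OF di] by (simp add: prod_eq_iff)
 have 1: "bdry_form lam i (snd ?x) (snd (fp v)) = 1"
 using v(2) z unfolding bdry_form_def xx[symmetric] fv[symmetric] by (simp add: lamN_def)
 have "ext_d (bdry_atlas W) (bdry_form lam) i (snd ?x) (snd (fp v)) u = om i ?x (fp v) (0, u)" for u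
 using ext_d_bdry_W[OF i, of "snd ?x" "snd (fp v)" u] x unfolding xx[symmetric] fv[symmetric] by blast
 also have "om i ?x (fp v) (0, u) = 0" for u
 using reeb_om[OF i i2 orbit_Bd t v(3)[rule_format] v(2), of "(0, u)"] DH_bdry(2)[OF i x x0[OF di]] by simp
 finally show "\<exists>v. (coord (bdry_atlas W) i \<circ> (%s. fst (gam s)) has_vector_derivative v) (at s) &
 reeb_vector (bdry_atlas W) (bdry_form lam) i (coord (bdry_atlas W) i (fst (gam s))) v"
 using d2 1 unfolding reeb_vector_def bdry_W_simps(3) o_def by blast
qed

text \<open>A continuous logarithm of z has imaginary part increasing at rate 2 \<pi>/\<tau>. Over a
  period it grows by 2 \<pi> times an integer, which is positive and hence at least 1.\<close>

lemma orbit_winding: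
 assumes z: "\<forall>s. snd (gam s) ~= 0" and T: "0 < T" "\<forall>s. gam (s + T) = gam s" shows "tau_min W lam H <= T"
proof -
 let ?z = "%s. snd (gam s)"
 have zc: "continuous_on UNIV ?z" by (intro continuous_intros orbit_continuous)
 have "contractible (UNIV :: real set)" by (simp add: convex_imp_contractible)
 from continuous_logarithm_on_contractible[OF zc this] z obtain g where g: "continuous_on UNIV g" "!!s. ?z s = exp (g s)" by auto
 have "\<forall>s. \<exists>k. ((%r. Im (g r)) has_real_derivative 2 * pi * k) (at s) & (\<exists>\<tau>. k * \<tau> = 1 & 0 < \<tau> & tau_min W lam H <= \<tau>)"
 proof
 fix s
 obtain z' k \<tau> where z': "(?z has_vector_derivative z') (at s)" "wC (?z s) z' = 2 * pi * k * (cmod (?z s))\<^sup>2"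
 "k * \<tau> = 1" "0 < \<tau>" "tau_min W lam H <= \<tau>" using orbit_z[of s] by (elim exE conjE) (rule that)
 have zs: "?z s ~= 0" using z by blast
 \<comment> \<open>The logarithm g is only known to be continuous. Where its imaginary part has
   moved by less than \<pi>, it equals the principal branch relative to time s, which gives the
   derivative.\<close>
 define R where "R = (%r. Im (g r - g s)) -` {- pi<..<pi}"
 have "continuous_on UNIV (%r. Im (g r - g s))" by (intro continuous_intros g(1))
 then have R: "open R" unfolding R_def by (intro open_vimage) auto
 have sR: "s : R" by (simp add: R_def)
 have gL: "g r = g s + Ln (?z r / ?z s)" if "r : R" for r
 proof -
 have "?z r / ?z s = exp (g r - g s)" unfolding g(2) by (simp add: exp_diff)
 moreover have "Ln (exp (g r - g s)) = g r - g s" using that by (intro Ln_exp) (auto simp: R_def)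
 ultimately show ?thesis by simp
 qed
 have one: "(*) (1 :: complex) = (%h. h)" by (simp add: fun_eq_iff)
 have Ld: "(Ln has_derivative (%h. h)) (at (?z s / ?z s))"
 using has_field_derivative_Ln[of 1] zs by (simp add: has_field_derivative_def one)
 have "((%r. ?z r / ?z s) has_derivative (%h. h *\<^sub>R z' / ?z s)) (at s)"
 by (rule bounded_linear.has_derivative[OF bounded_linear_divide z'(1)[unfolded has_vector_derivative_def]])
 from has_derivative_compose[OF this Ld]
 have "((%r. Ln (?z r / ?z s)) has_derivative (%h. h *\<^sub>R z' / ?z s)) (at s)" .
 from has_derivative_add[OF has_derivative_const this, of "g s"]
 have "((%r. g s + Ln (?z r / ?z s)) has_derivative (%h. h *\<^sub>R z' / ?z s)) (at s)" by simp
 from has_derivative_transform_within_open[OF this R sR, of g] gL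
 have "(g has_derivative (%h. h *\<^sub>R z' / ?z s)) (at s)" by simp
 from bounded_linear.has_derivative[OF bounded_linear_Im this]
 have "((%r. Im (g r)) has_derivative (%h. Im (h *\<^sub>R z' / ?z s))) (at s)" .
 moreover have "Im (h *\<^sub>R z' / ?z s) = 2 * pi * k * h" for h
 unfolding wC_Im_divide[OF zs] using z'(2) zs by simp
 ultimately have "((%r. Im (g r)) has_real_derivative 2 * pi * k) (at s)" unfolding has_field_derivative_def by simp
 with z'(3-5) show "\<exists>k. ((%r. Im (g r)) has_real_derivative 2 * pi * k) (at s) & (\<exists>\<tau>. k * \<tau> = 1 & 0 < \<tau> & tau_min W lam H <= \<tau>)" by blast
 qed
 from choice[OF this] obtain k where k: "!!s. ((%r. Im (g r)) has_real_derivative 2 * pi * k s) (at s)"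
 "!!s. \<exists>\<tau>. k s * \<tau> = 1 & 0 < \<tau> & tau_min W lam H <= \<tau>" by blast
 \<comment> \<open>One mean value point suffices: T k(s) is the winding number, so T is at least the
   value of 1/k there.\<close>
 from MVT2[of 0 T "%r. Im (g r)" "%s. 2 * pi * k s"] T(1) k(1) obtain s where s: "Im (g T) - Im (g 0) = T * (2 * pi * k s)" by auto
 obtain \<tau> where \<tau>: "k s * \<tau> = 1" "0 < \<tau>" "tau_min W lam H <= \<tau>" using k(2) by blast
 have ks: "0 < k s" using \<tau>(1,2) by (metis zero_less_mult_pos2 zero_less_one)
 have "exp (g T) = exp (g 0)" using T(2)[rule_format, of 0] g(2)[of T] g(2)[of 0] by simp
 then obtain m :: int where "g T = g 0 + of_int (2 * m) * of_real pi * \<i>" using exp_eq[of "g T" "g 0"] by auto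
 then have m: "Im (g T) - Im (g 0) = 2 * pi * of_int m" by simp
 then have "T * k s = of_int m" using s by simp
 moreover have "0 < T * k s" using T(1) ks by simp
 ultimately have "1 <= T * k s" by simp
 then have "1 * \<tau> <= T * k s * \<tau>" using \<tau>(2) by (intro mult_right_mono) auto
 then have "\<tau> <= T" using \<tau>(1) by (simp add: mult.assoc)
 with \<tau>(3) show ?thesis by simp
qed

end

lemma Sys_tube_ge: "min (Sys W lam) (ereal (tau_min W lam H)) <= Sys TB (tube_form W lam)"
 unfolding Sys_def[of TB] min_period_def[of BA]
proof (rule Inf_greatest)
 fix x assume "x : {ereal T |T. 0 < T & (\<exists>gam. reeb_orbit BA \<beta> gam & (\<forall>s. gam (s + T) = gam s))}"
 then obtain T gam where T: "x = ereal T" "0 < T" "reeb_orbit BA \<beta> gam" "\<forall>s. gam (s + T) = gam s" by blast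
 show "min (Sys W lam) (ereal (tau_min W lam H)) <= x"
 proof (cases "\<forall>s. snd (gam s) = 0")
 case True
 have "Sys W lam <= x" unfolding Sys_def min_period_def
 proof (rule Inf_lower)
 show "x : {ereal T |T. 0 < T & (\<exists>gam. reeb_orbit (bdry_atlas W) (bdry_form lam) gam & (\<forall>s. gam (s + T) = gam s))}"
 by (intro CollectI exI[of _ T] conjI T(1,2) exI[of _ "%s. fst (gam s)"] orbit_in_binding[OF T(3) True]) (simp add: T(4))
 qed
 then show ?thesis by (simp add: min.coboundedI1)
 next
 case False
 then have "\<forall>s. snd (gam s) ~= 0" using orbit_zero_dichotomy[OF T(3)] by blast
 from orbit_winding[OF T(3) this T(2,4)] show ?thesis unfolding T(1) by (simp add: min.coboundedI2)
 qed
qed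

end

section \<open>The contact volume of the tube\<close>

context ham
begin

lemma omN_continuous: "i : Ch ==> continuous_on (imgN i) (%y. omN i y u v)"
 unfolding omN_def
 by (intro continuous_intros continuous_on_compose2[OF om_continuous linear_continuous_on[OF bounded_linear_fp]]) auto

lemma lamN_Basis: "i : Ch ==> y : imgN i ==> lamN i y u = (\<Sum>b\<in>Basis. (u \<bullet> b) * lamN i y b)"
 using linear_basis_sum[OF lamN_linear, of i y u] by simp

lemma omN_linear: assumes "i : Ch" "y : imgN i" shows "linear (omN i y u)" "linear (%v. omN i y v u)"
 using omN_bilin[OF assms] unfolding bilin_def by blast+

lemma omN_Basis: "i : Ch ==> y : imgN i ==> omN i y u v = (\<Sum>b\<in>Basis. (u \<bullet> b) * (\<Sum>b'\<in>Basis. (v \<bullet> b') * omN i y b b'))"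
proof -
 assume iy: "i : Ch" "y : imgN i"
 have 1: "omN i y u v = (\<Sum>b\<in>Basis. (u \<bullet> b) * omN i y b v)" using linear_basis_sum[OF omN_linear(2)[OF iy, of v], of u] by simp
 have 2: "omN i y b v = (\<Sum>b'\<in>Basis. (v \<bullet> b') * omN i y b b')" for b using linear_basis_sum[OF omN_linear(1)[OF iy, of b], of v] by simp
 show ?thesis by (subst 1, rule sum.cong[OF refl], subst 2, rule refl)
qed

definition Th :: "real \<times> 'w => 'w \<times> complex" where
 "Th y = (snd y, of_real (sqrt (H (fst y) (snd y) / pi)) * cis (2 * pi * fst y))"

lemma Th_cmod: "snd y : Pts ==> cmod (snd (Th y)) = sqrt (H (fst y) (snd y) / pi)"
 using H_nonneg[of "snd y" "fst y"] by (simp add: Th_def norm_mult)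

lemma Th_ang: "snd y : Pts ==> ang (snd (Th y)) (fst y)"
 unfolding ang_def Th_cmod by (simp add: Th_def)

lemma Th_Bd: "snd y : Pts ==> Th y : Bd"
 using Bd_iff[OF Th_ang] H_nonneg[of "snd y" "fst y"] by (simp add: Th_cmod) (simp add: Th_def)

lemma Th_continuous: "continuous_on (UNIV \<times> Pts) Th"
 unfolding Th_def[abs_def] cis_conv_exp by (intro continuous_intros H_continuous) auto

lemma Th_zero: "snd y : Pts ==> snd (Th y) = 0 \<longleftrightarrow> snd y : bdry W"
 using H_zero_iff[of "snd y" "fst y"] by (simp add: Th_def)

text \<open>A nonzero z determines its angle up to an integer, and [0, 1) contains only one
  representative.\<close>

lemma Th_inj:
 assumes "snd y : Pts" "snd y' : Pts" "fst y : {0..<1}" "fst y' : {0..<1}" "snd (Th y) ~= 0" "Th y = Th y'"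
 shows "y = y'"
proof -
 obtain k where k: "fst y' = fst y + of_int k"
 using ang_unique[OF assms(5) Th_ang[OF assms(1)], of "fst y'"] Th_ang[OF assms(2)] assms(6) by auto
 have "- 1 < real_of_int k" "real_of_int k < 1" using k assms(3,4) by auto
 then have "- 1 < k" "k < 1" by linarith+
 then have "k = 0" by simp
 with k have "fst y = fst y'" by simp
 moreover have "snd y = snd y'" using assms(6) by (simp add: Th_def)
 ultimately show ?thesis by (rule prod_eqI)
qed

lemma Th_surj:
 assumes "p : Bd" shows "\<exists>t\<in>{0..<1}. Th (t, fst p) = p"
proof -
 obtain s where s: "ang (snd p) s" using ang_exists by blast
 define t where "t = frac s"
 have t: "ang (snd p) t" using ang_int[OF s, of "- \<lfloor>s\<rfloor>"] by (simp add: t_def frac_def)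
 have "pi * (cmod (snd p))\<^sup>2 = H t (fst p)" using Bd_iff[OF t] assms by blast
 then have "H t (fst p) / pi = (cmod (snd p))\<^sup>2" by (simp add: field_simps)
 then have "Th (t, fst p) = p" using t by (simp add: Th_def ang_def prod_eq_iff)
 moreover have "t : {0..<1}" by (simp add: t_def frac_lt_1)
 ultimately show ?thesis by blast
qed

text \<open>The measure \<tau> dt times (d\<lambda>)^n carried to the boundary of the tube, the
  candidate for the contact measure.\<close>

definition nu :: "('w \<times> complex) measure" where
 "nu = distr (density M0 (%y. ennreal (tau (fst y) (snd y)))) (restrict_space borel Bd) Th"

lemma Th_measurable: "Th : measurable M0 (restrict_space borel Bd)"
 by (rule measurable_restrict_space2[OF _ M0_measurable[OF Th_continuous]]) (use Th_Bd in \<open>auto simp: space_M0\<close>)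

lemma tau_measurable: "(%y. ennreal (tau (fst y) (snd y))) : borel_measurable M0"
 using M0_measurable[OF tau_continuous] by simp

lemma Bd_sets: "B : sets borel ==> B <= Bd ==> B : sets (restrict_space borel Bd)"
 by (subst sets_restrict_space_iff) (simp_all add: borel_closed[OF closed_Bd])

lemma emeasure_nu:
 assumes "B : sets borel" "B <= Bd"
 shows "emeasure nu B = (\<integral>\<^sup>+y. ennreal (tau (fst y) (snd y)) * indicator B (Th y) \<partial>M0)"
proof -
 have "emeasure nu B = emeasure (density M0 (%y. ennreal (tau (fst y) (snd y)))) (Th -` B Int space M0)"
 unfolding nu_def
 by (subst emeasure_distr[OF _ Bd_sets[OF assms]]) (simp_all add: Th_measurable measurable_cong_sets[OF sets_density refl])
 also have "\<dots> = (\<integral>\<^sup>+y. ennreal (tau (fst y) (snd y)) * indicator (Th -` B Int space M0) y \<partial>M0)"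
 by (rule emeasure_density[OF tau_measurable measurable_sets[OF Th_measurable Bd_sets[OF assms]]])
 also have "\<dots> = (\<integral>\<^sup>+y. ennreal (tau (fst y) (snd y)) * indicator B (Th y) \<partial>M0)"
 by (rule nn_integral_cong) (simp add: indicator_def)
 finally show ?thesis .
qed

text \<open>The parameters mapped to z = 0 are the points over the boundary of W, which has measure
  0.\<close>

lemma nu_binding:
 assumes "B : sets borel" "B <= Bd" "!!p. p : B ==> snd p = 0" shows "emeasure nu B = 0"
proof -
 let ?R = "restrict_space lborel {0..<1::real}"
 have b: "bdry W : sets \<mu>" using bdry_borel bdry_subset by (simp add: sets_mu borel_restrict)
 have sf: "sigma_finite_measure \<mu>" using finite_measure.axioms(1)[OF finite_measure_mu] .
 have "emeasure M0 (space ?R \<times> bdry W) = emeasure ?R (space ?R) * emeasure \<mu> (bdry W)"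
 unfolding M0_def by (rule sigma_finite_measure.emeasure_pair_measure_Times[OF sf sets.top b])
 then have N: "space ?R \<times> bdry W : null_sets M0"
 using mu_bdry pair_measureI[OF sets.top b, of ?R] unfolding M0_def null_sets_def by simp
 have "AE y in M0. ennreal (tau (fst y) (snd y)) * indicator B (Th y) = 0"
 proof (rule AE_I'[OF N], rule subsetI)
 fix y assume y: "y : {y : space M0. ennreal (tau (fst y) (snd y)) * indicator B (Th y) ~= 0}"
 then have "snd (Th y) = 0" "snd y : Pts" "fst y : {0..<1}" using assms(3)[of "Th y"] by (auto simp: space_M0 indicator_def split: if_splits)
 then show "y : space ?R \<times> bdry W" using Th_zero by (simp add: mem_Times_iff space_restrict_space)
 qed
 from nn_integral_cong_AE[OF this] show ?thesis unfolding emeasure_nu[OF assms(1,2)] by simp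
qed

text \<open>Where H is positive, the polar parametrization pulls the product form back to \<lambda>
  + H dt and its differential to d\<lambda> + dH \<and> dt: the square of the radius is
  H/\<pi>.\<close>

lemma polar_derivative:
 assumes i: "i : Ch" "x : img i" and pos: "0 < Hc i (t, x)"
 defines "\<rho> \<equiv> sqrt (Hc i (t, x) / pi)"
 shows "\<exists>E'. ((%q. coordN i (Th (fst q, param W i (snd q)))) has_derivative E') (at (t, x) within UNIV \<times> img i) &
 (\<forall>u. lamN i (coordN i (Th (t, param W i x))) (E' u) = lam i x (snd u) + Hc i (t, x) * fst u) &
 (\<forall>u v. omN i (coordN i (Th (t, param W i x))) (E' u) (E' v) = om i x (snd u) (snd v) + DH i (t, x) u * fst v - DH i (t, x) v * fst u)"
proof -
 let ?X = "(UNIV :: real set) \<times> img i"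
 let ?dr = "%u. inverse \<rho> / 2 * (DH i (t, x) u / pi)"
 let ?c = "cos (2 * pi * t)" and ?s = "sin (2 * pi * t)"
 have \<rho>: "0 < \<rho>" "\<rho> * \<rho> = Hc i (t, x) / pi" using pos by (simp_all add: \<rho>_def)
 have q: "(t, x) : ?X" using i by simp
 have "(sqrt has_real_derivative inverse \<rho> / 2) (at (Hc i (t, x) / pi))" unfolding \<rho>_def by (rule DERIV_real_sqrt) (use pos in simp)
 then have sq: "(sqrt has_derivative (%h. inverse \<rho> / 2 * h)) (at (Hc i (t, x) / pi))" by (simp only: has_field_derivative_def)
 have dr: "((%q. sqrt (Hc i q / pi)) has_derivative ?dr) (at (t, x) within ?X)"
 by (rule has_derivative_compose[OF bounded_linear.has_derivative[OF bounded_linear_divide Hc_derivative[OF i]] sq])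
 have dc: "((%q :: real \<times> (real \<times> 'f). cos (2 * pi * fst q)) has_derivative (%u. - ?s * (2 * pi * fst u))) (at (t, x) within ?X)"
 and ds: "((%q :: real \<times> (real \<times> 'f). sin (2 * pi * fst q)) has_derivative (%u. ?c * (2 * pi * fst u))) (at (t, x) within ?X)"
 by (auto intro!: derivative_eq_intros)
 define Z' where "Z' = (%u. (\<rho> * (- ?s * (2 * pi * fst u)) + ?dr u * ?c) *\<^sub>R 1 + (\<rho> * (?c * (2 * pi * fst u)) + ?dr u * ?s) *\<^sub>R \<i>)"
 define E' where "E' = (%u. asc (snd u) (Z' u))"
 have "((%q. (sqrt (Hc i q / pi) * cos (2 * pi * fst q)) *\<^sub>R 1 + (sqrt (Hc i q / pi) * sin (2 * pi * fst q)) *\<^sub>R \<i>) has_derivative Z') (at (t, x) within ?X)"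
 using has_derivative_add[OF has_derivative_scaleR_left[OF has_derivative_mult[OF dr dc], of "1 :: complex"] has_derivative_scaleR_left[OF has_derivative_mult[OF dr ds], of \<i>]]
 by (simp add: Z'_def \<rho>_def)
 then have "((%q. asc (snd q) ((sqrt (Hc i q / pi) * cos (2 * pi * fst q)) *\<^sub>R 1 + (sqrt (Hc i q / pi) * sin (2 * pi * fst q)) *\<^sub>R \<i>)) has_derivative E') (at (t, x) within ?X)"
 unfolding E'_def by (intro has_derivative_asc has_derivative_snd has_derivative_ident)
 note dz = this
 have cz: "of_real a * cis b = (a * cos b) *\<^sub>R 1 + (a * sin b) *\<^sub>R \<i>" for a b by (simp add: complex_eq_iff)
 from dz have D: "((%q. coordN i (Th (fst q, param W i (snd q)))) has_derivative E') (at (t, x) within ?X)"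
 proof (rule has_derivative_transform_on[OF _ q])
 fix q assume "q : ?X"
 then have "snd q : img i" by (simp add: mem_Times_iff)
 then show "coordN i (Th (fst q, param W i (snd q))) = asc (snd q) ((sqrt (Hc i q / pi) * cos (2 * pi * fst q)) *\<^sub>R 1 + (sqrt (Hc i q / pi) * sin (2 * pi * fst q)) *\<^sub>R \<i>)"
 by (simp add: coordN_def Th_def coord_param[OF i(1)] Hc_def case_prod_unfold cz)
 qed
 let ?y = "coordN i (Th (t, param W i x))"
 have y: "fp ?y = x" "Re (zp ?y) = \<rho> * ?c" "Im (zp ?y) = \<rho> * ?s"
 by (simp_all add: Th_def coord_param[OF i] \<rho>_def Hc_def)
 have sc: "?s * ?s + ?c * ?c = 1" using sin_cos_squared_add3[of "2 * pi * t"] by (simp add: add.commute)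
 \<comment> \<open>\<open>g1\<close> and \<open>g2\<close> are polynomial identities for the area
   form in polar coordinates, r^2 d\<theta> and r dr \<and> d\<theta>, with c and s in the place of
   cosine and sine.\<close>
 have g1: "(r * c) * (r * (c * th) + d * s) - (r * s) * (r * (- s * th) + d * c) = (r * r) * th * (s * s + c * c)" for r c s d th :: real
 by (simp add: algebra_simps)
 have g2: "(r * (- s * th) + d * c) * (r * (c * th') + d' * s) - (r * (c * th) + d * s) * (r * (- s * th') + d' * c)
 = r * (d * th' - d' * th) * (s * s + c * c)" for r c s d d' th th' :: real
 by (simp add: algebra_simps)
 have RZ: "Re (Z' u) = \<rho> * (- ?s * (2 * pi * fst u)) + ?dr u * ?c" and IZ: "Im (Z' u) = \<rho> * (?c * (2 * pi * fst u)) + ?dr u * ?s" for u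
 unfolding Z'_def by simp_all
 have "wC (zp ?y) (Z' u) = (\<rho> * \<rho>) * (2 * pi * fst u) * (?s * ?s + ?c * ?c)" for u
 unfolding wC_def y RZ IZ by (rule g1)
 then have 1: "wC (zp ?y) (Z' u) = 2 * Hc i (t, x) * fst u" for u unfolding sc \<rho>(2) by simp
 have a1: "wC (Z' u) (Z' v) = \<rho> * (?dr u * (2 * pi * fst v) - ?dr v * (2 * pi * fst u)) * (?s * ?s + ?c * ?c)" for u v
 unfolding wC_def RZ IZ by (rule g2)
 have a2: "\<rho> * (?dr u * (2 * pi * fst v) - ?dr v * (2 * pi * fst u)) = DH i (t, x) u * fst v - DH i (t, x) v * fst u" for u v
 using \<rho>(1) by (simp add: field_simps)
 have 2: "wC (Z' u) (Z' v) = DH i (t, x) u * fst v - DH i (t, x) v * fst u" for u v by (simp only: a1 a2 sc mult_1_right)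
 have "lamN i ?y (E' u) = lam i x (snd u) + Hc i (t, x) * fst u" for u
 unfolding lamN_def E'_def fp_asc zp_asc y(1) 1 by simp
 moreover have "omN i ?y (E' u) (E' v) = om i x (snd u) (snd v) + DH i (t, x) u * fst v - DH i (t, x) v * fst u" for u v
 unfolding omN_def E'_def fp_asc zp_asc y(1) 2 by simp
 ultimately show ?thesis using D by - (rule exI[of _ E'], intro conjI allI, assumption+)
qed

section \<open>The contact density in one chart of the tube\<close>

context
 fixes c assumes c: "c : charts TB"
begin

definition fd :: "'f \<times> complex => real" where "fd y = \<bar>contact_top_form BA \<beta> n c y basis_frame\<bar>"

text \<open>The coefficients of the form and of its differential are expanded in a product chart,
  where continuity of each ingredient is known. This gives the measurability of the density.\<close>

lemma fd_continuous:
 assumes i: "i : Ch" shows "continuous_on (Bi c i) fd"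
proof -
 have sub: "Phi c i (0, y) : imgN i" if "y : Bi c i" for y using Phi_img[OF c i, of "(0, y)"] that by (simp add: Bi_def[OF c])
 have P: "continuous_on (Bi c i) (%y. Phi c i (0, y))" by (rule smooth_on_continuous[OF Bi_smooth[OF c i]])
 have "continuous_on (Bi c i) (%y. fd_within (%y. Phi c i (0, y)) (Bi c i) y u)" for u
 by (rule smooth_on_continuous[OF smooth_on_derivative[OF Bi_smooth[OF c i] thick_open[OF Bi_open[OF c i]]]])
 then have D: "continuous_on (Bi c i) (%y. Dt c i (0, y) (0, u))" for u
 by (rule continuous_on_eq) (rule Bi_derivative[OF c i])
 have l: "continuous_on (Bi c i) (%y. \<beta> c y u)" for u
 proof (rule continuous_on_eq)
 show "continuous_on (Bi c i) (%y. \<Sum>b\<in>Basis. (Dt c i (0, y) (0, u) \<bullet> b) * lamN i (Phi c i (0, y)) b)"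
 by (intro continuous_intros D continuous_on_compose2[OF smooth_on_continuous[OF lamN_smooth[OF i]] P] image_subsetI sub)
 fix y assume y: "y : Bi c i"
 show "(\<Sum>b\<in>Basis. (Dt c i (0, y) (0, u) \<bullet> b) * lamN i (Phi c i (0, y)) b) = \<beta> c y u"
 unfolding beta_Bi[OF c i y] by (rule lamN_Basis[OF i sub[OF y], symmetric])
 qed
 have o: "continuous_on (Bi c i) (%y. ext_d BA \<beta> c y u v)" for u v
 proof (rule continuous_on_eq)
 show "continuous_on (Bi c i) (%y. \<Sum>b\<in>Basis. (Dt c i (0, y) (0, u) \<bullet> b) * (\<Sum>b'\<in>Basis. (Dt c i (0, y) (0, v) \<bullet> b') * omN i (Phi c i (0, y)) b b'))"
 by (intro continuous_intros D continuous_on_compose2[OF omN_continuous[OF i] P] image_subsetI sub)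
 fix y assume y: "y : Bi c i"
 show "(\<Sum>b\<in>Basis. (Dt c i (0, y) (0, u) \<bullet> b) * (\<Sum>b'\<in>Basis. (Dt c i (0, y) (0, v) \<bullet> b') * omN i (Phi c i (0, y)) b b')) = ext_d BA \<beta> c y u v"
 unfolding dbeta_Bi[OF c i y] by (rule omN_Basis[OF i sub[OF y], symmetric])
 qed
 show ?thesis unfolding fd_def[abs_def] contact_top_form_ctop ctop_def wedge_def dpow_formula pairs_def
 by (intro continuous_intros l o) auto
qed

lemma chart_img_open: "open (chart_img BA c)"
 unfolding chart_img_BA[OF c] by (rule open_slice[OF c T_open[OF c]])

lemma chart_img_Bi: "chart_img BA c = (\<Union>i\<in>Ch. Bi c i)"
proof (intro equalityI subsetI)
 fix y assume "y : chart_img BA c"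
 then obtain p where p: "p : fst c" "(0, y) = snd c p" unfolding chart_img_BA[OF c] by blast
 obtain i where "i : Ch" "p : dmN i" using S_chart[OF subsetD[OF V_S[OF c] p(1)]] by (elim exE conjE) (rule that)
 then show "y : (\<Union>i\<in>Ch. Bi c i)" using p unfolding Bi_def[OF c] Ti_def[OF c] by blast
next
 fix y assume "y : (\<Union>i\<in>Ch. Bi c i)"
 then show "y : chart_img BA c" unfolding chart_img_BA[OF c] Bi_def[OF c] Ti_def[OF c] by blast
qed

lemma fd_measurable: "(%y. indicator (chart_img BA c) y * fd y) : borel_measurable borel"
proof -
 have "continuous_on (chart_img BA c) fd"
 unfolding chart_img_Bi by (rule continuous_on_open_UN) (use Bi_open[OF c] fd_continuous in auto)
 from borel_measurable_continuous_on_indicator[OF _ this] chart_img_open show ?thesis by simp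
qed

definition mf :: "('f \<times> complex) measure" where
 "mf = density lborel (%y. ennreal (indicator (chart_img BA c) y * fd y))"

lemma coord_hom: "homeomorphism (fst c Int Bd) (chart_img BA c) (coord BA c) (%y. inv_into (fst c) (snd c) (0, y))"
proof (rule homeomorphismI)
 have z: "snd c p = (0, snd (snd c p))" if "p : fst c Int Bd" for p using Bd_fst_zero[OF c] that by (metis IntE prod.collapse)
 show "continuous_on (fst c Int Bd) (coord BA c)" unfolding BA_simps[abs_def]
 by (intro continuous_intros continuous_on_subset[OF homeomorphism_cont1[OF psi_hom[OF c]]]) auto
 show "continuous_on (chart_img BA c) (%y. inv_into (fst c) (snd c) (0, y))"
 by (rule continuous_on_compose2[OF homeomorphism_cont2[OF psi_hom[OF c]]]) (auto simp: chart_img_BA[OF c] intro!: continuous_intros)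
 show "coord BA c ` (fst c Int Bd) <= chart_img BA c" unfolding chart_img_def dom_BA[OF c] ..
 show i: "inv_into (fst c) (snd c) (0, coord BA c p) = p" if "p : fst c Int Bd" for p
 unfolding BA_simps z[OF that, symmetric] using inv_psi[OF c] that by blast
 show "(%y. inv_into (fst c) (snd c) (0, y)) ` chart_img BA c <= fst c Int Bd"
 unfolding chart_img_def dom_BA[OF c] image_image using i by auto
 show "coord BA c (inv_into (fst c) (snd c) (0, y)) = y" if "y : chart_img BA c" for y
 using that i unfolding chart_img_def dom_BA[OF c] by auto
qed

lemma coord_borel: "B : sets borel ==> B <= fst c Int Bd ==> coord BA c ` B : sets borel"
proof (rule homeomorphism_image_borel[OF coord_hom])
 obtain U where "open U" "fst c = S Int U" using V_open[OF c] by (auto simp: openin_open)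
 then have "fst c Int Bd = Bd Int U" using Bd_subset by blast
 then show "fst c Int Bd : sets borel" using \<open>open U\<close> closed_Bd by simp
 show "chart_img BA c : sets borel" using chart_img_open by simp
qed

lemma emeasure_mf:
 assumes "B : sets borel" "B <= fst c Int Bd"
 shows "emeasure mf (coord BA c ` B) = (\<integral>\<^sup>+y. ennreal (indicator (coord BA c ` B) y * fd y) \<partial>lborel)"
proof -
 have sub: "coord BA c ` B <= chart_img BA c" using assms(2) unfolding chart_img_def dom_BA[OF c] by blast
 have "emeasure mf (coord BA c ` B) = (\<integral>\<^sup>+y. ennreal (indicator (chart_img BA c) y * fd y) * indicator (coord BA c ` B) y \<partial>lborel)"
 unfolding mf_def by (rule emeasure_density) (use fd_measurable coord_borel[OF assms] in auto)
 also have "\<dots> = (\<integral>\<^sup>+y. ennreal (indicator (coord BA c ` B) y * fd y) \<partial>lborel)"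
 by (rule nn_integral_cong) (use sub in \<open>auto simp: indicator_def\<close>)
 finally show ?thesis .
qed

text \<open>The points with z = 0 are parametrized by boundary coordinates of W, two dimensions
  fewer than the chart, and a differentiable image of lower dimension is negligible.\<close>

lemma mf_binding:
 assumes i: "i : Ch" and B: "B : sets borel" "B <= fst c Int Bd" "B <= dmN i" and z: "!!p. p : B ==> snd p = 0"
 shows "emeasure mf (coord BA c ` B) = 0"
proof -
 define S0 where "S0 = {b :: 'f. (0, b) : img i & (param W i (0, b), 0) : fst c}"
 define f where "f = (%b. snd (snd c (param W i (0, b), 0)))"
 have "f differentiable_on S0"
 unfolding differentiable_on_def
 proof
 fix b assume b: "b : S0"
 let ?p = "(param W i (0, b), 0 :: complex)"
 have p: "?p : fst c" "?p : dmN i" using b param_in[OF i] by (auto simp: S0_def)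
 obtain U g where g: "open U" "coordN i ?p : U" "\<forall>k. Ck_on k U g" "\<forall>q. q : fst c --> q : dmN i --> coordN i q : U --> g (coordN i q) = snd c q"
 using psi_ext[OF c i p] by (elim exE conjE) (rule that)
 have cb: "coordN i (param W i (0, b'), 0) = asc (0, b') 0" if "b' : S0" for b'
 using that coord_param[OF i] by (simp add: S0_def coordN_def)
 define U' where "U' = (%b'. asc (0, b') 0) -` U"
 have bl: "((%b'. asc (0, b') 0) has_derivative (%b'. asc (0, b') 0)) (at b)"
 by (intro has_derivative_asc has_derivative_Pair has_derivative_const has_derivative_ident)
 have ca: "continuous_on UNIV (%b'. asc (0, b') (0 :: complex))" unfolding asc_def by (intro continuous_intros)
 have U': "open U'" "b : U'" unfolding U'_def using open_vimage[OF g(1) ca] g(2) cb[OF b] by auto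
 have "(g has_derivative frechet_derivative g (at (coordN i ?p))) (at (asc (0, b) 0))"
 using Ck_on_has_derivative[OF g(3)[rule_format, of "Suc 0"] g(2)] cb[OF b] by simp
 from has_derivative_snd[OF has_derivative_compose[OF bl this]]
 have "((%b'. snd (g (asc (0, b') 0))) has_derivative (%b'. snd (frechet_derivative g (at (coordN i ?p)) (asc (0, b') 0)))) (at b within S0 Int U')"
 by (rule has_derivative_at_withinI)
 then have "(f has_derivative (%b'. snd (frechet_derivative g (at (coordN i ?p)) (asc (0, b') 0)))) (at b within S0 Int U')"
 proof (rule has_derivative_transform_on)
 show "b : S0 Int U'" using b U' by simp
 fix b' assume b': "b' : S0 Int U'"
 then have "(param W i (0, b'), 0) : fst c" "(param W i (0, b'), 0) : dmN i" "coordN i (param W i (0, b'), 0) : U"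
 using param_in[OF i] cb[of b'] by (auto simp: S0_def U'_def)
 then have "g (coordN i (param W i (0, b'), 0)) = snd c (param W i (0, b'), 0)" using g(4) by blast
 then show "f b' = snd (g (asc (0, b') 0))" using cb[of b'] b' by (simp add: f_def)
 qed
 then show "f differentiable (at b within S0)" unfolding at_within_Int_open[OF U'] differentiable_def by blast
 qed
 moreover have "DIM('f) < DIM('f \<times> complex)" by simp
 ultimately have "negligible (f ` S0)" by (intro negligible_differentiable_image_lowdim)
 moreover have "coord BA c ` B <= f ` S0"
 proof (rule image_subsetI)
 fix p assume p: "p : B"
 have dp: "fst p : dm i" using p B(3) by (auto simp: mem_Times_iff)
 have "p : Bd" using p B(2) by blast
 have "fst (coord W i (fst p)) = 0" using Bd_z_zero[OF \<open>p : Bd\<close> z[OF p]] bdry_coord[OF i dp] by simp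
 then have x: "(0, snd (coord W i (fst p))) = coord W i (fst p)" by (simp add: prod_eq_iff)
 have pe: "(param W i (0, snd (coord W i (fst p))), 0) = p" unfolding x param_coord[OF i dp] using z[OF p] by (simp add: prod_eq_iff)
 have pV: "p : fst c" using subsetD[OF B(2) p] by (rule IntD1)
 have "(0, snd (coord W i (fst p))) : img i" unfolding x by (rule coord_in[OF i dp])
 then have "snd (coord W i (fst p)) : S0" unfolding S0_def mem_Collect_eq pe using pV by (rule conjI)
 moreover have "coord BA c p = f (snd (coord W i (fst p)))" unfolding f_def pe BA_simps ..
 ultimately show "coord BA c p : f ` S0" by blast
 qed
 ultimately have "negligible (coord BA c ` B)" by (rule negligible_subset)
 then have "coord BA c ` B : null_sets lborel"
 using coord_borel[OF B(1,2)] by (simp add: negligible_iff_null_sets null_sets_completion_iff)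
 then have N: "AE y in lborel. y \<notin> coord BA c ` B" by (rule AE_not_in)
 have "AE y in lborel. ennreal (indicator (coord BA c ` B) y * fd y) = 0" using N by eventually_elim simp
 from nn_integral_cong_AE[OF this] show ?thesis unfolding emeasure_mf[OF B(1,2)] by simp
qed

text \<open>The Jacobian of the parametrization followed by the chart turns the contact density into
  the value of the pulled back forms \<lambda> + H dt and d\<lambda> + dH \<and> dt on the basis,
  which is \<tau> times the density of (d\<lambda>)^n.\<close>

lemma piece_density:
 assumes i: "i : Ch" "x : img i" and pos: "0 < Hc i (t, x)" and V: "Th (t, param W i x) : fst c"
 shows "\<exists>g'. ((%q. coord BA c (Th (fst q, param W i (snd q)))) has_derivative g') (at (t, x) within UNIV \<times> img i) &
 tau t (param W i x) * \<bar>vol i x\<bar> = absdet g' * fd (coord BA c (Th (t, param W i x)))"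
proof -
 let ?X = "(UNIV :: real set) \<times> img i" and ?p = "Th (t, param W i x)"
 let ?E = "%q. coordN i (Th (fst q, param W i (snd q)))"
 have q: "(t, x) : ?X" using i by simp
 obtain E' where E: "(?E has_derivative E') (at (t, x) within ?X)"
 "\<forall>u. lamN i (coordN i ?p) (E' u) = lam i x (snd u) + Hc i (t, x) * fst u"
 "\<forall>u v. omN i (coordN i ?p) (E' u) (E' v) = om i x (snd u) (snd v) + DH i (t, x) u * fst v - DH i (t, x) v * fst u"
 using polar_derivative[OF i pos] by (elim exE conjE) (rule that)
 have pB: "?p : Bd" using Th_Bd[of "(t, param W i x)"] param_points[OF i] by simp
 have pi: "?p : dmN i" using param_in[OF i] by (simp add: Th_def)
 obtain U g where g: "open U" "coordN i ?p : U" "\<forall>k. Ck_on k U g" "\<forall>q. q : fst c --> q : dmN i --> coordN i q : U --> g (coordN i q) = snd c q"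
 "\<forall>u. frechet_derivative g (at (coordN i ?p)) (Dt c i (snd c ?p) u) = u" using psi_ext[OF c i(1) V pi] by (elim exE conjE) (rule that)
 let ?G = "frechet_derivative g (at (coordN i ?p))"
 have gD: "(g has_derivative ?G) (at (coordN i ?p))" by (rule Ck_on_has_derivative[OF g(3)[rule_format, of "Suc 0"] g(2)])
 obtain O1 where O1: "open O1" "fst c = S Int O1" using V_open[OF c] by (auto simp: openin_open)
 have cm: "continuous_on ?X (%q. (fst q, param W i (snd q)))"
 by (intro continuous_intros continuous_on_compose2[OF continuous_param[OF i(1)]]) auto
 have cT: "continuous_on ?X (%q. Th (fst q, param W i (snd q)))"
 by (rule continuous_on_compose2[OF Th_continuous cm]) (use param_points[OF i(1)] in auto)
 have dT: "Th (fst q, param W i (snd q)) : dmN i" "Th (fst q, param W i (snd q)) : Bd" if "q : ?X" for q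
 using param_in[OF i(1), of "snd q"] param_points[OF i(1), of "snd q"] that Th_Bd[of "(fst q, param W i (snd q))"] by (simp_all add: Th_def mem_Times_iff)
 have cE: "continuous_on ?X ?E" by (rule continuous_on_compose2[OF continuous_coordN[OF i(1)] cT]) (rule image_subsetI, rule dT(1))
 define Q where "Q = (?X Int (%q. Th (fst q, param W i (snd q))) -` O1) Int (?X Int ?E -` U)"
 have Q: "openin (top_of_set ?X) Q" unfolding Q_def
 by (intro openin_Int continuous_openin_preimage_gen cT cE O1(1) g(1))
 have "?p : O1" using V[unfolded O1(2)] by simp
 then have qQ: "(t, x) : Q" unfolding Q_def using q g(2) by simp
 have at: "at (t, x) within Q = at (t, x) within ?X" by (rule at_within_openin[OF Q qQ])
 have gE: "g (?E q) = (0, coord BA c (Th (fst q, param W i (snd q))))" if "q : Q" for q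
 proof -
 have q: "q : ?X" "Th (fst q, param W i (snd q)) : O1" "?E q : U" using that unfolding Q_def by auto
 have v: "Th (fst q, param W i (snd q)) : fst c" unfolding O1(2) using q(2) subsetD[OF Bd_subset dT(2)[OF q(1)]] by simp
 from Bd_fst_zero[OF c v dT(2)[OF q(1)]] g(4)[rule_format, OF v dT(1)[OF q(1)] q(3)] show ?thesis by (simp add: BA_simps prod_eq_iff)
 qed
 have E1: "(?E has_derivative E') (at (t, x) within Q)" using E(1) at by simp
 have "(g has_derivative ?G) (at (?E (t, x)) within ?E ` Q)" using has_derivative_at_withinI[OF gD] by simp
 from has_derivative_in_compose[OF E1 this]
 have "((%q. g (?E q)) has_derivative (%u. ?G (E' u))) (at (t, x) within Q)" .
 then have "((%q. (0, coord BA c (Th (fst q, param W i (snd q))))) has_derivative (%u. ?G (E' u))) (at (t, x) within Q)"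
 by (rule has_derivative_transform_on[OF _ qQ]) (simp only: gE)
 then have d: "((%q. (0 :: real, coord BA c (Th (fst q, param W i (snd q))))) has_derivative (%u. ?G (E' u))) (at (t, x) within ?X)" by (simp only: at)
 have "((%q. 0 :: real) has_derivative (%u. fst (?G (E' u)))) (at (t, x) within ?X)" using has_derivative_fst[OF d] by simp
 from thick_derivative_unique[OF thick_UNIV_img[OF i(1)] q this has_derivative_const]
 have fst0: "fst (?G (E' u)) = 0" for u by (rule fun_cong)
 define g' where "g' = (%u. snd (?G (E' u)))"
 have g': "((%q. coord BA c (Th (fst q, param W i (snd q)))) has_derivative g') (at (t, x) within ?X)"
 using has_derivative_snd[OF d] by (simp add: g'_def)
 \<comment> \<open>The velocity \<open>E' u\<close> is tangent to the boundary of the tube, so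
   passing through the chart by way of \<open>g'\<close> and back loses nothing.\<close>
 have DE: "Dt c i (snd c ?p) (0, g' u) = E' u" for u
 proof -
 obtain b where b: "E' u = Dt c i (snd c ?p) b" using Dt_surj[OF c i(1) V pi] by (metis surjD)
 then have "?G (E' u) = b" using g(5) by simp
 then have "b = (0, g' u)" using fst0[of u] by (simp add: g'_def prod_eq_iff)
 then show ?thesis using b by simp
 qed
 have y0: "snd c ?p = (0, snd (snd c ?p))" using Bd_fst_zero[OF c V pB] by (metis prod.collapse)
 let ?y = "snd (snd c ?p)"
 have "snd c ?p : Ti c i" unfolding Ti_def[OF c] by (rule imageI[OF IntI[OF V pi]])
 then have Bi: "?y : Bi c i" unfolding Bi_def[OF c] using y0 by simp
 note DL = Dt_linear[OF c i(1) \<open>snd c ?p : Ti c i\<close>]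
 have yN: "coordN i ?p : imgN i" by (rule coordN_in[OF i(1) pi])
 have b1: "\<beta> c ?y = (%u. lamN i (coordN i ?p) (Dt c i (snd c ?p) (0, u)))" using beta_chart[OF c V pB i(1) pi] by (rule ext)
 have b2: "ext_d BA \<beta> c ?y = (%u v. omN i (coordN i ?p) (Dt c i (snd c ?p) (0, u)) (Dt c i (snd c ?p) (0, v)))"
 using dbeta_Bi[OF c i(1) Bi] unfolding y0[symmetric] Phi_psi[OF c V] by (intro ext)
 have L0: "linear (%u. Dt c i (snd c ?p) (0, u))"
 using linear_compose[OF _ DL, of "%u. (0, u)"] by (simp add: o_def linear_iff)
 have lin1: "linear (\<beta> c ?y)" unfolding b1 using linear_compose[OF L0 lamN_linear[OF i(1) yN]] by (simp add: o_def)
 have lin2: "bilin (ext_d BA \<beta> c ?y)" unfolding b2 bilin_def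
 using linear_compose[OF L0 omN_linear(1)[OF i(1) yN]] linear_compose[OF L0 omN_linear(2)[OF i(1) yN]] by (simp add: o_def)
 have lg: "linear g'" using has_derivative_linear[OF g'] .
 have DD: "DIM('f \<times> complex) = DIM(real \<times> (real \<times> 'f))" by simp
 have af: "alt_form (DIM(real \<times> (real \<times> 'f))) (ctop (\<beta> c ?y) (ext_d BA \<beta> c ?y) n)"
 using alt_form_ctop[OF lin1 lin2, of n] DIM_W by simp
 have "absdet g' * fd ?y = \<bar>ctop (\<beta> c ?y) (ext_d BA \<beta> c ?y) n (%j. g' (basis_frame j))\<bar>"
 unfolding fd_def contact_top_form_ctop using alt_form_absdet[OF DD af lg] by simp
 also have "\<dots> = \<bar>ctop (%u. \<beta> c ?y (g' u)) (%u w. ext_d BA \<beta> c ?y (g' u) (g' w)) n basis_frame\<bar>" by (simp only: ctop_pullback)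
 also have "\<dots> = \<bar>ctop (%u. lamN i (coordN i ?p) (E' u)) (%u w. omN i (coordN i ?p) (E' u) (E' w)) n basis_frame\<bar>"
 unfolding b1 b2 DE ..
 also have "\<dots> = \<bar>(lam i x (ham_vec W lam (H t) i x) + Hc i (t, x)) * dpow (om i x) n bfr\<bar>"
 proof (rule ctop_suspension[where dh = "%u. DH i (t, x) (0, u)"])
 show "linear (lam i x)" "bilin (om i x)" using lam_linear om_bilin i by blast+
 show "om i x u v = - om i x v u" for u v by (rule om_skew)
 show "linear (%u. DH i (t, x) (0, u))" using has_derivative_linear[OF Ht_derivative[OF i]] .
 show "om i x (ham_vec W lam (H t) i x) u = DH i (t, x) (0, u)" for u
 using ham_vec[OF C1W_diffW[OF C1W_H] i, of t u] by (simp add: dW_H[OF i])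
 have "lam i x (ham_vec W lam (H t) i x) + Hc i (t, x) = tau t (param W i x)"
 using lam_ham_vec[OF C1W_diffW[OF C1W_H] i, of t] tau_chart[OF i, of t] by (simp add: dW_H[OF i])
 then show "lam i x (ham_vec W lam (H t) i x) + Hc i (t, x) ~= 0" using tau_pos[OF param_points[OF i], of t] by (simp add: tau_def)
 show "bij_betw bfr {..<2 * n} Basis" by (rule bfr_bij)
 show "bij_betw basis_frame {..<1 + 2 * n} (Basis :: (real \<times> (real \<times> 'f)) set)"
 using basis_frame_bij[where 'e = "real \<times> (real \<times> 'f)"] DIM_W by simp
 show "lamN i (coordN i ?p) (E' (s, x')) = lam i x x' + Hc i (t, x) * s" for s x' using E(2) by simp
 have sp: "DH i (t, x) (s, x') = s * DH i (t, x) (1, 0) + DH i (t, x) (0, x')" for s x'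
 proof -
 have "(s, x') = s *\<^sub>R (1, 0) + (0, x')" by simp
 then show ?thesis using linear_add[OF DH_linear[OF i]] linear_cmul[OF DH_linear[OF i]] by (metis real_scaleR_def)
 qed
 show "omN i (coordN i ?p) (E' (s, u)) (E' (s', u')) = om i x u u' + DH i (t, x) (0, u) * s' - DH i (t, x) (0, u') * s" for s u s' u'
 unfolding E(3)[rule_format] sp[of s u] sp[of s' u'] by (simp add: algebra_simps)
 qed
 also have "lam i x (ham_vec W lam (H t) i x) + Hc i (t, x) = tau t (param W i x)"
 using lam_ham_vec[OF C1W_diffW[OF C1W_H] i, of t] tau_chart[OF i, of t] by (simp add: dW_H[OF i])
 also have "\<bar>tau t (param W i x) * dpow (om i x) n bfr\<bar> = tau t (param W i x) * \<bar>vol i x\<bar>"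
 using tau_pos[OF param_points[OF i], of t] by (simp add: vol_def abs_mult tau_def)
 finally show ?thesis using g' by (intro exI[of _ g']) (simp add: BA_simps)
qed

end

end

section \<open>Comparison of the two measures and the total volume\<close>

context ham
begin

context
 fixes c assumes c: "c : charts TB"
begin

text \<open>Off z = 0 the parametrization followed by the chart is injective and differentiable with
  the matching density, so the change of variables formula applies; Fubini identifies the resulting
  integral over the parameters with the measure \<open>nu\<close>.\<close>

lemma nu_piece:
 assumes i: "i : Ch" and B: "B : sets borel" "B <= fst c Int Bd" "B <= dmN i" and nz: "!!p. p : B ==> snd p ~= 0"
 shows "emeasure nu B = emeasure (mf c) (coord BA c ` B)"
proof -
 let ?X = "(UNIV :: real set) \<times> img i"
 let ?m = "%q. Th (fst q, param W i (snd q))"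
 let ?g = "%q. coord BA c (?m q)"
 define Q where "Q = {q. fst q : {0..<1} & snd q : img i & ?m q : B}"
 define h where "h = (%q. \<bar>tau (fst q) (param W i (snd q)) * vol i (snd q)\<bar>)"
 have Qd: "fst q : {0..<1}" "snd q : img i" "?m q : B" if "q : Q" for q using that unfolding Q_def by blast+
 have XB: "?X : sets borel" by (intro borel_Times img_borel[OF i]) simp
 have cm: "continuous_on ?X (%q. (fst q, param W i (snd q)))"
 by (intro continuous_intros continuous_on_compose2[OF continuous_param[OF i]]) auto
 have mP: "(%q. (fst q, param W i (snd q))) ` ?X <= UNIV \<times> Pts" using param_points[OF i] by auto
 have cT: "continuous_on ?X ?m" by (rule continuous_on_compose2[OF Th_continuous cm mP])
 have QB: "Q : sets borel"
 proof -
 let ?mm = "%q. if q : ?X then ?m q else undefined"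
 have "?mm : borel_measurable borel" by (rule borel_measurable_continuous_on_if[OF XB cT continuous_on_const])
 from measurable_sets[OF this B(1)] have "?mm -` B : sets borel" by simp
 moreover have "{0..<1::real} \<times> img i : sets borel" by (intro borel_Times img_borel[OF i]) simp
 ultimately have "({0..<1} \<times> img i) Int ?mm -` B : sets borel" by (rule sets.Int[rotated])
 moreover have "({0..<1} \<times> img i) Int ?mm -` B = Q"
 proof (rule set_eqI)
 fix q show "q : ({0..<1} \<times> img i) Int ?mm -` B \<longleftrightarrow> q : Q"
 unfolding Q_def by (cases "snd q : img i") (simp_all add: mem_Times_iff conj_assoc)
 qed
 ultimately show ?thesis by simp
 qed
 have mPt: "param W i (snd q) : Pts" if "q : Q" for q using param_points[OF i Qd(2)[OF that]] .
 have inj: "inj_on ?g Q"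
 proof (rule inj_onI)
 fix q q' assume q: "q : Q" "q' : Q" "?g q = ?g q'"
 have mm: "?m q : fst c Int Bd" "?m q' : fst c Int Bd" using Qd(3) q B(2) by blast+
 have eq: "?m q = ?m q'"
 using arg_cong[OF q(3), of "%y. inv_into (fst c) (snd c) (0, y)"]
 unfolding homeomorphism_apply1[OF coord_hom[OF c] mm(1)] homeomorphism_apply1[OF coord_hom[OF c] mm(2)] .
 have "(fst q, param W i (snd q)) = (fst q', param W i (snd q'))"
 by (rule Th_inj[OF _ _ _ _ nz[OF Qd(3)[OF q(1)]] eq])
 (simp_all only: fst_conv snd_conv mPt[OF q(1)] mPt[OF q(2)] Qd(1)[OF q(1)] Qd(1)[OF q(2)])
 then have "fst q = fst q'" "coord W i (param W i (snd q)) = coord W i (param W i (snd q'))" by simp_all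
 then show "q = q'"
 unfolding coord_param[OF i Qd(2)[OF q(1)]] coord_param[OF i Qd(2)[OF q(2)]] by (rule prod_eqI)
 qed
 have gQ: "?g ` Q = coord BA c ` B"
 proof (intro equalityI image_subsetI)
 fix q assume "q : Q" then show "?g q : coord BA c ` B" using Qd(3) by blast
 next
 fix p assume p: "p : B"
 have dp: "fst p : dm i" using p B(3) by (auto simp: mem_Times_iff)
 have "p : Bd" using p B(2) by blast
 obtain t where t: "t : {0..<1}" "Th (t, fst p) = p" using Th_surj[OF \<open>p : Bd\<close>] by blast
 have m: "?m (t, coord W i (fst p)) = p" using t(2) param_coord[OF i dp] by simp
 have "(t, coord W i (fst p)) : Q" unfolding Q_def mem_Collect_eq m using t(1) coord_in[OF i dp] p by simp
 from imageI[OF this, of ?g] show "coord BA c p : ?g ` Q" unfolding m .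
 qed
 have "\<forall>q\<in>Q. \<exists>g'. (?g has_derivative g') (at q within ?X) & tau (fst q) (param W i (snd q)) * \<bar>vol i (snd q)\<bar> = absdet g' * fd c (?g q)"
 proof
 fix q assume q: "q : Q"
 have "snd (?m q) ~= 0" using nz[OF Qd(3)[OF q]] .
 then have "param W i (snd q) \<notin> bdry W" using Th_zero[of "(fst q, param W i (snd q))"] mPt[OF q] by simp
 then have "0 < Hc i (fst q, snd q)" using H_pos[OF mPt[OF q]] by (simp add: Hc_def case_prod_unfold)
 moreover have "Th (fst q, param W i (snd q)) : fst c" using Qd(3)[OF q] B(2) by blast
 ultimately show "\<exists>g'. (?g has_derivative g') (at q within ?X) & tau (fst q) (param W i (snd q)) * \<bar>vol i (snd q)\<bar> = absdet g' * fd c (?g q)"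
 using piece_density[OF c i Qd(2)[OF q], of "fst q"] by simp
 qed
 from bchoice[OF this] obtain g' where g': "!!q. q : Q ==> (?g has_derivative g' q) (at q within ?X)"
 "!!q. q : Q ==> tau (fst q) (param W i (snd q)) * \<bar>vol i (snd q)\<bar> = absdet (g' q) * fd c (?g q)" by blast
 have QX: "Q <= ?X" using Qd(2) by (auto simp: mem_Times_iff)
 have hm: "(%q. indicator Q q * h q) : borel_measurable borel"
 proof -
 have "continuous_on ?X (%q. tau (fst q) (param W i (snd q)))" using continuous_on_compose2[OF tau_continuous cm mP] by simp
 moreover have "continuous_on ?X (%q. vol i (snd q))" by (intro continuous_on_compose2[OF vol_continuous[OF i]] continuous_intros) auto
 ultimately have "continuous_on ?X h" unfolding h_def by (intro continuous_intros)
 from borel_measurable_continuous_on_indicator[OF _ this] XB have "(%q. indicator ?X q * h q) : borel_measurable borel" by simp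
 from borel_measurable_times[OF borel_measurable_indicator[OF QB] this]
 have "(%q. indicator Q q * (indicator ?X q * h q)) : borel_measurable borel" .
 moreover have "(%q. indicator Q q * (indicator ?X q * h q)) = (%q. indicator Q q * h q)" using QX by (auto simp: indicator_def fun_eq_iff)
 ultimately show ?thesis by simp
 qed
 have cB: "coord BA c ` B : sets borel" by (rule coord_borel[OF c B(1,2)])
 have sub: "coord BA c ` B <= chart_img BA c" using B(2) unfolding chart_img_def dom_BA[OF c] by blast
 have fm: "(%y. indicator (?g ` Q) y * fd c y) : borel_measurable borel"
 proof -
 have "(%y. indicator (coord BA c ` B) y * (indicator (chart_img BA c) y * fd c y)) : borel_measurable borel"
 by (rule borel_measurable_times[OF borel_measurable_indicator[OF cB] fd_measurable[OF c]])
 moreover have "(%y. indicator (coord BA c ` B) y * (indicator (chart_img BA c) y * fd c y)) = (%y. indicator (?g ` Q) y * fd c y)"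
 unfolding gQ using sub by (auto simp: indicator_def fun_eq_iff)
 ultimately show ?thesis by simp
 qed
 have "(\<integral>\<^sup>+y. ennreal (indicator (?g ` Q) y * fd c y) \<partial>lborel) = (\<integral>\<^sup>+q. ennreal (indicator Q q * h q) \<partial>lborel)"
 proof (rule nn_integral_change_of_variables[OF _ QB _ inj _ _ fm hm, of g'])
 show "DIM('f \<times> complex) = DIM(real \<times> (real \<times> 'f))" by simp
 show "(?g has_derivative g' q) (at q within Q)" if "q : Q" for q by (rule has_derivative_subset[OF g'(1)[OF that] QX])
 show "0 <= fd c y" for y by (simp add: fd_def[OF c])
 show "0 <= h q" for q by (simp add: h_def)
 show "h q = absdet (g' q) * fd c (?g q)" if "q : Q" for q
 unfolding g'(2)[OF that, symmetric] h_def using tau_pos[OF mPt[OF that], of "fst q"] by (simp add: abs_mult tau_def)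
 qed
 then have R: "emeasure (mf c) (coord BA c ` B) = (\<integral>\<^sup>+q. ennreal (indicator Q q * h q) \<partial>lborel)"
 unfolding gQ emeasure_mf[OF c B(1,2)] .
 have BBd: "B <= Bd" using B(2) by blast
 let ?f = "%y. ennreal (tau (fst y) (snd y)) * indicator B (Th y)"
 let ?R = "restrict_space lborel {0..<1::real}"
 have f0: "?f : borel_measurable M0"
 by (intro borel_measurable_times_ennreal tau_measurable measurable_compose[OF Th_measurable borel_measurable_indicator[OF Bd_sets[OF B(1) BBd]]])
 have sf: "sigma_finite_measure \<mu>" using finite_measure.axioms(1)[OF finite_measure_mu] .
 have "emeasure nu B = (\<integral>\<^sup>+t. (\<integral>\<^sup>+w. ?f (t, w) \<partial>\<mu>) \<partial>?R)"
 unfolding emeasure_nu[OF B(1) BBd] M0_def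
 by (rule sigma_finite_measure.nn_integral_fst[OF sf f0[unfolded M0_def], symmetric])
 also have "\<dots> = (\<integral>\<^sup>+t. (\<integral>\<^sup>+x. ennreal (indicator Q (t, x) * h (t, x)) \<partial>lborel) \<partial>?R)"
 proof (rule nn_integral_cong)
 fix t assume "t : space ?R"
 then have t: "t : {0..<1}" "t : space ?R" by (simp_all add: space_restrict_space)
 have "(%w. ?f (t, w)) : borel_measurable (restrict_space borel Pts)"
 using measurable_Pair2[OF f0[unfolded M0_def] t(2)] unfolding measurable_cong_sets[OF sets_mu refl] .
 moreover have "?f (t, w) = 0" if "w : Pts" "w \<notin> dm i" for w
 using that B(3) by (auto simp: Th_def indicator_def)
 ultimately have "(\<integral>\<^sup>+w. ?f (t, w) \<partial>\<mu>) = (\<integral>\<^sup>+x. ennreal (indicator (img i) x * \<bar>vol i x\<bar>) * ?f (t, param W i x) \<partial>lborel)"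
 by (intro nn_integral_mu_chart[OF i, of "%w. ?f (t, w)"])
 also have "\<dots> = (\<integral>\<^sup>+x. ennreal (indicator Q (t, x) * h (t, x)) \<partial>lborel)"
 proof (rule nn_integral_cong)
 fix x
 show "ennreal (indicator (img i) x * \<bar>vol i x\<bar>) * ?f (t, param W i x) = ennreal (indicator Q (t, x) * h (t, x))"
 proof (cases "(t, x) : Q")
 case True
 have tp: "0 < tau t (param W i x)" using tau_pos[OF mPt[OF True]] by (simp add: tau_def)
 show ?thesis using Qd[OF True] True tp
 by (simp add: h_def abs_mult ennreal_mult[symmetric] mult.commute)
 next
 case False
 then have "x \<notin> img i \<or> Th (t, param W i x) \<notin> B" using t(1) by (simp add: Q_def)
 then show ?thesis using False by auto
 qed
 qed
 finally show "(\<integral>\<^sup>+w. ?f (t, w) \<partial>\<mu>) = (\<integral>\<^sup>+x. ennreal (indicator Q (t, x) * h (t, x)) \<partial>lborel)" .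
 qed
 also have "\<dots> = (\<integral>\<^sup>+t. (\<integral>\<^sup>+x. ennreal (indicator Q (t, x) * h (t, x)) \<partial>lborel) * indicator {0..<1} t \<partial>lborel)"
 by (rule nn_integral_restrict_space) simp
 also have "\<dots> = (\<integral>\<^sup>+t. (\<integral>\<^sup>+x. ennreal (indicator Q (t, x) * h (t, x)) \<partial>lborel) \<partial>lborel)"
 proof (rule nn_integral_cong)
 fix t :: real
 show "(\<integral>\<^sup>+x. ennreal (indicator Q (t, x) * h (t, x)) \<partial>lborel) * indicator {0..<1} t = (\<integral>\<^sup>+x. ennreal (indicator Q (t, x) * h (t, x)) \<partial>lborel)"
 proof (cases "t : {0..<1}")
 case False
 then have "(t, x) \<notin> Q" for x by (auto simp: Q_def)
 then show ?thesis by simp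
 qed simp
 qed
 also have "\<dots> = (\<integral>\<^sup>+q. ennreal (indicator Q q * h q) \<partial>(lborel \<Otimes>\<^sub>M lborel))"
 proof (rule lborel.nn_integral_fst)
 show "(%q. ennreal (indicator Q q * h q)) : borel_measurable (lborel \<Otimes>\<^sub>M lborel)"
 unfolding lborel_prod using hm by simp
 qed
 finally show ?thesis unfolding R lborel_prod .
qed

text \<open>The part with z = 0, where the parametrization degenerates, is null for both
  measures.\<close>

lemma nu_cell:
 assumes i: "i : Ch" and B: "B : sets borel" "B <= fst c Int Bd" "B <= dmN i"
 shows "emeasure nu B = emeasure (mf c) (coord BA c ` B)"
proof -
 let ?Z = "{p :: 'w \<times> complex. snd p = 0}"
 have "closed ?Z" by (intro closed_Collect_eq continuous_intros)
 then have Z: "?Z : sets borel" by simp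
 have B0: "B Int ?Z : sets borel" and B1: "B - ?Z : sets borel" using B(1) Z by auto
 have sn: "sets nu = sets (restrict_space borel Bd)" by (simp add: nu_def)
 have b: "B Int ?Z <= fst c Int Bd" "B - ?Z <= fst c Int Bd" "B Int ?Z <= dmN i" "B - ?Z <= dmN i" using B(2,3) by blast+
 have inj: "inj_on (coord BA c) B"
 by (rule inj_on_subset[OF _ B(2)], rule inj_on_inverseI[of _ "%y. inv_into (fst c) (snd c) (0, y)"]) (rule homeomorphism_apply1[OF coord_hom[OF c]])
 have s: "B Int ?Z : sets nu" "B - ?Z : sets nu" unfolding sn by (rule Bd_sets; use B0 B1 b in blast)+
 have n0: "emeasure nu (B Int ?Z) = 0" by (rule nu_binding[OF B0 subset_trans[OF b(1) Int_lower2]]) simp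
 have m0: "emeasure (mf c) (coord BA c ` (B Int ?Z)) = 0" by (rule mf_binding[OF c i B0 b(1,3)]) simp
 have p1: "emeasure nu (B - ?Z) = emeasure (mf c) (coord BA c ` (B - ?Z))" by (rule nu_piece[OF i B1 b(2,4)]) simp
 have "emeasure nu B = emeasure nu (B Int ?Z) + emeasure nu (B - ?Z)"
 by (subst plus_emeasure[OF s]) (auto intro: arg_cong[where f = "emeasure nu"])
 also have "\<dots> = emeasure (mf c) (coord BA c ` (B Int ?Z)) + emeasure (mf c) (coord BA c ` (B - ?Z))"
 unfolding n0 m0 p1 ..
 also have "\<dots> = emeasure (mf c) (coord BA c ` (B Int ?Z) Un coord BA c ` (B - ?Z))"
 proof (rule plus_emeasure)
 show "coord BA c ` (B Int ?Z) : sets (mf c)" "coord BA c ` (B - ?Z) : sets (mf c)"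
 using coord_borel[OF c B0 b(1)] coord_borel[OF c B1 b(2)] by (simp_all add: mf_def[OF c])
 show "coord BA c ` (B Int ?Z) Int coord BA c ` (B - ?Z) = {}"
 using inj_on_image_Int[OF inj, of "B Int ?Z" "B - ?Z"] by blast
 qed
 also have "coord BA c ` (B Int ?Z) Un coord BA c ` (B - ?Z) = coord BA c ` B" by blast
 finally show ?thesis .
qed

text \<open>The set is cut along a countable cover by product charts, made disjoint, and both
  measures are summed over the pieces.\<close>

lemma nu_chart:
 assumes B: "B : sets borel" "B <= fst c Int Bd"
 shows "emeasure nu B = emeasure (mf c) (coord BA c ` B)"
proof -
 obtain C :: "nat => 'i" where C: "!!k. C k : Ch" "Pts = (\<Union>k. dm (C k))"
 using charts_countable_cover[OF dom_open Ch_nonempty] by blast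
 define D where "D = disjointed (%k. dmN (C k))"
 have EB: "dmN (C k) : sets borel" for k by (intro borel_Times dom_borel[OF C(1)]) simp
 have DB: "D k : sets borel" for k unfolding D_def using sets.range_disjointed_sets[of "%k. dmN (C k)" borel] EB by blast
 have Dd: "D k <= dmN (C k)" for k unfolding D_def by (rule disjointed_subset)
 have dis: "disjoint_family D" unfolding D_def by (rule disjoint_family_disjointed)
 have "B <= Pts \<times> UNIV" using B(2) Bd_subset S_Pts by blast
 also have "Pts \<times> UNIV = (\<Union>k. D k)" unfolding D_def UN_disjointed_eq C(2) by blast
 finally have U: "(\<Union>k. B Int D k) = B" by blast
 have Bk: "B Int D k : sets borel" "B Int D k <= fst c Int Bd" "B Int D k <= dmN (C k)" for k using B DB Dd by blast+
 have inj: "inj_on (coord BA c) B"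
 by (rule inj_on_subset[OF _ B(2)], rule inj_on_inverseI[of _ "%y. inv_into (fst c) (snd c) (0, y)"]) (rule homeomorphism_apply1[OF coord_hom[OF c]])
 have sn: "sets nu = sets (restrict_space borel Bd)" by (simp add: nu_def)
 have "(\<Sum>k. emeasure nu (B Int D k)) = emeasure nu (\<Union>k. B Int D k)"
 proof (rule suminf_emeasure)
 show "range (%k. B Int D k) <= sets nu" unfolding sn
 proof (rule image_subsetI)
 fix k show "B Int D k : sets (restrict_space borel Bd)" by (rule Bd_sets[OF Bk(1)]) (use Bk(2) in blast)
 qed
 show "disjoint_family (%k. B Int D k)" using dis unfolding disjoint_family_on_def by blast
 qed
 moreover have "(\<Sum>k. emeasure (mf c) (coord BA c ` (B Int D k))) = emeasure (mf c) (\<Union>k. coord BA c ` (B Int D k))"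
 proof (rule suminf_emeasure)
 show "range (%k. coord BA c ` (B Int D k)) <= sets (mf c)"
 proof (rule image_subsetI)
 fix k show "coord BA c ` (B Int D k) : sets (mf c)" using coord_borel[OF c Bk(1,2)] by (simp add: mf_def[OF c])
 qed
 show "disjoint_family (%k. coord BA c ` (B Int D k))"
 unfolding disjoint_family_on_def
 proof (intro ballI impI)
 fix k l :: nat assume "k ~= l"
 then have "(B Int D k) Int (B Int D l) = {}" using dis unfolding disjoint_family_on_def by blast
 moreover have "coord BA c ` ((B Int D k) Int (B Int D l)) = coord BA c ` (B Int D k) Int coord BA c ` (B Int D l)"
 by (rule inj_on_image_Int[OF inj]) blast+
 ultimately show "coord BA c ` (B Int D k) Int coord BA c ` (B Int D l) = {}" by simp
 qed
 qed
 moreover have "(\<Union>k. coord BA c ` (B Int D k)) = coord BA c ` B" unfolding image_UN[symmetric] U ..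
 ultimately show ?thesis using nu_cell[OF C(1) Bk] U by simp
qed

end

lemma form_measure_tube: "form_measure BA (contact_top_form BA \<beta> n) = nu"
proof -
 have op: "openin (top_of_set (points BA)) (chart_dom BA c)" if "c : charts BA" for c
 proof -
 have c: "c : charts TB" using that by (simp add: BA_simps(1))
 obtain U where "open U" "fst c = S Int U" using V_open[OF c] by (auto simp: openin_open)
 then have "fst c Int Bd = Bd Int U" using Bd_subset by blast
 then show ?thesis unfolding points_BA dom_BA[OF c] using \<open>open U\<close> by (simp add: openin_open_Int)
 qed
 obtain w where "w : Pts" using points_nonempty by blast
 then have "Th (0, w) : Bd" using Th_Bd[of "(0, w)"] by simp
 from chart_exists[OF this] have "charts BA ~= {}" unfolding BA_simps(1) by (elim bexE) (rule ex_in_conv[THEN iffD1], rule exI)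
 note ne = this
 obtain C :: "nat => ('w \<times> complex) set \<times> ('w \<times> complex => real \<times> ('f \<times> complex))"
 where C: "!!k. C k : charts BA" "points BA = (\<Union>k. chart_dom BA (C k))"
 by (rule charts_countable_cover[OF op ne], assumption, rule that) (simp_all only:)
 show ?thesis
 proof (rule form_measure_eqI[OF C])
 show "chart_dom BA (C k) : sets borel" for k
 by (rule borel_openin[OF op[OF C(1)]]) (simp add: points_BA borel_closed[OF closed_Bd])
 show "sets nu = sets (restrict_space borel (points BA))" by (simp add: nu_def points_BA)
 fix c B assume c: "c : charts BA" and B: "B : sets borel" "B <= chart_dom BA c"
 have c': "c : charts TB" using c by (simp add: BA_simps(1))
 have B': "B <= fst c Int Bd" using B(2) unfolding dom_BA[OF c'] .
 have "emeasure nu B = (\<integral>\<^sup>+y. ennreal (indicator (coord BA c ` B) y * fd c y) \<partial>lborel)"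
 using nu_chart[OF c' B(1) B'] emeasure_mf[OF c' B(1) B'] by simp
 also have "\<dots> = (\<integral>\<^sup>+y\<in>coord BA c ` B. ennreal \<bar>contact_top_form BA \<beta> n c y basis_frame\<bar> \<partial>lborel)"
 by (rule nn_integral_cong) (simp add: fd_def[OF c'] indicator_def)
 finally show "emeasure nu B = (\<integral>\<^sup>+y\<in>coord BA c ` B. ennreal \<bar>contact_top_form BA \<beta> n c y basis_frame\<bar> \<partial>lborel)" .
 qed
qed

text \<open>The total mass of \<open>nu\<close> is the integral of \<tau>, namely (n + 1) Cal(H) by
  Stokes; positivity of \<tau> lets it be read as an ordinary integral.\<close>

lemma contact_volume_tube: "contact_volume BA \<beta> n = real (n + 1) * Cal n W lam H / fact n"
 and Cal_nonneg: "0 <= Cal n W lam H"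
proof -
 have pos: "AE y in M0. 0 <= tau (fst y) (snd y)"
 by (rule AE_I2, unfold tau_def, rule less_imp_le, rule tau_pos) (simp add: space_M0 mem_Times_iff)
 have "emeasure nu Bd = (\<integral>\<^sup>+y. ennreal (tau (fst y) (snd y)) \<partial>M0)"
 unfolding emeasure_nu[OF borel_closed[OF closed_Bd] subset_refl]
 by (rule nn_integral_cong) (use Th_Bd in \<open>auto simp: space_M0\<close>)
 also have "\<dots> = ennreal (\<integral>y. tau (fst y) (snd y) \<partial>M0)"
 by (rule nn_integral_eq_integral[OF M0_integrable[OF tau_continuous] pos])
 finally have e: "emeasure nu Bd = ennreal (real (n + 1) * Cal n W lam H)" unfolding integral_tau_Cal .
 have "0 <= (\<integral>y. tau (fst y) (snd y) \<partial>M0)" by (rule integral_nonneg_AE[OF pos])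
 then have nn: "0 <= real (n + 1) * Cal n W lam H" unfolding integral_tau_Cal .
 then show "0 <= Cal n W lam H" by (simp add: zero_le_mult_iff)
 show "contact_volume BA \<beta> n = real (n + 1) * Cal n W lam H / fact n"
 unfolding contact_volume_def form_measure_tube points_BA measure_def e using nn by simp
qed

lemma Sys_nonneg: "0 <= Sys W lam"
 unfolding Sys_def min_period_def by (rule Inf_greatest) auto

end

lemma ereal_power_le: "0 <= x ==> x <= y ==> 0 <= x ^ k & x ^ k <= y ^ k" for x y :: ereal
proof (induction k)
 case (Suc k)
 then show ?case using ereal_mult_mono[of y "x ^ k" x "y ^ k"] ereal_0_le_mult[of x "x ^ k"] by (simp add: order_trans)
qed simp

text \<open>Also for v = 0 both sides are the same: they are x times infinity up to the positive
  factor \<open>fact n\<close>.\<close>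

lemma ereal_divide_fact:
 assumes "0 <= v" shows "x / ereal (v / fact n) = ereal (fact n) * x / ereal v"
proof (cases x)
 case (real r)
 show ?thesis
 proof (cases "v = 0")
 case True
 consider "r = 0" | "0 < r" | "r < 0" by linarith
 then show ?thesis by cases (simp_all add: real True divide_ereal_def zero_less_mult_iff mult_less_0_iff)
 next
 case False
 then show ?thesis by (simp add: real divide_ereal_def divide_inverse)
 qed
next
 case PInf
 with assms show ?thesis by (cases "v = 0") (simp_all add: divide_ereal_def)
next
 case MInf
 with assms show ?thesis by (cases "v = 0") (simp_all add: divide_ereal_def)
qed

theorem proposition1p31:
  fixes n :: nat
    and W :: "('i, 'w::{t2_space, second_countable_topology}, real \<times> 'f::euclidean_space) atlas"
    and lam :: "('i, real \<times> 'f) oneform"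
    and H :: "real \<Rightarrow> 'w \<Rightarrow> real"
  assumes "liouville_domain n W lam"
    and "H \<in> hamiltonians W lam"
  shows "ereal (fact n) * min (Sys W lam) (ereal (tau_min W lam H)) ^ (n + 1)
           / ereal (real (n + 1) * Cal n W lam H)
         \<le> systolic_ratio n (tube W H) (tube_form W lam) \<and>
         systolic_ratio n (tube W H) (tube_form W lam)
         \<le> ereal (fact n) * Sys W lam ^ (n + 1) / ereal (real (n + 1) * Cal n W lam H)"
proof -
  interpret ham n W lam H by standard (rule assms)+
  have v: "0 \<le> real (n + 1) * Cal n W lam H" using Cal_nonneg by simp
  have eq: "systolic_ratio n (tube W H) (tube_form W lam)
      = ereal (fact n) * Sys (tube W H) (tube_form W lam) ^ (n + 1) / ereal (real (n + 1) * Cal n W lam H)"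
    unfolding systolic_ratio_def contact_volume_tube by (rule ereal_divide_fact[OF v])
  have mono: "ereal (fact n) * x ^ (n + 1) / ereal (real (n + 1) * Cal n W lam H)
      \<le> ereal (fact n) * y ^ (n + 1) / ereal (real (n + 1) * Cal n W lam H)" if "0 \<le> x" "x \<le> y" for x y :: ereal
  proof -
    have "x ^ (n + 1) \<le> y ^ (n + 1)" by (rule ereal_power_le[OF that, THEN conjunct2])
    then have "ereal (fact n) * x ^ (n + 1) \<le> ereal (fact n) * y ^ (n + 1)" by (rule ereal_mult_left_mono) simp
    moreover have "0 \<le> inverse (ereal d)" if "0 \<le> d" for d
      by (cases "d = 0") (use that in simp_all)
    note this[OF v]
    ultimately show ?thesis unfolding divide_ereal_def by (rule ereal_mult_right_mono)
  qed
  have nn: "0 \<le> min (Sys W lam) (ereal (tau_min W lam H))" using Sys_nonneg tau_min_nonneg by simp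
  show ?thesis unfolding eq
    by (rule conjI[OF mono[OF nn Sys_tube_ge] mono[OF order_trans[OF nn Sys_tube_ge] Sys_tube_le]])
qed

end
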